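(* Let $n,m$ be positive integers and $\mathcal H=L^2(\mathbf R^n,\mathbf C^m)$. Let $D:\mathsf D(D)\to\mathcal H$ be a self-adjoint homogeneous first order differential operator with constant coefficients such that $\|\nabla u\|\lesssim\|Du\|$ for all $u\in\mathsf D(D)\cap\overline{\mathsf R(D)}$. Let $B$ be the operator of multiplication by a function $B\in L^\infty(\mathbf R^n,\mathcal L(\mathbf C^m))$, and assume that there is $\delta>0$ such that $\mathrm{Re}(BDu,Du)\ge\delta\|Du\|^2$ for all $u\in\mathsf D(D)$. Then the operator $\mathrm{sgn}(BD)$ is bounded on $\mathcal H$ and invertible on $\overline{\mathsf R(BD)}$.
   Context: $\mathsf D(A),\mathsf N(A),\mathsf R(A)$ denote the domain, null space and range of an operator $A$; $\lesssim$ means inequality up to a constant independent of $u$. Under the stated assumptions on $B,D$ the resolvents $(I+isBD)^{-1}$, $s\in\mathbf R$, are uniformly bounded and $\mathcal H=\overline{\mathsf R(BD)}\oplus\mathsf N(BD)$ as a topological (not necessarily orthogonal) direct sum. The operator $\mathrm{sgn}(BD)$ is defined as follows: $\mathrm{sgn}(BD)=0$ on $\mathsf N(BD)$, and for $f\in\mathsf D(BD)\cap\mathsf R(BD)$ (a dense subspace of $\overline{\mathsf R(BD)}$) $$\mathrm{sgn}(BD)f=c\int_0^\infty (tBD)^3(I+t^{2}BDBD)^{-3}f\,\frac{dt}t,\qquad c^{-1}=\int_0^\infty u^{2}(1+u^{2})^{-3}\,du,$$ the integral converging in norm. Boundedness of $\mathrm{sgn}(BD)$ means that this densely defined operator extends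 to a bounded operator on $\mathcal H$. *)

theory Defs
  imports "HOL-Analysis.Analysis"
begin

section \<open>The Hilbert space of square integrable functions\<close>

definition sq_integrable :: "('a::euclidean_space \<Rightarrow> 'b::euclidean_space) \<Rightarrow> bool" where
  "sq_integrable f \<longleftrightarrow>
     f \<in> borel_measurable lebesgue \<and> integrable lebesgue (\<lambda>x. (norm (f x))\<^sup>2)"

definition L2_rel :: "('a::euclidean_space \<Rightarrow> 'b::euclidean_space) \<Rightarrow> ('a \<Rightarrow> 'b) \<Rightarrow> bool" where
  "L2_rel f g \<longleftrightarrow> sq_integrable f \<and> sq_integrable g \<and> (AE x in lebesgue. f x = g x)"

lemma sq_integrable_0: "sq_integrable (\<lambda>x. 0)"
  by (simp add: sq_integrable_def)

quotient_type (overloaded) ('a, 'b) L2 =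
  "'a::euclidean_space \<Rightarrow> 'b::euclidean_space" / partial: L2_rel
proof (rule part_equivpI)
  show "\<exists>f::'a \<Rightarrow> 'b. L2_rel f f"
    using sq_integrable_0 by (auto simp: L2_rel_def)
  show "symp (L2_rel :: ('a \<Rightarrow> 'b) \<Rightarrow> _)"
    by (auto simp: symp_def L2_rel_def eq_commute)
  show "transp (L2_rel :: ('a \<Rightarrow> 'b) \<Rightarrow> _)"
    unfolding transp_def L2_rel_def by (auto elim: eventually_elim2)
qed

lemma sq_integrable_bound:
  fixes h :: "'a::euclidean_space \<Rightarrow> 'b::euclidean_space"
  assumes "h \<in> borel_measurable lebesgue" "integrable lebesgue g"
    "\<And>x. (norm (h x))\<^sup>2 \<le> g x"
  shows "sq_integrable h"
  unfolding sq_integrable_def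
proof
  show "integrable lebesgue (\<lambda>x. (norm (h x))\<^sup>2)"
    by (rule Bochner_Integration.integrable_bound[OF assms(2)])
      (use assms in \<open>auto intro!: AE_I2 order_trans[OF _ abs_ge_self]\<close>)
qed (fact assms)

lemma sq_integrable_add:
  fixes f g :: "'a::euclidean_space \<Rightarrow> 'b::euclidean_space"
  assumes "sq_integrable f" "sq_integrable g"
  shows "sq_integrable (\<lambda>x. f x + g x)"
proof (rule sq_integrable_bound)
  show "integrable lebesgue (\<lambda>x. 2 * (norm (f x))\<^sup>2 + 2 * (norm (g x))\<^sup>2)"
    using assms by (auto simp: sq_integrable_def)
  show "(norm (f x + g x))\<^sup>2 \<le> 2 * (norm (f x))\<^sup>2 + 2 * (norm (g x))\<^sup>2" for x
  proof -
    have "(norm (f x + g x))\<^sup>2 \<le> (norm (f x) + norm (g x))\<^sup>2"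
      by (simp add: norm_triangle_ineq power_mono)
    also have "\<dots> \<le> 2 * (norm (f x))\<^sup>2 + 2 * (norm (g x))\<^sup>2"
      using sum_squares_bound[of "norm (f x)" "norm (g x)"] by (simp add: power2_sum)
    finally show ?thesis .
  qed
qed (use assms in \<open>auto simp: sq_integrable_def\<close>)

lemma sq_integrable_scaleR:
  "sq_integrable f \<Longrightarrow> sq_integrable (\<lambda>x. r *\<^sub>R f x)"
  by (auto simp: sq_integrable_def power_mult_distrib)

lemma integrable_inner_sq_integrable:
  fixes f g :: "'a::euclidean_space \<Rightarrow> 'b::euclidean_space"
  assumes "sq_integrable f" "sq_integrable g"
  shows "integrable lebesgue (\<lambda>x. f x \<bullet> g x)"
proof (rule Bochner_Integration.integrable_bound)
  show "integrable lebesgue (\<lambda>x. (norm (f x))\<^sup>2 + (norm (g x))\<^sup>2)"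
    using assms by (auto simp: sq_integrable_def)
  show "AE x in lebesgue. norm (f x \<bullet> g x) \<le> norm ((norm (f x))\<^sup>2 + (norm (g x))\<^sup>2)"
  proof (rule AE_I2)
    fix x
    have "\<bar>f x \<bullet> g x\<bar> \<le> norm (f x) * norm (g x)"
      by (rule Cauchy_Schwarz_ineq2)
    also have "\<dots> \<le> 2 * norm (f x) * norm (g x)"
      by simp
    also have "\<dots> \<le> (norm (f x))\<^sup>2 + (norm (g x))\<^sup>2"
      by (rule sum_squares_bound)
    finally show "norm (f x \<bullet> g x) \<le> norm ((norm (f x))\<^sup>2 + (norm (g x))\<^sup>2)"
      by simp
  qed
qed (use assms in \<open>auto simp: sq_integrable_def\<close>)

lemma sq_integrable_diff:
  fixes f g :: "'a::euclidean_space \<Rightarrow> 'b::euclidean_space"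
  assumes "sq_integrable f" "sq_integrable g"
  shows "sq_integrable (\<lambda>x. f x - g x)"
  using sq_integrable_add[OF assms(1) sq_integrable_scaleR[OF assms(2), of "-1"]] by simp

instantiation L2 :: (euclidean_space, euclidean_space) real_vector
begin

lift_definition zero_L2 :: "('a, 'b) L2" is "\<lambda>x. 0"
  by (simp add: L2_rel_def sq_integrable_0)

lift_definition plus_L2 :: "('a, 'b) L2 \<Rightarrow> ('a, 'b) L2 \<Rightarrow> ('a, 'b) L2"
  is "\<lambda>f g x. f x + g x"
  unfolding L2_rel_def by (auto intro!: sq_integrable_add)

lift_definition uminus_L2 :: "('a, 'b) L2 \<Rightarrow> ('a, 'b) L2"
  is "\<lambda>f x. - f x"
  unfolding L2_rel_def by (auto simp: sq_integrable_def)

lift_definition minus_L2 :: "('a, 'b) L2 \<Rightarrow> ('a, 'b) L2 \<Rightarrow> ('a, 'b) L2"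
  is "\<lambda>f g x. f x - g x"
  unfolding L2_rel_def by (auto intro!: sq_integrable_diff)

lift_definition scaleR_L2 :: "real \<Rightarrow> ('a, 'b) L2 \<Rightarrow> ('a, 'b) L2"
  is "\<lambda>r f x. r *\<^sub>R f x"
  unfolding L2_rel_def by (auto intro!: sq_integrable_scaleR)

instance
proof
  fix f g h :: "('a, 'b) L2" and r s :: real
  show "f + g + h = f + (g + h)"
    by transfer (auto simp: L2_rel_def add.assoc intro!: sq_integrable_add)
  show "f + g = g + f"
    by transfer (auto simp: L2_rel_def add.commute intro!: sq_integrable_add)
  show "0 + f = f"
    by transfer (auto simp: L2_rel_def)
  show "- f + f = 0"
    by transfer (auto simp: L2_rel_def sq_integrable_0)
  show "f - g = f + - g"
    by transfer (auto simp: L2_rel_def intro!: sq_integrable_diff)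
  show "r *\<^sub>R (f + g) = r *\<^sub>R f + r *\<^sub>R g"
    by transfer (auto simp: L2_rel_def scaleR_add_right
        intro!: sq_integrable_add sq_integrable_scaleR)
  show "(r + s) *\<^sub>R f = r *\<^sub>R f + s *\<^sub>R f"
    by transfer (auto simp: L2_rel_def scaleR_add_left[symmetric]
        intro!: sq_integrable_scaleR)
  show "r *\<^sub>R s *\<^sub>R f = (r * s) *\<^sub>R f"
    by transfer (auto simp: L2_rel_def intro!: sq_integrable_scaleR)
  show "1 *\<^sub>R f = f"
    by transfer (auto simp: L2_rel_def)
qed

end

instantiation L2 :: (euclidean_space, euclidean_space) real_inner
begin

lift_definition inner_L2 :: "('a, 'b) L2 \<Rightarrow> ('a, 'b) L2 \<Rightarrow> real"
  is "\<lambda>f g. LINT x|lebesgue. f x \<bullet> g x"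
  unfolding L2_rel_def sq_integrable_def by (auto intro!: integral_cong_AE)

definition norm_L2 :: "('a, 'b) L2 \<Rightarrow> real" where
  "norm_L2 f = sqrt (inner f f)"

definition sgn_L2 :: "('a, 'b) L2 \<Rightarrow> ('a, 'b) L2" where
  "sgn_L2 f = f /\<^sub>R norm f"

definition dist_L2 :: "('a, 'b) L2 \<Rightarrow> ('a, 'b) L2 \<Rightarrow> real" where
  "dist_L2 f g = norm (f - g)"

definition uniformity_L2 :: "(('a, 'b) L2 \<times> ('a, 'b) L2) filter" where
  "uniformity_L2 = (INF e\<in>{0<..}. principal {(f, g). dist f g < e})"

definition open_L2 :: "('a, 'b) L2 set \<Rightarrow> bool" where
  "open_L2 U = (\<forall>f\<in>U. eventually (\<lambda>(f', g). f' = f \<longrightarrow> g \<in> U) uniformity)"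

instance
proof
  fix f g h :: "('a, 'b) L2" and r :: real and U :: "('a, 'b) L2 set"
  show "inner f g = inner g f"
    by transfer (simp add: inner_commute)
  show "inner (f + g) h = inner f h + inner g h"
    by transfer (simp add: L2_rel_def inner_add_left integrable_inner_sq_integrable)
  show "inner (r *\<^sub>R f) g = r * inner f g"
    by transfer simp
  show "0 \<le> inner f f"
    by transfer simp
  show "inner f f = 0 \<longleftrightarrow> f = 0"
  proof transfer
    fix f :: "'a \<Rightarrow> 'b"
    assume f: "L2_rel f f"
    then have "integrable lebesgue (\<lambda>x. f x \<bullet> f x)"
      by (simp add: L2_rel_def integrable_inner_sq_integrable)
    then have "(LINT x|lebesgue. f x \<bullet> f x) = 0 \<longleftrightarrow> (AE x in lebesgue. f x \<bullet> f x = 0)"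
      by (rule integral_nonneg_eq_0_iff_AE) simp
    then show "(LINT x|lebesgue. f x \<bullet> f x) = 0 \<longleftrightarrow> L2_rel f (\<lambda>x. 0)"
      using f by (simp add: L2_rel_def sq_integrable_0)
  qed
qed (simp_all only: norm_L2_def sgn_L2_def dist_L2_def uniformity_L2_def open_L2_def)

end

text \<open>The complex structure on the square integrable functions with values in
  \<open>complex ^ 'm\<close>. The inner product is linear in the first argument.\<close>

lemma norm_vector_scalar_mult: "norm (c *s v) = cmod c * norm (v :: complex ^ 'm)"
  by (simp add: norm_vec_def norm_mult L2_set_right_distrib)

lemma continuous_on_vector_scalar_mult: "continuous_on UNIV (\<lambda>v :: complex ^ 'm. c *s v)"
  unfolding vector_scalar_mult_def by (intro continuous_intros)

lift_definition cscale ::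
  "complex \<Rightarrow> ('a::euclidean_space, complex ^ 'm) L2 \<Rightarrow> ('a, complex ^ 'm) L2"
  is "\<lambda>c f x. c *s f x"
proof -
  fix c and f g :: "'a \<Rightarrow> complex ^ 'm"
  have *: "sq_integrable (\<lambda>x. c *s f x)" if "sq_integrable f" for f :: "'a \<Rightarrow> complex ^ 'm"
    using that borel_measurable_continuous_on[OF continuous_on_vector_scalar_mult, of f lebesgue c]
    by (auto simp: sq_integrable_def norm_vector_scalar_mult power_mult_distrib)
  assume "L2_rel f g"
  then show "L2_rel (\<lambda>x. c *s f x) (\<lambda>x. c *s g x)"
    by (auto simp: L2_rel_def *)
qed

lift_definition cinner ::
  "('a::euclidean_space, complex ^ 'm) L2 \<Rightarrow> ('a, complex ^ 'm) L2 \<Rightarrow> complex"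
  is "\<lambda>f g. LINT x|lebesgue. (\<Sum>i\<in>UNIV. f x $ i * cnj (g x $ i))"
proof -
  have vec: "(\<lambda>x. h x $ i) \<in> borel_measurable lebesgue"
    if "h \<in> borel_measurable lebesgue" for h :: "'a \<Rightarrow> complex ^ 'm" and i
    using borel_measurable_continuous_on[OF _ that, of "\<lambda>v. v $ i"]
    by (simp add: continuous_intros)
  have cnj: "(\<lambda>x. cnj (h x)) \<in> borel_measurable lebesgue"
    if "h \<in> borel_measurable lebesgue" for h :: "'a \<Rightarrow> complex"
    using borel_measurable_continuous_on[OF _ that, of cnj] by (simp add: continuous_intros)
  fix f f' g g' :: "'a \<Rightarrow> complex ^ 'm"
  assume "L2_rel f f'" "L2_rel g g'"
  then show "(LINT x|lebesgue. (\<Sum>i\<in>UNIV. f x $ i * cnj (g x $ i))) =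
      (LINT x|lebesgue. (\<Sum>i\<in>UNIV. f' x $ i * cnj (g' x $ i)))"
    unfolding L2_rel_def sq_integrable_def
    by (intro integral_cong_AE borel_measurable_sum borel_measurable_times vec cnj) auto
qed

text \<open>An arbitrary representative of an \<open>L2\<close> class; it is only used where the choice of the
  representative does not matter.\<close>

definition fn :: "('a::euclidean_space, 'b::euclidean_space) L2 \<Rightarrow> 'a \<Rightarrow> 'b" where
  "fn u = rep_L2 u"


section \<open>Unbounded operators\<close>

text \<open>An unbounded operator is given by its graph, so that its domain and its range are
  \<^const>\<open>Domain\<close> and \<^const>\<open>Range\<close>, powers are \<open>^^\<close>, and the inverse is
  \<^const>\<open>converse\<close>. Note that \<open>S O T\<close> applies \<open>S\<close> first.\<close>

type_synonym ('n, 'm) H = "(real ^ 'n, complex ^ 'm) L2"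
type_synonym ('n, 'm) oper = "(('n, 'm) H \<times> ('n, 'm) H) set"

definition linear_op :: "('n::finite, 'm::finite) oper \<Rightarrow> bool" where
  "linear_op T \<longleftrightarrow> single_valued T \<and> (0, 0) \<in> T \<and>
     (\<forall>(u, v)\<in>T. \<forall>(u', v')\<in>T. (u + u', v + v') \<in> T) \<and>
     (\<forall>c. \<forall>(u, v)\<in>T. (cscale c u, cscale c v) \<in> T)"

definition null_space :: "('n::finite, 'm::finite) oper \<Rightarrow> ('n, 'm) H set" where
  "null_space T = {u. (u, 0) \<in> T}"

definition adjoint_op :: "('n::finite, 'm::finite) oper \<Rightarrow> ('n, 'm) oper" where
  "adjoint_op T = {(v, w). \<forall>(u, z)\<in>T. cinner z v = cinner u w}"

definition self_adjoint :: "('n::finite, 'm::finite) oper \<Rightarrow> bool" where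
  "self_adjoint T \<longleftrightarrow> linear_op T \<and> closure (Domain T) = UNIV \<and> adjoint_op T = T"

definition scale_op :: "real \<Rightarrow> ('n::finite, 'm::finite) oper \<Rightarrow> ('n, 'm) oper" where
  "scale_op t T = {(u, t *\<^sub>R v) |u v. (u, v) \<in> T}"

definition id_plus :: "('n::finite, 'm::finite) oper \<Rightarrow> ('n, 'm) oper" where
  "id_plus T = {(u, u + v) |u v. (u, v) \<in> T}"

definition bounded_clinear :: "(('n::finite, 'm::finite) H \<Rightarrow> ('n, 'm) H) \<Rightarrow> bool" where
  "bounded_clinear S \<longleftrightarrow> bounded_linear S \<and> (\<forall>c u. S (cscale c u) = cscale c (S u))"

definition bounded_extension ::
  "('n::finite, 'm::finite) oper \<Rightarrow> (('n, 'm) H \<Rightarrow> ('n, 'm) H) \<Rightarrow> bool" where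
  "bounded_extension T S \<longleftrightarrow>
     bounded_clinear S \<and> closure (Domain T) = UNIV \<and> (\<forall>(u, v)\<in>T. S u = v)"

definition invertible_on ::
  "(('n::finite, 'm::finite) H \<Rightarrow> ('n, 'm) H) \<Rightarrow> ('n, 'm) H set \<Rightarrow> bool" where
  "invertible_on S K \<longleftrightarrow>
     bij_betw S K K \<and> (\<exists>C. \<forall>u\<in>K. norm (inv_into K S u) \<le> C * norm u)"


section \<open>Differential and multiplication operators\<close>

definition partial_deriv :: "'n::finite \<Rightarrow> (real ^ 'n \<Rightarrow> real) \<Rightarrow> real ^ 'n \<Rightarrow> real" where
  "partial_deriv j \<phi> x = frechet_derivative \<phi> (at x) (axis j 1)"

fun C_k :: "nat \<Rightarrow> (real ^ 'n::finite \<Rightarrow> real) \<Rightarrow> bool" where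
  "C_k 0 \<phi> \<longleftrightarrow> continuous_on UNIV \<phi>"
| "C_k (Suc k) \<phi> \<longleftrightarrow> \<phi> differentiable_on UNIV \<and> (\<forall>j. C_k k (partial_deriv j \<phi>))"

definition test_function :: "(real ^ 'n::finite \<Rightarrow> real) \<Rightarrow> bool" where
  "test_function \<phi> \<longleftrightarrow> (\<forall>k. C_k k \<phi>) \<and> compact (closure {x. \<phi> x \<noteq> 0})"

text \<open>\<open>weak_gradient u G\<close>: the distributional gradient of \<open>u\<close> is the square integrable
  function \<open>G\<close>, where \<open>G $ j\<close> is the derivative in the direction \<open>j\<close>. Real-valued test
  functions suffice, by linearity.\<close>

definition weak_gradient ::
  "('n::finite, 'm::finite) H \<Rightarrow> (real ^ 'n, complex ^ 'm ^ 'n) L2 \<Rightarrow> bool" where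
  "weak_gradient u G \<longleftrightarrow> (\<forall>\<phi> j. test_function \<phi> \<longrightarrow>
     (LINT x|lebesgue. \<phi> x *\<^sub>R (fn G x $ j)) = - (LINT x|lebesgue. partial_deriv j \<phi> x *\<^sub>R fn u x))"

text \<open>\<open>D u = (\<Sum>j. A j (\<partial>\<^sub>j u))\<close> in the sense of distributions, for constant matrices \<open>A j\<close>.
  The domain is not prescribed here; if \<open>D\<close> is self-adjoint, it is necessarily the maximal
  one, i.e. all square integrable \<open>u\<close> for which the right-hand side is square integrable.\<close>

definition homogeneous_first_order_const_coeff ::
  "('n::finite, 'm::finite) oper \<Rightarrow> bool" where
  "homogeneous_first_order_const_coeff D \<longleftrightarrow>
     (\<exists>A :: 'n \<Rightarrow> complex ^ 'm ^ 'm. \<forall>(u, v)\<in>D. \<forall>\<phi>. test_function \<phi> \<longrightarrow>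
        (LINT x|lebesgue. \<phi> x *\<^sub>R fn v x) =
        - (\<Sum>j\<in>UNIV. A j *v (LINT x|lebesgue. partial_deriv j \<phi> x *\<^sub>R fn u x)))"

definition L_infinity :: "(real ^ 'n::finite \<Rightarrow> complex ^ 'm::finite ^ 'm) \<Rightarrow> bool" where
  "L_infinity B \<longleftrightarrow>
     B \<in> borel_measurable lebesgue \<and> (\<exists>C. AE x in lebesgue. norm (B x) \<le> C)"

text \<open>Only meaningful if \<open>B\<close> is essentially bounded, so that \<open>B u\<close> is square integrable.\<close>

definition mult_op ::
  "(real ^ 'n::finite \<Rightarrow> complex ^ 'm::finite ^ 'm) \<Rightarrow> ('n, 'm) H \<Rightarrow> ('n, 'm) H" where
  "mult_op B u = abs_L2 (\<lambda>x. B x *v fn u x)"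

definition mult_comp ::
  "(real ^ 'n::finite \<Rightarrow> complex ^ 'm::finite ^ 'm) \<Rightarrow> ('n, 'm) oper \<Rightarrow> ('n, 'm) oper" where
  "mult_comp B D = {(u, mult_op B v) |u v. (u, v) \<in> D}"


section \<open>The sign of an operator\<close>

text \<open>\<open>sgn_integrand T f t\<close> is \<open>(t T)\<^sup>3 (I + t\<^sup>2 T T)\<^sup>-\<^sup>3 f / t\<close>.\<close>

definition sgn_integrand ::
  "('n::finite, 'm::finite) oper \<Rightarrow> ('n, 'm) H \<Rightarrow> real \<Rightarrow> ('n, 'm) H" where
  "sgn_integrand T f t =
     (1 / t) *\<^sub>R (THE y. (f, y) \<in> ((id_plus (scale_op (t\<^sup>2) (T ^^ 2)))\<inverse>) ^^ 3 O (scale_op t T) ^^ 3)"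

definition sgn_const :: real where
  "sgn_const = 1 / integral {0<..} (\<lambda>u. u\<^sup>2 * (1 / (1 + u\<^sup>2) ^ 3))"

definition sgn_domain :: "('n::finite, 'm::finite) oper \<Rightarrow> ('n, 'm) H set" where
  "sgn_domain T = {g + f |g f. g \<in> null_space T \<and> f \<in> Domain T \<inter> Range T}"

text \<open>The Henstock-Kurzweil integral over \<open>{0<..}\<close> covers norm-convergent improper integrals.
  Elements of \<^const>\<open>sgn_domain\<close> for which the integral diverges are not in the domain of
  \<open>sgn_op\<close>.\<close>

definition sgn_op :: "('n::finite, 'm::finite) oper \<Rightarrow> ('n, 'm) oper" where
  "sgn_op T = {(g + f, sgn_const *\<^sub>R y) |g f y. g \<in> null_space T \<and>
     f \<in> Domain T \<inter> Range T \<and> (sgn_integrand T f has_integral y) {0<..}}"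

end

theory Submission imports Defs begin

text \<open>
  \<^bold>\<open>Reduction.\<close> The space is regarded as a real Hilbert space on which \<open>J\<close>, multiplication by the imaginary unit, is an isometry
  commuting with \<open>D\<close> and with the multiplication \<open>b\<close> by \<open>B\<close>. Put \<open>T = b D\<close>. Because \<open>D\<close> is self-adjoint and \<open>b\<close> is accretive on
  the range of \<open>D\<close>, the resolvents \<open>R s = (I + s J T)\<^sup>-\<^sup>1\<close> exist and are bounded uniformly in \<open>s\<close>, hence so are
  \<open>U t = (I + t\<^sup>2 T\<^sup>2)\<^sup>-\<^sup>1\<close> and \<open>Q t = t T U t\<close>, and the integrand of the sign operator is \<open>(Q t)\<^sup>3 f / t\<close>.

  \<^bold>\<open>Boundedness.\<close> By duality, \<open>\<integral> (Q t)\<^sup>3 f dt/t\<close> paired with \<open>g\<close> is at most the product of two square functions: that of \<open>f\<close> for \<open>T\<close>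
  and that of \<open>g\<close> for the operator with the adjoint multiplier \<open>b'\<close> in place of \<open>b\<close>. So quadratic estimates
  \<open>\<Sum> \<parallel>Q (t / 2 ^ i) f\<parallel>\<^sup>2 \<le> C \<parallel>f\<parallel>\<^sup>2\<close> for both give a bounded operator (\<open>SN_bound\<close>, \<open>sign_operator\<close>).

  \<^bold>\<open>Invertibility.\<close> An integration by parts in \<open>t\<close> shows that \<open>\<integral> (Q t)\<^sup>3 f dt/t\<close> is one eighth of \<open>X f = \<integral> Q t f dt/t\<close>
  (\<open>PQ_derivative\<close>). The composition of \<open>X\<close> with itself is a double integral of \<open>Q t (Q s f)\<close>, and
  \<open>(t/s - s/t) Q t Q s = U s - U t\<close> turns it into an integral of Frullani type. As \<open>U t\<close> goes from the identity at \<open>t = 0\<close>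
  to zero at infinity, its value is a nonzero constant times \<open>f\<close> (\<open>frullani_double_integral\<close>). So \<open>X\<close> is
  its own inverse on the closure of the range of \<open>T\<close>, up to a constant factor.

  \<^bold>\<open>Quadratic estimates.\<close> Work on dyadic cubes of side \<open>l\<close>, at the scale \<open>t = l\<close>. The operator \<open>Th l = Q l b\<close> decays rapidly off the diagonal
  (\<open>off_diagonal\<close>), so it can be applied to constants; this defines \<open>G a l\<close> on the cube with corner \<open>a\<close>.
  The error made when \<open>Th l v\<close> is replaced by \<open>G a l\<close> of the mean of \<open>v\<close> is summable in square (\<open>principal_part\<close>).
  On \<open>P v\<close>, with \<open>P = (I + l\<^sup>2 D\<^sup>2)\<^sup>-\<^sup>1\<close>, this is a Poincare inequality, where the coercivity of \<open>D\<close> bounds differences of translates.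
  The rest \<open>v - P v\<close> is treated by almost orthogonality, as the mean of \<open>D x\<close> over a cube is small when \<open>x\<close> is small compared to the scale. The square
  function of the unperturbed \<open>D\<close> that controls both is elementary: it telescopes (\<open>identity_square_function\<close>).

  What remains is \<open>\<Sum> \<parallel>G a l (mean of v)\<parallel>\<^sup>2\<close>. By Carleson's embedding theorem (\<open>carleson_embedding\<close>), proved with a Bellman function,
  it suffices that \<open>\<parallel>G a l\<parallel>\<^sup>2\<close> is a Carleson measure. Here the local \<open>T(b)\<close> idea enters. For every cube and direction
  \<open>w\<close> there is a vector in the range of \<open>D\<close> whose square function is under control and whose mean over the cube is close to \<open>w\<close>
  (\<open>test_vector\<close>). A stopping time argument keeps the means at smaller cubes near \<open>w\<close>, outside stopping cubes that
  miss a fixed proportion of the cube; there \<open>G\<close> is controlled by its value on that mean, if attention is restricted to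
  the points where \<open>G\<close> looks in a direction near \<open>w\<close>. Induction over the generations sums the stopping cubes, and finitely many
  directions suffice by compactness (\<open>carleson_cone\<close>, \<open>carleson_measure\<close>, \<open>quadratic_estimate\<close>).
\<close>

section \<open>Notation\<close>

text \<open>The binders \<open>NN\<close> and \<open>LB\<close> are the nonnegative and the Bochner integral over Lebesgue measure.\<close>

lemmas integral_join = Henstock_Kurzweil_Integration.integral_combine
lemmas integrable_dominated = Bochner_Integration.integrable_bound
abbreviation "pd == partial_deriv"
abbreviation "testf == test_function"
abbreviation "borelm == borel_measurable borel"
notation scaleR (infixr "*R" 75)
abbreviation LIMSEQ' (infixr "---->" 60) where "X ----> l == X \<longlonglongrightarrow> l"
abbreviation nn_lborel (binder "NN " 10) where "nn_lborel f == nn_integral lborel f"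
abbreviation int_lborel (binder "LB " 10) where "int_lborel f == lebesgue_integral lborel f"

section \<open>Orthogonal complements in a real Hilbert space\<close>

text \<open>A minimising sequence is Cauchy by the parallelogram law.\<close>

lemma closest_point_closed_subspace:
 fixes Z :: "'h::{real_inner, banach} set"
 assumes Z: "subspace Z" "closed Z"
 obtains p where "p : Z" "!!z. z : Z ==> norm (x-p) <= norm (x-z)"
proof -
 define d where "d = infdist x Z"
 have ne: "Z ~= {}" using Z(1) subspace_0 by auto
 have d0: "d >= 0" by (simp add: d_def infdist_nonneg)
 have dle: "d <= norm (x-z)" if "z : Z" for z
  using that by (simp add: d_def dist_norm[symmetric] infdist_le)
 have "\<exists>z\<in>Z. norm (x-z) < d+1/Suc n" for n
 proof (rule ccontr)
  assume "~ ?thesis"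
  hence "d+1/Suc n <= infdist x Z"
   unfolding infdist_def using ne by (auto intro!: cINF_greatest simp: dist_norm not_less)
  thus False by (simp add: d_def)
 qed
 then obtain z where z: "!!n. z n : Z" "!!n. norm (x-z n) < d+1/Suc n" by metis
 have bound: "(norm (z n-z m))^2 <= (8*d+4)*(1/Suc N)" if nm: "n >= N" "m >= N" for n m N
 proof -
  have mid: "(1/2) *R (z n+z m) : Z" using Z z by (simp add: subspace_add subspace_scale)
  have e: "1/real (Suc k) <= 1/Suc N" if "k >= N" for k
   using that by (simp add: frac_le)
  have up: "(norm (x-z k))^2 <= d^2+(2*d+1)*(1/Suc N)" if "k >= N" for k
  proof -
   define e where "e = 1/real (Suc N)"
   have e01: "0 <= e" "e <= 1" by (auto simp: e_def)
   have "norm (x-z k) <= d+e" using z(2)[of k] e[OF that] by (simp add: e_def)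
   hence "(norm (x-z k))^2 <= (d+e)^2" by (simp add: power_mono)
   also have "... <= d^2+(2*d+1)*e"
    using e01 mult_left_le[of e e] by (simp add: power2_eq_square algebra_simps)
   finally show ?thesis by (simp add: e_def)
  qed
  have "d^2 <= (norm (x-(1/2) *R (z n+z m)))^2" using dle[OF mid] d0 by (simp add: power_mono)
  moreover have "(norm (z n-z m))^2+4*(norm (x-(1/2) *R (z n+z m)))^2
    = 2*(norm (x-z n))^2+2*(norm (x-z m))^2"
   by (simp add: power2_norm_eq_inner inner_diff inner_add inner_commute algebra_simps)
  ultimately have "(norm (z n-z m))^2 <= 2*(norm (x-z n))^2+2*(norm (x-z m))^2-4*d^2" by simp
  also have "... <= (8*d+4)*(1/Suc N)" using up[OF nm(1)] up[OF nm(2)] by argo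
  finally show ?thesis .
 qed
 have "Cauchy z"
 proof (rule metric_CauchyI)
  fix e :: real assume e: "e > 0"
  have "(%N. (8*d+4)*(1/real (Suc N))) ----> (8*d+4)*0"
   by (intro tendsto_intros LIMSEQ_Suc lim_1_over_n[unfolded o_def])
  hence "eventually (%N. (8*d+4)*(1/real (Suc N)) < e^2) sequentially"
   using e by (intro order_tendstoD(2)) auto
  then obtain N where N: "(8*d+4)*(1/real (Suc N)) < e^2" by (auto simp: eventually_sequentially)
  show "\<exists>M. \<forall>m\<ge>M. \<forall>n\<ge>M. dist (z m) (z n) < e"
  proof (intro exI allI impI)
   fix m n assume "N <= m" "N <= n"
   from bound[OF this] N have "(norm (z m-z n))^2 < e^2" by simp
   thus "dist (z m) (z n) < e" using e by (simp add: dist_norm power_less_imp_less_base)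
  qed
 qed
 then obtain p where p: "z ----> p" using Cauchy_convergent convergent_def by blast
 have "p : Z" using closed_sequentially[OF Z(2)] z(1) p by blast
 moreover have "norm (x-p) <= d"
 proof (rule LIMSEQ_le)
  show "(%n. norm (x-z n)) ----> norm (x-p)" by (intro tendsto_intros p)
  have "(%n. d+1/real (Suc n)) ----> d+0"
   by (intro tendsto_intros LIMSEQ_Suc lim_1_over_n[unfolded o_def])
  thus "(%n. d+1/real (Suc n)) ----> d" by simp
  show "\<exists>N. \<forall>n\<ge>N. norm (x-z n) <= d+1/real (Suc n)" using z(2) less_imp_le by blast
 qed
 ultimately show ?thesis using that dle by (meson order_trans)
qed

text \<open>The difference of \<open>x\<close> and its closest point in \<open>Z\<close> is orthogonal to \<open>Z\<close>, hence to
  \<open>x\<close> and to itself.\<close>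

lemma closed_subspace_double_complement:
 fixes Z :: "'h::{real_inner, banach} set"
 assumes Z: "subspace Z" "closed Z" and perp: "!!g. (!!z. z : Z ==> inner z g = 0) ==> inner x g = 0"
 shows "x : Z"
proof -
 obtain p where p: "p : Z" "!!z. z : Z ==> norm (x-p) <= norm (x-z)"
  using closest_point_closed_subspace[OF Z] by blast
 have orth: "inner z (x-p) = 0" if z: "z : Z" for z
 proof (cases "z = 0")
  case False
  define c where "c = inner z (x-p)/inner z z"
  have zz: "inner z z > 0" using False by simp
  have "p+c *R z : Z" using Z p z by (simp add: subspace_add subspace_scale)
  from p(2)[OF this] have "(norm (x-p))^2 <= (norm ((x-p)-c *R z))^2"
   by (simp add: power_mono diff_diff_eq)
  also have "... = (norm (x-p))^2-(inner z (x-p))^2/inner z z"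
  proof -
   have "c*inner z z = inner z (x-p)" using zz by (simp add: c_def)
   moreover have "(norm ((x-p)-c *R z))^2 = (norm (x-p))^2-2*c*inner z (x-p)+c*(c*inner z z)"
    unfolding power2_norm_eq_inner inner_diff_left[of "x-p"] inner_diff_right[of _ "x-p"]
    by (simp add: inner_commute)
   ultimately show ?thesis by (simp add: c_def power2_eq_square)
  qed
  finally have "(inner z (x-p))^2/inner z z <= 0" by simp
  thus ?thesis using zz by (simp add: divide_le_0_iff)
 qed auto
 from perp[OF orth] orth[OF p(1)] have "inner (x-p) (x-p) = 0" by (simp add: inner_diff_left)
 thus ?thesis using p by simp
qed

lemma subspace_closure:
 fixes Z :: "'h::real_normed_vector set"
 assumes "subspace Z"
 shows "subspace (closure Z)"
proof (rule subspaceI)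
 show "0 : closure Z" using assms closure_subset subspace_0 by blast
next
 fix x y assume "x : closure Z" "y : closure Z"
 then obtain X Y where *: "!!n. X n : Z" "!!n. Y n : Z" "X ----> x" "Y ----> y"
  unfolding closure_sequential by metis
 have "(%n. X n+Y n) ----> x+y" by (intro tendsto_intros *)
 moreover have "X n+Y n : Z" for n using * assms subspace_add by blast
 ultimately show "x+y : closure Z" unfolding closure_sequential by (intro exI[of _ "%n. X n+Y n"]) auto
next
 fix c x assume "x : closure Z"
 then obtain X where *: "!!n. X n : Z" "X ----> x" unfolding closure_sequential by metis
 have "(%n. c *R X n) ----> c *R x" by (intro tendsto_intros *)
 moreover have "c *R X n : Z" for n using * assms subspace_scale by blast
 ultimately show "c *R x : closure Z" unfolding closure_sequential by (intro exI[of _ "%n. c *R X n"]) auto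
qed

lemma closure_subspace_dense:
 fixes Z :: "'h::{real_inner, banach} set"
 assumes "subspace Z" and "!!g. (!!z. z : Z ==> inner z g = 0) ==> g = 0"
 shows "closure Z = UNIV"
proof -
 have "x : closure Z" for x
 proof (rule closed_subspace_double_complement)
  show "subspace (closure Z)" "closed (closure Z)" by (auto simp: assms subspace_closure)
  fix g assume "!!z. z : closure Z ==> inner z g = 0"
  hence "g = 0" using assms(2) closure_subset by blast
  thus "inner x g = 0" by simp
 qed
 thus ?thesis by auto
qed

section \<open>Resolvents of an accretively perturbed self-adjoint operator\<close>

text \<open>Operators are graphs. Self-adjointness refers to the real inner product; the complex structure survives as the isometry
  \<open>J\<close>.\<close>

locale selfadj_op =
 fixes D :: "('h::{real_inner, banach} \<times> 'h) set" and J :: "'h => 'h"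
 assumes D_adj: "(v, w) : D \<longleftrightarrow> (\<forall>u z. (u, z) : D --> inner z v = inner u w)"
  and D_dense: "closure (Domain D) = UNIV"
  and J_linear: "linear J" and J_J [simp]: "J (J x) = - x"
  and J_iso [simp]: "inner (J x) (J y) = inner x y"
  and D_J: "(u, v) : D ==> (J u, J v) : D"
begin

lemma J_simps [simp]:
 "J (x+y) = J x+J y" "J (x-y) = J x-J y" "J (c *R x) = c *R J x" "J 0 = 0" "J (- x) = - J x"
 using J_linear by (simp_all add: linear_add linear_diff linear_scale linear_0 linear_neg)

lemma norm_J [simp]: "norm (J x) = norm x"
 by (simp add: norm_eq_sqrt_inner)

lemma bounded_linear_J: "bounded_linear J"
 using J_linear by (intro bounded_linear_intro[where K = 1]) (auto simp: linear_add linear_scale)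

lemma inner_J_left: "inner (J x) y = - inner x (J y)"
 using J_iso[of x "J y"] J_J[of y] by simp

lemma D_sym: "(u, z) : D ==> (v, w) : D ==> inner z v = inner u w"
 using D_adj by blast

lemma D_zero: "(0, 0) : D"
 by (subst D_adj) simp

lemma D_add: "(u, v) : D ==> (u', v') : D ==> (u+u', v+v') : D"
 by (subst D_adj) (auto simp: inner_add_right D_sym)

lemma D_scale: "(u, v) : D ==> (c *R u, c *R v) : D"
 by (subst D_adj) (auto simp: D_sym)

lemma D_diff: "(u, v) : D ==> (u', v') : D ==> (u-u', v-v') : D"
 by (subst D_adj) (auto simp: inner_diff_right D_sym)

lemma D_closed:
 assumes "!!n. (u n, v n) : D" "u ----> x" "v ----> y"
 shows "(x, y) : D"
proof (subst D_adj, intro allI impI)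
 fix w z assume wz: "(w, z) : D"
 have "(%n. inner z (u n)) ----> inner z x" by (intro tendsto_intros assms)
 moreover have "(%n. inner w (v n)) ----> inner w y" by (intro tendsto_intros assms)
 moreover have "inner z (u n) = inner w (v n)" for n using D_sym[OF wz assms(1)] .
 ultimately show "inner z x = inner w y" using LIMSEQ_unique by simp
qed

lemma D_fun:
 assumes "(u, v) : D" "(u, v') : D" shows "v = v'"
proof -
 have z: "(0, v-v') : D" using D_diff[OF assms] by simp
 have "closure (Domain D) \<subseteq> {x. inner x (v-v') = 0}"
 proof (rule closure_minimal)
  show "Domain D \<subseteq> {x. inner x (v-v') = 0}" using D_sym[OF _ z] by force
  show "closed {x. inner x (v-v') = 0}" by (intro closed_Collect_eq continuous_intros)
 qed
 hence "v-v' : {x. inner x (v-v') = 0}" using D_dense by blast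
 hence "inner (v-v') (v-v') = 0" by simp
 thus ?thesis by (simp only: inner_eq_zero_iff) simp
qed

text \<open>The quadratic form of a self-adjoint operator is real, and \<open>inner y (J v)\<close> is its imaginary part up to
  sign.\<close>

lemma inner_D_J: "(y, v) : D ==> inner y (J v) = 0"
proof -
 assume y: "(y, v) : D"
 have "inner v (J y) = inner y (J v)" by (rule D_sym[OF y D_J[OF y]])
 moreover have "inner y (J v) = - inner v (J y)" using inner_J_left[of v y] by (simp add: inner_commute)
 ultimately show ?thesis by simp
qed

end

text \<open>The operator of interest is \<open>b D\<close>. Only the accretivity of \<open>b\<close> on the range of \<open>D\<close> is
  available; the adjoint \<open>b'\<close> then has the same property, which makes the hypotheses symmetric under exchanging
  \<open>b\<close> and \<open>b'\<close>. The isometry \<open>J\<close> is multiplication by the imaginary unit.\<close>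

locale accretive_op = selfadj_op D J
 for D :: "('h::{real_inner, banach} \<times> 'h) set" and J :: "'h => 'h" +
 fixes b b' :: "'h => 'h" and \<delta> K :: real
 assumes b_linear: "linear b" and b'_linear: "linear b'"
  and b_adj: "inner (b x) y = inner x (b' y)"
  and b_J: "b (J x) = J (b x)"
  and b_le: "norm (b x) <= K*norm x"
  and delta_pos: "\<delta> > 0"
  and acc: "(u, v) : D ==> \<delta>*(norm v)^2 <= inner (b v) v"
begin

lemma b_simps [simp]:
 "b (x+y) = b x+b y" "b (x-y) = b x-b y" "b (c *R x) = c *R b x" "b 0 = 0" "b (- x) = - b x"
 using b_linear by (simp_all add: linear_add linear_diff linear_scale linear_0 linear_neg)

lemma bounded_linear_b: "bounded_linear b"
 using b_linear b_le by (intro bounded_linear_intro[where K = K]) (auto simp: linear_add linear_scale mult.commute)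

lemma K_bound: "K*norm (x::'h) >= 0"
 using b_le[of x] norm_ge_zero order_trans by blast

lemma acc_le: assumes "(u, v) : D" shows "norm v <= norm (b v)/\<delta>"
proof (cases "v = 0")
 case False
 have "\<delta>*(norm v)^2 <= norm (b v)*norm v"
  using acc[OF assms] norm_cauchy_schwarz order_trans by blast
 hence "\<delta>*norm v <= norm (b v)" using False by (simp add: power2_eq_square)
 thus ?thesis using delta_pos by (simp add: field_simps)
qed simp

text \<open>The adjoint of \<open>b\<close> has the same numerical range, so every result holds for \<open>b'\<close> as well.\<close>

lemma flip: "accretive_op D J b' b \<delta> K"
proof (intro accretive_op.intro[OF selfadj_op_axioms] accretive_op_axioms.intro)
 show "linear b'" "linear b" by (fact b'_linear b_linear)+
 show "inner (b' x) y = inner x (b y)" for x y :: 'h using b_adj[of y x] by (simp add: inner_commute)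
 show "b' (J x) = J (b' x)" for x :: 'h
 proof -
  have "inner y (b' (J x)) = inner y (J (b' x))" for y
  proof -
   have "inner y (b' (J x)) = inner (b y) (J x)" by (simp add: b_adj)
   also have "... = - inner (b (J y)) x" by (simp add: b_J inner_J_left)
   also have "... = - inner (J y) (b' x)" by (simp add: b_adj)
   also have "... = inner y (J (b' x))" by (simp add: inner_J_left)
   finally show ?thesis .
  qed
  hence "inner (b' (J x)-J (b' x)) (b' (J x)-J (b' x)) = 0" by (simp add: inner_diff_right)
  thus ?thesis by simp
 qed
 show "norm (b' x) <= K*norm x" for x :: 'h
 proof (cases "b' x = 0")
  case True thus ?thesis using K_bound by simp
 next
  case False
  have "(norm (b' x))^2 = inner (b (b' x)) x" by (simp add: b_adj power2_norm_eq_inner)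
  also have "... <= norm (b (b' x))*norm x" by (rule norm_cauchy_schwarz)
  also have "... <= (K*norm (b' x))*norm x" by (intro mult_right_mono b_le) auto
  finally show ?thesis using False by (simp add: power2_eq_square)
 qed
 show "\<delta> > 0" by (fact delta_pos)
 show "\<delta>*(norm v)^2 <= inner (b' v) v" if "(u, v) : D" for u v :: 'h
  using acc[OF that] b_adj[of v v] by (simp add: inner_commute)
qed

text \<open>Pairing the equation with \<open>J v\<close> removes \<open>y\<close>, since \<open>inner y (J v) = 0\<close>, and leaves the
  accretive form \<open>inner (b v) v\<close>.\<close>

lemma resolvent_bound:
 assumes "(y, v) : D" "y+s *R J (b v) = f"
 shows "\<bar>s\<bar>*norm v <= norm f/\<delta>"
proof (cases "v = 0")
 case True thus ?thesis using delta_pos by simp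
next
 case False
 have "inner f (J v) = s*inner (b v) v"
  unfolding assms(2)[symmetric] using inner_D_J[OF assms(1)] by (simp add: inner_add_left)
 hence "\<bar>s\<bar>*\<bar>inner (b v) v\<bar> = \<bar>inner f (J v)\<bar>" by (simp add: abs_mult)
 also have "... <= norm f*norm v" using Cauchy_Schwarz_ineq2[of f "J v"] by simp
 finally have "\<bar>s\<bar>*\<bar>inner (b v) v\<bar> <= norm f*norm v" .
 moreover have "\<bar>s\<bar>*(\<delta>*(norm v)^2) <= \<bar>s\<bar>*\<bar>inner (b v) v\<bar>"
  using acc[OF assms(1)] by (intro mult_left_mono) auto
 ultimately have "(\<bar>s\<bar>*norm v * \<delta>)*norm v <= norm f*norm v" by (simp add: power2_eq_square mult_ac)
 thus ?thesis using False delta_pos by (simp add: field_simps)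
qed

text \<open>The range is dense: a vector orthogonal to it solves the adjoint equation, where the same pairing with accretivity of
  \<open>b'\<close> forces it to vanish. The a priori bound makes it closed.\<close>

lemma resolvent_exists:
 assumes s: "s ~= 0"
 shows "\<exists>y v. (y, v) : D & y+s *R J (b v) = f"
proof -
 define X where "X = {y+s *R J (b v) |y v. (y, v) : D}"
 have sub: "subspace X"
 proof (rule subspaceI)
  show "0 : X" using D_zero by (force simp: X_def)
  show "x+y : X" if "x : X" "y : X" for x y
  proof -
   from that obtain a c a' c' where "(a, c) : D" "(a', c') : D" "x = a+s *R J (b c)" "y = a'+s *R J (b c')"
    by (auto simp: X_def)
   thus ?thesis unfolding X_def
    by (intro CollectI exI[of _ "a+a'"] exI[of _ "c+c'"]) (auto simp: D_add algebra_simps)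
  qed
  show "c *R x : X" if "x : X" for c x
  proof -
   from that obtain a d where "(a, d) : D" "x = a+s *R J (b d)" by (auto simp: X_def)
   thus ?thesis unfolding X_def
    by (intro CollectI exI[of _ "c *R a"] exI[of _ "c *R d"]) (auto simp: D_scale algebra_simps)
  qed
 qed
 have "closure X = UNIV"
 proof (rule closure_subspace_dense[OF sub])
  fix g assume g: "!!z. z : X ==> inner z g = 0"
  interpret adj: accretive_op D J b' b \<delta> K by (rule flip)
  have "(b' (J g), (1/s) *R g) : D"
  proof (subst D_adj, intro allI impI)
   fix u z assume "(u, z) : D"
   hence "u+s *R J (b z) : X" by (auto simp: X_def)
   from g[OF this] have "inner u g+s*inner (J (b z)) g = 0" by (simp add: inner_add_left)
   thus "inner z (b' (J g)) = inner u ((1/s) *R g)"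
    using s by (simp add: inner_J_left b_adj field_simps)
  qed
  note gD = this
  have "inner (b' (J g)) (J ((1/s) *R g)) = 0" by (rule inner_D_J[OF gD])
  hence "inner (b' g) g = 0" using s by (simp add: adj.b_J)
  moreover have "\<delta>*(norm ((1/s) *R g))^2 <= inner (b' ((1/s) *R g)) ((1/s) *R g)" by (rule adj.acc[OF gD])
  ultimately have "\<delta>*(norm ((1/s) *R g))^2 <= 0" by simp
  hence "(norm ((1/s) *R g))^2 <= 0" using delta_pos by (simp only: mult_le_0_iff) auto
  thus "g = 0" using s by simp
 qed
 hence "f : closure X" by simp
 then obtain F where F: "!!n. F n : X" "F ----> f" unfolding closure_sequential by blast
 hence "\<exists>y v. (y, v) : D & F n = y+s *R J (b v)" for n unfolding X_def by blast
 then obtain Y V where YV: "!!n. (Y n, V n) : D" "!!n. F n = Y n+s *R J (b (V n))" by metis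
 have Vle: "norm (V n-V m) <= norm (F n-F m)/(\<delta>*\<bar>s\<bar>)" for n m
 proof -
  have "\<bar>s\<bar>*norm (V n-V m) <= norm (F n-F m)/\<delta>"
   by (rule resolvent_bound[OF D_diff[OF YV(1) YV(1)]]) (simp add: YV(2) algebra_simps)
  thus ?thesis using s delta_pos by (simp add: field_simps)
 qed
 have "Cauchy V"
 proof (rule metric_CauchyI)
  fix e :: real assume "e > 0"
  hence "e*(\<delta>*\<bar>s\<bar>) > 0" using s delta_pos by simp
  from metric_CauchyD[OF LIMSEQ_imp_Cauchy[OF F(2)] this] obtain M
   where M: "!!m n. m >= M ==> n >= M ==> norm (F m-F n) < e*(\<delta>*\<bar>s\<bar>)" by (auto simp: dist_norm)
  show "\<exists>M. \<forall>m\<ge>M. \<forall>n\<ge>M. dist (V m) (V n) < e"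
  proof (intro exI allI impI)
   fix m n assume mn: "M <= m" "M <= n"
   have "norm (V m-V n) <= norm (F m-F n)/(\<delta>*\<bar>s\<bar>)" by (rule Vle)
   also have "... < e" using M[OF mn] s delta_pos by (simp add: field_simps)
   finally show "dist (V m) (V n) < e" by (simp add: dist_norm)
  qed
 qed
 then obtain v where v: "V ----> v" using Cauchy_convergent convergent_def by blast
 have JbV: "(%n. J (b (V n))) ----> J (b v)"
  by (intro bounded_linear.tendsto[OF bounded_linear_J] bounded_linear.tendsto[OF bounded_linear_b] v)
 have "(%n. F n-s *R J (b (V n))) ----> f-s *R J (b v)" by (intro tendsto_intros F JbV)
 moreover have "F n-s *R J (b (V n)) = Y n" for n by (simp add: YV(2))
 ultimately have "Y ----> f-s *R J (b v)" by simp
 from D_closed[OF YV(1) this v] show ?thesis by (intro exI[of _ "f-s *R J (b v)"] exI[of _ v]) simp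
qed

lemma resolvent_unique:
 assumes s: "s ~= 0" and 1: "(y, v) : D" "y+s *R J (b v) = f" and 2: "(y', v') : D" "y'+s *R J (b v') = f"
 shows "y = y'" "v = v'"
proof -
 have "\<bar>s\<bar>*norm (v-v') <= norm (0::'h)/\<delta>"
  by (rule resolvent_bound[OF D_diff[OF 1(1) 2(1)]]) (use 1 2 in \<open>simp add: algebra_simps\<close>)
 thus v: "v = v'" using s by (simp add: mult_le_0_iff)
 show "y = y'" using 1(2) 2(2) by (metis v add_right_cancel)
qed

text \<open>\<open>R s = (I + s J b D)\<^sup>-\<^sup>1\<close> and \<open>W s = D R s\<close>.\<close>

definition R :: "real => 'h => 'h" where
 "R s f = (SOME y. \<exists>v. (y, v) : D & y+s *R J (b v) = f)"

definition W :: "real => 'h => 'h" where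
 "W s f = (SOME v. (R s f, v) : D & R s f+s *R J (b v) = f)"

lemma RW:
 assumes "s ~= 0"
 shows "(R s f, W s f) : D" "R s f+s *R J (b (W s f)) = f"
proof -
 have "\<exists>v. (R s f, v) : D & R s f+s *R J (b v) = f"
  unfolding R_def by (rule someI_ex) (rule resolvent_exists[OF assms])
 from someI_ex[OF this] show "(R s f, W s f) : D" "R s f+s *R J (b (W s f)) = f"
  by (simp_all add: W_def)
qed

lemma RW_eqI:
 assumes "s ~= 0" "(y, v) : D" "y+s *R J (b v) = f"
 shows "R s f = y" "W s f = v"
 using resolvent_unique[OF assms(1) RW[OF assms(1)] assms(2,3)] by auto

lemma RW_add: "s ~= 0 ==> R s (f+g) = R s f+R s g" "s ~= 0 ==> W s (f+g) = W s f+W s g"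
 using RW_eqI[OF _ D_add[OF RW(1) RW(1)], of s s s f g "f+g"] RW(2)[of s f] RW(2)[of s g]
 by (simp_all add: algebra_simps)

lemma RW_scale: "s ~= 0 ==> R s (c *R f) = c *R R s f" "s ~= 0 ==> W s (c *R f) = c *R W s f"
proof -
 assume s: "s ~= 0"
 have "c *R R s f+s *R J (b (c *R W s f)) = c *R f"
  by (subst (2) RW(2)[OF s, of f, symmetric]) (simp add: algebra_simps)
 from RW_eqI[OF s D_scale[OF RW(1)[OF s]] this]
 show "R s (c *R f) = c *R R s f" "W s (c *R f) = c *R W s f" by auto
qed

lemma RW_J: "s ~= 0 ==> R s (J f) = J (R s f)" "s ~= 0 ==> W s (J f) = J (W s f)"
proof -
 assume s: "s ~= 0"
 have "J (R s f)+s *R J (b (J (W s f))) = J f"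
  by (subst (2) RW(2)[OF s, of f, symmetric]) (simp add: b_J)
 from RW_eqI[OF s D_J[OF RW(1)[OF s]] this]
 show "R s (J f) = J (R s f)" "W s (J f) = J (W s f)" by auto
qed

lemma W_bound: "s ~= 0 ==> \<bar>s\<bar>*norm (W s f) <= norm f/\<delta>"
 using resolvent_bound[OF RW] by blast

text \<open>The bound for the resolvents, uniform in \<open>s\<close>.\<close>

definition CR :: real where "CR = 1+\<bar>K\<bar>/\<delta>"

lemma CR_ge1: "CR >= 1" using delta_pos by (simp add: CR_def)

lemma bW_bound: "s ~= 0 ==> \<bar>s\<bar>*norm (b (W s f)) <= \<bar>K\<bar>/\<delta>*norm f"
proof -
 assume s: "s ~= 0"
 have "\<bar>s\<bar>*norm (b (W s f)) <= \<bar>s\<bar>*(\<bar>K\<bar>*norm (W s f))"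
  using b_le[of "W s f"] mult_right_mono[OF abs_ge_self[of K] norm_ge_zero[of "W s f"]]
  by (intro mult_left_mono) auto
 also have "... <= \<bar>K\<bar>*(norm f/\<delta>)" using mult_left_mono[OF W_bound[OF s, of f], of "\<bar>K\<bar>"]
  by (simp add: mult.left_commute)
 finally show ?thesis by (simp add: field_simps)
qed

lemma R_bound: "s ~= 0 ==> norm (R s f) <= CR*norm f"
proof -
 assume s: "s ~= 0"
 have "R s f = f-s *R J (b (W s f))" using RW(2)[OF s, of f] by (simp add: algebra_simps)
 hence "norm (R s f) <= norm f+\<bar>s\<bar>*norm (b (W s f))" using norm_triangle_ineq4[of f "s *R J (b (W s f))"] by simp
 with bW_bound[OF s, of f] show ?thesis by (simp add: CR_def algebra_simps)
qed

lemma linear_R: "s ~= 0 ==> linear (R s)" by (rule linearI) (auto simp: RW_add RW_scale)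
lemma linear_W: "s ~= 0 ==> linear (W s)" by (rule linearI) (auto simp: RW_add RW_scale)

lemma RW_diff: "s ~= 0 ==> R s (f-g) = R s f-R s g" "s ~= 0 ==> W s (f-g) = W s f-W s g"
 using linear_R linear_W by (auto simp: linear_diff)

lemma R_domain: "s ~= 0 ==> (f, w) : D ==> R s f+s *R J (R s (b w)) = f"
 using RW_eqI(1)[of s f w "f+s *R J (b w)"] by (simp add: RW_add RW_scale RW_J)

lemma bW_domain: "s ~= 0 ==> (f, w) : D ==> b (W s f) = R s (b w)"
proof -
 assume s: "s ~= 0" and f: "(f, w) : D"
 have "s *R J (b (W s f)) = s *R J (R s (b w))"
  using RW(2)[OF s, of f] R_domain[OF s f] by (metis add_left_cancel)
 hence "J (J (b (W s f))) = J (J (R s (b w)))" using s by simp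
 thus ?thesis by simp
qed

lemma R_commute:
 assumes s: "s ~= 0" and t: "t ~= 0" shows "R t (R s f) = R s (R t f)"
proof -
 define y v where "y = R t f" and "v = W t f"
 have yv: "(y, v) : D" "y+t *R J (b v) = f" using RW[OF t] by (auto simp: y_def v_def)
 have "R s y+t *R J (b (W s y)) = R s f"
  unfolding yv(2)[symmetric] using s by (simp add: RW_add RW_scale RW_J bW_domain[OF s yv(1)])
 from RW_eqI(1)[OF t RW(1)[OF s] this] show ?thesis by (simp add: y_def)
qed

lemma R_resolvent: "s ~= 0 ==> t ~= 0 ==> R s f = R t f+(t-s) *R R s (J (b (W t f)))"
proof -
 assume s: "s ~= 0" and t: "t ~= 0"
 have "f = (R t f+s *R J (b (W t f)))+(t-s) *R J (b (W t f))"
  by (subst RW(2)[OF t, of f, symmetric]) (simp add: algebra_simps)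
 hence "R s f = R s (R t f+s *R J (b (W t f)))+(t-s) *R R s (J (b (W t f)))"
  by (metis RW_add(1) RW_scale(1) s)
 thus ?thesis using RW_eqI(1)[OF s RW(1)[OF t] refl, of f] by simp
qed

text \<open>On the domain of \<open>D\<close> the difference \<open>R s f - f\<close> is of order \<open>s\<close>; uniform boundedness
  extends this to the closure.\<close>

lemma R_tendsto_0: "((%s. R s f) \<longlongrightarrow> f) (at 0)"
proof (rule tendstoI)
 fix e :: real assume e: "e > 0"
 define e' where "e' = e/(2*(CR+1))"
 have e': "e' > 0" using e CR_ge1 by (simp add: e'_def)
 have "f : closure (Domain D)" using D_dense by simp
 from this e' have "\<exists>f'\<in>Domain D. dist f' f < e'" by (simp add: closure_approachable)
 then obtain f' w where f': "(f', w) : D" "norm (f'-f) < e'" by (auto simp: dist_norm)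
 define c where "c = CR*norm (b w)+1"
 have c: "c > 0" using CR_ge1 by (simp add: c_def add_nonneg_pos)
 have "eventually (%s. \<bar>s\<bar> < e/2/c & s ~= 0) (at 0)"
  unfolding eventually_at by (rule exI[of _ "e/2/c"]) (use e c in auto)
 thus "eventually (%s. dist (R s f) f < e) (at 0)"
 proof eventually_elim
  case (elim s)
  hence s: "s ~= 0" "\<bar>s\<bar> < e/2/c" by auto
  have "R s f-f = R s (f-f')+(f'-f)-s *R J (R s (b w))"
   using R_domain[OF s(1) f'(1)] by (simp add: RW_diff s algebra_simps)
  hence "norm (R s f-f) <= norm (R s (f-f'))+norm (f'-f)+\<bar>s\<bar>*norm (R s (b w))"
   apply (simp only:) using norm_triangle_ineq4[of "R s (f-f')+(f'-f)" "s *R J (R s (b w))"]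
    norm_triangle_ineq[of "R s (f-f')" "f'-f"] by simp
  also have "... <= CR*norm (f-f')+norm (f'-f)+\<bar>s\<bar>*(CR*norm (b w))"
   by (intro add_mono mult_left_mono R_bound s) auto
  also have "... <= (CR+1)*e'+\<bar>s\<bar>*c"
  proof -
   have "(CR+1)*norm (f'-f) <= (CR+1)*e'" using f'(2) CR_ge1 by (intro mult_left_mono) auto
   moreover have "\<bar>s\<bar>*(CR*norm (b w)) <= \<bar>s\<bar>*c" by (intro mult_left_mono) (auto simp: c_def)
   ultimately show ?thesis by (simp add: norm_minus_commute algebra_simps)
  qed
  also have "... < e"
  proof -
   have "(CR+1)*e' = e/2" using CR_ge1 by (simp add: e'_def field_simps)
   moreover have "\<bar>s\<bar>*c < e/2" using s(2) c by (simp add: field_simps)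
   ultimately show ?thesis by simp
  qed
  finally show ?case by (simp add: dist_norm)
 qed
qed

lemma R_has_derivative:
 assumes t: "t ~= 0"
 shows "((%s. R s f) has_vector_derivative (1/t) *R (R t (R t f)-R t f)) (at t)"
proof -
 define g where "g = J (b (W t f))"
 have tg: "t *R g = f-R t f" using RW(2)[OF t, of f] by (simp add: g_def algebra_simps)
 have lip: "norm (R s h-R t h) <= \<bar>t-s\<bar>*(CR*norm (b (W t h)))" if "s ~= 0" for s h
  using R_resolvent[OF that t, of h] R_bound[OF that, of "J (b (W t h))"] by (simp add: mult_left_mono)
 have ev: "eventually (%s. s ~= 0 & s ~= t) (at t)"
  by (intro eventually_conj eventually_neq_at_within)
 have "((%s. R s g) \<longlongrightarrow> R t g) (at t)"
 proof (rule Lim_null[THEN iffD2], rule Lim_null_comparison)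
  show "eventually (%s. norm (R s g-R t g) <= \<bar>t-s\<bar>*(CR*norm (b (W t g)))) (at t)"
   using ev by eventually_elim (use lip in auto)
  have "((%s. \<bar>t-s\<bar>*(CR*norm (b (W t g)))) \<longlongrightarrow> \<bar>t-t\<bar>*(CR*norm (b (W t g)))) (at t)"
   by (intro tendsto_intros)
  thus "((%s. \<bar>t-s\<bar>*(CR*norm (b (W t g)))) \<longlongrightarrow> 0) (at t)" by simp
 qed
 hence lim: "((%s. - R s g) \<longlongrightarrow>-R t g) (at t)" by (intro tendsto_intros)
 have eq: "- R t g = (1/t) *R (R t (R t f)-R t f)"
 proof -
  have "t *R R t g = R t f-R t (R t f)" using tg by (metis RW_diff(1) RW_scale(1) t)
  hence "(1/t) *R (t *R R t g) = (1/t) *R (R t f-R t (R t f))" by simp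
  thus ?thesis using t by (simp add: algebra_simps)
 qed
 have lim0: "((%s. norm (- R s g - - R t g)) \<longlongrightarrow> 0) (at t)"
  using lim by (intro tendsto_norm_zero) (use Lim_null[THEN iffD1, OF lim] in simp)
 show ?thesis unfolding eq[symmetric] has_vector_derivative_def has_derivative_at2
 proof (intro conjI bounded_linear_scaleR_left)
  show "((%s. (1/norm (s-t)) *R (R s f-(R t f+(s-t) *R-R t g))) \<longlongrightarrow> 0) (at t)"
  proof (rule Lim_null_comparison[OF _ lim0])
   show "eventually (%s. norm ((1/norm (s-t)) *R (R s f-(R t f+(s-t) *R-R t g)))
     <= norm (- R s g - - R t g)) (at t)"
    using ev
   proof eventually_elim
    case (elim s)
    have "R s f-(R t f+(s-t) *R-R t g) = (s-t) *R (- R s g - - R t g)"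
     using R_resolvent[of s t f] elim t by (simp add: g_def algebra_simps)
    thus ?case using elim by simp
   qed
  qed
 qed
qed

end

context accretive_op
begin

text \<open>\<open>U t = (I + t\<^sup>2 T T)\<^sup>-\<^sup>1\<close> and \<open>Q t = t T U t\<close> with \<open>T = b D\<close>, expressed
  through the resolvents at \<open>\<plusminus>t\<close>.\<close>

definition U :: "real => 'h => 'h" where "U t f = (1/2) *R (R t f+R (- t) f)"
definition WU :: "real => 'h => 'h" where "WU t f = (1/2) *R (W t f+W (- t) f)"
definition Q :: "real => 'h => 'h" where "Q t f = (1/2) *R J (R t f-R (- t) f)"
definition WQ :: "real => 'h => 'h" where "WQ t f = (1/2) *R J (W t f-W (- t) f)"

lemma UQ_D: "t ~= 0 ==> (U t f, WU t f) : D" "t ~= 0 ==> (Q t f, WQ t f) : D"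
 using RW(1)[of t f] RW(1)[of "- t" f] by (simp_all only: U_def WU_def Q_def WQ_def D_scale D_add D_diff D_J neg_equal_0_iff_equal not_False_eq_True)

lemma b_WU: assumes t: "t ~= 0" shows "t *R b (WU t f) = Q t f"
proof -
 have "R t f-R (- t) f = - (t *R J (b (W t f)))-t *R J (b (W (- t) f))"
  using RW(2)[of t f] RW(2)[of "- t" f] t by (simp add: algebra_simps)
 hence "J (R t f-R (- t) f) = t *R b (W t f)+t *R b (W (- t) f)" by simp
 thus ?thesis by (simp add: Q_def WU_def scaleR_add_right)
qed

lemma b_WQ: assumes t: "t ~= 0" shows "t *R b (WQ t f) = f-U t f"
proof -
 have e: "t *R J (b (W t f)) = f-R t f" "t *R J (b (W (- t) f)) = - (f-R (- t) f)"
  using RW(2)[of t f] RW(2)[of "- t" f] t by (simp_all add: algebra_simps)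
 have "t *R b (WQ t f) = (1/2) *R (t *R J (b (W t f))-t *R J (b (W (- t) f)))"
  by (simp add: WQ_def b_J algebra_simps)
 also have "... = (1/2) *R (f+f)-U t f" unfolding U_def e scaleR_diff_right[symmetric]
  by (rule arg_cong[where f = "scaleR (1/2)"]) simp
 also have "... = f-U t f" by (simp only: scaleR_half_double)
 finally show ?thesis .
qed

text \<open>\<open>J\<close> diagonalises the pair of first order equations for \<open>x\<close> and \<open>q = t b v\<close>: \<open>x - J
  q\<close> and \<open>x + J q\<close> solve the resolvent equations at \<open>t\<close> and \<open>- t\<close>.\<close>

lemma UQ_eqI:
 assumes t: "t ~= 0" and "(x, v) : D" "(t *R b v, v') : D" "x+t *R b v' = f"
 shows "U t f = x" "Q t f = t *R b v"
proof -
 define q where "q = t *R b v"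
 have q: "(q, v') : D" using assms by (simp add: q_def)
 have "x-J q+t *R J (b (v-J v')) = f"
  using assms(4) by (simp add: b_J q_def algebra_simps)
 from RW_eqI(1)[OF t D_diff[OF assms(2) D_J[OF q]] this] have 1: "R t f = x-J q" .
 have "x+J q+(- t) *R J (b (v+J v')) = f"
  using assms(4) by (simp add: b_J q_def algebra_simps)
 from RW_eqI(1)[OF _ D_add[OF assms(2) D_J[OF q]] this] t have 2: "R (- t) f = x+J q" by simp
 show "U t f = x" "Q t f = t *R b v" unfolding U_def Q_def 1 2
  by (simp_all add: q_def scaleR_2[symmetric])
qed

lemma U_linear: "t ~= 0 ==> linear (U t)" and Q_linear: "t ~= 0 ==> linear (Q t)"
 and WU_linear: "t ~= 0 ==> linear (WU t)" and WQ_linear: "t ~= 0 ==> linear (WQ t)"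
 by (rule linearI; simp add: U_def Q_def WU_def WQ_def RW_add RW_scale algebra_simps)+

lemmas UQ_simps =
 linear_add[OF U_linear] linear_diff[OF U_linear] linear_scale[OF U_linear]
 linear_add[OF Q_linear] linear_diff[OF Q_linear] linear_scale[OF Q_linear]
 linear_0[OF U_linear] linear_0[OF Q_linear]

lemma U_J: "t ~= 0 ==> U t (J f) = J (U t f)" and Q_J: "t ~= 0 ==> Q t (J f) = J (Q t f)"
 by (simp_all add: U_def Q_def RW_J)

lemma U_bound: assumes "t ~= 0" shows "norm (U t f) <= CR*norm f"
 using norm_triangle_ineq[of "R t f" "R (- t) f"] R_bound[of t f] R_bound[of "- t" f] assms by (simp add: U_def)

lemma Q_bound: assumes "t ~= 0" shows "norm (Q t f) <= CR*norm f"
 using norm_triangle_ineq4[of "R t f" "R (- t) f"] R_bound[of t f] R_bound[of "- t" f] assms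
 by (simp add: Q_def del: J_simps)

lemma bounded_linear_U: "t ~= 0 ==> bounded_linear (U t)" and bounded_linear_Q: "t ~= 0 ==> bounded_linear (Q t)"
 by (rule bounded_linear_intro[where K = CR]; simp add: UQ_simps U_bound Q_bound mult.commute[of _ CR])+

lemma UQ_domain:
 assumes t: "t ~= 0" and f: "(f, w) : D"
 shows "U t f+t *R Q t (b w) = f" "Q t f = t *R U t (b w)"
proof -
 define h where "h = b w"
 have x: "(f-t *R Q t h, w-t *R WQ t h) : D"
  by (intro D_diff D_scale f UQ_D t)
 have q: "t *R b (w-t *R WQ t h) = t *R U t h"
  using b_WQ[OF t, of h] by (simp add: h_def[symmetric])
 have q': "(t *R b (w-t *R WQ t h), t *R WU t h) : D"
  unfolding q by (intro D_scale UQ_D t)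
 have "f-t *R Q t h+t *R b (t *R WU t h) = f" using b_WU[OF t, of h] by simp
 from UQ_eqI[OF t x q' this] show "U t f+t *R Q t (b w) = f" "Q t f = t *R U t (b w)"
  by (simp_all only: q) (simp_all add: h_def)
qed

lemma R_commute_UQ: "s ~= 0 ==> t ~= 0 ==> R s (U t f) = U t (R s f)" "s ~= 0 ==> t ~= 0 ==> R s (Q t f) = Q t (R s f)"
 by (simp_all add: U_def Q_def RW_add RW_diff RW_scale RW_J R_commute[of _ s])

lemma UQ_commute:
 "s ~= 0 ==> t ~= 0 ==> U s (U t f) = U t (U s f)"
 "s ~= 0 ==> t ~= 0 ==> Q s (Q t f) = Q t (Q s f)"
 "s ~= 0 ==> t ~= 0 ==> U s (Q t f) = Q t (U s f)"
 by (simp_all add: U_def[of s] Q_def[of s] R_commute_UQ UQ_simps U_J Q_J del: J_simps)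

lemma QQ_eq: "s ~= 0 ==> t ~= 0 ==> s *R Q t (Q s f) = t *R (U t f-U t (U s f))"
proof -
 assume s: "s ~= 0" and t: "t ~= 0"
 have "s *R Q t (Q s f) = t *R U t (s *R b (WQ s f))"
  using UQ_domain(2)[OF t UQ_D(2)[OF s, of f]] t by (simp add: UQ_simps mult.commute)
 thus ?thesis using t by (simp add: b_WQ[OF s] UQ_simps)
qed

lemma Q_sq: "t ~= 0 ==> Q t (Q t f) = U t f-U t (U t f)"
 using QQ_eq[of t t f] by simp

text \<open>This is the identity \<open>t s / ((1 + t\<^sup>2 z\<^sup>2) (1 + s\<^sup>2 z\<^sup>2)) * z\<^sup>2 (t\<^sup>2 - s\<^sup>2) = t
  s (1 / (1 + s\<^sup>2 z\<^sup>2) - 1 / (1 + t\<^sup>2 z\<^sup>2))\<close> with \<open>z\<close> replaced by \<open>T\<close>.\<close>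

lemma frullani_identity:
 assumes "s ~= 0" "t ~= 0"
 shows "(t^2-s^2) *R Q t (Q s f) = (t * s) *R (U s f-U t f)"
proof -
 have 1: "s *R Q t (Q s f) = t *R (U t f-U t (U s f))" by (rule QQ_eq[OF assms])
 have 2: "t *R Q t (Q s f) = s *R (U s f-U t (U s f))"
  using QQ_eq[OF assms(2,1), of f] UQ_commute(1,2)[OF assms, of f] by simp
 have "t *R (t *R Q t (Q s f))-s *R (s *R Q t (Q s f)) = (t * s) *R (U s f-U t f)"
  unfolding 1 2 by (simp add: algebra_simps)
 thus ?thesis by (simp add: power2_eq_square algebra_simps)
qed

lemma U_tendsto_0: "((%t. U t f) \<longlongrightarrow> f) (at 0)" and Q_tendsto_0: "((%t. Q t f) \<longlongrightarrow> 0) (at 0)"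
proof -
 have m: "((%t. R (- t) f) \<longlongrightarrow> f) (at 0)"
 proof (rule filterlim_compose[OF R_tendsto_0])
  have "((%t::real. - t) \<longlongrightarrow>-0) (at 0)" by (intro tendsto_intros)
  thus "filterlim uminus (at 0) (at (0::real))"
   by (auto simp: filterlim_at eventually_at_filter)
 qed
 have "((%t. U t f) \<longlongrightarrow> (1/2) *R (f+f)) (at 0)" unfolding U_def by (intro tendsto_intros R_tendsto_0 m)
 thus "((%t. U t f) \<longlongrightarrow> f) (at 0)" by (simp add: scaleR_2[symmetric])
 have "((%t. Q t f) \<longlongrightarrow> (1/2) *R J (f-f)) (at 0)" unfolding Q_def
  by (intro tendsto_intros bounded_linear.tendsto[OF bounded_linear_J] R_tendsto_0 m)
 thus "((%t. Q t f) \<longlongrightarrow> 0) (at 0)" by simp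
qed

text \<open>The product rule needs only strong continuity of \<open>R\<close>, because \<open>g\<close> is differentiable in norm and
  \<open>R\<close> is bounded uniformly.\<close>

lemma R_product_derivative:
 assumes t: "t ~= 0" and g: "(g has_vector_derivative g') (at t)"
 shows "((%s. R s (g s)) has_vector_derivative R t g'+(1/t) *R (R t (R t (g t))-R t (g t))) (at t)"
proof -
 define c where "c = (1/t) *R (R t (R t (g t))-R t (g t))"
 have ev: "eventually (%s. s ~= 0 & s ~= t) (at t)"
  using t by (intro eventually_conj eventually_neq_at_within)
 have 1: "((%s. (1/norm (s-t)) *R (g s-(g t+(s-t) *R g'))) \<longlongrightarrow> 0) (at t)"
  using g by (simp add: has_vector_derivative_def has_derivative_at2)
 let ?Y = "%s. R t (g t)+(s-t) *R c"
 have 2: "((%s. (1/norm (s-t)) *R (R s (g t)-(?Y s))) \<longlongrightarrow> 0) (at t)"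
  using R_has_derivative[OF t, of "g t"] by (simp add: has_vector_derivative_def has_derivative_at2 c_def)
 have "isCont (%s. R s g') t"
  using R_has_derivative[OF t, of g'] by (rule has_vector_derivative_continuous)
 hence 3: "((%s. R s g'-R t g') \<longlongrightarrow> 0) (at t)"
  by (simp add: isCont_def Lim_null[symmetric])
 have lim: "((%s. CR*norm ((1/norm (s-t)) *R (g s-(g t+(s-t) *R g')))
   + norm ((1/norm (s-t)) *R (R s (g t)-(?Y s)))+norm (R s g'-R t g')) \<longlongrightarrow> CR*0+0+0) (at t)"
  by (intro tendsto_add tendsto_mult tendsto_const tendsto_norm_zero 1 2 3)
 show ?thesis unfolding c_def[symmetric] has_vector_derivative_def has_derivative_at2
 proof (intro conjI bounded_linear_scaleR_left)
  show "((%s. (1/norm (s-t)) *R (R s (g s)-(R t (g t)+(s-t) *R (R t g'+c)))) \<longlongrightarrow> 0) (at t)"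
  proof (rule Lim_null_comparison[OF _ lim[unfolded mult_zero_right add_0_right]])
   show "eventually (%s. norm ((1/norm (s-t)) *R (R s (g s)-(R t (g t)+(s-t) *R (R t g'+c))))
     <= CR*norm ((1/norm (s-t)) *R (g s-(g t+(s-t) *R g')))
   + norm ((1/norm (s-t)) *R (R s (g t)-(?Y s)))+norm (R s g'-R t g')) (at t)"
    using ev
   proof eventually_elim
    case (elim s)
    define d where "d = g s-(g t+(s-t) *R g')"
    have gs: "g s = d+g t+(s-t) *R g'" by (simp add: d_def)
    have eq: "R s (g s)-(R t (g t)+(s-t) *R (R t g'+c))
      = R s d+(R s (g t)-(?Y s))+(s-t) *R (R s g'-R t g')"
     unfolding gs using elim by (simp add: RW_add RW_diff RW_scale algebra_simps)
    have "norm ((1/norm (s-t)) *R (R s (g s)-(R t (g t)+(s-t) *R (R t g'+c))))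
     <= (1/norm (s-t))*(norm (R s d)+norm (R s (g t)-(?Y s))+norm ((s-t) *R (R s g'-R t g')))"
     unfolding eq norm_scaleR by (intro mult_mono norm_add_rule_thm order_refl norm_triangle_mono) (auto intro: norm_triangle_ineq)
    also have "... <= (1/norm (s-t))*(CR*norm d+norm (R s (g t)-(?Y s))+norm ((s-t) *R (R s g'-R t g')))"
     using elim by (intro mult_left_mono add_mono R_bound) auto
    also have "... = CR*norm ((1/norm (s-t)) *R d)+norm ((1/norm (s-t)) *R (R s (g t)-(?Y s)))
      + (1/norm (s-t))*norm ((s-t) *R (R s g'-R t g'))"
     by (simp only: distrib_left norm_scaleR) simp
    also have "(1/norm (s-t))*norm ((s-t) *R (R s g'-R t g')) = norm (R s g'-R t g')"
     using elim by simp
    finally show ?case by (simp add: d_def)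
   qed
  qed
 qed
qed

definition Z :: "real => 'h => 'h" where "Z t f = R t (R t f)-R t f"

text \<open>Minus the logarithmic derivative \<open>t d/dt\<close> of \<open>Q t f\<close>. With \<open>u = t T\<close>, the antiderivative
  of \<open>8 u\<^sup>2 / (1 + u\<^sup>2)\<^sup>3\<close> is \<open>arctan u + (u\<^sup>3 - u) / (1 + u\<^sup>2)\<^sup>2\<close>, which
  trades the cube of \<open>Q t\<close> for \<open>Q t\<close> itself.\<close>

definition PQ :: "real => 'h => 'h" where "PQ t f = - ((1/2) *R J (Z t f-Z (- t) f))"

lemma R_eq: "R t f = U t f-J (Q t f)" "R (- t) f = U t f+J (Q t f)"
proof -
 have "U t f-J (Q t f) = (1/2) *R (R t f+R t f)" "U t f+J (Q t f) = (1/2) *R (R (- t) f+R (- t) f)"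
  by (simp_all only: U_def Q_def J_simps J_J) (simp_all only: algebra_simps, simp_all)
 thus "R t f = U t f-J (Q t f)" "R (- t) f = U t f+J (Q t f)" by (simp_all only: scaleR_half_double)
qed

lemma PQ_eq: assumes t: "t ~= 0" shows "PQ t f = Q t f-2 *R U t (Q t f)"
proof -
 have t': "- t ~= 0" using t by simp
 have cm: "U t (Q t f) = Q t (U t f)" for f by (rule UQ_commute(3)[OF t t])
 show ?thesis unfolding PQ_def Z_def R_eq(1)[of t] R_eq(2)[of t] using t
  by (simp add: UQ_simps U_J Q_J cm algebra_simps scaleR_add_left[symmetric]) (simp add: scaleR_2)
qed

lemma Z_derivative:
 assumes t: "t ~= 0"
 shows "((%s. Z s f) has_vector_derivative (1/t) *R (2 *R R t (R t (R t f))-3 *R R t (R t f)+R t f)) (at t)"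
proof -
 have e: "R t ((1/t) *R (R t (R t f)-R t f))+(1/t) *R (R t (R t (R t f))-R t (R t f)) -
   (1/t) *R (R t (R t f)-R t f) = (1/t) *R (2 *R R t (R t (R t f))-3 *R R t (R t f)+R t f)"
  using t by (simp add: RW_scale RW_diff algebra_simps scaleR_2 scaleR_add_left[symmetric])
 show ?thesis unfolding Z_def e[symmetric]
  by (intro has_vector_derivative_diff R_product_derivative R_has_derivative t)
qed

lemma PQ_derivative:
 assumes t: "t ~= 0"
 shows "((%s. PQ s f) has_vector_derivative (1/t) *R (8 *R Q t (Q t (Q t f))-Q t f)) (at t)"
proof -
 have t': "- t ~= 0" using t by simp
 define Z' where "Z' = (%t. 2 *R R t (R t (R t f))-3 *R R t (R t f)+R t f)"
 have m: "((%s::real. - s) has_vector_derivative-1) (at t)" by (auto intro!: derivative_eq_intros)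
 have "((%s. Z (- s) f) has_vector_derivative-1 *R ((1/(- t)) *R Z' (- t))) (at t)"
  using vector_diff_chain_at[OF m Z_derivative[OF t', of f]] by (simp add: o_def Z'_def)
 hence zm: "((%s. Z (- s) f) has_vector_derivative (1/t) *R Z' (- t)) (at t)" by simp
 have "((%s. - ((1/2) *R J (Z s f-Z (- s) f))) has_vector_derivative-((1/2) *R J ((1/t) *R Z' t-(1/t) *R Z' (- t)))) (at t)"
  by (intro has_vector_derivative_minus bounded_linear.has_vector_derivative[OF bounded_linear_scaleR_right]
   bounded_linear.has_vector_derivative[OF bounded_linear_J] has_vector_derivative_diff zm Z_derivative[OF t, of f, folded Z'_def])
  (simp add: Z'_def Z_derivative[OF t, of f])
 moreover have "- ((1/2) *R J ((1/t) *R Z' t-(1/t) *R Z' (- t))) = (1/t) *R (8 *R Q t (Q t (Q t f))-Q t f)"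
 proof -
  have uu: "U t (U t f) = U t f-Q t (Q t f)" for f using Q_sq[OF t, of f] by simp
  have cm: "U t (Q t f) = Q t (U t f)" for f by (rule UQ_commute(3)[OF t t])
  have "- ((1/2) *R J (Z' t-Z' (- t))) = 8 *R Q t (Q t (Q t f))-Q t f"
   unfolding Z'_def R_eq(1)[of t] R_eq(2)[of t] using t
   by (simp add: UQ_simps U_J Q_J cm uu algebra_simps scaleR_add_left[symmetric])
  moreover have "- ((1/2) *R J ((1/t) *R Z' t-(1/t) *R Z' (- t))) = (1/t) *R (- ((1/2) *R J (Z' t-Z' (- t))))"
   by (simp add: scaleR_diff_right mult.commute)
  ultimately show ?thesis by simp
 qed
 ultimately show ?thesis by (simp add: PQ_def)
qed

end

text \<open>The adjoint of \<open>Q t\<close> is controlled by the operator \<open>Q t\<close> of the adjoint perturbation.\<close>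

context accretive_op
begin

interpretation adj: accretive_op D J b' b \<delta> K by (rule flip)

lemma Q_adjoint:
 assumes t: "t ~= 0"
 shows "\<exists>g'. (\<forall>f. inner (Q t f) g = inner f g') & norm g' <= norm (adj.Q t (b' g))/\<delta>"
proof -
 define h where "h = b' g"
 define g' where "g' = t *R adj.WU t h"
 have "inner (Q t f) g = inner f g'" for f
 proof -
  have "inner (Q t f) g = t*inner (WU t f) h"
   by (simp add: b_WU[OF t, symmetric] b_adj h_def)
  also have "... = t*inner (WU t f) (adj.U t h+t *R b' (adj.WQ t h))"
   using adj.b_WQ[OF t, of h] by simp
  also have "... = t*inner (WU t f) (adj.U t h)+t*inner (t *R b (WU t f)) (adj.WQ t h)"
   by (simp add: inner_add_right b_adj algebra_simps)
  also have "... = t*inner (U t f) (adj.WU t h)+t*inner (Q t f) (adj.WQ t h)"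
   using D_sym[OF UQ_D(1)[OF t] adj.UQ_D(1)[OF t]] by (simp only: b_WU[OF t])
  also have "inner (Q t f) (adj.WQ t h) = inner (WQ t f) (adj.Q t h)"
   using D_sym[OF UQ_D(2)[OF t] adj.UQ_D(2)[OF t]] by simp
  also have "... = inner (t *R b (WQ t f)) (adj.WU t h)"
   by (simp add: adj.b_WU[OF t, symmetric] b_adj)
  also have "t*inner (U t f) (adj.WU t h)+t*inner (t *R b (WQ t f)) (adj.WU t h) = inner f g'"
   unfolding b_WQ[OF t] g'_def by (simp add: inner_diff_left algebra_simps)
  finally show ?thesis .
 qed
 moreover have "norm g' <= norm (adj.Q t h)/\<delta>"
  using adj.acc_le[OF D_scale[OF adj.UQ_D(1)[OF t]], of t h] by (simp add: g'_def adj.b_WU[OF t, symmetric])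
 ultimately show ?thesis unfolding h_def by blast
qed

end

section \<open>A double integral of Frullani type\<close>

lemma integrable_exp_abs:
 assumes c: "c > 0"
 shows "integrable lborel (%x::real. exp (- c*\<bar>x\<bar>))"
proof -
 let ?g = "%x::real. indicator {0..} x *R exp (- c*x)"
 have "set_integrable lebesgue {0..} (%x::real. exp (- c*x))"
  by (rule nonnegative_absolutely_integrable_1) (use integrable_on_exp_minus_to_infinity[OF c] in auto)
 hence g: "integrable lborel ?g"
  unfolding set_integrable_def by (subst (asm) integrable_completion) auto
 have g': "integrable lborel (%x. ?g (0+(-1)*x))"
  by (rule lborel_integrable_real_affine[OF g]) simp
 show ?thesis
  by (rule integrable_dominated[OF Bochner_Integration.integrable_add[OF g g']])
   (auto intro!: AE_I2 simp: indicator_def)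
qed

text \<open>Minus the integral of \<open>V\<close> over the interval from \<open>y\<close> to \<open>y + h\<close> is an antiderivative of
  the integrand. It tends to zero at the right end and to \<open>- h * a\<close> at the left end.\<close>

lemma integral_shift_difference:
 fixes V :: "real => real"
 assumes cont: "continuous_on UNIV V" and bot: "(V \<longlongrightarrow> a) at_bot" and top: "(V \<longlongrightarrow> 0) at_top"
  and int: "integrable lborel (%y. V y-V (y+h))"
 shows "(LB y. V y-V (y+h)) = h*a"
proof -
 obtain \<Phi> where \<Phi>: "!!y. (\<Phi> has_vector_derivative V y) (at y)"
  using einterval_antiderivative[of "-\<infinity>" "\<infinity>" V] cont by (auto simp: continuous_on_eq_continuous_at)
 define W where "W = (%y. \<Phi> y-\<Phi> (y+h))"
 have W': "(W has_vector_derivative V y-V (y+h)) (at y)" for y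
  using has_vector_derivative_diff[OF \<Phi> vector_diff_chain_at[OF has_vector_derivative_add_const[THEN iffD2, OF has_vector_derivative_id] \<Phi>], of h y]
  by (simp add: W_def o_def)
 have id: "((%z. z *R b) has_vector_derivative b) (at z)" for z b :: real
  unfolding has_real_derivative_iff_has_vector_derivative[symmetric] by (auto intro!: derivative_eq_intros)
 have near: "\<bar>W y - - h*b\<bar> <= e*\<bar>h\<bar>" if "!!z. z : closed_segment y (y+h) ==> \<bar>V z-b\<bar> <= e" for y b e
 proof -
  have "norm ((\<Phi> (y+h)-(y+h)*b)-(\<Phi> y-y*b)) <= e*norm ((y+h)-y)"
  proof (rule differentiable_bound[where S = "closed_segment y (y+h)" and f' = "%z t. t*(V z-b)"])
   show "((%z. \<Phi> z-z*b) has_derivative (%t. t*(V z-b))) (at z within closed_segment y (y+h))" for z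
    unfolding real_scaleR_def[symmetric]
    by (rule has_derivative_at_withinI, fold has_vector_derivative_def, rule has_vector_derivative_diff[OF \<Phi> id])
   show "onorm (%t. t*(V z-b)) <= e" if "z : closed_segment y (y+h)" for z
    using \<open>!!z. z \<in> closed_segment y (y + h) ==> _\<close>[OF that] by (intro onorm_le) (simp add: abs_mult mult.commute[of e] mult_left_mono)
  qed auto
  thus ?thesis by (simp add: W_def algebra_simps abs_minus_commute)
 qed
 have lim: "(W \<longlongrightarrow>-h*b) F" if V: "(V \<longlongrightarrow> b) F" and F: "!!P. eventually P F ==> eventually (%y. \<forall>z\<in>closed_segment y (y+h). P z) F" for b F
 proof (rule tendstoI)
  fix r :: real assume r: "r > 0"
  define e where "e = r/(\<bar>h\<bar>+1)"
  have e: "e > 0" "e*\<bar>h\<bar> < r" using r by (auto simp: e_def field_simps intro: add_nonneg_pos)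
  from F[OF tendstoD[OF V e(1)]] show "eventually (%y. dist (W y) (- h*b) < r) F"
  proof eventually_elim
   case (elim y)
   hence "\<bar>W y - - h*b\<bar> <= e*\<bar>h\<bar>" by (intro near) (auto simp: dist_real_def less_imp_le)
   with e show ?case by (simp add: dist_real_def)
  qed
 qed
 have "(W \<longlongrightarrow>-h*0) at_top"
 proof (rule lim[OF top])
  fix P :: "real => bool" assume "eventually P at_top"
  then obtain B where "!!z. z >= B ==> P z" by (auto simp: eventually_at_top_linorder)
  thus "eventually (%y. \<forall>z\<in>closed_segment y (y+h). P z) at_top"
   by (intro eventually_mono[OF eventually_ge_at_top[of "B+\<bar>h\<bar>"]]) (auto simp: closed_segment_eq_real_ivl split: if_splits)
 qed
 moreover have "(W \<longlongrightarrow>-h*a) at_bot"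
 proof (rule lim[OF bot])
  fix P :: "real => bool" assume "eventually P at_bot"
  then obtain B where "!!z. z <= B ==> P z" by (auto simp: eventually_at_bot_linorder)
  thus "eventually (%y. \<forall>z\<in>closed_segment y (y+h). P z) at_bot"
   by (intro eventually_mono[OF eventually_le_at_bot[of "B-\<bar>h\<bar>"]]) (auto simp: closed_segment_eq_real_ivl split: if_splits)
 qed
 moreover have "continuous_on UNIV (%y. V y-V (y+h))" by (intro continuous_intros cont continuous_on_compose2[OF cont]) auto
 ultimately have "(LBINT y=-\<infinity>..\<infinity>. V y-V (y+h)) = - h*0 - - h*a"
  using int W' by (intro interval_integral_FTC_integrable[where F = W])
   (auto simp: set_integrable_def ereal_tendsto_simps1 continuous_on_eq_continuous_at)
 thus ?thesis by (simp add: interval_lebesgue_integral_def set_lebesgue_integral_def)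
qed

text \<open>This is \<open>1 / (2 sinh (h ln 2))\<close>.\<close>

definition sinh_kernel :: "real => real" where
 "sinh_kernel h = 1/(2 powr h-2 powr (- h))"

lemma sinh_kernel_pos: "h ~= 0 ==> h * sinh_kernel h > 0"
 by (cases "h > 0") (auto simp: sinh_kernel_def zero_less_mult_iff zero_less_divide_iff divide_less_0_iff mult_neg_neg)

text \<open>In logarithmic variables the product of two of the operators \<open>Q t\<close>, \<open>Q s\<close> is a difference of two
  \<open>U\<close> divided by a hyperbolic sine. Integrating along lines \<open>x - y = h\<close> evaluates the double integral.\<close>

lemma frullani_double_integral:
 fixes V :: "real => real" and F :: "real => real => real"
 assumes cont: "continuous_on UNIV V" and bot: "(V \<longlongrightarrow> a) at_bot" and top: "(V \<longlongrightarrow> 0) at_top"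
  and F: "!!x y. x ~= y ==> F x y = sinh_kernel (x-y)*(V y-V x)"
  and c: "c > 0" and bd: "!!x y. \<bar>F x y\<bar> <= A*(exp (- c*\<bar>x\<bar>)*exp (- c*\<bar>y\<bar>))"
 shows "integrable lborel (%h. a*(h * sinh_kernel h))"
  and "(%N::nat. integral {- real N..real N} (%x. integral {- real N..real N} (F x)))
   ----> (LB h. a*(h * sinh_kernel h))"
proof -
 define d where "d = (%x::real. exp (- c*\<bar>x\<bar>))"
 define k where "k = sinh_kernel"
 have dint: "integrable lborel d" unfolding d_def by (rule integrable_exp_abs[OF c])
 have d1: "0 < d x" "d x <= 1" for x using c by (auto simp: d_def)
 have [measurable]: "V : borelm" by (rule borel_measurable_continuous_onI[OF cont])
 have [measurable]: "k : borelm" unfolding k_def sinh_kernel_def by measurable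
 have [measurable]: "d : borelm" unfolding d_def by measurable
 define F' where "F' = (%x y. k (x-y)*(V y-V x))"
 have FF': "F' x y = F x y" if "x ~= y" for x y using F[OF that] by (simp add: F'_def k_def)
 have A: "A >= 0"
  using bd[of 0 0] by simp
 have bd': "\<bar>F' x y\<bar> <= A*(d x*d y)" for x y
 proof (cases "x = y")
  case True thus ?thesis using A d1 by (simp add: F'_def less_imp_le)
 next
  case False thus ?thesis using bd[of x y] FF' by (simp add: d_def)
 qed
 have meas2 [measurable]: "case_prod F' : borel_measurable (lborel \<Otimes>\<^sub>M lborel)"
  unfolding F'_def by measurable
 have "integrable (lborel \<Otimes>\<^sub>M lborel) (%(x, y). d x*d y)"
 proof (rule lborel_pair.Fubini_integrable)
  show "integrable lborel (%x. LB y. norm (case (x, y) of (x, y) => d x*d y))"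
   using d1 dint by (simp add: abs_mult less_imp_le)
  show "AE x in lborel. integrable lborel (%y. case (x, y) of (x, y) => d x*d y)" using dint by simp
 qed measurable
 hence dd: "integrable (lborel \<Otimes>\<^sub>M lborel) (%(x, y). A*(d x*d y))"
  unfolding case_prod_beta by (rule integrable_mult_right)
 have F'int: "integrable (lborel \<Otimes>\<^sub>M lborel) (case_prod F')"
  by (rule integrable_dominated[OF dd]) (use bd' A d1 in \<open>auto intro!: AE_I2 simp: abs_mult less_imp_le\<close>)
 have shear: "integrable (lborel \<Otimes>\<^sub>M lborel) (%(y, h). F' (y+h) y)"
 proof -
  have "integrable (lborel \<Otimes>\<^sub>M lborel) (%(y, h). d (y+h)*d y)"
  proof (rule lborel_pair.Fubini_integrable)
   have i: "integrable lborel (%h. d (y+1*h))" for y by (rule lborel_integrable_real_affine[OF dint]) simp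
   have "(LB h. d (y+h)) = (LB h. d h)" for y
    using lborel_integral_real_affine[of 1 d y] by simp
   thus "integrable lborel (%x. LB y. norm (case (x, y) of (y, h) => d (y+h)*d y))"
    using d1 dint by (simp add: abs_mult less_imp_le)
   show "AE x in lborel. integrable lborel (%y. case (x, y) of (y, h) => d (y+h)*d y)" using i by simp
  qed measurable
  hence "integrable (lborel \<Otimes>\<^sub>M lborel) (%(y, h). A*(d (y+h)*d y))"
   unfolding case_prod_beta by (rule integrable_mult_right)
  thus ?thesis
  proof (rule integrable_dominated)
   show "(%(y, h). F' (y+h) y) : borel_measurable (lborel \<Otimes>\<^sub>M lborel)" unfolding F'_def by measurable
   show "AE p in lborel \<Otimes>\<^sub>M lborel. norm (case p of (y, h) => F' (y+h) y) <= norm (case p of (y, h) => A*(d (y+h)*d y))"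
    using bd' by (auto intro!: AE_I2 intro: order_trans[OF _ abs_ge_self])
  qed
 qed
 have inner: "(LB y. F' (y+h) y) = a*(h * k h)" for h
 proof (cases "h = 0")
  case True thus ?thesis by (simp add: F'_def)
 next
  case False
  hence kh: "k h ~= 0" using sinh_kernel_pos[of h] by (auto simp: k_def)
  have "integrable lborel (%y. V y-V (y+h))"
  proof (rule integrable_dominated)
   show "integrable lborel (%y. (A/\<bar>k h\<bar>)*d y)" using dint by simp
   show "AE y in lborel. norm (V y-V (y+h)) <= norm ((A/\<bar>k h\<bar>)*d y)"
   proof (rule AE_I2)
    fix y
    have "\<bar>k h\<bar>*\<bar>V y-V (y+h)\<bar> <= A*(d (y+h)*d y)" using bd'[of "y+h" y] by (simp add: F'_def abs_mult)
    also have "... <= A*d y" using d1[of y] d1[of "y+h"] A by (intro mult_left_mono mult_left_le_one_le) auto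
    finally show "norm (V y-V (y+h)) <= norm ((A/\<bar>k h\<bar>)*d y)"
     using kh A d1[of y] by (simp add: abs_mult field_simps)
   qed
  qed measurable
  from integral_shift_difference[OF cont bot top this]
  have "k h*(LB y. V y-V (y+h)) = a*(h * k h)" by simp
  thus ?thesis by (simp add: F'_def)
 qed
 have hy: "integrable (lborel \<Otimes>\<^sub>M lborel) (%(h, y). F' (y+h) y)"
  using lborel_pair.integrable_product_swap[OF shear] by (simp add: case_prod_beta)
 show "integrable lborel (%h. a*(h * sinh_kernel h))"
  using lborel_pair.integrable_fst'[OF hy] by (simp add: inner k_def)
 have "integral\<^sup>L (lborel \<Otimes>\<^sub>M lborel) (case_prod F') = (LB y. LB x. F' x y)"
  using lborel_pair.integral_snd[OF F'int] by simp
 also have "... = (LB y. LB h. F' (y+h) y)"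
  using lborel_integral_real_affine[of 1 "%x. F' x y" y for y] by simp
 also have "... = (LB h. LB y. F' (y+h) y)"
  using lborel_pair.Fubini_integral[OF hy] by simp
 finally have total: "integral\<^sup>L (lborel \<Otimes>\<^sub>M lborel) (case_prod F') = (LB h. a*(h * k h))"
  by (simp add: inner)
 let ?I = "%N::nat. {- real N..real N}"
 let ?G = "%N::nat. %(x, y). indicator (?I N) x *R (indicator (?I N) y *R F' x y)"
 have Gint: "integrable (lborel \<Otimes>\<^sub>M lborel) (?G N)" for N
  by (rule integrable_dominated[OF F'int]) (auto intro!: AE_I2 simp: indicator_def)
 have eqN: "integral (?I N) (%x. integral (?I N) (F x)) = integral\<^sup>L (lborel \<Otimes>\<^sub>M lborel) (?G N)" for N
 proof -
  have i1: "integral (?I N) (F x) = (LB y. indicator (?I N) y *R F' x y)" for x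
  proof -
   have "integrable lborel (F' x)"
   proof (rule integrable_dominated)
    show "integrable lborel (%y. (A*d x)*d y)" using dint by simp
    show "F' x : borel_measurable lborel" unfolding F'_def by measurable
    show "AE y in lborel. norm (F' x y) <= norm ((A*d x)*d y)"
     using bd'[of x] by (auto intro!: AE_I2 simp: mult.assoc intro: order_trans[OF _ abs_ge_self])
   qed
   hence "integrable lborel (%y. indicator (?I N) y *R F' x y)"
    by (rule integrable_dominated) (auto intro!: AE_I2 simp: indicator_def F'_def)
   hence "(LB y. indicator (?I N) y *R F' x y) = integral (?I N) (F' x)"
    using set_borel_integral_eq_integral(2)[of "?I N" "F' x"] by (simp add: set_integrable_def set_lebesgue_integral_def)
   also have "... = integral (?I N) (F x)"
    by (rule integral_spike[of "{x}"]) (auto simp: FF')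
   finally show ?thesis by simp
  qed
  have "integrable lborel (%x. LB y. ?G N (x, y))"
   by (rule lborel_pair.integrable_fst'[OF Gint])
  hence i2: "integrable lborel (%x. indicator (?I N) x *R (LB y. indicator (?I N) y *R F' x y))"
   by simp
  have "integral\<^sup>L (lborel \<Otimes>\<^sub>M lborel) (?G N) = (LB x. LB y. ?G N (x, y))"
   by (rule lborel_pair.integral_fst'[OF Gint, symmetric])
  also have "... = (LB x. indicator (?I N) x *R (LB y. indicator (?I N) y *R F' x y))" by simp
  also have "... = integral (?I N) (%x. LB y. indicator (?I N) y *R F' x y)"
   using set_borel_integral_eq_integral(2)[of "?I N" "%x. LB y. indicator (?I N) y *R F' x y"] i2
   by (simp add: set_integrable_def set_lebesgue_integral_def)
  finally show ?thesis by (simp only: i1)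
 qed
 show "(%N::nat. integral (?I N) (%x. integral (?I N) (F x))) ----> (LB h. a*(h * sinh_kernel h))"
  unfolding eqN k_def[symmetric] total[symmetric]
 proof (rule integral_dominated_convergence)
  show "integrable (lborel \<Otimes>\<^sub>M lborel) (%p. norm (case_prod F' p))" using F'int by (rule integrable_norm)
  show "AE p in lborel \<Otimes>\<^sub>M lborel. (%N. ?G N p) ----> case_prod F' p"
  proof (rule AE_I2)
   fix p :: "real \<times> real"
   obtain x y where p: "p = (x, y)" by force
   have "eventually (%N. ?G N p = case_prod F' p) sequentially"
    using eventually_ge_at_top[of "nat \<lceil>max \<bar>x\<bar> \<bar>y\<bar>\<rceil>"] by eventually_elim (auto simp: indicator_def p)
   thus "(%N. ?G N p) ----> case_prod F' p" by (rule tendsto_eventually)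
  qed
  show "AE p in lborel \<Otimes>\<^sub>M lborel. norm (?G N p) <= norm (case_prod F' p)" for N
   by (auto intro!: AE_I2 simp: indicator_def)
  show "?G N : borel_measurable (lborel \<Otimes>\<^sub>M lborel)" for N using Gint by auto
 qed auto
qed

section \<open>The sign operator, given quadratic estimates\<close>

lemma integral_inner_commute:
 fixes phi :: "real => 'h::{real_inner, banach}"
 assumes "phi integrable_on S"
 shows "inner (integral S phi) g = integral S (%x. inner (phi x) g)"
 using integral_linear[OF assms bounded_linear_inner_left[of g]] by (simp add: o_def)

text \<open>An integral over \<open>n\<close> unit intervals is the integral over one of them of a sum of \<open>n\<close> translates. This
  turns sums over dyadic scales into integrals over all scales.\<close>

lemma integral_unit_steps_bound:
 fixes phi :: "real => real"
 assumes c: "continuous_on UNIV phi" and M: "!!x. (\<Sum>i<n. \<bar>phi (x-real i)\<bar>) <= M"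
 shows "\<bar>integral {B-real n..B} phi\<bar> <= M"
proof -
 have cs: "continuous_on S (%x. \<bar>phi x\<bar>)" for S
  by (intro continuous_intros continuous_on_subset[OF c]) auto
 have split: "integral {B-real m..B} (%x. \<bar>phi x\<bar>) = integral {0..1} (%x. \<Sum>i<m. \<bar>phi ((x+(B-1))-real i)\<bar>)" for m
 proof (induction m)
  case (Suc m)
  have c2: "continuous_on {0..1} (%x. \<bar>phi ((x+(B-1))-real i)\<bar>)" for i
   by (intro continuous_intros continuous_on_compose2[OF c]) auto
  have "integral {B-real (Suc m)..B} (%x. \<bar>phi x\<bar>) =
   integral {B-real (Suc m)..B-real m} (%x. \<bar>phi x\<bar>)+integral {B-real m..B} (%x. \<bar>phi x\<bar>)"
   by (intro integral_join[symmetric] integrable_continuous_interval cs) auto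
  also have "integral {B-real (Suc m)..B-real m} (%x. \<bar>phi x\<bar>) = integral {0..1} (%x. \<bar>phi ((x+(B-1))-real m)\<bar>)"
   using integral_shift[where f = "%x. \<bar>phi x\<bar>" and a = 0 and b = 1 and c = "B-1-real m", OF cs]
   by (simp add: o_def algebra_simps)
  also note Suc.IH
  also have "integral {0..1} (%x. \<bar>phi (x+(B-1)-real m)\<bar>)+integral {0..1} (%x. \<Sum>i<m. \<bar>phi (x+(B-1)-real i)\<bar>)
    = integral {0..1} (%x. \<bar>phi (x+(B-1)-real m)\<bar>+(\<Sum>i<m. \<bar>phi (x+(B-1)-real i)\<bar>))"
   by (intro Henstock_Kurzweil_Integration.integral_add[symmetric] integrable_continuous_interval continuous_on_sum c2)
  finally show ?case by (simp add: add.commute)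
 qed simp
 have "\<bar>integral {B-real n..B} phi\<bar> <= integral {B-real n..B} (%x. \<bar>phi x\<bar>)"
  using integral_norm_bound_integral[of phi "{B-real n..B}" "%x. \<bar>phi x\<bar>"] integrable_continuous_interval[OF continuous_on_subset[OF c subset_UNIV]]
   integrable_continuous_interval[OF cs] by auto
 also have "... <= integral {0..1::real} (%x. M)"
  unfolding split
 proof (rule integral_le)
  show "(%x. \<Sum>i<n. \<bar>phi (x+(B-1)-real i)\<bar>) integrable_on {0..1}"
   by (intro integrable_continuous_interval continuous_intros continuous_on_compose2[OF c]) auto
 qed (use M in auto)
 finally show ?thesis by simp
qed

lemma convergent_on_dense:
 fixes T :: "nat => 'a::real_normed_vector => 'b::banach"
 assumes lin: "!!n. linear (T n)" and bd: "!!n f. norm (T n f) <= C*norm f"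
  and dense: "f : closure A" and conv: "!!a. a : A ==> convergent (%n. T n a)"
 shows "convergent (%n. T n f)"
proof (rule Cauchy_convergent, rule metric_CauchyI)
 fix e :: real assume e: "e > 0"
 define C' where "C' = \<bar>C\<bar>+1"
 have "C*norm f <= C'*norm f" for f :: 'a by (intro mult_right_mono) (auto simp: C'_def)
 hence C': "C' > 0" "!!n f. norm (T n f) <= C'*norm f"
  using bd order_trans by (auto simp: C'_def) blast
 have "e/(3*C') > 0" using e C' by simp
 then obtain a where a: "a : A" "norm (a-f) < e/(3*C')"
  using dense by (auto simp: closure_approachable dist_norm)
 have "e/3 > 0" using e by simp
 from metric_CauchyD[OF convergent_Cauchy[OF conv[OF a(1)]] this] obtain M
  where M: "!!m n. m >= M ==> n >= M ==> norm (T m a-T n a) < e/3" by (auto simp: dist_norm)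
 show "\<exists>M. \<forall>m\<ge>M. \<forall>n\<ge>M. dist (T m f) (T n f) < e"
 proof (intro exI allI impI)
  fix m n assume mn: "M <= m" "M <= n"
  have d: "norm (T k f-T k a) < e/3" for k
  proof -
   have "norm (T k f-T k a) = norm (T k (f-a))" by (simp add: linear_diff[OF lin])
   also have "... <= C'*norm (a-f)" using C'(2)[of k "f-a"] by (simp add: norm_minus_commute)
   also have "... < e/3" using a(2) C' by (simp add: field_simps)
   finally show ?thesis .
  qed
  have eq: "T m f-T n f = (T m f-T m a)+(T m a-T n a)-(T n f-T n a)" by simp
  have "norm (T m f-T n f) <= norm (T m f-T m a)+norm (T m a-T n a)+norm (T n f-T n a)"
   unfolding eq using norm_triangle_ineq4[of "(T m f-T m a)+(T m a-T n a)" "T n f-T n a"]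
    norm_triangle_ineq[of "T m f-T m a" "T m a-T n a"] by linarith
  with d[of m] d[of n] M[OF mn] show "dist (T m f) (T n f) < e" by (simp add: dist_norm)
 qed
qed

lemma (in accretive_op) acc_closure:
 assumes "v : closure (Range D)"
 shows "\<delta>*(norm v)^2 <= inner (b v) v"
proof -
 have "closed {v. \<delta>*(norm v)^2 <= inner (b v) v}"
  by (intro closed_Collect_le continuous_intros linear_continuous_on bounded_linear_b)
 moreover have "Range D \<subseteq> {v. \<delta>*(norm v)^2 <= inner (b v) v}" using acc by auto
 ultimately show ?thesis using closure_minimal assms by blast
qed

lemma (in selfadj_op) range_complement:
 assumes "!!u v. (u, v) : D ==> inner v g = 0"
 shows "(g, 0) : D"
 using assms by (subst D_adj) auto

lemma (in selfadj_op) subspace_Range: "subspace (Range D)"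
 by (rule subspaceI) (use D_zero D_add D_scale in blast)+

lemma (in selfadj_op) in_closure_Range:
 assumes "!!n. (n, 0) : D ==> inner g n = 0"
 shows "g : closure (Range D)"
proof (rule closed_subspace_double_complement)
 show "subspace (closure (Range D))" by (rule subspace_closure[OF subspace_Range])
 fix h assume "!!z. z : closure (Range D) ==> inner z h = 0"
 hence "(h, 0) : D" by (intro range_complement) (use closure_subset in blast)
 thus "inner g h = 0" by (rule assms)
qed simp

context accretive_op
begin

interpretation adj: accretive_op D J b' b \<delta> K by (rule flip)

text \<open>The vectors in the domain and in the range of \<open>b D\<close>.\<close>

definition nice :: "'h set" where
 "nice = {f. \<exists>w u v. (f, w) : D & (u, v) : D & f = b v}"

lemma nice_U: "(u, v) : D ==> s ~= 0 ==> U s (b v) : nice"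
proof -
 assume u: "(u, v) : D" and s: "s ~= 0"
 have e: "U s (b v) = (1/s) *R Q s u" using UQ_domain(2)[OF s u] s by simp
 have "(U s (b v), (1/s) *R WQ s u) : D" unfolding e by (intro D_scale UQ_D s)
 moreover have "U s (b v) = b (WU s u)" unfolding e using b_WU[OF s, of u, symmetric] s by simp
 ultimately show ?thesis using UQ_D(1)[OF s, of u] by (auto simp: nice_def)
qed

lemma range_in_closure_nice: assumes "(u, v) : D" shows "b v : closure nice"
proof -
 have "(%n. U (1/real (Suc n)) (b v)) ----> b v"
 proof (rule filterlim_compose[OF U_tendsto_0])
  have "(%n. 1/real (Suc n)) ----> 0" by (intro LIMSEQ_Suc lim_1_over_n[unfolded o_def])
  thus "filterlim (%n. 1/real (Suc n)) (at 0) sequentially"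
   by (auto simp: filterlim_at)
 qed
 moreover have "U (1/real (Suc n)) (b v) : nice" for n by (rule nice_U[OF assms]) simp
 ultimately show ?thesis unfolding closure_sequential by (intro exI[of _ "%n. U (1/real (Suc n)) (b v)"]) auto
qed

lemma subspace_nice: "subspace nice"
proof (rule subspaceI)
 show "0 : nice" using D_zero by (force simp: nice_def)
 show "x+y : nice" if x: "x : nice" and y: "y : nice" for x y
 proof -
  obtain w u v w' u' v' where *: "(x, w) : D" "(u, v) : D" "x = b v" "(y, w') : D" "(u', v') : D" "y = b v'"
   using x y by (auto simp: nice_def)
  show ?thesis unfolding nice_def
   using D_add[OF *(1,4)] D_add[OF *(2,5)] *(3,6) by (intro CollectI exI[of _ "w+w'"] exI[of _ "u+u'"] exI[of _ "v+v'"]) auto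
 qed
 show "c *R x : nice" if x: "x : nice" for c x
 proof -
  obtain w u v where *: "(x, w) : D" "(u, v) : D" "x = b v" using x by (auto simp: nice_def)
  show ?thesis unfolding nice_def
   using D_scale[OF *(1)] D_scale[OF *(2)] *(3) by (intro CollectI exI[of _ "c *R w"] exI[of _ "c *R u"] exI[of _ "c *R v"]) auto
 qed
qed

text \<open>A vector orthogonal to the null space lies in the closure of the range of \<open>D\<close>, where \<open>b'\<close> is
  accretive.\<close>

lemma null_plus_nice_dense: "closure {n+f |n f. (n, 0) : D & f : nice} = UNIV"
proof (rule closure_subspace_dense)
 have "subspace {n. (n, 0) : D}"
  by (rule subspaceI) (use D_zero D_add[of _ 0 _ 0] D_scale[of _ 0] in auto)
 from subspace_sums[OF this subspace_nice]
 show "subspace {n+f |n f. (n, 0) : D & f : nice}" by simp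
 fix g assume g: "!!z. z : {n+f |n f. (n, 0) : D & f : nice} ==> inner z g = 0"
 have gn: "inner n g = 0" if "(n, 0) : D" for n
  using g[of "n+0"] that subspace_0[OF subspace_nice] by fastforce
 have "inner f g = 0" if "f : nice" for f
 proof -
  have "0+f : {n+f |n f. (n, 0) : D & f : nice}" using D_zero that by blast
  from g[OF this] show ?thesis by simp
 qed
 hence "nice \<subseteq> {f. inner f g = 0}" by auto
 hence "closure nice \<subseteq> {f. inner f g = 0}"
  by (rule closure_minimal) (intro closed_Collect_eq continuous_intros)
 hence "inner (b v) g = 0" if "(u, v) : D" for u v using range_in_closure_nice[OF that] by blast
 hence "(b' g, 0) : D" by (intro range_complement) (simp add: b_adj)
 from gn[OF this] have "inner (b' g) g = 0" .
 moreover have "g : closure (Range D)" by (rule in_closure_Range) (use gn in \<open>simp add: inner_commute\<close>)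
 from adj.acc_closure[OF this] have "\<delta>*(norm g)^2 <= inner (b' g) g" .
 ultimately have "\<delta>*(norm g)^2 <= 0" by simp
 hence "(norm g)^2 <= 0" using delta_pos by (simp add: mult_le_0_iff)
 thus "g = 0" by simp
qed

text \<open>The quadratic estimate on the range of \<open>b D\<close>, over geometric sequences of scales and uniformly in their starting
  point.\<close>

definition square_bound :: "real => bool" where
 "square_bound C \<longleftrightarrow> C >= 0 & (\<forall>u v t n. (u, v) : D --> t > 0 -->
  (\<Sum>i<n. (norm (Q (t/2^i) (b v)))^2) <= C*(norm v)^2)"

lemma Q_null: "t ~= 0 ==> (n, 0) : D ==> Q t n = 0"
 using UQ_domain(2)[of t n 0] by (simp add: UQ_simps)

text \<open>For \<open>f = n + b v\<close> with \<open>n\<close> in the null space of \<open>D\<close>, which is orthogonal to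
  \<open>v\<close>, accretivity bounds \<open>\<parallel>v\<parallel>\<close> by \<open>\<parallel>f\<parallel> / \<delta>\<close>; such
  \<open>f\<close> are dense.\<close>

lemma square_bound_all:
 assumes sq: "square_bound C" and t: "t > 0"
 shows "(\<Sum>i<n. (norm (Q (t/2^i) f))^2) <= C/\<delta>^2*(norm f)^2"
proof -
 let ?A = "{f. (\<Sum>i<n. (norm (Q (t/2^i) f))^2) <= C/\<delta>^2*(norm f)^2}"
 have "{n+f |n f. (n, 0) : D & f : nice} \<subseteq> ?A"
 proof safe
  fix m f assume m: "(m, 0) : D" and "f : nice"
  then obtain u v where uv: "(u, v) : D" "f = b v" by (auto simp: nice_def)
  have "inner m v = 0" using D_sym[OF m uv(1)] by simp
  hence "\<delta>*(norm v)^2 <= inner (m+b v) v" using acc[OF uv(1)] by (simp add: inner_add_left)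
  also have "... <= norm (m+b v)*norm v" by (rule norm_cauchy_schwarz)
  finally have "\<delta>*norm v <= norm (m+b v)"
   by (cases "v = 0") (auto simp: power2_eq_square)
  hence "norm v <= norm (m+b v)/\<delta>" using delta_pos by (simp add: field_simps)
  hence nv: "(norm v)^2 <= (norm (m+b v))^2/\<delta>^2" by (metis norm_ge_zero power_divide power_mono)
  have "(\<Sum>i<n. (norm (Q (t/2^i) (m+f)))^2) = (\<Sum>i<n. (norm (Q (t/2^i) (b v)))^2)"
   using t m by (simp add: UQ_simps Q_null uv)
  also have "... <= C*(norm v)^2" using sq uv t by (auto simp: square_bound_def)
  also have "... <= C*((norm (m+b v))^2/\<delta>^2)" using nv sq by (intro mult_left_mono) (auto simp: square_bound_def)
  finally show "(\<Sum>i<n. (norm (Q (t/2^i) (m+f)))^2) <= C/\<delta>^2*(norm (m+f))^2" by (simp add: uv)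
 qed
 moreover have "closed ?A"
  using t by (intro closed_Collect_le continuous_intros linear_continuous_on bounded_linear_Q) auto
 ultimately have "closure {n+f |n f. (n, 0) : D & f : nice} \<subseteq> ?A" by (rule closure_minimal)
 thus ?thesis using null_plus_nice_dense by auto
qed

definition q :: "real => 'h => 'h" where "q x f = Q (2 powr x) f"

lemma linear_q: "linear (q x)" unfolding q_def by (rule Q_linear) simp
lemma bounded_linear_q: "bounded_linear (q x)" unfolding q_def by (rule bounded_linear_Q) simp
lemma q_bound: "norm (q x f) <= CR*norm f" unfolding q_def by (rule Q_bound) simp
lemma q_commute: "q x (q y f) = q y (q x f)" unfolding q_def by (rule UQ_commute) auto

lemma continuous_U: "t ~= 0 ==> isCont (%t. U t f) t" and continuous_Q: "t ~= 0 ==> isCont (%t. Q t f) t"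
proof -
 assume t: "t ~= 0"
 have 1: "isCont (%t. R t f) t" by (rule has_vector_derivative_continuous[OF R_has_derivative[OF t]])
 have "isCont (%t. R t f) (- t)" using t by (intro has_vector_derivative_continuous[OF R_has_derivative]) auto
 hence 2: "isCont (%t. R (- t) f) t" using isCont_o2[of t uminus "%t. R t f"] by simp
 show "isCont (%t. U t f) t" unfolding U_def by (intro continuous_intros 1 2)
 show "isCont (%t. Q t f) t" unfolding Q_def
  by (intro continuous_intros bounded_linear.isCont[OF bounded_linear_J] 1 2)
qed

lemma isCont_Q_compose:
 assumes t: "t ~= 0" and g: "isCont g t"
 shows "isCont (%s. Q s (g s)) t"
 unfolding isCont_def
proof (rule Lim_null[THEN iffD2], rule Lim_null_comparison)
 have "((%s. g s-g t) \<longlongrightarrow> 0) (at t)" "((%s. Q s (g t)-Q t (g t)) \<longlongrightarrow> 0) (at t)"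
  using g continuous_Q[OF t, of "g t"] by (auto simp: isCont_def Lim_null[symmetric])
 hence "((%s. CR*norm (g s-g t)+norm (Q s (g t)-Q t (g t))) \<longlongrightarrow> CR*0+0) (at t)"
  by (intro tendsto_intros tendsto_norm_zero)
 thus "((%s. CR*norm (g s-g t)+norm (Q s (g t)-Q t (g t))) \<longlongrightarrow> 0) (at t)" by simp
 have "eventually (%s. s ~= 0) (at t)" by (rule eventually_neq_at_within)
 thus "eventually (%s. norm (Q s (g s)-Q t (g t)) <= CR*norm (g s-g t)+norm (Q s (g t)-Q t (g t))) (at t)"
 proof eventually_elim
  case (elim s)
  have "Q s (g s)-Q t (g t) = Q s (g s-g t)+(Q s (g t)-Q t (g t))" using elim by (simp add: UQ_simps)
  hence "norm (Q s (g s)-Q t (g t)) <= norm (Q s (g s-g t))+norm (Q s (g t)-Q t (g t))"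
   by (metis norm_triangle_ineq)
  with Q_bound[OF elim, of "g s-g t"] show ?case by linarith
 qed
qed

lemma continuous_q: assumes g: "continuous_on UNIV g" shows "continuous_on UNIV (%x. q x (g x))"
proof -
 have "isCont (%x. q x (g x)) x" for x
 proof -
  have "isCont (%x. log 2 x) (2 powr x)" by (intro continuous_intros) auto
  moreover have "isCont g (log 2 (2 powr x))" using g by (simp add: continuous_on_eq_continuous_at)
  ultimately have "isCont (%t. g (log 2 t)) (2 powr x)" by (rule isCont_o2)
  hence "isCont (%t. Q t (g (log 2 t))) (2 powr x)" by (intro isCont_Q_compose) auto
  moreover have "isCont (%x. 2 powr x) x" by (intro continuous_intros) auto
  ultimately show ?thesis
   using isCont_o2[of x "%x. 2 powr x" "%t. Q t (g (log 2 t))"] by (simp add: q_def)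
 qed
 thus ?thesis by (simp add: continuous_on_eq_continuous_at)
qed

lemma continuous_q1: "continuous_on S (%x. q x f)"
 using continuous_q[OF continuous_on_const, of f] continuous_on_subset by blast

lemma continuous_q3: "continuous_on S (%x. q x (q x (q x f)))"
 using continuous_q[OF continuous_q[OF continuous_q1[of UNIV f]]] continuous_on_subset by blast

lemma nice_Q_bounds:
 assumes "f : nice"
 obtains w u where "!!t. t > 0 ==> Q t f = t *R U t (b w)" "!!t. t > 0 ==> t *R Q t f = u-U t u"
  "!!t. t > 0 ==> t *R U t f = Q t u"
proof -
 obtain w u v where *: "(f, w) : D" "(u, v) : D" "f = b v" using assms by (auto simp: nice_def)
 show thesis
 proof (rule that[of w u])
  fix t :: real assume "t > 0"
  hence t: "t ~= 0" by simp
  show "Q t f = t *R U t (b w)" by (rule UQ_domain(2)[OF t *(1)])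
  show "t *R Q t f = u-U t u" using UQ_domain(1)[OF t *(2)] *(3) by (simp add: algebra_simps)
  show "t *R U t f = Q t u" using UQ_domain(2)[OF t *(2)] *(3) by simp
 qed
qed

text \<open>At small scales use that \<open>f\<close> lies in the domain of \<open>T = b D\<close>, so that \<open>Q t f = t U t (T
  f)\<close>; at large scales that \<open>f = T u\<close>, so that \<open>t Q t f = u - U t u\<close>.\<close>

lemma nice_decay:
 assumes "f : nice"
 obtains M where "M >= 0" "!!x. norm (q x f) <= M*2 powr (- \<bar>x\<bar>)"
proof -
 obtain w u where wu: "!!t. t > 0 ==> Q t f = t *R U t (b w)" "!!t. t > 0 ==> t *R Q t f = u-U t u"
  using nice_Q_bounds[OF assms] by metis
 define M where "M = CR*norm (b w)+(1+CR)*norm u"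
 have M: "CR*norm (b w) <= M" "(1+CR)*norm u <= M" "M >= 0" using CR_ge1 by (auto simp: M_def)
 have "norm (q x f) <= M*2 powr (- \<bar>x\<bar>)" for x
 proof (cases "x <= 0")
  case True
  have "norm (q x f) = 2 powr x*norm (U (2 powr x) (b w))" unfolding q_def by (subst wu(1)) auto
  also have "... <= 2 powr x*(CR*norm (b w))" by (intro mult_left_mono U_bound) auto
  also have "... <= 2 powr x*M" using M by (intro mult_left_mono) auto
  finally show ?thesis using True by (simp add: mult.commute)
 next
  case False
  have "2 powr x*norm (q x f) = norm (u-U (2 powr x) u)"
   unfolding q_def by (subst wu(2)[symmetric]) auto
  also have "... <= norm u+norm (U (2 powr x) u)" by (rule norm_triangle_ineq4)
  also have "... <= norm u+CR*norm u" by (intro add_left_mono U_bound) auto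
  also have "... <= M" using M by (simp add: algebra_simps)
  finally show ?thesis using False by (simp add: powr_minus field_simps)
 qed
 with M(3) show thesis by (rule that)
qed

definition XN :: "nat => 'h => 'h" where "XN N f = integral {- real N..real N} (%x. q x f)"
definition SN :: "nat => 'h => 'h" where "SN N f = integral {- real N..real N} (%x. q x (q x (q x f)))"

lemma integrable_q: "(%x. q x f) integrable_on {a..c}" "(%x. q x (q x (q x f))) integrable_on {a..c}"
 by (intro integrable_continuous_interval continuous_q1 continuous_q3)+

lemma linear_XN: "linear (XN N)"
proof (rule linearI)
 show "XN N (f+g) = XN N f+XN N g" for f g
  unfolding XN_def linear_add[OF linear_q] by (intro Henstock_Kurzweil_Integration.integral_add integrable_q)
 show "XN N (c *R f) = c *R XN N f" for c f
  unfolding XN_def linear_scale[OF linear_q] by (rule Henstock_Kurzweil_Integration.integral_cmul)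
qed

lemma XN_J: "XN N (J f) = J (XN N f)"
 using integral_linear[OF integrable_q(1) bounded_linear_J, of "- real N" "real N" f]
 by (simp add: XN_def q_def Q_J o_def)

end

context accretive_op
begin

interpretation adj: accretive_op D J b' b \<delta> K by (rule flip)

text \<open>One factor \<open>Q t\<close> is bounded, one falls on \<open>f\<close> and one, by duality, on \<open>g\<close>; the
  Cauchy--Schwarz inequality then separates the two square functions.\<close>

lemma SN_bound:
 assumes sq: "square_bound C" and sq': "adj.square_bound C'"
 shows "norm (SN N f) <= (CR/\<delta>*(sqrt C/\<delta>)*(sqrt C'/\<delta>*\<bar>K\<bar>))*norm f"
proof -
 define M where "M = CR/\<delta>*(sqrt C/\<delta>)*(sqrt C'/\<delta>*\<bar>K\<bar>)"
 have C: "C >= 0" "C' >= 0" using sq sq' by (auto simp: square_bound_def adj.square_bound_def)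
 have bd: "\<bar>inner (SN N f) g\<bar> <= M*norm f*norm g" for g
 proof -
  let ?phi = "%x. inner (q x (q x (q x f))) g"
  have p: "\<bar>?phi x\<bar> <= CR/\<delta>*(norm (q x f)*norm (adj.q x (b' g)))" for x
  proof -
   obtain g' where g': "!!f. inner (q x f) g = inner f g'" "norm g' <= norm (adj.q x (b' g))/\<delta>"
    using Q_adjoint[of "2 powr x" g] unfolding q_def adj.q_def by auto
   have "\<bar>?phi x\<bar> <= norm (q x (q x f))*norm g'" unfolding g'(1) by (rule Cauchy_Schwarz_ineq2)
   also have "... <= (CR*norm (q x f))*(norm (adj.q x (b' g))/\<delta>)"
    by (intro mult_mono q_bound g') (use CR_ge1 in auto)
   finally show ?thesis by (simp add: field_simps)
  qed
  have "(\<Sum>i<2*N. \<bar>?phi (x-real i)\<bar>) <= M*norm f*norm g" for x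
  proof -
   have e: "2 powr (x-real i) = 2 powr x/2^i" for i by (simp add: powr_diff powr_realpow)
   have "(\<Sum>i<2*N. \<bar>?phi (x-real i)\<bar>) <= (\<Sum>i<2*N. CR/\<delta>*(norm (q (x-real i) f)*norm (adj.q (x-real i) (b' g))))"
    by (intro sum_mono p)
   also have "... = CR/\<delta>*(\<Sum>i<2*N. norm (q (x-real i) f)*norm (adj.q (x-real i) (b' g)))"
    by (simp only: sum_distrib_left)
   also have "... <= CR/\<delta>*((sqrt C/\<delta>*norm f)*(sqrt C'/\<delta>*norm (b' g)))"
   proof (rule mult_left_mono)
    have "(\<Sum>i<2*N. norm (q (x-real i) f)*norm (adj.q (x-real i) (b' g)))
      <= L2_set (%i. norm (q (x-real i) f)) {..<2*N}*L2_set (%i. norm (adj.q (x-real i) (b' g))) {..<2*N}"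
     using L2_set_mult_ineq[where A = "{..<2*N}" and f = "%i. norm (q (x-real i) f)" and g = "%i. norm (adj.q (x-real i) (b' g))"] by simp
    also have "... <= sqrt (C/\<delta>^2*(norm f)^2) * sqrt (C'/\<delta>^2*(norm (b' g))^2)"
     unfolding L2_set_def q_def adj.q_def e
     by (intro mult_mono real_sqrt_le_mono square_bound_all[OF sq] adj.square_bound_all[OF sq']) (auto intro: sum_nonneg simp: C)
    also have "... = (sqrt C/\<delta>*norm f)*(sqrt C'/\<delta>*norm (b' g))"
     using delta_pos by (simp add: real_sqrt_mult real_sqrt_divide)
    finally show "(\<Sum>i<2*N. norm (q (x-real i) f)*norm (adj.q (x-real i) (b' g))) <= (sqrt C/\<delta>*norm f)*(sqrt C'/\<delta>*norm (b' g))" .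
    show "0 <= CR/\<delta>" using CR_ge1 delta_pos by simp
   qed
   also have "... <= CR/\<delta>*((sqrt C/\<delta>*norm f)*(sqrt C'/\<delta>*(\<bar>K\<bar>*norm g)))"
    using CR_ge1 delta_pos C adj.b_le[of g] mult_right_mono[OF abs_ge_self[of K] norm_ge_zero[of g]]
    by (intro mult_left_mono) auto
   finally show ?thesis by (simp add: M_def mult_ac)
  qed
  from integral_unit_steps_bound[OF _ this, of "real N"]
  have "\<bar>integral {- real N..real N} ?phi\<bar> <= M*norm f*norm g"
   by (simp add: continuous_intros continuous_q3)
  thus ?thesis unfolding SN_def by (simp add: integral_inner_commute integrable_q)
 qed
 have "norm (SN N f) <= M*norm f"
 proof (cases "SN N f = 0")
  case True
  have "M >= 0" using C CR_ge1 delta_pos by (simp add: M_def)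
  thus ?thesis using True by simp
 next
  case False
  have "norm (SN N f)*norm (SN N f) <= (M*norm f)*norm (SN N f)"
   using bd[of "SN N f"] by (simp add: dot_square_norm power2_eq_square)
  thus ?thesis using False by simp
 qed
 thus ?thesis by (simp only: M_def)
qed

text \<open>The fundamental theorem of calculus for \<open>PQ\<close>: up to boundary terms \<open>X\<close> and the integral of the cubes
  are proportional.\<close>

lemma XN_SN: "8 *R SN N f = XN N f+(1/ln 2) *R (PQ (2 powr real N) f-PQ (2 powr-real N) f)"
proof -
 have "((%x. ln 2 *R (8 *R q x (q x (q x f))-q x f)) has_integral
   (PQ (2 powr real N) f-PQ (2 powr-real N) f)) {- real N..real N}"
 proof (rule fundamental_theorem_of_calculus)
  fix x assume "x : {- real N..real N}"
  have p: "((%x. 2 powr x) has_vector_derivative ln 2*2 powr x) (at x)" for x :: real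
   unfolding has_real_derivative_iff_has_vector_derivative[symmetric]
   by (rule derivative_eq_intros refl | simp)+
  have "(((%s. PQ s f) \<circ> (%x. 2 powr x)) has_vector_derivative
   (ln 2*2 powr x) *R ((1/(2 powr x)) *R (8 *R Q (2 powr x) (Q (2 powr x) (Q (2 powr x) f))-Q (2 powr x) f))) (at x)"
   by (intro vector_diff_chain_at p PQ_derivative) auto
  hence "((%x. PQ (2 powr x) f) has_vector_derivative ln 2 *R (8 *R q x (q x (q x f))-q x f)) (at x)"
   by (simp add: o_def q_def)
  thus "((%x. PQ (2 powr x) f) has_vector_derivative ln 2 *R (8 *R q x (q x (q x f))-q x f)) (at x within {- real N..real N})"
   by (rule has_vector_derivative_at_within)
 qed simp
 moreover have "((%x. ln 2 *R (8 *R q x (q x (q x f))-q x f)) has_integral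
   ln 2 *R (8 *R SN N f-XN N f)) {- real N..real N}"
  unfolding SN_def XN_def by (intro has_integral_cmul has_integral_diff integrable_integral integrable_q)
 ultimately have e: "PQ (2 powr real N) f-PQ (2 powr-real N) f = ln 2 *R (8 *R SN N f-XN N f)"
  by (rule has_integral_unique)
 have "(1/ln 2) *R (PQ (2 powr real N) f-PQ (2 powr-real N) f) = 8 *R SN N f-XN N f"
  unfolding e by (simp del: scaleR_right_diff_distrib)
 thus ?thesis by (metis add_diff_cancel_left' diff_add_cancel add.commute)
qed

lemma PQ_bound: assumes "t > 0" shows "norm (PQ t f) <= (1+2*CR)*norm (Q t f)"
proof -
 have t: "t ~= 0" using assms by simp
 have "norm (PQ t f) <= norm (Q t f)+norm (2 *R U t (Q t f))"
  unfolding PQ_eq[OF t] by (rule norm_triangle_ineq4)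
 also have "... <= norm (Q t f)+2*(CR*norm (Q t f))" using U_bound[OF t, of "Q t f"] by simp
 finally show ?thesis by (simp add: algebra_simps)
qed

end

text \<open>Henstock--Kurzweil integrability on an unbounded set from convergence along one sequence of intervals, using the decay of
  \<open>h\<close> for the tails.\<close>

lemma has_integral_half_line:
 fixes h :: "real => 'b::banach"
 assumes cont: "continuous_on UNIV h" and zero: "!!t. t <= 0 ==> h t = 0"
  and decay: "!!t. t > 0 ==> norm (h t) <= M/t^2"
  and lim: "(%N::nat. integral {2 powr-real N..2 powr real N} h) ----> y"
 shows "(h has_integral y) {0<..}"
proof -
 have ii: "h integrable_on {a..c}" for a c
  by (intro integrable_continuous_interval continuous_on_subset[OF cont]) auto
 have M: "M >= 0" using order_trans[OF norm_ge_zero decay[of 1]] by simp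
 have tail: "norm (integral {a..c} h) <= M/a" if "0 < a" "a <= c" for a c
 proof -
  have "((%t. M/t^2) has_integral (- M/c-(- M/a))) {a..c}"
  proof (rule fundamental_theorem_of_calculus)
   fix t assume "t : {a..c}"
   hence "t ~= 0" using that by auto
   hence "((%t. - M/t) has_real_derivative M/t^2) (at t within {a..c})"
    by (auto intro!: derivative_eq_intros simp: power2_eq_square)
   thus "((%t. - M/t) has_vector_derivative M/t^2) (at t within {a..c})"
    by (simp add: has_real_derivative_iff_has_vector_derivative)
  qed (use that in auto)
  hence "norm (integral {a..c} h) <=-M/c-(- M/a)"
   by (intro integral_norm_bound_integral[THEN order_trans, OF ii has_integral_integrable])
    (use decay that in \<open>auto simp: integral_unique\<close>)
  also have "... <= M/a" using M that by simp
  finally show ?thesis .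
 qed
 have "bounded (h ` {0..1})" by (intro compact_imp_bounded compact_continuous_image continuous_on_subset[OF cont]) auto
 then obtain B where B: "\<forall>t\<in>{0..1}. norm (h t) <= B" by (auto simp: bounded_iff)
 have head: "(%N::nat. integral {0..2 powr-real N} h) ----> 0"
 proof (rule Lim_null_comparison)
  show "eventually (%N. norm (integral {0..2 powr-real N} h) <= B*2 powr-real N) sequentially"
  proof (rule always_eventually, rule allI)
   fix N
   have "2 powr-real N <= 2 powr 0" by (intro powr_mono) auto
   thus "norm (integral {0..2 powr-real N} h) <= B*2 powr-real N"
    using integral_bound[of 0 "2 powr-real N" h B] B by (force intro: continuous_on_subset[OF cont])
  qed
  have "(%N::nat. B*(1/2)^N) ----> B*0" by (intro tendsto_intros) auto
  thus "(%N::nat. B*2 powr-real N) ----> 0" by (simp add: powr_minus powr_realpow power_one_over inverse_eq_divide)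
 qed
 have I: "(%N::nat. integral {0..2 powr real N} h) ----> y"
 proof -
  have "integral {0..2 powr-real N} h+integral {2 powr-real N..2 powr real N} h = integral {0..2 powr real N} h" for N :: nat
   by (intro integral_join ii) auto
  with tendsto_add[OF head lim] show ?thesis by simp
 qed
 have "(h has_integral y) UNIV"
 proof (subst has_integral', simp, intro allI impI)
  fix e :: real assume e: "e > 0"
  have "eventually (%N::nat. norm (integral {0..2 powr real N} h-y) < e/2) sequentially"
   using tendstoD[OF I, of "e/2"] e by (simp add: dist_norm)
  moreover have "eventually (%N::nat. M*(1/2)^N < e/2) sequentially"
  proof -
   have "(%N::nat. M*(1/2)^N) ----> M*0" by (intro tendsto_intros) auto
   thus ?thesis using e by (intro order_tendstoD(2)) auto
  qed
  ultimately have "eventually (%N::nat. norm (integral {0..2 powr real N} h-y) < e/2 & M*(1/2)^N < e/2) sequentially"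
   by (rule eventually_conj)
  then obtain N :: nat where N: "norm (integral {0..2 powr real N} h-y) < e/2" "M*(1/2)^N < e/2"
   by (auto simp: eventually_sequentially)
  show "\<exists>B>0. \<forall>a b. ball 0 B \<subseteq> {a..b} --> (\<exists>z. (h has_integral z) {a..b} & norm (z-y) < e)"
  proof (intro exI conjI allI impI)
   show "2 powr real N+1 > (0::real)" by (simp add: add_pos_pos)
   fix a c :: real assume sub: "ball 0 (2 powr real N+1) \<subseteq> {a..c}"
   have "0 : {a..c}" by (rule subsetD[OF sub]) (simp add: add_pos_pos)
   moreover have "2 powr real N : {a..c}" by (rule subsetD[OF sub]) simp
   ultimately have ac: "a <= 0" "2 powr real N <= c" by auto
   have "integral {a..c} h = integral {a..0} h+integral {0..c} h"
    using ac powr_gt_zero[of 2 "real N"] by (intro integral_join[symmetric] ii) linarith+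
   also have "integral {a..0} h = 0" using zero by (intro integral_unique has_integral_is_0) auto
   also have "integral {0..c} h = integral {0..2 powr real N} h+integral {2 powr real N..c} h"
    using ac by (intro integral_join[symmetric] ii) auto
   finally have eq: "integral {a..c} h-y = (integral {0..2 powr real N} h-y)+integral {2 powr real N..c} h" by simp
   have "norm (integral {2 powr real N..c} h) <= M/2 powr real N" using ac by (intro tail) auto
   also have "... = M*(1/2)^N" by (simp add: powr_realpow power_one_over)
   finally have "norm (integral {a..c} h-y) < e"
    unfolding eq using N norm_triangle_ineq[of "integral {0..2 powr real N} h-y" "integral {2 powr real N..c} h"] by linarith
   thus "(h has_integral integral {a..c} h) {a..c}" "norm (integral {a..c} h-y) < e"
    using ii by auto
  qed
 qed
 moreover have "h = (%t. if t : {0<..} then h t else 0)" using zero by (auto simp: not_less)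
 ultimately show ?thesis by (metis has_integral_restrict_UNIV)
qed

lemma integral_log_substitution:
 fixes h :: "real => 'h::{real_inner, banach}"
 assumes cont: "continuous_on {0<..} h"
 shows "integral {2 powr-real N..2 powr real N} h = ln 2 *R integral {- real N..real N} (%x. 2 powr x *R h (2 powr x))"
proof -
 have c1: "continuous_on {2 powr-real N..2 powr real N} h"
  by (rule continuous_on_subset[OF cont]) (use less_le_trans[of 0 "2 powr-real N"] in auto)
 have c2: "continuous_on {- real N..real N} (%x. 2 powr x *R h (2 powr x))"
  by (intro continuous_intros continuous_on_compose2[OF cont]) auto
 have "inner (integral {2 powr-real N..2 powr real N} h) g = inner (ln 2 *R integral {- real N..real N} (%x. 2 powr x *R h (2 powr x))) g" for g
 proof -
  have "((%x. (ln 2*2 powr x) *R inner (h (2 powr x)) g) has_integral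
    (integral {2 powr-real N..2 powr real N} (%t. inner (h t) g))) {- real N..real N}"
  proof (rule has_integral_substitution)
   show "(%x. 2 powr x) ` {- real N..real N} \<subseteq> {2 powr-real N..2 powr real N}" by auto
   show "continuous_on {2 powr-real N..2 powr real N} (%t. inner (h t) g)" by (intro continuous_intros c1)
   show "((%x. 2 powr x) has_real_derivative ln 2*2 powr x) (at x within {- real N..real N})" for x
    by (rule has_field_derivative_at_within, (rule derivative_eq_intros refl | simp)+)
  qed auto
  hence "integral {2 powr-real N..2 powr real N} (%t. inner (h t) g) = integral {- real N..real N} (%x. (ln 2*2 powr x) *R inner (h (2 powr x)) g)"
   by (simp add: integral_unique)
  also have "... = integral {- real N..real N} (%x. ln 2*inner (2 powr x *R h (2 powr x)) g)" by (simp add: mult_ac)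
  also have "... = ln 2*integral {- real N..real N} (%x. inner (2 powr x *R h (2 powr x)) g)"
   by (rule integral_mult_right)
  finally show ?thesis
   by (simp add: integral_inner_commute integrable_continuous_interval c1 c2)
 qed
 hence "inner (integral {2 powr-real N..2 powr real N} h-ln 2 *R integral {- real N..real N} (%x. 2 powr x *R h (2 powr x))) g = 0" for g
  by (simp only: inner_diff_left)
 thus ?thesis using inner_eq_zero_iff right_minus_eq by blast
qed

context accretive_op
begin

interpretation adj: accretive_op D J b' b \<delta> K by (rule flip)

definition X :: "'h => 'h" where "X f = lim (%N. XN N f)"

lemma XN_nice_convergent: assumes f: "f : nice" shows "convergent (%N. XN N f)"
proof -
 obtain M where M: "M >= 0" "!!x. norm (q x f) <= M*2 powr (- \<bar>x\<bar>)" using nice_decay[OF f] by metis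
 have bd: "norm (integral {a..a+1} (%x. q x f)) <= (2*M)*(1/2)^N" if "a = real N | a = - real (Suc N)" for a N
 proof -
  have "norm (integral {a..a+1} (%x. q x f)) <= (M*2 powr (- real N))*(a+1-a)"
  proof (rule integral_bound)
   fix x assume "x : {a..a+1}"
   hence "\<bar>x\<bar> >= real N" using that by auto
   hence "2 powr (- \<bar>x\<bar>) <= 2 powr (- real N)" by simp
   thus "norm (q x f) <= M*2 powr (- real N)" using M(2)[of x] mult_left_mono[OF _ M(1)] order_trans by blast
  qed (auto intro: continuous_q1)
  also have "... = M*(1/2)^N" by (simp add: powr_minus powr_realpow power_one_over inverse_eq_divide)
  also have "... <= (2*M)*(1/2)^N" using M(1) by (intro mult_right_mono) auto
  finally show ?thesis .
 qed
 have step: "norm (XN (Suc N) f-XN N f) <= (4*M)*(1/2)^N" for N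
 proof -
  have "XN (Suc N) f = integral {- real (Suc N)..- real N} (%x. q x f)+integral {- real N..real (Suc N)} (%x. q x f)"
   unfolding XN_def by (intro integral_join[symmetric] integrable_q) auto
  also have "integral {- real N..real (Suc N)} (%x. q x f) = XN N f+integral {real N..real (Suc N)} (%x. q x f)"
   unfolding XN_def by (intro integral_join[symmetric] integrable_q) auto
  finally have "XN (Suc N) f-XN N f = integral {- real (Suc N)..- real (Suc N)+1} (%x. q x f)+integral {real N..real N+1} (%x. q x f)"
   by (simp add: add.commute)
  also have "norm ... <= (2*M)*(1/2)^N+(2*M)*(1/2)^N"
   by (intro order_trans[OF norm_triangle_ineq] add_mono bd) auto
  finally show ?thesis by simp
 qed
 have "summable (%N. XN (Suc N) f-XN N f)"
  by (rule summable_comparison_test'[where g = "%N. (4*M)*(1/2)^N" and N = 0]) (use step in auto)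
 hence "convergent (%n. \<Sum>N<n. XN (Suc N) f-XN N f)" by (simp add: summable_iff_convergent)
 hence "convergent (%n. XN n f-XN 0 f)" by (simp only: sum_lessThan_telescope[of "%N. XN N f"])
 then obtain l where "(%n. XN n f-XN 0 f) ----> l" by (auto simp: convergent_def)
 hence "(%n. (XN n f-XN 0 f)+XN 0 f) ----> l+XN 0 f" by (intro tendsto_intros)
 thus ?thesis by (auto simp: convergent_def)
qed

lemma XN_null: "(n, 0) : D ==> XN N n = 0"
 by (simp add: XN_def q_def Q_null)

definition kappa :: real where "kappa = (LB h. h * sinh_kernel h)"

context
 fixes C C' :: real
 assumes sq: "square_bound C" and sq': "adj.square_bound C'"
begin

lemma XN_bound:
 obtains CX where "CX >= 0" "!!N f. norm (XN N f) <= CX*norm f"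
proof -
 define C3 where "C3 = CR/\<delta>*(sqrt C/\<delta>)*(sqrt C'/\<delta>*\<bar>K\<bar>)"
 define C4 where "C4 = (1+2*CR)*CR"
 have C3: "norm (SN N f) <= C3*norm f" for N f unfolding C3_def by (rule SN_bound[OF sq sq'])
 have C4: "norm (PQ (2 powr x) f) <= C4*norm f" for x f
 proof -
  have "norm (PQ (2 powr x) f) <= (1+2*CR)*norm (Q (2 powr x) f)" by (rule PQ_bound) simp
  also have "... <= (1+2*CR)*(CR*norm f)" using CR_ge1 by (intro mult_left_mono Q_bound) auto
  finally show ?thesis by (simp add: C4_def)
 qed
 define CX where "CX = 8*C3+(1/ln 2)*(2*C4)"
 have 1: "norm (XN N f) <= CX*norm f" for N f
 proof -
  have "XN N f = 8 *R SN N f-(1/ln 2) *R (PQ (2 powr real N) f-PQ (2 powr-real N) f)"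
   unfolding XN_SN by simp
  hence "norm (XN N f) <= norm (8 *R SN N f)+norm ((1/ln 2) *R (PQ (2 powr real N) f-PQ (2 powr-real N) f))"
   by (metis norm_triangle_ineq4)
  also have "... = 8*norm (SN N f)+(1/ln 2)*norm (PQ (2 powr real N) f-PQ (2 powr-real N) f)" by simp
  also have "... <= 8*(C3*norm f)+(1/ln 2)*(C4*norm f+C4*norm f)"
   by (intro add_mono mult_left_mono C3 order_trans[OF norm_triangle_ineq4] C4) auto
  finally show ?thesis by (simp add: CX_def algebra_simps)
 qed
 have 2: "norm (XN N f) <= \<bar>CX\<bar>*norm f" for N f
  using 1[of N f] mult_right_mono[OF abs_ge_self[of CX] norm_ge_zero[of f]] by linarith
 show thesis by (rule that[of "\<bar>CX\<bar>"]) (use 2 in auto)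
qed

lemma XN_limit:
 shows "(%N. XN N f) ----> X f"
proof -
 obtain CX where CX: "!!N f. norm (XN N f) <= CX*norm f" using XN_bound by metis
 have "convergent (%N. XN N f)"
 proof (rule convergent_on_dense[OF linear_XN CX])
  show "f : closure {n+f |n f. (n, 0) : D & f : nice}" using null_plus_nice_dense by simp
  fix a assume "a : {n+f |n f. (n, 0) : D & f : nice}"
  thus "convergent (%N. XN N a)"
   by (auto simp: linear_add[OF linear_XN] XN_null XN_nice_convergent)
 qed
 thus ?thesis by (simp add: X_def convergent_LIMSEQ_iff)
qed

lemma bounded_linear_X:
 shows "bounded_linear X"
proof -
 note lim = XN_limit
 obtain CX where CX: "!!N f. norm (XN N f) <= CX*norm f" using XN_bound by metis
 show ?thesis
 proof (rule bounded_linear_intro[where K = CX])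
  show "X (f+g) = X f+X g" for f g
   using LIMSEQ_unique[OF lim[of "f+g"]] tendsto_add[OF lim[of f] lim[of g]] by (simp add: linear_add[OF linear_XN])
  show "X (r *R f) = r *R X f" for r f
   using LIMSEQ_unique[OF lim[of "r *R f"]] tendsto_scaleR[OF tendsto_const lim[of f], of r] by (simp add: linear_scale[OF linear_XN])
  show "norm (X f) <= norm f*CX" for f
   using LIMSEQ_le_const2[OF tendsto_norm[OF lim[of f]]] CX[of _ f] by (auto simp: mult.commute)
 qed
qed

lemma continuous_X:
 shows "continuous_on S X"
 by (intro linear_continuous_on bounded_linear_X)

lemma SN_nice_limit:
 assumes f: "f : nice"
 shows "(%N. SN N f) ----> (1/8) *R X f"
proof -
 obtain M where M: "M >= 0" "!!x. norm (q x f) <= M*2 powr (- \<bar>x\<bar>)" using nice_decay[OF f] by metis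
 have h: "(%N::nat. (1+2*CR)*(M*(1/2)^N)) ----> (1+2*CR)*(M*0)" by (intro tendsto_intros) auto
 have lim: "(%N::nat. PQ (2 powr (s*real N)) f) ----> 0" if s: "s = 1 | s = -1" for s
 proof (rule Lim_null_comparison[OF always_eventually, rule_format])
  fix N :: nat
  have "norm (PQ (2 powr (s*real N)) f) <= (1+2*CR)*norm (q (s*real N) f)"
   unfolding q_def by (rule PQ_bound) simp
  also have "... <= (1+2*CR)*(M*2 powr (- \<bar>s*real N\<bar>))" using CR_ge1 by (intro mult_left_mono M) auto
  also have "... = (1+2*CR)*(M*(1/2)^N)"
   using s by (auto simp: powr_minus powr_realpow power_one_over inverse_eq_divide)
  finally show "norm (PQ (2 powr (s*real N)) f) <= (1+2*CR)*(M*(1/2)^N)" .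
 qed (use h in simp)
 have "(%N. (1/8) *R (XN N f+(1/ln 2) *R (PQ (2 powr real N) f-PQ (2 powr-real N) f)))
  ----> (1/8) *R (X f+(1/ln 2) *R (0-0))"
  using lim[of 1] lim[of "-1"] by (intro tendsto_intros XN_limit) auto
 moreover have "SN N f = (1/8) *R (XN N f+(1/ln 2) *R (PQ (2 powr real N) f-PQ (2 powr-real N) f))" for N
  unfolding XN_SN[symmetric] by simp
 ultimately show ?thesis by simp
qed

lemma sgn_integral:
 assumes f: "f : nice"
 shows "((%t. (1/t) *R Q t (Q t (Q t f))) has_integral (ln 2/8) *R X f) {0<..}"
proof -
 obtain w u where wu: "!!t. t > 0 ==> Q t f = t *R U t (b w)" "!!t. t > 0 ==> t *R Q t f = u-U t u"
  using nice_Q_bounds[OF f] by metis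
 define h where "h = (%t. if t > 0 then (1/t) *R Q t (Q t (Q t f)) else 0)"
 have "isCont h t" for t
 proof -
  consider "t < 0" | "t = 0" | "t > 0" by linarith
  thus ?thesis
  proof cases
   case 1
   have "isCont (%t. 0 :: 'h) t" by simp
   moreover have "eventually (%t. h t = 0) (nhds t)"
    using eventually_nhds_in_open[of "{..<0}" t] 1 by (auto elim!: eventually_mono simp: h_def)
   ultimately show ?thesis by (subst isCont_cong[where g = "%t. 0"]) auto
  next
   case 3
   have "isCont (%t. (1/t) *R Q t (Q t (Q t f))) t"
    using 3 by (intro continuous_intros isCont_Q_compose continuous_Q) auto
   moreover have "eventually (%t. h t = (1/t) *R Q t (Q t (Q t f))) (nhds t)"
    using eventually_nhds_in_open[of "{0<..}" t] 3 by (auto elim!: eventually_mono simp: h_def)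
   ultimately show ?thesis by (subst isCont_cong[where g = "%t. (1/t) *R Q t (Q t (Q t f))"]) auto
  next
   case 2
   have "(h \<longlongrightarrow> 0) (at 0)"
   proof (rule Lim_null_comparison)
    have "((%t. CR*(CR*norm (Q t (b w)))) \<longlongrightarrow> CR*(CR*0)) (at 0)"
     by (intro tendsto_intros tendsto_norm_zero Q_tendsto_0)
    thus "((%t. CR*(CR*norm (Q t (b w)))) \<longlongrightarrow> 0) (at 0)" by simp
    show "eventually (%t. norm (h t) <= CR*(CR*norm (Q t (b w)))) (at 0)"
    proof (rule always_eventually, rule allI)
     fix t
     show "norm (h t) <= CR*(CR*norm (Q t (b w)))"
     proof (cases "t > 0")
      case True
      hence t: "t ~= 0" by simp
      have "h t = Q t (U t (Q t (b w)))"
       using True t by (simp add: h_def wu(1) UQ_simps UQ_commute(3)[OF t t])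
      also have "norm ... <= CR*norm (U t (Q t (b w)))" by (rule Q_bound[OF t])
      also have "... <= CR*(CR*norm (Q t (b w)))" using CR_ge1 by (intro mult_left_mono U_bound[OF t]) auto
      finally show ?thesis .
     qed (use CR_ge1 in \<open>simp add: h_def\<close>)
    qed
   qed
   thus ?thesis using 2 by (simp add: isCont_def h_def)
  qed
 qed
 hence ch: "continuous_on UNIV h" by (simp add: continuous_on_eq_continuous_at)
 have dec: "norm (h t) <= (CR*(CR*((1+CR)*norm u)))/t^2" if t: "t > 0" for t
 proof -
  have t': "t ~= 0" using t by simp
  have "norm (Q t (Q t (Q t f))) <= CR*(CR*norm (Q t f))"
   using CR_ge1 by (intro order_trans[OF Q_bound[OF t']] mult_left_mono Q_bound[OF t']) auto
  hence "t^2*norm (h t) <= t*(CR*(CR*norm (Q t f)))"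
   using t by (simp add: h_def power2_eq_square)
  also have "... = CR*(CR*norm (t *R Q t f))" using t by simp
  also have "... <= CR*(CR*((1+CR)*norm u))"
   unfolding wu(2)[OF t] using CR_ge1 norm_triangle_ineq4[of u "U t u"] U_bound[OF t', of u]
   by (intro mult_left_mono) (auto simp: algebra_simps)
  finally show ?thesis using t by (simp add: field_simps)
 qed
 have "(h has_integral (ln 2/8) *R X f) {0<..}"
 proof (rule has_integral_half_line[OF ch _ dec])
  have "(%N. ln 2 *R SN N f) ----> ln 2 *R ((1/8) *R X f)"
   by (intro tendsto_intros SN_nice_limit[OF f])
  moreover have "integral {2 powr-real N..2 powr real N} h = ln 2 *R SN N f" for N
   unfolding integral_log_substitution[OF continuous_on_subset[OF ch subset_UNIV]] SN_def
   by (simp add: h_def q_def)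
  ultimately show "(%N. integral {2 powr-real N..2 powr real N} h) ----> (ln 2/8) *R X f" by simp
 qed (simp add: h_def)
 thus ?thesis by (rule has_integral_eq[rotated]) (simp add: h_def)
qed

text \<open>On functions with decay at both ends, \<open>X\<close> squares to a constant. This is what makes the sign operator
  invertible.\<close>

lemma X_square_nice:
 assumes f: "f : nice"
 shows "integrable lborel (%h. inner f g*(h * sinh_kernel h))" and "X (X f) = kappa *R f"
proof -
 obtain w u where wu: "!!t. t > 0 ==> Q t f = t *R U t (b w)" "!!t. t > 0 ==> t *R U t f = Q t u"
  using nice_Q_bounds[OF f] by metis
 obtain M where M: "M >= 0" "!!x. norm (q x f) <= M*2 powr (- \<bar>x\<bar>)" using nice_decay[OF f] by metis
 have main: "integrable lborel (%h. inner f g*(h * sinh_kernel h)) &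
  inner (X (X f)) g = (LB h. inner f g*(h * sinh_kernel h))" for g
 proof -
  define V where "V = (%x. inner (U (2 powr x) f) g)"
  define F where "F = (%x y. inner (q x (q y f)) g)"
  define c where "c = ln 2/(2::real)"
  have c0: "c > 0" by (simp add: c_def)
  have e2: "2 powr (- \<bar>x\<bar>) = exp (- c*\<bar>x\<bar>)*exp (- c*\<bar>x\<bar>)" for x
   by (simp add: powr_def c_def exp_add[symmetric] mult.commute)
  have cV: "continuous_on UNIV V"
  proof -
   have "isCont (%x. U (2 powr x) f) x" for x
    using isCont_o2[of x "%x. 2 powr x" "%t. U t f"] continuous_U[of "2 powr x" f] by (simp add: continuous_intros)
   thus ?thesis unfolding V_def by (intro continuous_intros) (simp add: continuous_on_eq_continuous_at)
  qed
  have Vbot: "(V \<longlongrightarrow> inner f g) at_bot"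
   unfolding V_def
  proof (intro tendsto_intros filterlim_compose[OF U_tendsto_0])
   have "((%x::real. 2 powr x) \<longlongrightarrow> 0) at_bot" by real_asymp
   thus "filterlim (%x::real. 2 powr x) (at 0) at_bot" by (auto simp: filterlim_at)
  qed
  have Vtop: "(V \<longlongrightarrow> 0) at_top"
  proof (rule Lim_null_comparison)
   show "eventually (%x. norm (V x) <= CR*norm u*norm g*2 powr (- x)) at_top"
   proof (rule always_eventually, rule allI)
    fix x :: real
    have "2 powr x*norm (U (2 powr x) f) = norm (Q (2 powr x) u)"
     by (subst wu(2)[symmetric]) auto
    also have "... <= CR*norm u" by (rule Q_bound) simp
    finally have "norm (U (2 powr x) f) <= CR*norm u*2 powr (- x)" by (simp add: powr_minus field_simps)
    hence "norm (U (2 powr x) f)*norm g <= CR*norm u*2 powr (- x)*norm g" by (rule mult_right_mono) simp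
    thus "norm (V x) <= CR*norm u*norm g*2 powr (- x)"
     unfolding V_def using Cauchy_Schwarz_ineq2[of "U (2 powr x) f" g] by (simp add: mult_ac)
   qed
   have "((%x::real. 2 powr (- x)) \<longlongrightarrow> 0) at_top" by real_asymp
   hence "((%x::real. CR*norm u*norm g*2 powr (- x)) \<longlongrightarrow> CR*norm u*norm g*0) at_top" by (intro tendsto_intros)
   thus "((%x::real. CR*norm u*norm g*2 powr (- x)) \<longlongrightarrow> 0) at_top" by simp
  qed
  have FV: "F x y = sinh_kernel (x-y)*(V y-V x)" if xy: "x ~= y" for x y
  proof -
   let ?t = "2 powr x" and ?s = "2 powr y"
   have "((?t)^2-(?s)^2) *R Q ?t (Q ?s f) = (?t*?s) *R (U ?s f-U ?t f)"
    by (rule frullani_identity) auto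
   hence "inner (((?t)^2-(?s)^2) *R Q ?t (Q ?s f)) g = inner ((?t*?s) *R (U ?s f-U ?t f)) g" by simp
   hence eq: "((?t)^2-(?s)^2)*F x y = ?t*?s*(V y-V x)"
    by (simp add: F_def V_def q_def inner_diff_left)
   have ts: "(?t)^2-(?s)^2 ~= 0"
   proof
    assume "(?t)^2-(?s)^2 = 0"
    hence "?t = ?s" using power2_eq_imp_eq[of ?t ?s] by simp
    hence "log 2 ?t = log 2 ?s" by (rule arg_cong)
    thus False using xy by simp
   qed
   have "sinh_kernel (x-y) = ?t*?s/((?t)^2-(?s)^2)"
   proof -
    have "2 powr (x-y)-2 powr (- (x-y)) = ((?t)^2-(?s)^2)/(?t*?s)"
     by (simp add: powr_diff powr_minus field_simps power2_eq_square)
    thus ?thesis by (simp add: sinh_kernel_def)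
   qed
   moreover have "F x y = ?t*?s*(V y-V x)/((?t)^2-(?s)^2)"
    by (rule eq_divide_imp[OF ts]) (use eq in \<open>simp only: mult.commute\<close>)
   ultimately show ?thesis by simp
  qed
  have bd: "\<bar>F x y\<bar> <= (CR*M*norm g)*(exp (- c*\<bar>x\<bar>)*exp (- c*\<bar>y\<bar>))" for x y
  proof -
   have *: "norm (q x (q y f)) <= CR*M*2 powr (- \<bar>z\<bar>)" if "z = x | z = y" for z
   proof -
    have "norm (q x (q y f)) <= CR*norm (q z f)" using that q_bound q_commute[of x y f] by metis
    also have "... <= CR*(M*2 powr (- \<bar>z\<bar>))" using CR_ge1 by (intro mult_left_mono M) auto
    finally show ?thesis by simp
   qed
   define z where "z = (if \<bar>x\<bar> <= \<bar>y\<bar> then y else x)"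
   have "norm (q x (q y f)) <= CR*M*(exp (- c*\<bar>z\<bar>)*exp (- c*\<bar>z\<bar>))"
    using *[of z] unfolding e2 by (simp add: z_def)
   also have "... <= CR*M*(exp (- c*\<bar>x\<bar>)*exp (- c*\<bar>y\<bar>))"
    using CR_ge1 M(1) c0 by (intro mult_left_mono mult_mono) (auto simp: z_def)
   finally have "norm (q x (q y f))*norm g <= CR*M*(exp (- c*\<bar>x\<bar>)*exp (- c*\<bar>y\<bar>))*norm g"
    by (rule mult_right_mono) simp
   thus ?thesis unfolding F_def using Cauchy_Schwarz_ineq2[of "q x (q y f)" g] by (simp add: mult_ac)
  qed
  note fr = frullani_double_integral[OF cV Vbot Vtop FV c0 bd]
  have eq: "inner (XN N (XN N f)) g = integral {- real N..real N} (%x. integral {- real N..real N} (F x))" for N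
  proof -
   have "q x (XN N f) = integral {- real N..real N} (%y. q x (q y f))" for x
    using integral_linear[OF integrable_q(1)[of f "- real N" "real N"] bounded_linear_q[of x]] by (simp add: XN_def o_def)
   hence "inner (q x (XN N f)) g = integral {- real N..real N} (F x)" for x
    using integrable_linear[OF integrable_q(1)[of f "- real N" "real N"] bounded_linear_q[of x]]
    by (simp add: integral_inner_commute F_def o_def)
   thus ?thesis by (simp add: XN_def[of N "XN N f"] integral_inner_commute integrable_q)
  qed
  obtain CX where CX: "!!N f. norm (XN N f) <= CX*norm f" "CX >= 0" using XN_bound by metis
  have "(%N. XN N (XN N f)) ----> X (X f)"
  proof -
   have "(%N. XN N (XN N f-X f)) ----> 0"
   proof (rule Lim_null_comparison[OF always_eventually, rule_format])
    show "norm (XN N (XN N f-X f)) <= CX*norm (XN N f-X f)" for N by (rule CX)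
    have "(%N. CX*norm (XN N f-X f)) ----> CX*0"
     by (intro tendsto_intros tendsto_norm_zero) (use XN_limit[of f] in \<open>simp add: Lim_null[symmetric]\<close>)
    thus "(%N. CX*norm (XN N f-X f)) ----> 0" by simp
   qed
   from tendsto_add[OF this XN_limit[of "X f"]] show ?thesis by (simp add: linear_diff[OF linear_XN])
  qed
  hence "(%N. inner (XN N (XN N f)) g) ----> inner (X (X f)) g" by (intro tendsto_intros)
  hence "inner (X (X f)) g = (LB h. inner f g*(h * sinh_kernel h))"
   unfolding eq by (rule LIMSEQ_unique[OF _ fr(2)])
  with fr(1) show ?thesis by blast
 qed
 show "integrable lborel (%h. inner f g*(h * sinh_kernel h))" using main by blast
 have "inner (X (X f)) g = inner (kappa *R f) g" for g using main[of g] by (simp add: kappa_def)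
 hence "inner (X (X f)-kappa *R f) (X (X f)-kappa *R f) = 0" by (simp only: inner_diff_left)
 thus "X (X f) = kappa *R f" by (simp only: inner_eq_zero_iff) simp
qed

lemma X_square:
 assumes f: "f : closure (b ` Range D)"
 shows "X (X f) = kappa *R f"
proof -
 have "closure (b ` Range D) \<subseteq> closure nice"
  by (rule closure_minimal) (use range_in_closure_nice in auto)
 hence f': "f : closure nice" using f by blast
 have "closed {f. X (X f) = kappa *R f}"
  by (intro closed_Collect_eq continuous_intros continuous_on_compose2[OF continuous_X] continuous_X) auto
 hence "closure nice \<subseteq> {f. X (X f) = kappa *R f}"
  by (rule closure_minimal[rotated]) (use X_square_nice(2) in auto)
 thus ?thesis using f' by auto
qed

text \<open>The values of \<open>Q\<close> lie in the range of \<open>b D\<close>, so a vector orthogonal to that range annihilates \<open>X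
  f\<close>.\<close>

lemma X_in_range:
 shows "X f : closure (b ` Range D)"
proof (rule closed_subspace_double_complement)
 show "subspace (closure (b ` Range D))"
  by (intro subspace_closure linear_subspace_image b_linear subspace_Range)
 fix g assume g: "!!z. z : closure (b ` Range D) ==> inner z g = 0"
 have "inner (q x f) g = 0" for x
 proof (rule g)
  have "q x f = b ((2 powr x) *R WU (2 powr x) f)" using b_WU[of "2 powr x" f] by (simp add: q_def)
  moreover have "(2 powr x) *R WU (2 powr x) f : Range D"
   by (rule RangeI, rule D_scale, rule UQ_D(1)) simp
  ultimately show "q x f : closure (b ` Range D)" by (simp only: closure_subset[THEN subsetD] imageI)
 qed
 hence "inner (XN N f) g = 0" for N by (simp add: XN_def integral_inner_commute integrable_q)
 moreover have "(%N. inner (XN N f) g) ----> inner (X f) g" by (intro tendsto_intros XN_limit)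
 ultimately have "(%N::nat. 0) ----> inner (X f) g" by simp
 thus "inner (X f) g = 0" by (rule LIMSEQ_unique[OF tendsto_const, symmetric])
qed simp

text \<open>The kernel \<open>h * sinh_kernel h\<close> is positive away from zero.\<close>

lemma kappa_nonzero:
 assumes f: "f : nice" "f ~= 0"
 shows "kappa ~= 0"
proof
 assume k: "kappa = 0"
 have ff: "inner f f ~= 0" using f by simp
 have "integrable lborel (%h. (1/inner f f)*(inner f f*(h * sinh_kernel h)))"
  by (intro integrable_mult_right X_square_nice(1)[OF f(1)])
 hence i: "integrable lborel (%h. h * sinh_kernel h)" using ff by simp
 have nn: "0 <= h * sinh_kernel h" for h using sinh_kernel_pos[of h] by (cases "h = 0") auto
 have "AE h in lborel. h * sinh_kernel h = 0"
  using integral_nonneg_eq_0_iff_AE[OF i] nn k by (simp add: kappa_def)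
 moreover have "AE h in lborel. h ~= (0::real)" by (rule AE_lborel_singleton)
 ultimately have "AE h in (lborel :: real measure). False"
  by eventually_elim (use sinh_kernel_pos in force)
 thus False by (simp add: AE_iff_measurable[where N = UNIV])
qed

end

end

text \<open>The integral of the cubes is a constant multiple of \<open>X\<close>, whose properties it inherits.\<close>

theorem (in accretive_op) sign_operator:
 assumes sq: "square_bound C" and sq': "accretive_op.square_bound D J b' C'"
 obtains S \<kappa> where "bounded_linear S" "!!f. S (J f) = J (S f)" "!!n. (n, 0) : D ==> S n = 0"
  "!!f. f : nice ==> ((%t. (1/t) *R Q t (Q t (Q t f))) has_integral S f) {0<..}"
  "!!f. S f : closure (b ` Range D)" "\<kappa> ~= 0"
  "!!f. f : closure (b ` Range D) ==> S (S f) = \<kappa> *R f"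
proof -
 note lim = XN_limit[OF sq sq']
 have nullX: "X n = 0" if "(n, 0) : D" for n
  using lim[of n] XN_null[OF that] LIMSEQ_unique[OF _ tendsto_const] by simp
 have JX: "X (J f) = J (X f)" for f
  using lim[of "J f"] bounded_linear.tendsto[OF bounded_linear_J lim[of f]] LIMSEQ_unique by (simp add: XN_J)
 define S where "S = (%f. (ln 2/8) *R X f)"
 \<comment> \<open>Without nonzero vectors in \<open>nice\<close> the closure of the range is trivial, and any nonzero constant will
   do.\<close>
 define \<kappa> where "\<kappa> = (if \<exists>f\<in>nice. f ~= 0 then (ln 2/8)^2 * kappa else 1)"
 show thesis
 proof (rule that[of S \<kappa>])
  show "bounded_linear S" unfolding S_def
   by (intro bounded_linear_scaleR_right[THEN bounded_linear_compose] bounded_linear_X[OF sq sq'])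
  show "((%t. (1/t) *R Q t (Q t (Q t f))) has_integral S f) {0<..}" if "f : nice" for f
   unfolding S_def by (rule sgn_integral[OF sq sq' that])
  show "S f : closure (b ` Range D)" for f
  proof -
   have "subspace (closure (b ` Range D))"
    by (intro subspace_closure linear_subspace_image b_linear subspace_Range)
   thus ?thesis unfolding S_def using X_in_range[OF sq sq', of f] by (rule subspace_scale)
  qed
  show "\<kappa> ~= 0" using kappa_nonzero[OF sq sq'] by (auto simp: \<kappa>_def)
  fix f assume f: "f : closure (b ` Range D)"
  show "S (S f) = \<kappa> *R f"
  proof (cases "\<exists>f\<in>nice. f ~= 0")
   case True
   thus ?thesis
    using X_square[OF sq sq' f] linear_scale[OF bounded_linear.linear[OF bounded_linear_X[OF sq sq']]]
    by (simp add: S_def \<kappa>_def power2_eq_square)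
  next
   case False
   hence "nice \<subseteq> {0}" by auto
   hence "closure nice \<subseteq> {0}" by (rule closure_minimal) simp
   moreover have "closure (b ` Range D) \<subseteq> closure nice"
    by (rule closure_minimal) (use range_in_closure_nice in auto)
   ultimately have "f = 0" using f by blast
   thus ?thesis by (simp add: linear_0[OF bounded_linear.linear[OF bounded_linear_X[OF sq sq']]] S_def)
  qed
 qed (auto simp: S_def JX nullX)
qed

section \<open>Square integrable functions through Borel representatives\<close>

definition sqb :: "('a::euclidean_space => 'b::euclidean_space) => bool" where
 "sqb g \<longleftrightarrow> g : borelm & integrable lborel (%x. (norm (g x))^2)"

lemma sqb_measurable: "sqb g ==> g : borelm"
 by (simp add: sqb_def)

lemma sqb_sq_integrable: "sqb g ==> sq_integrable g"
 unfolding sqb_def sq_integrable_def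
proof (intro conjI; elim conjE)
 assume g: "g : borelm" and i: "integrable lborel (%x. (norm (g x))^2)"
 show "g : borel_measurable lebesgue" by (rule measurable_completion) (use g in simp)
 show "integrable lebesgue (%x. (norm (g x))^2)" by (subst integrable_completion) (use g i in auto)
qed

lemma lebesgue_borel_representative:
 fixes f :: "'a::euclidean_space => 'b::euclidean_space"
 assumes "f : borel_measurable lebesgue"
 obtains g where "g : borelm" "AE x in lborel. f x = g x"
proof -
 have "\<forall>i\<in>(Basis::'b set). \<exists>g\<in>borel_measurable lborel. (AE x in lborel. f x \<bullet> i = g x)"
  using assms by (intro ballI completion_ex_borel_measurable_real) auto
 then obtain g where g: "!!i. i : Basis ==> g i : borel_measurable lborel"
  "!!i. i : (Basis::'b set) ==> AE x in lborel. f x \<bullet> i = g i x"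
  by metis
 show thesis
 proof (rule that[of "%x. \<Sum>i\<in>Basis. g i x *R i"])
  show "(%x. \<Sum>i\<in>Basis. g i x *R i) : borelm" using g(1) by measurable
  have "AE x in lborel. \<forall>i\<in>(Basis::'b set). f x \<bullet> i = g i x" using g(2) by (simp add: AE_ball_countable countable_finite)
  thus "AE x in lborel. f x = (\<Sum>i\<in>Basis. g i x *R i)"
  proof eventually_elim
   case (elim x)
   hence "(\<Sum>i\<in>Basis. g i x *R i) = (\<Sum>i\<in>Basis. (f x \<bullet> i) *R i)" by simp
   thus ?case by (simp add: euclidean_representation)
  qed
 qed
qed

lemma Quot_L2: "Quotient3 L2_rel abs_L2 rep_L2"
 by (rule Quotient3_L2)

lemma L2_rel_rep: "L2_rel (rep_L2 u) (rep_L2 u)"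
 using Quotient3_rep_reflp[OF Quot_L2] by blast

lemma sq_integrable_fn: "sq_integrable (fn u)"
 using L2_rel_rep[of u] by (simp add: fn_def L2_rel_def)

lemma abs_fn: "abs_L2 (fn u) = u"
 unfolding fn_def by (rule Quotient3_abs_rep[OF Quot_L2])

lemma abs_L2_eqI: "sq_integrable f ==> sq_integrable g ==> AE x in lebesgue. f x = g x ==> abs_L2 f = abs_L2 g"
 using Quotient3_rel_abs[OF Quot_L2, of f g] by (simp add: L2_rel_def)

lemma fn_abs: "sq_integrable f ==> AE x in lebesgue. fn (abs_L2 f) x = f x"
proof -
 assume "sq_integrable f"
 hence "L2_rel f f" by (simp add: L2_rel_def)
 hence "L2_rel (rep_L2 (abs_L2 f)) f" by (rule rep_abs_rsp_left[OF Quot_L2])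
 thus ?thesis by (simp add: L2_rel_def fn_def)
qed

text \<open>Borel measurable representatives keep translates and functions of two variables measurable.\<close>

definition fb :: "('a::euclidean_space, 'b::euclidean_space) L2 => 'a => 'b" where
 "fb u = (SOME g. g : borelm & (AE x in lborel. fn u x = g x))"

lemma fb_borel [measurable]: "fb u : borelm"
 and fn_eq_fb: "AE x in lborel. fn u x = fb u x"
proof -
 have "fn u : borel_measurable lebesgue" using sq_integrable_fn[of u] by (simp add: sq_integrable_def)
 then obtain g where "g : borelm & (AE x in lborel. fn u x = g x)"
  by (rule lebesgue_borel_representative) blast
 from someI[of "%g. g : borelm & (AE x in lborel. fn u x = g x)", OF this]
 show "fb u : borelm" "AE x in lborel. fn u x = fb u x" by (simp_all add: fb_def)
qed

lemma fn_eq_fb_lebesgue: "AE x in lebesgue. fn u x = fb u x"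
 using fn_eq_fb by (rule AE_completion)

lemma sqb_fb: "sqb (fb u)"
 unfolding sqb_def
proof (intro conjI fb_borel)
 have "integrable lebesgue (%x. (norm (fn u x))^2)" using sq_integrable_fn[of u] by (simp add: sq_integrable_def)
 hence "integrable lebesgue (%x. (norm (fb u x))^2)"
  by (rule integrable_cong_AE_imp) (use fn_eq_fb_lebesgue[of u] in \<open>auto intro!: measurable_completion elim!: eventually_mono\<close>)
 thus "integrable lborel (%x. (norm (fb u x))^2)" by (subst (asm) integrable_completion) auto
qed

lemma integrable_fb_sq: "integrable lborel (%x. (norm (fb u x))^2)"
 using sqb_fb by (simp add: sqb_def)

definition mk :: "('a::euclidean_space => 'b::euclidean_space) => ('a, 'b) L2" where "mk g = abs_L2 g"

lemma AE_lebesgue_iff: "(AE x in lebesgue. P x) \<longleftrightarrow> (AE x in lborel. P x)"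
 by (rule AE_completion_iff)

lemma fb_mk: "sqb g ==> AE x in lborel. fb (mk g) x = g x"
 using fn_abs[OF sqb_sq_integrable, of g] fn_eq_fb[of "mk g"] unfolding AE_lebesgue_iff mk_def
 by (auto elim: eventually_elim2)

lemma mk_fb: "mk (fb u) = u"
proof -
 have "mk (fb u) = abs_L2 (fn u)" unfolding mk_def
  by (intro abs_L2_eqI sqb_sq_integrable sqb_fb sq_integrable_fn) (use fn_eq_fb_lebesgue[of u] in \<open>auto elim: eventually_mono\<close>)
 thus ?thesis by (simp add: abs_fn)
qed

lemma mk_cong: "sqb f ==> sqb g ==> AE x in lborel. f x = g x ==> mk f = mk g"
 unfolding mk_def by (intro abs_L2_eqI sqb_sq_integrable) (auto simp: AE_lebesgue_iff)

lemma L2_eqI: "AE x in lborel. fb u x = fb v x ==> u = v"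
 using mk_cong[OF sqb_fb sqb_fb, of u v] by (simp add: mk_fb)

lemma sqb_borel_iff: "h : borelm ==> sqb h \<longleftrightarrow> sq_integrable h"
 using integrable_completion[of "%x. (norm (h x))^2" lborel] sqb_sq_integrable[of h]
 by (auto simp: sqb_def sq_integrable_def)

lemma assumes "sqb f" "sqb g" shows sqb_add: "sqb (%x. f x+g x)"
 and sqb_diff: "sqb (%x. f x-g x)" and sqb_scaleR: "sqb (%x. c *R f x)"
proof -
 have [measurable]: "f : borelm" "g : borelm" using assms by (auto simp: sqb_def)
 note sq = sqb_sq_integrable[OF assms(1)] sqb_sq_integrable[OF assms(2)]
 show "sqb (%x. f x+g x)" by (subst sqb_borel_iff) (measurable, rule sq_integrable_add[OF sq])
 show "sqb (%x. f x-g x)" by (subst sqb_borel_iff) (measurable, rule sq_integrable_diff[OF sq])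
 show "sqb (%x. c *R f x)" by (subst sqb_borel_iff) (measurable, rule sq_integrable_scaleR[OF sq(1)])
qed

lemma fb_add: "AE x in lborel. fb (u+v) x = fb u x+fb v x"
 and fb_diff: "AE x in lborel. fb (u-v) x = fb u x-fb v x"
 and fb_scaleR: "AE x in lborel. fb (c *R u) x = c *R fb u x"
proof -
 have rel: "L2_rel (fb u) (fb u)" for u :: "('a, 'b) L2" using sqb_sq_integrable[OF sqb_fb[of u]] by (simp add: L2_rel_def)
 have "u+v = mk (%x. fb u x+fb v x)"
  using plus_L2.abs_eq[OF rel rel, of u v] mk_fb[of u] mk_fb[of v] by (simp add: mk_def)
 with fb_mk[OF sqb_add[OF sqb_fb sqb_fb]] show "AE x in lborel. fb (u+v) x = fb u x+fb v x" by simp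
 have "u-v = mk (%x. fb u x-fb v x)"
  using minus_L2.abs_eq[OF rel rel, of u v] mk_fb[of u] mk_fb[of v] by (simp add: mk_def)
 with fb_mk[OF sqb_diff[OF sqb_fb sqb_fb]] show "AE x in lborel. fb (u-v) x = fb u x-fb v x" by simp
 have "c *R u = mk (%x. c *R fb u x)"
  using scaleR_L2.abs_eq[OF rel, of c u] mk_fb[of u] by (simp add: mk_def)
 with fb_mk[OF sqb_scaleR[OF sqb_fb sqb_fb]] show "AE x in lborel. fb (c *R u) x = c *R fb u x" by simp
qed

lemma fb_zero: "AE x in lborel. fb (0 :: ('a::euclidean_space, 'b::euclidean_space) L2) x = 0"
proof -
 have "(0 :: ('a, 'b) L2) = mk (%x. 0)" using zero_L2.abs_eq by (simp add: mk_def)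
 moreover have "sqb (%x::'a. 0 :: 'b)" by (simp add: sqb_def)
 ultimately show "AE x in lborel. fb (0::('a, 'b) L2) x = 0" using fb_mk[of "%x::'a. 0 :: 'b"] by simp
qed

lemma inner_L2: "inner u v = (LB x. fb u x \<bullet> fb v x)"
proof -
 have "inner u v = (LINT x|lebesgue. fb u x \<bullet> fb v x)"
  using inner_L2.abs_eq[of "fb u" "fb v"] mk_fb[of u] mk_fb[of v] sqb_sq_integrable[OF sqb_fb[of u]] sqb_sq_integrable[OF sqb_fb[of v]] by (simp add: mk_def L2_rel_def)
 also have "... = (LB x. fb u x \<bullet> fb v x)" by (rule integral_completion) measurable
 finally show ?thesis .
qed

lemma norm_L2_sq: "(norm u)^2 = (LB x. (norm (fb u x))^2)"
 by (simp add: power2_norm_eq_inner inner_L2)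

lemma nn_norm_L2: "ennreal ((norm u)^2) = (NN x. ennreal ((norm (fb u x))^2))"
 unfolding norm_L2_sq by (rule nn_integral_eq_integral[symmetric]) (auto simp: integrable_fb_sq)

lemma sqb_nn: "g : borelm ==> (NN x. ennreal ((norm (g x))^2)) <= ennreal C ==> sqb g"
 unfolding sqb_def by (auto intro!: integrableI_bounded simp: le_less_trans[OF _ ennreal_less_top])

lemma norm_mk_le:
 assumes "g : borelm" "(NN x. ennreal ((norm (g x))^2)) <= ennreal C" "C >= 0"
 shows "(norm (mk g))^2 <= C"
proof -
 have g: "sqb g" using sqb_nn assms by blast
 have "ennreal ((norm (mk g))^2) = (NN x. ennreal ((norm (g x))^2))"
  unfolding nn_norm_L2 by (rule nn_integral_cong_AE) (use fb_mk[OF g] in \<open>auto elim: eventually_mono\<close>)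
 hence "ennreal ((norm (mk g))^2) <= ennreal C" using assms(2) by simp
 thus ?thesis using assms(3) by (subst (asm) ennreal_le_iff) auto
qed

text \<open>Riesz--Fischer: \<open>\<Sum> 2 ^ k * norm (u (k+1) - u k)^2\<close> is integrable, hence finite almost everywhere, and
  therefore the increments decay geometrically there.\<close>

lemma L2_fast_Cauchy_pointwise:
 fixes u :: "nat => ('a::euclidean_space, 'b::euclidean_space) L2"
 assumes fast: "!!k. norm (u (Suc k)-u k) <= (1/2)^k"
 shows "AE x in lborel. convergent (%k. fb (u k) x)"
proof -
 define d where "d = (%k x. norm (fb (u (Suc k)) x-fb (u k) x))"
 define H where "H = (%x. \<Sum>k. ennreal (2^k*(d k x)^2))"
 have [measurable]: "d k : borelm" for k unfolding d_def by measurable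
 have Hm: "H : borel_measurable lborel" unfolding H_def by measurable
 have "(NN x. ennreal (2^k*(d k x)^2)) <= ennreal ((1/2)^k)" for k
 proof -
  have "(NN x. ennreal (2^k*(d k x)^2)) = ennreal (2^k)*(NN x. ennreal ((d k x)^2))"
   by (subst nn_integral_cmult[symmetric]) (auto simp: ennreal_mult)
  also have "(NN x. ennreal ((d k x)^2)) = ennreal ((norm (u (Suc k)-u k))^2)"
   unfolding nn_norm_L2 by (rule nn_integral_cong_AE) (use fb_diff[of "u (Suc k)" "u k"] in \<open>auto simp: d_def elim!: eventually_mono\<close>)
  also have "ennreal (2^k)*... <= ennreal (2^k)*ennreal (((1/2)^k)^2)" using fast[of k] by (intro mult_left_mono ennreal_leI power_mono) auto
  also have "... = ennreal ((1/2)^k)" by (simp add: ennreal_mult[symmetric] power2_eq_square power_mult_distrib[symmetric])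
  finally show ?thesis .
 qed
 hence "(NN x. H x) <= (\<Sum>k. ennreal ((1/2)^k))"
  unfolding H_def by (subst nn_integral_suminf) (auto intro!: suminf_le)
 also have "... = ennreal 2" by (rule suminf_ennreal_eq) (use geometric_sums[of "1/2::real"] in simp_all)
 finally have "(NN x. H x) ~= \<infinity>" using order.strict_trans1[OF _ ennreal_less_top] by fastforce
 from nn_integral_PInf_AE[OF Hm this] show ?thesis
 proof eventually_elim
  case (elim x)
  define c where "c = sqrt (enn2real (H x))"
  have "d k x <= c * sqrt (1/2)^k" for k
  proof -
   define f where "f = (%k. ennreal (2^k*(d k x)^2))"
   have "sum f {k} <= suminf f" by (rule sum_le_suminf) auto
   hence "ennreal (2^k*(d k x)^2) <= H x" by (simp add: f_def H_def)
   also have "H x = ennreal (c^2)" unfolding c_def real_sqrt_pow2[OF enn2real_nonneg] using elim by (intro ennreal_enn2real[symmetric]) (simp add: less_top)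
   finally have "2^k*(d k x)^2 <= c^2" by (subst (asm) ennreal_le_iff) auto
   moreover have "(c * sqrt (1/2)^k)^2 = c^2/2^k"
   proof -
    have "(sqrt (1/2)^k)^2 = ((sqrt (1/2))^2)^k" by (simp only: power_mult[symmetric] mult.commute)
    thus ?thesis by (simp add: power_mult_distrib power_divide)
   qed
   ultimately have "(d k x)^2 <= (c * sqrt (1/2)^k)^2" by (simp add: pos_le_divide_eq mult.commute)
   thus ?thesis by (rule power2_le_imp_le) (simp add: c_def)
  qed
  moreover have "summable (%k. c * sqrt (1/2)^k)" by (intro summable_mult summable_geometric) (simp add: real_sqrt_lt_1_iff)
  ultimately have "summable (%k. fb (u (Suc k)) x-fb (u k) x)" unfolding d_def by (rule summable_comparison_test'[rotated])
  hence "convergent (%n. fb (u n) x-fb (u 0) x)" by (simp only: summable_iff_convergent sum_lessThan_telescope[of "%n. fb (u n) x"])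
  from convergent_add[OF this convergent_const[of "fb (u 0) x"]] show ?case by simp
 qed
qed

text \<open>Along a fast subsequence there is a pointwise limit; convergence in norm follows by Fatou's lemma.\<close>

instance L2 :: (euclidean_space, euclidean_space) banach
proof
 fix u :: "nat => ('a, 'b) L2" assume C: "Cauchy u"
 have "\<forall>k. \<exists>N. \<forall>m\<ge>N. \<forall>n\<ge>N. dist (u m) (u n) < (1/2)^k" using C by (auto simp: Cauchy_def)
 then obtain N where N: "!!k m n. m >= N k ==> n >= N k ==> dist (u m) (u n) < (1/2)^k" by metis
 define r where "r = (%k. (\<Sum>i\<le>k. N i)+k)"
 have rN: "r m >= N k" "r m >= m" if "k <= m" for k m
  using member_le_sum[of k "{..m}" N] that by (auto simp: r_def)
 define g where "g = (%k. fb (u (r k)))"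
 define l where "l = (%x. lim (%k. g k x))"
 have [measurable]: "g k : borelm" for k by (simp add: g_def)
 have [measurable]: "l : borelm" unfolding l_def by (rule borel_measurable_lim_metric) measurable
 have "AE x in lborel. convergent (%k. g k x)" unfolding g_def
 proof (rule L2_fast_Cauchy_pointwise)
  fix k
  have "dist (u (r (Suc k))) (u (r k)) < (1/2)^k" by (intro N rN) auto
  thus "norm (u (r (Suc k))-u (r k)) <= (1/2)^k" by (simp add: dist_norm)
 qed
 hence lim: "AE x in lborel. (%k. g k x) ----> l x" by eventually_elim (simp add: l_def convergent_LIMSEQ_iff)
 have bound: "(NN x. ennreal ((norm (l x-fb (u n) x))^2)) <= ennreal (((1/2)^k)^2)" if n: "n >= N k" for n k
 proof -
  have "(NN x. ennreal ((norm (l x-fb (u n) x))^2)) = (NN x. liminf (%j. ennreal ((norm (g j x-fb (u n) x))^2)))"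
   by (rule nn_integral_cong_AE) (use lim in \<open>eventually_elim, intro lim_imp_Liminf[symmetric] tendsto_intros tendsto_ennrealI, auto\<close>)
  also have "... <= liminf (%j. NN x. ennreal ((norm (g j x-fb (u n) x))^2))" by (rule nn_integral_liminf) measurable
  also have "... = liminf (%j. ennreal ((norm (u (r j)-u n))^2))"
  proof (intro arg_cong[where f = liminf] ext)
   fix j
   show "(NN x. ennreal ((norm (g j x-fb (u n) x))^2)) = ennreal ((norm (u (r j)-u n))^2)"
    unfolding nn_norm_L2 by (rule nn_integral_cong_AE) (use fb_diff[of "u (r j)" "u n"] in \<open>eventually_elim, simp add: g_def\<close>)
  qed
  also have "... <= ennreal (((1/2)^k)^2)"
  proof (rule Liminf_le[OF trivial_limit_sequentially], rule eventually_mono[OF eventually_ge_at_top[of k]])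
   fix j assume "k <= j"
   hence "dist (u (r j)) (u n) < (1/2)^k" by (intro N rN n)
   thus "ennreal ((norm (u (r j)-u n))^2) <= ennreal (((1/2)^k)^2)" by (intro ennreal_leI power_mono) (auto simp: dist_norm)
  qed
  finally show ?thesis .
 qed
 have "sqb (%x. l x-fb (u (N 0)) x)" by (rule sqb_nn[OF _ bound[OF order_refl]]) measurable
 from sqb_add[OF this sqb_fb[of "u (N 0)"]] have sl: "sqb l" by simp
 have main: "norm (u n-mk l) <= (1/2)^k" if n: "n >= N k" for n k
 proof -
  have "mk l-u n = mk (%x. l x-fb (u n) x)"
  proof (rule L2_eqI)
   have "sqb (%x. l x-fb (u n) x)" by (rule sqb_nn[OF _ bound[OF n]]) measurable
   from fb_diff[of "mk l" "u n"] fb_mk[OF sl] fb_mk[OF this]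
   show "AE x in lborel. fb (mk l-u n) x = fb (mk (%x. l x-fb (u n) x)) x" by eventually_elim simp
  qed
  hence "(norm (mk l-u n))^2 <= ((1/2)^k)^2" using norm_mk_le[OF _ bound[OF n]] by simp
  thus ?thesis unfolding norm_minus_commute[of "u n"] by (rule power2_le_imp_le) simp
 qed
 have "u ----> mk l"
 proof (rule LIMSEQ_I)
  fix e :: real assume "e > 0"
  then obtain k where k: "(1/2)^k < e" using real_arch_pow_inv[of e "1/2"] by auto
  show "\<exists>n0. \<forall>n\<ge>n0. norm (u n-mk l) < e" using le_less_trans[OF main k] by blast
 qed
 thus "convergent u" by (auto simp: convergent_def)
qed

section \<open>Smooth functions\<close>

lemma partial_deriv_eqI: "(phi has_derivative f') (at x) ==> pd j phi x = f' (axis j 1)"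
 unfolding partial_deriv_def by (simp add: frechet_derivative_at[symmetric])

lemma has_derivative_frechet: "phi differentiable_on UNIV ==> (phi has_derivative frechet_derivative phi (at x)) (at x)"
 by (simp add: differentiable_on_def frechet_derivative_works)

lemma C_k_Suc: "C_k (Suc k) phi ==> C_k k phi"
 by (induction k arbitrary: phi) (auto intro: differentiable_imp_continuous_on)

lemma C_k_const: "C_k k (%x. c)"
proof (induction k arbitrary: c)
 case (Suc k)
 have "pd j (%x. c) = (%x. 0)" for j :: 'a
  by (rule ext, rule partial_deriv_eqI) (rule has_derivative_const)
 thus ?case using Suc[of 0] by (simp add: differentiable_on_def)
qed simp

lemma C_k_add: "C_k k phi ==> C_k k psi ==> C_k k (%x. phi x+psi x)"
proof (induction k arbitrary: phi psi)
 case (Suc k)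
 hence d: "phi differentiable_on UNIV" "psi differentiable_on UNIV" by auto
 have "pd j (%x. phi x+psi x) = (%x. pd j phi x+pd j psi x)" for j
  by (rule ext, subst partial_deriv_eqI[OF has_derivative_add[OF has_derivative_frechet[OF d(1)] has_derivative_frechet[OF d(2)]]])
   (simp add: partial_deriv_def)
 thus ?case using Suc d by (auto intro: differentiable_on_add)
qed (auto intro: continuous_intros)

lemma partial_deriv_mult:
 assumes d: "phi differentiable_on UNIV" "psi differentiable_on UNIV"
 shows "pd j (%x. phi x*psi x) x = phi x*pd j psi x+pd j phi x*psi x"
 by (subst partial_deriv_eqI[OF has_derivative_mult[OF has_derivative_frechet[OF d(1)] has_derivative_frechet[OF d(2)]]])
  (simp add: partial_deriv_def)

lemma C_k_mult: "C_k k phi ==> C_k k psi ==> C_k k (%x. phi x*psi x)"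
proof (induction k arbitrary: phi psi)
 case (Suc k)
 hence d: "phi differentiable_on UNIV" "psi differentiable_on UNIV" by auto
 have "pd j (%x. phi x*psi x) = (%x. phi x*pd j psi x+pd j phi x*psi x)" for j
  by (rule ext, rule partial_deriv_mult[OF d])
 moreover have "(%x. phi x*psi x) differentiable_on UNIV" using d
  unfolding differentiable_on_def by (intro ballI differentiable_mult) auto
 ultimately show ?case using Suc C_k_Suc[OF Suc.prems(1)] C_k_Suc[OF Suc.prems(2)] by (auto intro!: C_k_add)
qed (auto intro: continuous_intros)

lemma C_k_minus: "C_k k phi ==> C_k k (%x. - phi x)"
 using C_k_mult[OF C_k_const[of k "-1"]] by simp

lemma partial_deriv_exp:
 assumes d: "phi differentiable_on UNIV"
 shows "pd j (%x. exp (phi x)) x = pd j phi x*exp (phi x)"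
 by (subst partial_deriv_eqI[OF has_derivative_exp[OF has_derivative_frechet[OF d]]]) (simp add: partial_deriv_def)

lemma C_k_exp: "C_k k phi ==> C_k k (%x. exp (phi x))"
proof (induction k)
 case (Suc k)
 hence d: "phi differentiable_on UNIV" by auto
 have "pd j (%x. exp (phi x)) = (%x. pd j phi x*exp (phi x))" for j
  by (rule ext, rule partial_deriv_exp[OF d])
 moreover have "(%x. exp (phi x)) differentiable_on UNIV"
  unfolding differentiable_on_def using has_derivative_exp[OF has_derivative_frechet[OF d]] differentiableI by blast
 ultimately show ?case using Suc C_k_Suc[OF Suc.prems(1)] by (auto intro!: C_k_mult)
qed (auto intro: continuous_intros)

lemma C_k_inverse: "C_k k phi ==> (!!x. phi x ~= 0) ==> C_k k (%x. inverse (phi x))"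
proof (induction k)
 case (Suc k)
 hence d: "phi differentiable_on UNIV" by auto
 have "pd j (%x. inverse (phi x)) = (%x. (- 1)*(pd j phi x*(inverse (phi x)*inverse (phi x))))" for j
  by (rule ext, subst partial_deriv_eqI[OF Deriv.has_derivative_inverse[OF Suc.prems(2) has_derivative_frechet[OF d]]])
   (simp add: partial_deriv_def)
 moreover have "(%x. inverse (phi x)) differentiable_on UNIV"
  unfolding differentiable_on_def
  using Deriv.has_derivative_inverse[OF Suc.prems(2) has_derivative_frechet[OF d]] differentiableI by blast
 ultimately show ?case using Suc C_k_Suc[OF Suc.prems(1)] by (auto intro!: C_k_minus C_k_mult)
qed (auto intro: continuous_intros)

lemma C_k_prod: "finite I ==> (!!i. i : I ==> C_k k (f i)) ==> C_k k (%x. \<Prod>i\<in>I. f i x)"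
 by (induction I rule: finite_induct) (auto intro: C_k_const C_k_mult)

lemma C_k_shift: "C_k k phi ==> C_k k (%x. phi (x+h))"
proof (induction k arbitrary: phi)
 case (Suc k)
 hence d: "phi differentiable_on UNIV" by auto
 have hd: "((%x. phi (x+h)) has_derivative frechet_derivative phi (at (x+h))) (at x)" for x
  using has_derivative_compose[OF has_derivative_add[OF has_derivative_ident has_derivative_const[of h]] has_derivative_frechet[OF d]]
  by simp
 have "pd j (%x. phi (x+h)) = (%x. pd j phi (x+h))" for j
  by (rule ext, subst partial_deriv_eqI[OF hd]) (simp add: partial_deriv_def)
 moreover have "(%x. phi (x+h)) differentiable_on UNIV"
  unfolding differentiable_on_def using hd differentiableI by blast
 ultimately show ?case using Suc by auto
next
 case 0
 thus ?case using continuous_on_compose2[of UNIV phi UNIV "%x. x+h"] by (simp add: continuous_intros)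
qed

lemma partial_deriv_shift: "phi differentiable_on UNIV ==> pd j (%x. phi (x+h)) x = pd j phi (x+h)"
 by (subst partial_deriv_eqI[OF has_derivative_compose[OF has_derivative_add[OF has_derivative_ident has_derivative_const[of h]] has_derivative_frechet]])
  (auto simp: partial_deriv_def)

lemma C_k_reflect: "C_k k phi ==> C_k k (%x. phi (h-x))"
 and partial_deriv_reflect: "phi differentiable_on UNIV ==> pd j (%x. phi (h-x)) x = - pd j phi (h-x)"
proof -
 have pd: "((%x. phi (h-x)) has_derivative (%y. frechet_derivative phi (at (h-x)) (- y))) (at x)"
  if d: "phi differentiable_on UNIV" for x and phi :: "real^'a => real"
  using has_derivative_compose[OF has_derivative_diff[OF has_derivative_const[of h] has_derivative_ident] has_derivative_frechet[OF d]]
  by simp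
 have e: "pd j (%x. phi (h-x)) x = - pd j phi (h-x)"
  if d: "phi differentiable_on UNIV" for x j and phi :: "real^'a => real"
  using linear_neg[OF has_derivative_linear[OF has_derivative_frechet[OF d, of "h-x"]], of "axis j 1"]
  by (subst partial_deriv_eqI[OF pd[OF d]]) (simp add: partial_deriv_def)
 show "phi differentiable_on UNIV ==> pd j (%x. phi (h-x)) x = - pd j phi (h-x)" by (rule e)
 show "C_k k phi ==> C_k k (%x. phi (h-x))"
 proof (induction k arbitrary: phi)
  case (Suc k)
  hence d: "phi differentiable_on UNIV" by auto
  have "pd j (%x. phi (h-x)) = (%x. (- 1)*pd j phi (h-x))" for j
   by (rule ext) (simp add: e[OF d])
  moreover have "(%x. phi (h-x)) differentiable_on UNIV"
   unfolding differentiable_on_def using pd[OF d] differentiableI by blast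
  ultimately show ?case using Suc by (auto intro!: C_k_minus)
 next
  case 0
  thus ?case using continuous_on_compose2[of UNIV phi UNIV "%x. h-x"] by (simp add: continuous_intros)
 qed
qed

lemma C_k_coordinate_function:
 fixes d :: "nat => real => real"
 assumes d: "!!k x. (d k has_real_derivative d (Suc k) x) (at x)"
 shows "C_k m (%x::real^'n::finite. d k (x $ i))"
proof (induction m arbitrary: k)
 case 0
 have "continuous_on UNIV (d k)" by (intro continuous_at_imp_continuous_on ballI DERIV_isCont[OF d])
 thus ?case by (auto intro!: continuous_on_compose2[of UNIV "d k"] continuous_intros)
next
 case (Suc m)
 have hd: "((%x. d k (x $ i)) has_derivative (%y. d (Suc k) (x $ i)*(y $ i))) (at x)" for x :: "real^'n"
  by (rule has_derivative_compose[OF bounded_linear_imp_has_derivative[OF bounded_linear_vec_nth] d[of k, unfolded has_field_derivative_def]])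
 have "pd j (%x. d k (x $ i)) = (%x. (if i = j then 1 else 0)*d (Suc k) (x $ i))" for j
  by (rule ext, subst partial_deriv_eqI[OF hd]) (auto simp: axis_def)
 moreover have "(%x::real^'n. d k (x $ i)) differentiable_on UNIV"
  unfolding differentiable_on_def using hd differentiableI by blast
 ultimately show ?case using Suc by (auto intro!: C_k_mult C_k_const)
qed

subsection \<open>A smooth step\<close>

primrec flat_poly :: "nat => real poly" where
 "flat_poly 0 = 1"
| "flat_poly (Suc k) = [:0, 0, 1:]*(flat_poly k-pderiv (flat_poly k))"

text \<open>The derivatives of the flat function \<open>exp (- 1 / x)\<close>, extended by zero.\<close>

definition flat :: "nat => real => real" where
 "flat k x = (if x > 0 then poly (flat_poly k) (1/x)*exp (- (1/x)) else 0)"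

lemma poly_exp_tendsto_0: "((%y::real. poly p y*exp (- y)) \<longlongrightarrow> 0) at_top"
proof (induction p)
 case (pCons a p)
 have "((%y::real. a*exp (- y)) \<longlongrightarrow> 0) at_top" by real_asymp
 moreover have "((%y::real. y*(poly p y*exp (- y))) \<longlongrightarrow> 0) at_top"
 proof -
  have *: "((%y::real. y*(c*y^k*exp (- y))) \<longlongrightarrow> c*0) at_top" for c k
  proof -
   have "((%y::real. c*(y^Suc k/exp y)) \<longlongrightarrow> c*0) at_top"
    by (intro tendsto_intros tendsto_power_div_exp_0)
   thus ?thesis by (simp add: exp_minus field_simps)
  qed
  have "((%y::real. \<Sum>i\<le>degree p. y*(coeff p i*y^i*exp (- y))) \<longlongrightarrow> (\<Sum>i\<le>degree p. coeff p i*0)) at_top"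
   by (intro tendsto_sum *)
  thus ?thesis by (simp add: poly_altdef sum_distrib_left sum_distrib_right)
 qed
 ultimately show ?case using tendsto_add[of _ 0 at_top _ 0] by (fastforce simp: algebra_simps)
qed simp

lemma flat_derivative: "(flat k has_real_derivative flat (Suc k) x) (at x)"
proof -
 consider "x < 0" | "x = 0" | "x > 0" by linarith
 thus ?thesis
 proof cases
  case 1
  have "((%x. 0) has_real_derivative 0) (at x)" by simp
  moreover have "eventually (%y. flat k y = 0) (nhds x)"
   using eventually_nhds_in_open[of "{..<0}" x] 1 by (auto elim!: eventually_mono simp: flat_def)
  ultimately show ?thesis using 1 by (subst DERIV_cong_ev[OF refl _ refl, where g = "%x. 0"]) (auto simp: flat_def)
 next
  case 3
  have "((%x. poly (flat_poly k) (1/x)*exp (- (1/x))) has_real_derivative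
    poly (flat_poly k) (1/x)*(exp (- (1/x))*(1/x^2))+(poly (pderiv (flat_poly k)) (1/x)*(- (1/x^2)))*exp (- (1/x))) (at x)"
   using 3 by (auto intro!: derivative_eq_intros simp: power2_eq_square)
  moreover have "poly (flat_poly k) (1/x)*(exp (- (1/x))*(1/x^2))+(poly (pderiv (flat_poly k)) (1/x)*(- (1/x^2)))*exp (- (1/x)) = flat (Suc k) x"
   using 3 by (simp add: flat_def power2_eq_square field_simps)
  moreover have "eventually (%y. flat k y = poly (flat_poly k) (1/y)*exp (- (1/y))) (nhds x)"
   using eventually_nhds_in_open[of "{0<..}" x] 3 by (auto elim!: eventually_mono simp: flat_def)
  ultimately show ?thesis by (subst DERIV_cong_ev[OF refl _ refl]) auto
 next
  case 2
  have "((%h. flat k h/h) \<longlongrightarrow> 0) (at_right 0)"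
  proof -
   have "((%y::real. poly (pCons 0 (flat_poly k)) y*exp (- y)) \<longlongrightarrow> 0) at_top" by (rule poly_exp_tendsto_0)
   hence "((%h::real. poly (pCons 0 (flat_poly k)) (inverse h)*exp (- (inverse h))) \<longlongrightarrow> 0) (at_right 0)"
    by (rule filterlim_compose[OF _ filterlim_inverse_at_top_right])
   moreover have "eventually (%h::real. poly (pCons 0 (flat_poly k)) (inverse h)*exp (- (inverse h)) = flat k h/h) (at_right 0)"
    using eventually_at_right_less[of "0::real"] by eventually_elim (simp add: flat_def field_simps inverse_eq_divide)
   ultimately show ?thesis by (rule Lim_transform_eventually)
  qed
  moreover have "((%h. flat k h/h) \<longlongrightarrow> 0) (at_left 0)"
  proof (rule tendsto_eventually)
   show "eventually (%h. flat k h/h = 0) (at_left 0)"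
    by (auto simp: eventually_at_filter flat_def intro!: always_eventually)
  qed
  ultimately have "((%h. flat k h/h) \<longlongrightarrow> 0) (at 0)" by (simp add: filterlim_split_at)
  thus ?thesis using 2 by (simp add: DERIV_def flat_def[of _ 0])
 qed
qed

definition step :: "real => real" where "step x = flat 0 x/(flat 0 x+flat 0 (1-x))"

lemma flat0: "flat 0 x >= 0" "x > 0 ==> flat 0 x > 0" "x <= 0 ==> flat k x = 0"
 by (auto simp: flat_def)

lemma step_denominator_pos: "flat 0 x+flat 0 (1-x) > 0"
 using flat0(1)[of x] flat0(1)[of "1-x"] flat0(2)[of x] flat0(2)[of "1-x"] by (cases "x > 0") auto

lemma step_bounds: "0 <= step x" "step x <= 1"
 using step_denominator_pos[of x] flat0(1)[of x] flat0(1)[of "1-x"] by (auto simp: step_def field_simps)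

lemma step_0: "x <= 0 ==> step x = 0" and step_1: "x >= 1 ==> step x = 1"
 using step_denominator_pos[of x] flat0(3)[of "1-x" 0] by (auto simp: step_def flat0(3))

definition step' :: "real => real" where
 "step' x = (flat 1 x*flat 0 (1-x)+flat 0 x*flat 1 (1-x))/(flat 0 x+flat 0 (1-x))^2"

lemma step_derivative: "(step has_real_derivative step' x) (at x)"
proof -
 have f1: "(flat 0 has_real_derivative flat 1 x) (at x)" for x using flat_derivative[of 0 x] by simp
 have f2: "((%x. flat 0 (1-x)) has_real_derivative-flat 1 (1-x)) (at x)"
 proof -
  have "((%x. 1-x) has_real_derivative-1) (at x)" by (auto intro!: derivative_eq_intros)
  from DERIV_chain'[OF this f1] show ?thesis by simp
 qed
 have "((%x. flat 0 x/(flat 0 x+flat 0 (1-x))) has_real_derivative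
  (flat 1 x*(flat 0 x+flat 0 (1-x))-flat 0 x*(flat 1 x + - flat 1 (1-x)))/((flat 0 x+flat 0 (1-x))*(flat 0 x+flat 0 (1-x)))) (at x)"
  using step_denominator_pos[of x] by (intro DERIV_divide DERIV_add f1 f2) auto
 thus ?thesis by (simp add: step_def[abs_def] step'_def power2_eq_square algebra_simps)
qed

lemma step'_bounded: obtains S where "S >= 1" "!!x. \<bar>step' x\<bar> <= S"
proof -
 have c: "continuous_on T (flat k)" for k T
  by (intro continuous_at_imp_continuous_on ballI DERIV_isCont[OF flat_derivative])
 have cc: "continuous_on T (%x. flat k (1-x))" for k T
  by (rule continuous_on_compose2[OF c[of UNIV]]) (auto intro: continuous_intros)
 have "continuous_on {0..1} step'" unfolding step'_def
  using step_denominator_pos by (intro continuous_intros c cc) (auto simp: less_imp_neq[symmetric])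
 hence "bounded (step' ` {0..1})" by (intro compact_imp_bounded compact_continuous_image) auto
 then obtain S where S: "\<forall>x\<in>{0..1}. norm (step' x) <= S" by (auto simp: bounded_iff)
 have "\<bar>step' x\<bar> <= max S 1" for x
 proof (cases "x : {0..1}")
  case False
  hence "step' x = 0" by (cases "x < 0") (auto simp: step'_def flat0(3))
  thus ?thesis by simp
 qed (use S in force)
 thus thesis by (intro that[of "max S 1"]) auto
qed

definition plateau :: "real => real^'n::finite => real^'n => real^'n => real" where
 "plateau eps a b x = (\<Prod>i\<in>UNIV. step ((x $ i-a $ i)/eps) * step ((b $ i-x $ i)/eps))"

lemma C_k_step: "C_k k (%x::real^'n::finite. step ((x $ i-a)/e))"
proof -
 define d where "d = (%k y. flat k ((y-a)/e)/e^k)"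
 define d' where "d' = (%k y. flat k (1-(y-a)/e)*(- 1/e)^k)"
 have 1: "(d k has_real_derivative d (Suc k) y) (at y)" for k y
 proof -
  have "((%y. (y-a)/e) has_real_derivative 1/e) (at y)" by (auto intro!: derivative_eq_intros simp: divide_inverse)
  from DERIV_cdivide[OF DERIV_chain'[OF this flat_derivative[of k]], of "e^k"] show ?thesis
   by (simp add: d_def mult.commute)
 qed
 have 2: "(d' k has_real_derivative d' (Suc k) y) (at y)" for k y
 proof -
  have "((%y. 1-(y-a)/e) has_real_derivative-1/e) (at y)" by (auto intro!: derivative_eq_intros simp: divide_inverse)
  from DERIV_cmult_right[OF DERIV_chain'[OF this flat_derivative[of k]], of "(- 1/e)^k"] show ?thesis
   by (simp add: d'_def mult_ac)
 qed
 have "C_k k (%x::real^'n. d 0 (x $ i)*inverse (d 0 (x $ i)+d' 0 (x $ i)))"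
  by (intro C_k_mult C_k_inverse C_k_add C_k_coordinate_function 1 2)
   (use step_denominator_pos in \<open>auto simp: d_def d'_def less_imp_neq[symmetric]\<close>)
 thus ?thesis by (simp add: d_def d'_def step_def divide_inverse)
qed

lemma C_k_plateau: "C_k k (plateau eps a b)"
proof -
 have "C_k k (%x. step ((b $ i-x $ i)/eps))" for i
 proof -
  have "(b $ i-y)/eps = (y-b $ i)/(- eps)" for y by (metis minus_diff_eq minus_divide_left minus_divide_right)
  thus ?thesis using C_k_step[of k i "b $ i" "- eps"] by simp
 qed
 thus ?thesis unfolding plateau_def[abs_def] by (intro C_k_prod C_k_mult C_k_step) auto
qed

lemma plateau_bounds: "0 <= plateau eps a b x" "plateau eps a b x <= 1"
 unfolding plateau_def by (auto intro!: prod_nonneg prod_le_1 mult_nonneg_nonneg mult_le_one step_bounds)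

lemma plateau_0: "eps > 0 ==> x \<notin> box a b ==> plateau eps a b x = 0"
proof -
 assume e: "eps > 0" and "x \<notin> box a b"
 then obtain i where "x $ i <= a $ i | b $ i <= x $ i" by (auto simp: mem_box_cart not_less)
 hence "step ((x $ i-a $ i)/eps) * step ((b $ i-x $ i)/eps) = 0"
  using e by (auto simp: step_0 divide_le_0_iff)
 thus ?thesis unfolding plateau_def by (intro prod_zero) auto
qed

lemma plateau_1:
 assumes "eps > 0" "!!i. a $ i+eps <= x $ i" "!!i. x $ i+eps <= b $ i"
 shows "plateau eps a b x = 1"
 unfolding plateau_def
proof (rule prod.neutral, rule ballI)
 fix i
 show "step ((x $ i-a $ i)/eps) * step ((b $ i-x $ i)/eps) = 1"
  using assms(1) assms(2,3)[of i] by (simp add: step_1)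
qed

lemma test_function_supported_in_box:
 assumes "!!k. C_k k phi" "!!x. x \<notin> box a b ==> phi x = 0"
 shows "testf phi"
 unfolding test_function_def
proof (intro conjI allI assms(1))
 have "closure {x. phi x ~= 0} \<subseteq> cbox a b"
  by (rule closure_minimal) (use assms(2) box_subset_cbox in auto)
 thus "compact (closure {x. phi x ~= 0})" using bounded_subset[OF bounded_cbox] by (auto simp: compact_eq_bounded_closed)
qed

lemma test_function_plateau: "eps > 0 ==> testf (plateau eps a b)"
 by (rule test_function_supported_in_box[OF C_k_plateau]) (rule plateau_0)

lemma C_k_differentiable: "(!!k. C_k k phi) ==> phi differentiable_on UNIV"
 using C_k.simps(2)[of 0 phi] by blast

lemma test_function_differentiable: "testf phi ==> phi differentiable_on UNIV"
 by (auto simp: test_function_def intro: C_k_differentiable)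

lemma partial_deriv_line:
 assumes d: "phi differentiable_on UNIV"
 shows "((%t. phi (x+t *R axis j 1)) has_real_derivative pd j phi (x+t *R axis j 1)) (at t)"
proof -
 have "((%t. x+t *R axis j 1) has_derivative (%t. 0+t *R axis j 1)) (at t)"
  by (intro derivative_intros)
 from has_derivative_compose[OF this has_derivative_frechet[OF d]]
 have "((%t. phi (x+t *R axis j 1)) has_derivative (%s. frechet_derivative phi (at (x+t *R axis j 1)) (0+s *R axis j 1))) (at t)" .
 thus ?thesis unfolding has_field_derivative_def
  by (rule has_derivative_eq_rhs)
   (simp add: fun_eq_iff partial_deriv_def linear_scale[OF has_derivative_linear[OF has_derivative_frechet[OF d]]])
qed

text \<open>Only the factor belonging to the \<open>j\<close>-th coordinate is differentiated; the others lie between zero and one.\<close>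

lemma plateau_partial_deriv_bound:
 assumes e: "eps > 0" and S: "!!x. \<bar>step' x\<bar> <= S"
 shows "\<bar>pd j (plateau eps a b) x\<bar> <= 2*S/eps"
proof -
 define P where "P = (\<Prod>i\<in>UNIV - {j}. step ((x $ i-a $ i)/eps) * step ((b $ i-x $ i)/eps))"
 have P: "0 <= P" "P <= 1" unfolding P_def by (auto intro!: prod_nonneg prod_le_1 mult_nonneg_nonneg mult_le_one step_bounds)
 define g where "g = (%t. step ((x $ j+t-a $ j)/eps) * step ((b $ j-(x $ j+t))/eps)*P)"
 have "plateau eps a b (x+t *R axis j 1) = g t" for t
  unfolding plateau_def g_def P_def
  by (subst prod.remove[of UNIV j]) (auto simp: axis_def intro!: arg_cong2[where f = "(*)"] prod.cong)
 hence 1: "(g has_real_derivative pd j (plateau eps a b) x) (at 0)"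
  using partial_deriv_line[OF C_k_differentiable[OF C_k_plateau], of eps a b x j 0] by simp
 let ?s1 = "(x $ j-a $ j)/eps" and ?s2 = "(b $ j-x $ j)/eps"
 have "((%t. step ((x $ j+t-a $ j)/eps)) has_real_derivative step' ?s1*(1/eps)) (at 0)"
 proof -
  have "((%t. (x $ j+t-a $ j)/eps) has_real_derivative 1/eps) (at 0)" by (auto intro!: derivative_eq_intros simp: divide_inverse)
  from DERIV_chain'[OF this step_derivative] show ?thesis by simp
 qed
 moreover have "((%t. step ((b $ j-(x $ j+t))/eps)) has_real_derivative step' ?s2*(- 1/eps)) (at 0)"
 proof -
  have "((%t. (b $ j-(x $ j+t))/eps) has_real_derivative-1/eps) (at 0)" by (auto intro!: derivative_eq_intros simp: divide_inverse)
  from DERIV_chain'[OF this step_derivative] show ?thesis by simp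
 qed
 ultimately have 2: "(g has_real_derivative (step ?s1*(step' ?s2*(- 1/eps))+step' ?s1*(1/eps) * step ?s2)*P) (at 0)"
  unfolding g_def by (auto intro!: derivative_eq_intros)
 have "\<bar>pd j (plateau eps a b) x\<bar> = \<bar>(step ?s1*(step' ?s2*(- 1/eps))+step' ?s1*(1/eps) * step ?s2)\<bar>*P"
  using DERIV_unique[OF 1 2] P by (simp add: abs_mult)
 also have "... <= \<bar>(step ?s1*(step' ?s2*(- 1/eps))+step' ?s1*(1/eps) * step ?s2)\<bar>"
  using P by (intro mult_left_le) auto
 also have "... <= \<bar>step ?s1\<bar>*(\<bar>step' ?s2\<bar>*(1/eps))+\<bar>step' ?s1\<bar>*(1/eps)*\<bar>step ?s2\<bar>"
  using e abs_triangle_ineq by (intro order_trans[OF abs_triangle_ineq]) (simp add: abs_mult)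
 also have "... <= 1*(S*(1/eps))+S*(1/eps)*1"
  using e S step_bounds order_trans[OF abs_ge_zero S]
  by (intro add_mono mult_mono mult_nonneg_nonneg) (auto simp: step_bounds)
 finally show ?thesis by simp
qed

section \<open>Multipliers, test functions and translations on square integrable functions\<close>

lemma sqb_bound:
 assumes g [measurable]: "g : borelm" and le: "AE x in lborel. norm (g x) <= C*norm (fb u x)" and C: "C >= 0"
 shows "sqb g" "norm (mk g) <= C*norm u"
proof -
 have "(NN x. ennreal ((norm (g x))^2)) <= (NN x. ennreal (C^2)*ennreal ((norm (fb u x))^2))"
  using le
 proof (intro nn_integral_mono_AE, eventually_elim)
  case (elim x)
  hence "(norm (g x))^2 <= C^2*(norm (fb u x))^2" by (metis norm_ge_zero power_mono power_mult_distrib)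
  thus ?case by (simp add: ennreal_mult[symmetric] ennreal_leI)
 qed
 also have "... = ennreal (C^2)*ennreal ((norm u)^2)" by (subst nn_integral_cmult) (auto simp: nn_norm_L2)
 also have "... = ennreal ((C*norm u)^2)" by (simp add: ennreal_mult[symmetric] power_mult_distrib)
 finally have *: "(NN x. ennreal ((norm (g x))^2)) <= ennreal ((C*norm u)^2)" .
 show "sqb g" by (rule sqb_nn[OF g *])
 have "(norm (mk g))^2 <= (C*norm u)^2" by (rule norm_mk_le[OF g *]) simp
 thus "norm (mk g) <= C*norm u" by (rule power2_le_imp_le) (simp add: C)
qed

definition bdd :: "('a::euclidean_space => real) => bool" where
 "bdd phi \<longleftrightarrow> phi : borelm & (\<exists>C. \<forall>x. \<bar>phi x\<bar> <= C)"

definition mulr :: "('a::euclidean_space => real) => ('a, 'b::euclidean_space) L2 => ('a, 'b) L2" where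
 "mulr phi u = mk (%x. phi x *R fb u x)"

lemma mulr_props:
 assumes "phi : borelm" "!!x. \<bar>phi x\<bar> <= C"
 shows fb_mulr_bound: "AE x in lborel. fb (mulr phi u) x = phi x *R fb u x"
  and norm_mulr_le: "norm (mulr phi u) <= C*norm u"
proof -
 have [measurable]: "phi : borelm" by fact
 have C: "C >= 0" using assms(2)[of undefined] by linarith
 have "AE x in lborel. norm (phi x *R fb u x) <= C*norm (fb u x)"
  using assms(2) by (intro AE_I2) (simp add: mult_right_mono)
 note b = sqb_bound[OF _ this C]
 show "AE x in lborel. fb (mulr phi u) x = phi x *R fb u x" unfolding mulr_def by (rule fb_mk[OF b(1)]) measurable
 show "norm (mulr phi u) <= C*norm u" unfolding mulr_def by (rule b(2)) measurable
qed

lemma fb_mulr: "bdd phi ==> AE x in lborel. fb (mulr phi u) x = phi x *R fb u x"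
 unfolding bdd_def using fb_mulr_bound by blast

lemma linear_mulr: assumes "bdd phi" shows "linear (mulr phi)"
proof (rule linearI)
 show "mulr phi (u+v) = mulr phi u+mulr phi v" for u v :: "('a, 'b) L2"
  by (rule L2_eqI) (use fb_mulr[OF assms, of "u+v"] fb_mulr[OF assms, of u] fb_mulr[OF assms, of v] fb_add[of u v]
   fb_add[of "mulr phi u" "mulr phi v"] in \<open>eventually_elim, simp add: scaleR_add_right\<close>)
 show "mulr phi (c *R u) = c *R mulr phi u" for c and u :: "('a, 'b) L2"
  by (rule L2_eqI) (use fb_mulr[OF assms, of "c *R u"] fb_mulr[OF assms, of u] fb_scaleR[of c u]
   fb_scaleR[of c "mulr phi u"] in \<open>eventually_elim, simp\<close>)
qed

lemmas mulr_simps = linear_add[OF linear_mulr] linear_diff[OF linear_mulr] linear_scale[OF linear_mulr] linear_0[OF linear_mulr]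

lemma mulr_mulr:
 assumes "bdd phi" "bdd psi" "bdd (%x. phi x*psi x)"
 shows "mulr phi (mulr psi u) = mulr (%x. phi x*psi x) u"
 by (rule L2_eqI) (use fb_mulr[OF assms(1), of "mulr psi u"] fb_mulr[OF assms(2), of u] fb_mulr[OF assms(3), of u] in \<open>eventually_elim, simp\<close>)

lemma mulr_add_fun:
 assumes "bdd phi" "bdd psi" "bdd (%x. phi x+psi x)"
 shows "mulr (%x. phi x+psi x) u = mulr phi u+mulr psi u"
 by (rule L2_eqI) (use fb_add[of "mulr phi u" "mulr psi u"] fb_mulr[OF assms(1), of u] fb_mulr[OF assms(2), of u] fb_mulr[OF assms(3), of u]
  in \<open>eventually_elim, simp add: scaleR_add_left\<close>)

lemma mulr_one [simp]: "mulr (%x. 1) u = u"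
 by (simp add: mulr_def mk_fb)

lemma inner_mulr: assumes "bdd phi" shows "inner (mulr phi u) v = inner u (mulr phi v)"
proof -
 have [measurable]: "phi : borelm" using assms by (simp add: bdd_def)
 show ?thesis unfolding inner_L2
  by (rule integral_cong_AE) (measurable, use fb_mulr[OF assms, of u] fb_mulr[OF assms, of v] in \<open>eventually_elim, simp\<close>)
qed

lemma bdd_indicator: "S : sets borel ==> bdd (indicator S)"
 unfolding bdd_def by (auto simp: indicator_def intro!: exI[of _ 1])

abbreviation chi :: "'a::euclidean_space set => ('a, 'b::euclidean_space) L2 => ('a, 'b) L2" where
 "chi S u \<equiv> mulr (indicator S) u"

lemma norm_chi_le: "S : sets borel ==> norm (chi S u) <= norm u"
 using norm_mulr_le[of "indicator S" 1 u] by (auto simp: indicator_def)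

lemma norm_chi_sq: assumes S: "S : sets borel" shows "(norm (chi S u))^2 = (LB x. indicator S x*(norm (fb u x))^2)"
proof -
 have [measurable]: "S : sets borel" by fact
 show ?thesis unfolding norm_L2_sq
  by (rule integral_cong_AE) (measurable, use fb_mulr[OF bdd_indicator[OF S], of u] in \<open>eventually_elim, auto simp: indicator_def\<close>)
qed

lemma nn_norm_chi: assumes S: "S : sets borel" shows "ennreal ((norm (chi S u))^2) = (NN x. indicator S x*ennreal ((norm (fb u x))^2))"
proof -
 have [measurable]: "S : sets borel" by fact
 show ?thesis unfolding nn_norm_L2
  by (rule nn_integral_cong_AE) (use fb_mulr[OF bdd_indicator[OF S], of u] in \<open>eventually_elim, auto simp: indicator_def\<close>)
qed

text \<open>Constant linear maps of the values.\<close>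

definition lmap :: "('b::euclidean_space => 'c::euclidean_space) => ('a::euclidean_space, 'b) L2 => ('a, 'c) L2" where
 "lmap L u = mk (%x. L (fb u x))"

lemma lmap_props:
 fixes L :: "'b::euclidean_space => 'c::euclidean_space" and u :: "('a::euclidean_space, 'b) L2"
 assumes L: "linear L"
 shows fb_lmap: "AE x in lborel. fb (lmap L u) x = L (fb u x)"
  and norm_lmap_le: "norm (lmap L u) <= onorm L*norm u"
proof -
 have bl: "bounded_linear L" using L by (rule linear_conv_bounded_linear[THEN iffD1])
 have m: "(%x. L (fb u x)) : borelm"
  by (rule borel_measurable_continuous_on[OF linear_continuous_on[OF bl] fb_borel])
 have n: "(norm (L y))^2 <= (onorm L)^2*(norm y)^2" for y
  using power_mono[OF onorm[OF bl, of y], of 2] by (simp add: power_mult_distrib)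
 have "(NN x. ennreal ((norm (L (fb u x)))^2)) <= (NN x. ennreal ((onorm L)^2)*ennreal ((norm (fb u x))^2))"
  using n by (intro nn_integral_mono) (simp add: ennreal_mult[symmetric] ennreal_leI)
 also have "... = ennreal ((onorm L)^2)*ennreal ((norm u)^2)" by (subst nn_integral_cmult) (auto simp: nn_norm_L2)
 also have "... = ennreal ((onorm L*norm u)^2)" by (simp add: ennreal_mult[symmetric] power_mult_distrib)
 finally have *: "(NN x. ennreal ((norm (L (fb u x)))^2)) <= ennreal ((onorm L*norm u)^2)" .
 show "AE x in lborel. fb (lmap L u) x = L (fb u x)" unfolding lmap_def by (rule fb_mk[OF sqb_nn[OF m *]])
 have "(norm (lmap L u))^2 <= (onorm L*norm u)^2" unfolding lmap_def by (rule norm_mk_le[OF m *]) simp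
 thus "norm (lmap L u) <= onorm L*norm u" by (rule power2_le_imp_le) (simp add: onorm_pos_le[OF bl])
qed

subsection \<open>Integration against scalar functions\<close>

definition Itg :: "('a::euclidean_space => real) => ('a, 'b::euclidean_space) L2 => 'b" where
 "Itg phi u = (LB x. phi x *R fb u x)"

definition tv :: "('a::euclidean_space => real) => 'b::euclidean_space => ('a, 'b) L2" where
 "tv phi c = mk (%x. phi x *R c)"

lemma sqb_tv: "sqb phi ==> sqb (%x. phi x *R c)"
 by (auto simp: sqb_def power_mult_distrib)

lemma fb_tv: "sqb phi ==> AE x in lborel. fb (tv phi c) x = phi x *R c"
 unfolding tv_def by (rule fb_mk[OF sqb_tv])

lemma integrable_Itg: assumes "sqb phi" shows "integrable lborel (%x. phi x *R fb u x)"
proof -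
 have [measurable]: "phi : borelm" using assms by (simp add: sqb_def)
 have "integrable lborel (%x. (phi x)^2+(norm (fb u x))^2)"
  using assms integrable_fb_sq[of u] by (simp add: sqb_def)
 thus ?thesis
 proof (rule integrable_dominated)
  show "AE x in lborel. norm (phi x *R fb u x) <= norm ((phi x)^2+(norm (fb u x))^2)"
  proof (rule AE_I2)
   fix x
   have "2*(\<bar>phi x\<bar>*norm (fb u x)) <= \<bar>phi x\<bar>^2+(norm (fb u x))^2" using sum_squares_bound[of "\<bar>phi x\<bar>" "norm (fb u x)"] by (simp add: mult.assoc)
   moreover have "0 <= \<bar>phi x\<bar>*norm (fb u x)" by simp
   ultimately have "\<bar>phi x\<bar>*norm (fb u x) <= (phi x)^2+(norm (fb u x))^2" unfolding power2_abs by linarith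
   thus "norm (phi x *R fb u x) <= norm ((phi x)^2+(norm (fb u x))^2)" by simp
  qed
 qed measurable
qed

lemma inner_tv: assumes "sqb phi" shows "inner u (tv phi c) = Itg phi u \<bullet> c"
proof -
 have [measurable]: "phi : borelm" using assms by (simp add: sqb_def)
 have "inner u (tv phi c) = (LB x. (phi x *R fb u x) \<bullet> c)" unfolding inner_L2
  by (rule integral_cong_AE) (measurable, use fb_tv[OF assms, of c] in \<open>eventually_elim, simp\<close>)
 also have "... = Itg phi u \<bullet> c" unfolding Itg_def
  by (rule integral_inner_left) (use integrable_Itg[OF assms, of u] in auto)
 finally show ?thesis .
qed

lemma norm_tv: assumes "sqb phi" shows "norm (tv phi c) = sqrt (LB x. (phi x)^2)*norm c"
proof -
 have "(norm (tv phi c))^2 = (LB x. (phi x)^2*(norm c)^2)"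
  unfolding norm_L2_sq by (rule integral_cong_AE)
   (use sqb_measurable[OF assms] fb_tv[OF assms, of c] in \<open>auto elim!: eventually_mono simp: power_mult_distrib\<close>)
 also have "... = (LB x. (phi x)^2)*(norm c)^2" by simp
 finally show ?thesis
  by (intro power2_eq_imp_eq[OF _ norm_ge_zero]) (auto simp: power_mult_distrib)
qed

lemma norm_Itg_le: assumes "sqb phi" shows "norm (Itg phi u) <= sqrt (LB x. (phi x)^2)*norm u"
proof (cases "Itg phi u = 0")
 case False
 have "norm (Itg phi u)*norm (Itg phi u) = inner u (tv phi (Itg phi u))" unfolding inner_tv[OF assms] by (simp add: dot_square_norm power2_eq_square)
 also have "... <= norm u*(sqrt (LB x. (phi x)^2)*norm (Itg phi u))"
  using norm_cauchy_schwarz[of u "tv phi (Itg phi u)"] by (simp add: norm_tv[OF assms])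
 finally have "norm (Itg phi u)*norm (Itg phi u) <= (sqrt (LB x. (phi x)^2)*norm u)*norm (Itg phi u)" by (simp add: mult_ac)
 thus ?thesis using False by simp
qed simp

lemma Itg_add: "sqb phi ==> Itg phi (u+v) = Itg phi u+Itg phi v"
 and Itg_diff: "sqb phi ==> Itg phi (u-v) = Itg phi u-Itg phi v"
 and Itg_scaleR: "sqb phi ==> Itg phi (r *R u) = r *R Itg phi u"
 by (rule euclidean_eqI, simp only: inner_tv[symmetric] inner_add_left inner_diff_left inner_scaleR_left)+

lemma Itg_add_fun: "sqb phi ==> sqb psi ==> Itg (%x. phi x+psi x) u = Itg phi u+Itg psi u"
 and Itg_diff_fun: "sqb phi ==> sqb psi ==> Itg (%x. phi x-psi x) u = Itg phi u-Itg psi u"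
 unfolding Itg_def scaleR_add_left scaleR_diff_left by (simp_all add: integrable_Itg)

lemma Itg_scaleR_fun: "Itg (%x. r*phi x) u = r *R Itg phi u"
 unfolding Itg_def by (simp add: scaleR_scaleR[symmetric] del: scaleR_scaleR)

lemma Itg_minus_fun: "Itg (%x. - phi x) u = - Itg phi u"
 unfolding Itg_def by simp

lemma Itg_cong: assumes "AE x in lborel. fb u x = f x" "phi : borelm" "f : borelm"
 shows "Itg phi u = (LB x. phi x *R f x)"
 unfolding Itg_def by (rule integral_cong_AE) (use assms in \<open>auto elim: eventually_mono\<close>)

lemma Itg_lmap:
 fixes L :: "'b::euclidean_space => 'c::euclidean_space" and u :: "('a::euclidean_space, 'b) L2"
 assumes L: "linear L" and phi: "sqb phi" shows "Itg phi (lmap L u) = L (Itg phi u)"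
proof -
 have bl: "bounded_linear L" using L by (rule linear_conv_bounded_linear[THEN iffD1])
 have m: "(%x. L (fb u x)) : borelm"
  by (rule borel_measurable_continuous_on[OF linear_continuous_on[OF bl] fb_borel])
 have "Itg phi (lmap L u) = (LB x. L (phi x *R fb u x))"
  using Itg_cong[OF fb_lmap[OF L] sqb_measurable[OF phi] m] by (simp add: linear_scale[OF L])
 also have "... = L (Itg phi u)" unfolding Itg_def by (rule integral_bounded_linear[OF bl integrable_Itg[OF phi]])
 finally show ?thesis .
qed

lemma Itg_mulr: assumes "bdd psi" "phi : borelm" shows "Itg phi (mulr psi u) = Itg (%x. phi x*psi x) u"
proof -
 have [measurable]: "psi : borelm" using assms by (simp add: bdd_def)
 show ?thesis using Itg_cong[OF fb_mulr[OF assms(1), of u] assms(2)] by (simp add: Itg_def)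
qed

subsection \<open>Test functions\<close>

lemma test_function_continuous: "testf phi ==> continuous_on S phi"
 using C_k.simps(1)[of phi] continuous_on_subset unfolding test_function_def by blast

lemma test_function_bounds:
 assumes "testf phi"
 obtains r M where "r > 0" "M >= 0" "!!x. norm x > r ==> phi x = 0" "!!x. \<bar>phi x\<bar> <= M"
proof -
 have "bounded (closure {x. phi x ~= 0})" using assms by (simp add: test_function_def compact_imp_bounded)
 then obtain r where r: "r > 0" "\<forall>x\<in>closure {x. phi x ~= 0}. norm x <= r" unfolding bounded_pos by blast
 hence r0: "norm x > r ==> phi x = 0" for x using closure_subset[of "{x. phi x ~= 0}"] by (meson mem_Collect_eq not_le subsetD)
 have "bounded (phi ` cball 0 r)"
  by (intro compact_imp_bounded compact_continuous_image test_function_continuous assms) auto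
 then obtain M where "\<forall>x\<in>cball 0 r. norm (phi x) <= M" by (auto simp: bounded_iff)
 hence "norm (phi x) <= M" if "norm x <= r" for x using that by simp
 hence "\<bar>phi x\<bar> <= max M 0" for x using r0[of x] by (cases "norm x <= r") (auto simp: not_le max.coboundedI1)
 thus thesis using r(1) r0 by (intro that[of r "max M 0"]) auto
qed

lemma test_function_measurable: "testf phi ==> phi : borelm"
 by (rule borel_measurable_continuous_onI[OF test_function_continuous])

lemma bdd_test: "testf phi ==> bdd phi"
 unfolding bdd_def using test_function_bounds[of phi] test_function_measurable by metis

lemma sqb_bounded_support:
 assumes [measurable]: "phi : borelm" and r: "!!x. norm x > r ==> phi x = 0" and M: "!!x. norm (phi x) <= M"
 shows "sqb phi"
 unfolding sqb_def
proof (intro conjI assms(1))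
 have "integrable lborel (%x. M^2*indicator (cball 0 r) x :: real)"
  using emeasure_lborel_cball_finite[of 0 r] by (intro integrable_mult_right integrable_real_indicator) auto
 thus "integrable lborel (%x. (norm (phi x))^2)"
  by (rule integrable_dominated)
   (use r M in \<open>auto intro!: AE_I2 simp: indicator_def not_le power_mono\<close>)
qed

lemma sqb_test: "testf phi ==> sqb phi"
 using test_function_bounds[of phi] test_function_measurable[of phi] by (metis real_norm_def sqb_bounded_support)

lemma test_functionI:
 assumes C: "!!k. C_k k phi" and 0: "!!x. norm x > r ==> phi x = 0"
 shows "testf phi"
 unfolding test_function_def
proof (intro conjI allI C)
 have "closure {x. phi x ~= 0} \<subseteq> cball 0 r"
  by (rule closure_minimal) (use 0 in \<open>auto simp: not_less[symmetric]\<close>)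
 thus "compact (closure {x. phi x ~= 0})" using bounded_subset[OF bounded_cball] by (auto simp: compact_eq_bounded_closed)
qed

lemma test_partial_deriv:
 fixes phi :: "real^'n::finite => real"
 assumes "testf phi" shows "testf (pd j phi)"
proof -
 obtain r where r: "!!x. norm x > r ==> phi x = 0" using test_function_bounds[OF assms] by metis
 show ?thesis
 proof (rule test_functionI)
  show "C_k k (pd j phi)" for k
   using assms C_k.simps(2)[of k phi] unfolding test_function_def by blast
  fix x :: "real^'n" assume x: "norm x > r"
  have "((%x. 0) has_derivative (%x. 0)) (at x)" by simp
  hence "(phi has_derivative (%x. 0)) (at x)"
   by (rule has_derivative_transform_within_open[of _ _ _ _ "- cball 0 r"]) (use x r in \<open>auto intro: open_Compl\<close>)
  thus "pd j phi x = 0" by (simp add: partial_deriv_eqI)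
 qed
qed

lemma test_mult: assumes "testf phi" "!!k. C_k k psi" shows "testf (%x. phi x*psi x)"
proof -
 obtain r where r: "!!x. norm x > r ==> phi x = 0" using test_function_bounds[OF assms(1)] by metis
 show ?thesis by (rule test_functionI[of _ r]) (use assms r in \<open>auto simp: test_function_def intro: C_k_mult\<close>)
qed

lemma test_mult2: "testf phi ==> testf psi ==> testf (%x. phi x*psi x)"
 by (rule test_mult) (auto simp: test_function_def)

lemma test_add: assumes "testf phi" "testf psi" shows "testf (%x. phi x+psi x)"
proof -
 obtain r where r: "!!x. norm x > r ==> phi x = 0" using test_function_bounds[OF assms(1)] by metis
 obtain s where s: "!!x. norm x > s ==> psi x = 0" using test_function_bounds[OF assms(2)] by metis
 show ?thesis by (rule test_functionI[of _ "max r s"]) (use assms r s in \<open>auto simp: test_function_def intro: C_k_add\<close>)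
qed

lemma test_cmult: "testf phi ==> testf (%x. c*phi x)"
 using test_mult[of phi "%x. c"] by (simp add: C_k_const mult.commute)

lemma test_shift: assumes "testf phi" shows "testf (%x. phi (x+h))"
proof -
 obtain r where r: "!!x. norm x > r ==> phi x = 0" using test_function_bounds[OF assms] by metis
 show ?thesis
 proof (rule test_functionI[of _ "r+norm h"])
  show "C_k k (%x. phi (x+h))" for k using assms by (auto simp: test_function_def intro: C_k_shift)
  show "phi (x+h) = 0" if "norm x > r+norm h" for x
   using that norm_triangle_ineq4[of "x+h" h] by (intro r) simp
 qed
qed

lemma test_reflect: assumes "testf phi" shows "testf (%x. phi (h-x))"
proof -
 obtain r where r: "!!x. norm x > r ==> phi x = 0" using test_function_bounds[OF assms] by metis
 show ?thesis
 proof (rule test_functionI[of _ "r+norm h"])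
  show "C_k k (%x. phi (h-x))" for k using assms by (auto simp: test_function_def intro: C_k_reflect)
  show "phi (h-x) = 0" if "norm x > r+norm h" for x
   using that norm_triangle_ineq4[of "h" "h-x"] by (intro r) simp
 qed
qed

subsection \<open>Density of test functions\<close>

lemma sqb_indicator_box: "sqb (indicator (box a b) :: 'a::euclidean_space => real)"
proof -
 have "(%x. (norm (indicator (box a b) x :: real))^2) = indicator (box a b)" by (auto simp: indicator_def)
 thus ?thesis unfolding sqb_def using emeasure_lborel_box_finite[of a b] by auto
qed

lemma Itg_plateau_limit:
 fixes u :: "(real^'n::finite, 'b::euclidean_space) L2"
 shows "(%n. Itg (plateau (1/Suc n) a b) u) ----> Itg (indicator (box a b)) u"
 unfolding Itg_def
proof (rule integral_dominated_convergence)
 from integrable_norm[OF integrable_Itg[OF sqb_indicator_box, of a b u]]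
 show "integrable lborel (%x. indicator (box a b) x*norm (fb u x))" by simp
 show "AE x in lborel. (%n. plateau (1/Suc n) a b x *R fb u x) ----> indicator (box a b) x *R fb u x"
 proof (rule AE_I2, rule tendsto_scaleR[OF _ tendsto_const], rule tendsto_eventually)
  fix x
  show "eventually (%n. plateau (1/Suc n) a b x = indicator (box a b) x) sequentially"
  proof (cases "x : box a b")
   case False
   thus ?thesis by (simp add: plateau_0)
  next
   case True
   define m where "m = Min ((%i. min (x $ i-a $ i) (b $ i-x $ i)) ` UNIV)"
   have m: "m > 0" unfolding m_def using True by (auto simp: mem_box_cart)
   have mi: "m <= x $ i-a $ i" "m <= b $ i-x $ i" for i
   proof -
    have "m <= min (x $ i-a $ i) (b $ i-x $ i)" unfolding m_def by (intro Min_le) auto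
    thus "m <= x $ i-a $ i" "m <= b $ i-x $ i" by auto
   qed
   have "(%n. 1/real (Suc n)) ----> 0" by (intro LIMSEQ_Suc lim_1_over_n[unfolded o_def])
   from order_tendstoD(2)[OF this m] show ?thesis
   proof eventually_elim
    case (elim n)
    have "plateau (1/Suc n) a b x = 1"
     by (rule plateau_1) (use elim mi in \<open>auto simp: algebra_simps intro: order_trans\<close>, (smt (verit) mi elim)+)
    thus ?case using True by simp
   qed
  qed
 qed
 show "AE x in lborel. norm (plateau (1/Suc n) a b x *R fb u x) <= indicator (box a b) x*norm (fb u x)" for n
  by (rule AE_I2) (use plateau_bounds[of "1/Suc n" a b] plateau_0[of "1/Suc n" _ a b] in \<open>auto simp: indicator_def mult_left_le_one_le\<close>)
 show "(%x. plateau (1/Suc n) a b x *R fb u x) : borel_measurable lborel" for n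
  using test_function_measurable[OF test_function_plateau[of "1/Suc n" a b]] by auto
qed auto

text \<open>The positive and the negative part of \<open>h\<close> are densities of two measures that are finite and agree on boxes, which
  generate the Borel sets.\<close>

lemma zero_integral_boxes:
 fixes h :: "'a::euclidean_space => real"
 assumes [measurable]: "h : borelm"
  and int: "!!a b. integrable lborel (%x. indicator (box a b) x*h x)"
  and z: "!!a b. (LB x. indicator (box a b) x*h x) = 0"
 shows "AE x in lborel. h x = 0"
proof -
 have fin: "(NN x. ennreal (max 0 (s*h x))*indicator (box a b) x) = ennreal (LB x. indicator (box a b) x*max 0 (s*h x))" for a b s
 proof -
  have "integrable lborel (%x. indicator (box a b) x*max 0 (s*h x))"
  proof (rule integrable_dominated)
   show "integrable lborel (%x. s*(indicator (box a b) x*h x))" by (intro integrable_mult_right int)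
  qed (auto intro!: AE_I2 simp: indicator_def)
  from nn_integral_eq_integral[OF this]
  have "(NN x. ennreal (indicator (box a b) x*max 0 (s*h x))) = ennreal (LB x. indicator (box a b) x*max 0 (s*h x))"
   by (auto simp: indicator_def)
  moreover have "(NN x. ennreal (max 0 (s*h x))*indicator (box a b) x) = (NN x. ennreal (indicator (box a b) x*max 0 (s*h x)))"
   by (rule nn_integral_cong) (auto simp: indicator_def)
  ultimately show ?thesis by simp
 qed
 have eq: "(LB x. indicator (box a b) x*max 0 (1*h x)) = (LB x. indicator (box a b) x*max 0 (- 1*h x))" for a b
 proof -
  have i: "integrable lborel (%x. indicator (box a b) x*max 0 (s*h x))" for s
  proof (rule integrable_dominated)
   show "integrable lborel (%x. s*(indicator (box a b) x*h x))" by (intro integrable_mult_right int)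
  qed (auto intro!: AE_I2 simp: indicator_def)
  have "(LB x. indicator (box a b) x*max 0 (1*h x))-(LB x. indicator (box a b) x*max 0 (- 1*h x))
   = (LB x. indicator (box a b) x*max 0 (1*h x)-indicator (box a b) x*max 0 (- 1*h x))"
   by (rule Bochner_Integration.integral_diff[symmetric]; rule i)
  also have "... = (LB x. indicator (box a b) x*h x)" by (rule Bochner_Integration.integral_cong) (auto simp: indicator_def max_def)
  finally show ?thesis using z by simp
 qed
 have "density lborel (%x. ennreal (max 0 (1*h x))) = density lborel (%x. ennreal (max 0 (- 1*h x)))"
 proof (rule measure_eqI_generator_eq)
  let ?E = "range (%(a, b). box a b :: 'a set)"
  show "Int_stable ?E" by (force simp: Int_stable_def box_Int_box)
  show "?E \<subseteq> Pow UNIV" by simp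
  show "sets (density lborel (%x. ennreal (max 0 (1*h x)))) = sigma_sets UNIV ?E"
   "sets (density lborel (%x. ennreal (max 0 (- 1*h x)))) = sigma_sets UNIV ?E"
   by (simp_all add: borel_eq_box)
  let ?A = "%n::nat. box (- (real n *R One)) (real n *R One) :: 'a set"
  show "range ?A \<subseteq> ?E" by auto
  show "(\<Union>i. ?A i) = UNIV" unfolding UN_box_eq_UNIV by auto
  show "emeasure (density lborel (%x. ennreal (max 0 (1*h x)))) (?A i) ~= \<infinity>" for i
   by (subst emeasure_density) (measurable, simp only: fin, simp)
  fix X assume "X : ?E"
  then obtain a b where X: "X = box a b" by auto
  show "emeasure (density lborel (%x. ennreal (max 0 (1*h x)))) X = emeasure (density lborel (%x. ennreal (max 0 (- 1*h x)))) X"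
   unfolding X by (subst (1 2) emeasure_density) (auto simp only: fin eq, auto)
 qed
 hence "AE x in lborel. ennreal (max 0 (1*h x)) = ennreal (max 0 (- 1*h x))"
  by (intro sigma_finite_measure.density_unique[OF sigma_finite_lborel]) auto
 thus ?thesis by eventually_elim (auto simp: max_def split: if_splits)
qed

lemma test_functions_separate:
 fixes u :: "(real^'n::finite, 'b::euclidean_space) L2"
 assumes "!!phi. testf phi ==> Itg phi u = 0"
 shows "u = 0"
proof -
 have box: "Itg (indicator (box a b)) u = 0" for a b
 proof -
  have "(%n. Itg (plateau (1/Suc n) a b) u) = (%n. 0)"
   by (rule ext) (intro assms test_function_plateau, simp)
  with Itg_plateau_limit[of a b u] show ?thesis using LIMSEQ_unique[OF _ tendsto_const[of 0]] by simp
 qed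
 have "AE x in lborel. fb u x \<bullet> e = 0" if "e : Basis" for e
 proof (rule zero_integral_boxes)
  show "integrable lborel (%x. indicator (box a b) x*(fb u x \<bullet> e))" for a b
   using integrable_inner_left[OF integrable_Itg[OF sqb_indicator_box, of a b u], of e] by simp
  have "(LB x. indicator (box a b) x*(fb u x \<bullet> e)) = Itg (indicator (box a b)) u \<bullet> e" for a b
   unfolding Itg_def by (subst integral_inner_left[symmetric]) (auto intro: integrable_Itg[OF sqb_indicator_box])
  thus "(LB x. indicator (box a b) x*(fb u x \<bullet> e)) = 0" for a b by (simp add: box)
 qed measurable
 hence "AE x in lborel. \<forall>e\<in>Basis. fb u x \<bullet> e = 0" by (simp add: AE_ball_countable countable_finite)
 with fb_zero have "AE x in lborel. fb u x = fb 0 x"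
  by eventually_elim (simp add: euclidean_all_zero_iff)
 thus ?thesis by (rule L2_eqI)
qed

definition tests :: "(real^'n::finite, 'b::euclidean_space) L2 set" where
 "tests = span {tv phi c |phi c. testf phi}"

lemma tests_dense: "closure tests = UNIV"
proof (rule closure_subspace_dense)
 show "subspace tests" by (simp add: tests_def)
 fix g :: "(real^'n, 'b) L2" assume g: "!!z. z : tests ==> inner z g = 0"
 show "g = 0"
 proof (rule test_functions_separate)
  fix phi :: "real^'n => real" assume phi: "testf phi"
  have "Itg phi g \<bullet> c = 0" for c
  proof -
   have "tv phi c : tests" unfolding tests_def by (rule span_base) (use phi in blast)
   from g[OF this] show ?thesis unfolding inner_tv[OF sqb_test[OF phi], symmetric] by (simp only: inner_commute)
  qed
  thus "Itg phi g = 0" by (metis inner_eq_zero_iff)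
 qed
qed

subsection \<open>Translations\<close>

lemma nn_integral_shift:
 fixes f :: "'a::euclidean_space => ennreal"
 assumes [measurable]: "f : borelm"
 shows "(NN x. f (x+h)) = (NN x. f x)"
 by (subst (2) lborel_distr_plus[of h, symmetric]) (simp add: nn_integral_distr add.commute)

lemma lborel_integral_shift:
 fixes f :: "'a::euclidean_space => 'b::{banach, second_countable_topology}"
 assumes [measurable]: "f : borelm"
 shows "(LB x. f (x+h)) = (LB x. f x)"
 by (subst (2) lborel_distr_plus[of h, symmetric]) (simp add: integral_distr add.commute)

lemma AE_shift:
 fixes h :: "'a::euclidean_space"
 assumes "AE x in lborel. P x"
 shows "AE x in lborel. P (x+h)"
proof -
 obtain N where N: "{x : space lborel. ~ P x} \<subseteq> N" "emeasure lborel N = 0" "N : sets lborel"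
  using assms by (rule AE_E)
 have "emeasure lborel ((%x. h+x) -` N \<inter> space lborel) = emeasure (distr lborel borel ((+) h)) N"
  by (rule emeasure_distr[symmetric]) (use N in auto)
 also have "... = 0" by (simp add: lborel_distr_plus N)
 finally have "emeasure lborel ((%x. h+x) -` N) = 0" by simp
 moreover have "(%x. h+x) -` N : sets lborel"
  using measurable_sets[of "(+) h" borel borel N] N by simp
 ultimately show ?thesis
  by (intro AE_I[of _ _ "(%x. h+x) -` N"]) (use N in \<open>auto simp: add.commute\<close>)
qed

definition tr :: "'a::euclidean_space => ('a, 'b::euclidean_space) L2 => ('a, 'b) L2" where
 "tr h u = mk (%x. fb u (x+h))"

lemma tr_props:
 shows fb_tr: "AE x in lborel. fb (tr h u) x = fb u (x+h)"
  and norm_tr [simp]: "norm (tr h u) = norm u"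
proof -
 have *: "(NN x. ennreal ((norm (fb u (x+h)))^2)) = ennreal ((norm u)^2)"
  unfolding nn_norm_L2 by (rule nn_integral_shift) measurable
 show fb: "AE x in lborel. fb (tr h u) x = fb u (x+h)"
  unfolding tr_def by (rule fb_mk, rule sqb_nn[OF _ eq_refl[OF *]]) measurable
 have "ennreal ((norm (tr h u))^2) = ennreal ((norm u)^2)"
  unfolding nn_norm_L2[of "tr h u"] *[symmetric] by (rule nn_integral_cong_AE) (use fb in \<open>auto elim: eventually_mono\<close>)
 thus "norm (tr h u) = norm u" by (simp add: power2_eq_iff_nonneg)
qed

lemma linear_tr: "linear (tr h)"
proof (rule linearI)
 show "tr h (u+v) = tr h u+tr h v" for u v :: "('a, 'b) L2"
  by (rule L2_eqI) (use fb_tr[of h "u+v"] fb_tr[of h u] fb_tr[of h v] AE_shift[OF fb_add[of u v], of h] fb_add[of "tr h u" "tr h v"] in \<open>eventually_elim, simp\<close>)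
 show "tr h (c *R u) = c *R tr h u" for c and u :: "('a, 'b) L2"
  by (rule L2_eqI) (use fb_tr[of h "c *R u"] fb_tr[of h u] AE_shift[OF fb_scaleR[of c u], of h] fb_scaleR[of c "tr h u"] in \<open>eventually_elim, simp\<close>)
qed

lemma tr_tr: "tr h (tr k u) = tr (h+k) u"
 by (rule L2_eqI) (use fb_tr[of h "tr k u"] AE_shift[OF fb_tr[of k u], of h] fb_tr[of "h+k" u] in \<open>eventually_elim, simp add: add.assoc\<close>)

lemma tr_0 [simp]: "tr 0 u = u"
 by (simp add: tr_def mk_fb)

lemma inner_tr_tr: "inner (tr h u) (tr h v) = inner u v"
proof -
 have "inner (tr h u) (tr h v) = (LB x. fb u (x+h) \<bullet> fb v (x+h))"
  unfolding inner_L2 by (rule integral_cong_AE) (measurable, use fb_tr[of h u] fb_tr[of h v] in \<open>eventually_elim, simp\<close>)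
 also have "... = inner u v" unfolding inner_L2 by (rule lborel_integral_shift) measurable
 finally show ?thesis .
qed

lemma inner_tr: "inner (tr h u) v = inner u (tr (- h) v)"
 using inner_tr_tr[of h u "tr (- h) v"] by (simp add: tr_tr)

lemma tr_tv: assumes "testf phi" shows "tr h (tv phi c) = tv (%x. phi (x+h)) c"
 by (rule L2_eqI) (use fb_tr[of h "tv phi c"] AE_shift[OF fb_tv[OF sqb_test[OF assms], of c], of h] fb_tv[OF sqb_test[OF test_shift[OF assms]], of h c] in \<open>eventually_elim, simp\<close>)

lemma tv_diff: assumes "sqb phi" "sqb psi" shows "tv phi c-tv psi c = tv (%x. phi x-psi x) c"
 by (rule L2_eqI) (use fb_diff[of "tv phi c" "tv psi c"] fb_tv[OF assms(1), of c] fb_tv[OF assms(2), of c] fb_tv[OF sqb_diff[OF assms], of c] in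
  \<open>eventually_elim, simp add: scaleR_diff_left\<close>)

lemma sqb_cmult: "sqb phi ==> sqb (%x. r*phi x)" for phi :: "_ => real"
 using sqb_scaleR[of phi phi r] by simp

lemma tv_scale: assumes "sqb phi" shows "tv (%x. r*phi x) c = r *R tv phi c"
 by (rule L2_eqI) (use fb_scaleR[of r "tv phi c"] fb_tv[OF assms, of c] fb_tv[OF sqb_cmult[OF assms], of r c] in
  \<open>eventually_elim, simp\<close>)

lemma tv_scale_vec: assumes "sqb phi" shows "tv phi (r *R c) = r *R tv phi c"
 by (rule L2_eqI) (use fb_scaleR[of r "tv phi c"] fb_tv[OF assms, of c] fb_tv[OF assms, of "r *R c"] in
  \<open>eventually_elim, simp\<close>)

lemma tv_add_vec: assumes "sqb phi" shows "tv phi (c+d) = tv phi c+tv phi d"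
 by (rule L2_eqI) (use fb_add[of "tv phi c" "tv phi d"] fb_tv[OF assms, of c] fb_tv[OF assms, of d] fb_tv[OF assms, of "c+d"] in
  \<open>eventually_elim, simp add: scaleR_add_right\<close>)

lemma tv_tendsto_0:
 fixes psi :: "nat => 'a::euclidean_space => real"
 assumes meas: "!!n. psi n : borelm" and lim: "!!x. (%n. psi n x) ----> 0"
  and supp: "!!n x. norm x > r ==> psi n x = 0" and M: "!!n x. \<bar>psi n x\<bar> <= M"
 shows "(%n. tv (psi n) c) ----> 0"
proof -
 have sq: "sqb (psi n)" for n by (rule sqb_bounded_support[OF meas supp]) (use M in auto)
 have "(%n. LB x. (psi n x)^2) ----> (LINT x|(lborel::'a measure). (0::real))"
 proof (rule integral_dominated_convergence)
  show "integrable lborel (%x. M^2*indicator (cball (0::'a) r) x :: real)"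
   using emeasure_lborel_cball_finite[of "0::'a" r] by (intro integrable_mult_right integrable_real_indicator) auto
  show "AE x in lborel. (%n. (psi n x)^2) ----> (0::real)"
  proof (rule AE_I2)
   fix x
   have "(%n. (psi n x)^2) ----> 0^2" by (intro tendsto_intros lim)
   thus "(%n. (psi n x)^2) ----> 0" by simp
  qed
  show "AE x in lborel. norm ((psi n x)^2) <= M^2*indicator (cball 0 r) x" for n
   using M supp by (auto intro!: AE_I2 simp: indicator_def not_le abs_le_square_iff[symmetric] intro: order_trans[OF _ abs_ge_self])
  show "(%x. (psi n x)^2) : borel_measurable lborel" for n using meas[of n] by measurable
 qed simp
 hence "(%n. sqrt (LB x. (psi n x)^2)*norm c) ----> sqrt 0*norm c" by (intro tendsto_intros) simp
 hence "(%n. norm (tv (psi n) c)) ----> 0" by (simp add: norm_tv[OF sq])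
 thus ?thesis by (rule tendsto_norm_zero_cancel)
qed

lemma tendsto_id_on_dense:
 fixes T :: "nat => 'a::real_normed_vector => 'a"
 assumes lin: "!!n. linear (T n)" and bd: "!!n f. norm (T n f) <= C*norm f" and C: "C >= 0"
  and dense: "f : closure A" and conv: "!!a. a : A ==> (%n. T n a) ----> a"
 shows "(%n. T n f) ----> f"
proof (rule metric_LIMSEQ_I)
 fix e :: real assume e: "e > 0"
 have "e/(2*(C+1)) > 0" using e C by simp
 then obtain a where a: "a : A" "norm (a-f) < e/(2*(C+1))"
  using dense by (auto simp: closure_approachable dist_norm)
 have "e/2 > 0" using e by simp
 from metric_LIMSEQ_D[OF conv[OF a(1)] this] obtain N where N: "!!n. n >= N ==> norm (T n a-a) < e/2" by (auto simp: dist_norm)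
 show "\<exists>N. \<forall>n\<ge>N. dist (T n f) f < e"
 proof (intro exI allI impI)
  fix n assume n: "N <= n"
  have eq: "T n f-f = T n (f-a)+(T n a-a)+(a-f)" by (simp add: linear_diff[OF lin])
  have "norm (T n f-f) <= norm (T n (f-a))+norm (T n a-a)+norm (a-f)"
   unfolding eq by (intro order_trans[OF norm_triangle_ineq] add_mono norm_triangle_ineq order_refl)
  also have "... <= C*norm (a-f)+norm (T n a-a)+norm (a-f)"
   using bd[of n "f-a"] by (simp add: norm_minus_commute)
  also have "... = (C+1)*norm (a-f)+norm (T n a-a)" by (simp add: algebra_simps)
  also have "... < e/2+e/2"
  proof (rule add_strict_mono[OF _ N[OF n]])
   have "(C+1)*norm (a-f) < (C+1)*(e/(2*(C+1)))" using a C by (intro mult_strict_left_mono) auto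
   moreover have "(C+1)*(e/(2*(C+1))) = e/2" using C by (simp add: field_simps)
   ultimately show "(C+1)*norm (a-f) < e/2" by (simp only:)
  qed
  finally show "dist (T n f) f < e" by (simp add: dist_norm)
 qed
qed

lemma tr_continuous:
 fixes u :: "(real^'n::finite, 'b::euclidean_space) L2"
 assumes X: "X ----> 0"
 shows "(%n. tr (X n) u) ----> u"
proof (rule tendsto_id_on_dense[OF linear_tr, where C = 1 and A = tests])
 show "u : closure tests" by (simp add: tests_dense)
 fix a :: "(real^'n, 'b) L2" assume "a : tests"
 thus "(%n. tr (X n) a) ----> a"
  unfolding tests_def
 proof (induction rule: span_induct_alt)
  case base
  show ?case by (simp add: linear_0[OF linear_tr])
 next
  case (step c x y)
  then obtain phi d where x: "x = tv phi d" and phi: "testf phi" by auto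
  obtain r M where rM: "!!x. norm x > r ==> phi x = 0" "!!x. \<bar>phi x\<bar> <= M" using test_function_bounds[OF phi] by metis
  have "Bseq X" using X by (intro convergent_imp_Bseq) (auto simp: convergent_def)
  then obtain B where B: "!!n. norm (X n) <= B" by (auto simp: Bseq_def)
  have B0: "B >= 0" using order_trans[OF norm_ge_zero B[of 0]] .
  have "(%n. tv (%x. phi (x+X n)-phi x) d) ----> 0"
  proof (rule tv_tendsto_0)
   show "(%x. phi (x+X n)-phi x) : borelm" for n
    using test_function_measurable[OF phi] by measurable
   show "(%n. phi (x+X n)-phi x) ----> 0" for x
   proof -
    have "isCont phi (x+0)" using test_function_continuous[OF phi, of UNIV] by (simp add: continuous_on_eq_continuous_at)
    hence "(%n. phi (x+X n)) ----> phi (x+0)"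
     by (rule isCont_tendsto_compose) (intro tendsto_intros X)
    thus ?thesis using LIM_zero by force
   qed
   show "phi (x+X n)-phi x = 0" if "norm x > r+B" for n x
   proof -
    have "norm x <= norm (x+X n)+norm (X n)" using norm_triangle_ineq4[of "x+X n" "X n"] by simp
    hence "norm (x+X n) > r" "norm x > r" using that B[of n] B0 by linarith+
    thus ?thesis by (simp add: rM)
   qed
   show "\<bar>phi (x+X n)-phi x\<bar> <= 2*M" for n x using rM(2)[of x] rM(2)[of "x+X n"] by linarith
  qed
  hence "(%n. tr (X n) x-x) ----> 0"
   by (simp add: x tr_tv[OF phi] tv_diff sqb_test phi test_shift)
  hence "(%n. tr (X n) x) ----> x" by (rule LIM_zero_cancel)
  from tendsto_add[OF tendsto_scaleR[OF tendsto_const this, of c] step(2)]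
  show ?case by (simp add: linear_add[OF linear_tr] linear_scale[OF linear_tr])
 qed
qed (auto)

definition dird :: "real^'n::finite => (real^'n => real) => real^'n => real" where
 "dird h phi x = (\<Sum>j\<in>UNIV. h $ j*pd j phi x)"

lemma test_sum: "finite I ==> (!!i. i : I ==> testf (f i)) ==> testf (%x. \<Sum>i\<in>I. f i x)"
proof (induction I rule: finite_induct)
 case empty
 show ?case using test_cmult[OF test_function_plateau[of 1 0 0], of 0] by simp
qed (auto intro: test_add)

lemma test_dird: "testf phi ==> testf (dird h phi)"
 unfolding dird_def[abs_def] by (intro test_sum test_cmult test_partial_deriv) auto

lemma dird_line:
 assumes d: "phi differentiable_on UNIV"
 shows "((%t. phi (x+t *R h)) has_real_derivative dird h phi (x+t *R h)) (at t)"
proof -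
 note f = has_derivative_frechet[OF d, of "x+t *R h"]
 have "((%t. x+t *R h) has_derivative (%t. 0+t *R h)) (at t)"
  by (intro derivative_intros)
 from has_derivative_compose[OF this f]
 have 1: "((%t. phi (x+t *R h)) has_derivative (%s. frechet_derivative phi (at (x+t *R h)) (0+s *R h))) (at t)" .
 have lin: "linear (frechet_derivative phi (at (x+t *R h)))" by (rule has_derivative_linear[OF f])
 have "h = (\<Sum>j\<in>UNIV. h $ j *R axis j 1)" using basis_expansion[of h] by (simp add: scalar_mult_eq_scaleR)
 hence "frechet_derivative phi (at (x+t *R h)) h = frechet_derivative phi (at (x+t *R h)) (\<Sum>j\<in>UNIV. h $ j *R axis j 1)"
  by (rule arg_cong)
 also have "... = (\<Sum>j\<in>UNIV. h $ j *R frechet_derivative phi (at (x+t *R h)) (axis j 1))"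
  by (simp add: linear_sum[OF lin] linear_scale[OF lin])
 finally have "frechet_derivative phi (at (x+t *R h)) h = dird h phi (x+t *R h)" by (simp add: dird_def partial_deriv_def)
 thus ?thesis unfolding has_field_derivative_def
  by (intro has_derivative_eq_rhs[OF 1]) (simp add: fun_eq_iff linear_scale[OF lin])
qed

lemma difference_quotient_bounds:
 assumes phi: "testf phi" and s: "!!n. s n ~= 0" "s ----> 0"
 obtains r M where "!!x. (%n. (phi (x+s n *R h)-phi x)/s n) ----> dird h phi x"
  "!!n x. norm x > r ==> (phi (x+s n *R h)-phi x)/s n = 0" "!!n x. \<bar>(phi (x+s n *R h)-phi x)/s n\<bar> <= M"
  "!!x. norm x > r ==> dird h phi x = 0" "!!x. \<bar>dird h phi x\<bar> <= M"
proof -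
 have d: "phi differentiable_on UNIV" by (rule test_function_differentiable[OF phi])
 obtain r where r: "!!x. norm x > r ==> phi x = 0" using test_function_bounds[OF phi] by metis
 obtain r' M where M: "!!x. \<bar>dird h phi x\<bar> <= M" "!!x. norm x > r' ==> dird h phi x = 0" using test_function_bounds[OF test_dird[OF phi]] by metis
 have "Bseq s" using s by (intro convergent_imp_Bseq) (auto simp: convergent_def)
 then obtain B where B: "!!n. \<bar>s n\<bar> <= B" by (auto simp: Bseq_def)
 have B0: "B >= 0" using order_trans[OF abs_ge_zero B[of 0]] .
 define r2 where "r2 = max r' (r+B*norm h)"
 show thesis
 proof (rule that[of r2 M])
  fix x
  have "((%t. (phi (x+t *R h)-phi x)/t) \<longlongrightarrow> dird h phi x) (at 0)"
   using dird_line[OF d, of x h 0] by (simp add: has_field_derivative_iff)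
  moreover have "filterlim s (at 0) sequentially" using s by (auto simp: filterlim_at)
  ultimately show "(%n. (phi (x+s n *R h)-phi x)/s n) ----> dird h phi x" by (rule filterlim_compose)
  show "norm x > r2 ==> dird h phi x = 0" by (simp add: M r2_def)
  show "\<bar>dird h phi x\<bar> <= M" by (rule M)
  fix n
  show "(phi (x+s n *R h)-phi x)/s n = 0" if "norm x > r2"
  proof -
   have "norm (s n *R h) <= B*norm h" using B[of n] by (simp add: mult_right_mono)
   moreover have "norm x <= norm (x+s n *R h)+norm (s n *R h)" using norm_triangle_ineq4[of "x+s n *R h" "s n *R h"] by simp
   moreover have "0 <= B*norm h" using B0 by simp
   ultimately have "norm (x+s n *R h) > r" "norm x > r" using that by (auto simp: r2_def)
   thus ?thesis by (simp add: r)
  qed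
  have "norm (phi (x+s n *R h)-phi (x+0 *R h)) <= M*norm (s n-0)"
   by (rule field_differentiable_bound[OF convex_UNIV, of "%t. phi (x+t *R h)" "%t. dird h phi (x+t *R h)"])
    (use dird_line[OF d] M in \<open>auto intro: has_field_derivative_at_within\<close>)
  thus "\<bar>(phi (x+s n *R h)-phi x)/s n\<bar> <= M" using s(1)[of n] by (simp add: field_simps)
 qed
qed

text \<open>Pointwise the quotients converge to the directional derivative; they are bounded and supported in a common ball, so dominated
  convergence applies.\<close>

lemma tr_difference_quotient:
 assumes phi: "testf phi" and s: "!!n. s n ~= 0" "s ----> 0"
 shows "(%n. (1/s n) *R (tr (s n *R h) (tv phi c)-tv phi c)) ----> tv (dird h phi) c"
proof -
 let ?d = "%n x. phi (x+s n *R h)-phi x"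
 obtain r M where rM: "!!x. (%n. (?d n x)/s n) ----> dird h phi x"
  "!!n x. norm x > r ==> (?d n x)/s n = 0" "!!n x. \<bar>(?d n x)/s n\<bar> <= M"
  "!!x. norm x > r ==> dird h phi x = 0" "!!x. \<bar>dird h phi x\<bar> <= M" by (rule difference_quotient_bounds[OF phi s, of h], rule that)
 have [measurable]: "phi : borelm" "dird h phi : borelm"
  using test_function_measurable phi test_dird by auto
 have "(%n. tv (%x. (1/s n)*(?d n x)-dird h phi x) c) ----> 0"
 proof (rule tv_tendsto_0)
  show "(%n. (1/s n)*(?d n x)-dird h phi x) ----> 0" for x
   using rM(1)[of x] by (simp add: Lim_null[symmetric] field_simps)
  show "norm x > r ==> (1/s n)*(?d n x)-dird h phi x = 0" for n x
   using rM(2,4)[of x] by simp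
  show "\<bar>(1/s n)*(?d n x)-dird h phi x\<bar> <= 2*M" for n x
   using rM(3)[of x n] rM(5)[of x] abs_triangle_ineq4[of "(?d n x)/s n" "dird h phi x"] by simp
 qed measurable
 moreover have "tv (%x. (1/s n)*(?d n x)-dird h phi x) c
  = (1/s n) *R (tr (s n *R h) (tv phi c)-tv phi c)-tv (dird h phi) c" for n
 proof -
  have q1: "sqb phi" "sqb (%x. phi (x+s n *R h))" "sqb (dird h phi)" by (intro sqb_test phi test_shift test_dird)+
  have q2: "sqb (%x. phi (x+s n *R h)-phi x)" by (rule sqb_diff[OF q1(2,1)])
  show ?thesis unfolding tr_tv[OF phi] tv_diff[OF q1(2,1)] tv_scale[OF q2, symmetric]
   by (rule tv_diff[OF sqb_cmult[OF q2] q1(3), symmetric])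
 qed
 ultimately show ?thesis by (simp add: Lim_null[symmetric])
qed

lemma integrable_test: assumes "testf phi" shows "integrable lborel phi"
proof -
 obtain r M where rM: "!!x. norm x > r ==> phi x = 0" "!!x. \<bar>phi x\<bar> <= M" using test_function_bounds[OF assms] by metis
 have "integrable lborel (%x. M*indicator (cball 0 r) x :: real)"
  using emeasure_lborel_cball_finite[of 0 r] by (intro integrable_mult_right integrable_real_indicator) auto
 thus ?thesis
  by (rule integrable_dominated)
   (use rM test_function_measurable[OF assms] in \<open>auto intro!: AE_I2 simp: indicator_def not_le intro: order_trans[OF _ abs_ge_self]\<close>)
qed

text \<open>The integral of a translate does not depend on the translation.\<close>

lemma integral_dird_zero:
 assumes phi: "testf phi" shows "(LB x. dird h phi x) = 0"
proof -
 define s where "s = (%n. 1/real (Suc n))"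
 have s: "s n ~= 0" for n by (simp add: s_def)
 have s0: "s ----> 0" unfolding s_def by (rule LIMSEQ_Suc[OF lim_1_over_n])
 note s = s s0
 let ?d = "%n x. phi (x+s n *R h)-phi x"
 obtain r M where rM: "!!x. (%n. (?d n x)/s n) ----> dird h phi x"
  "!!n x. norm x > r ==> (?d n x)/s n = 0" "!!n x. \<bar>(?d n x)/s n\<bar> <= M"
  by (rule difference_quotient_bounds[OF phi s, of h], rule that)
 have [measurable]: "phi : borelm" "dird h phi : borelm"
  using test_function_measurable phi test_dird by auto
 have "(%n. LB x. (?d n x)/s n) ----> (LB x. dird h phi x)"
 proof (rule integral_dominated_convergence)
  show "integrable lborel (%x. M*indicator (cball 0 r) x :: real)"
   using emeasure_lborel_cball_finite[of 0 r] by (intro integrable_mult_right integrable_real_indicator) auto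
  show "AE x in lborel. norm ((?d n x)/s n) <= M*indicator (cball 0 r) x" for n
  proof (rule AE_I2)
   fix x show "norm ((?d n x)/s n) <= M*indicator (cball 0 r) x"
    using rM(2)[of x n] rM(3)[of x n] by (cases "norm x <= r") (auto simp: indicator_def not_le)
  qed
 qed (use rM(1) in \<open>auto intro!: AE_I2\<close>)
 moreover have "(LB x. (?d n x)/s n) = 0" for n
  using integrable_test[OF phi] integrable_test[OF test_shift[OF phi, of "s n *R h"]]
   lborel_integral_shift[of phi "s n *R h"] by simp
 ultimately have "(%n::nat. 0) ----> (LB x. dird h phi x)" by (simp only:)
 thus ?thesis by (rule LIMSEQ_unique[OF tendsto_const, symmetric])
qed

lemma dird_axis: "dird (axis j 1) phi x = pd j phi x"
 unfolding dird_def axis_def by (simp add: if_distrib[of "%c. c*_"] cong: if_cong)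

lemma integration_by_parts_test:
 assumes "testf phi" "testf psi"
 shows "(LB x. phi x*pd j psi x) = - (LB x. pd j phi x*psi x)"
proof -
 have "(LB x. pd j (%x. phi x*psi x) x) = 0"
  using integral_dird_zero[OF test_mult2[OF assms], of "axis j 1"] by (simp add: dird_axis)
 moreover have "(LB x. pd j (%x. phi x*psi x) x)
  = (LB x. phi x*pd j psi x)+(LB x. pd j phi x*psi x)"
  unfolding partial_deriv_mult[OF test_function_differentiable[OF assms(1)] test_function_differentiable[OF assms(2)]]
  by (intro Bochner_Integration.integral_add integrable_test test_mult2 test_partial_deriv assms)
 ultimately show ?thesis by simp
qed

section \<open>Self-adjoint first order operators with constant coefficients\<close>

lemma C_k_affine_coordinate: "C_k k (%x::real^'n::finite. x $ j+c)"
proof -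
 define d where "d = (%(k::nat) (x::real). if k = 0 then x+c else if k = 1 then 1 else 0)"
 have "(d k has_real_derivative d (Suc k) x) (at x)" for k x
  by (cases "k = 0"; cases "k = 1") (auto simp: d_def intro!: derivative_eq_intros)
 from C_k_coordinate_function[of d k 0 j, OF this] show ?thesis by (simp add: d_def)
qed

lemma partial_deriv_mult_coordinate:
 assumes "testf phi"
 shows "pd i (%x. phi x*(x $ j+c)) y = phi y*(if i = j then 1 else 0)+pd i phi y*(y $ j+c)"
proof -
 have "pd i (%x. x $ j+c) y = (if i = j then 1 else 0)"
  by (subst partial_deriv_eqI[OF has_derivative_add[OF bounded_linear_imp_has_derivative[OF bounded_linear_vec_nth] has_derivative_const]]) (auto simp: axis_def)
 thus ?thesis
  by (subst partial_deriv_mult[OF test_function_differentiable[OF assms] C_k_differentiable[OF C_k_affine_coordinate]]) simp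
qed

text \<open>The weak formula with coefficients \<open>A j\<close> makes \<open>D\<close> a first order operator; \<open>coercive\<close>
  provides the weak partial derivatives \<open>g j\<close> of \<open>u\<close>.\<close>

locale dirac = selfadj_op D J
 for D :: "((real^'n::finite, 'b::euclidean_space) L2 \<times> (real^'n, 'b) L2) set" and J +
 fixes A :: "'n => 'b => 'b" and C0 :: real
 assumes A_linear: "linear (A j)"
  and J_mulr: "bdd phi ==> J (mulr phi u) = mulr phi (J u)"
  and weak: "(u, v) : D ==> testf phi ==> Itg phi v = - (\<Sum>j\<in>UNIV. A j (Itg (pd j phi) u))"
  and coercive: "(u, v) : D ==> u : closure (Range D) ==>
   \<exists>g. \<forall>j. norm (g j) <= C0*norm v & (\<forall>phi. testf phi --> Itg phi (g j) = - Itg (pd j phi) u)"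
begin

lemma A_simps: "A j (x+y) = A j x+A j y" "A j (x-y) = A j x-A j y" "A j (c *R x) = c *R A j x" "A j 0 = 0" "A j (- x) = - A j x"
 using A_linear by (simp_all add: linear_add linear_diff linear_scale linear_0 linear_neg)

text \<open>By the weak formula the pairing of \<open>D u\<close> with a test vector is continuous in \<open>u\<close>, so the test vector
  lies in the domain of the adjoint, which is \<open>D\<close> itself.\<close>

lemma tests_adjoint_D:
 assumes phi: "testf phi"
 shows "(tv phi c, - (\<Sum>j\<in>UNIV. tv (pd j phi) (adjoint (A j) c))) : D"
proof (subst D_adj, intro allI impI)
 fix u z assume uz: "(u, z) : D"
 note q = sqb_test[OF phi] sqb_test[OF test_partial_deriv[OF phi]]
 have "inner z (tv phi c) = - (\<Sum>j\<in>UNIV. A j (Itg (pd j phi) u) \<bullet> c)"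
  unfolding inner_tv[OF q(1)] weak[OF uz phi] by (simp add: inner_sum_left)
 also have "... = - (\<Sum>j\<in>UNIV. inner u (tv (pd j phi) (adjoint (A j) c)))"
  by (simp add: inner_tv[OF q(2)] adjoint_works[OF A_linear])
 also have "... = inner u (- (\<Sum>j\<in>UNIV. tv (pd j phi) (adjoint (A j) c)))"
  by (simp add: inner_sum_right)
 finally show "inner z (tv phi c) = inner u (- (\<Sum>j\<in>UNIV. tv (pd j phi) (adjoint (A j) c)))" .
qed

lemma Itg_tv: assumes "sqb phi" "sqb psi" shows "Itg psi (tv phi c) = (LB x. psi x*phi x) *R c"
proof -
 have [measurable]: "phi : borelm" "psi : borelm" using assms by (auto simp: sqb_def)
 have i: "integrable lborel (%x. psi x*phi x)"
  using integrable_Itg[OF assms(2), of "mk phi"] fb_mk[OF assms(1)]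
  by (subst integrable_cong_AE[of _ _ "%x. psi x *R fb (mk phi) x"]) (auto elim: eventually_mono)
 have "Itg psi (tv phi c) = (LB x. (psi x*phi x) *R c)"
  using Itg_cong[OF fb_tv[OF assms(1), of c], of psi] by simp
 also have "... = (LB x. psi x*phi x) *R c" using i by simp
 finally show ?thesis .
qed

lemma Itg_sum:
 assumes "sqb phi" and fin: "finite I" shows "Itg phi (\<Sum>i\<in>I. f i) = (\<Sum>i\<in>I. Itg phi (f i))"
 using fin
proof (induction I rule: finite_induct)
 case empty
 from Itg_add[OF assms(1), of "sum f {}" "sum f {}"] show ?case by simp
qed (simp add: Itg_add assms)

lemma Itg_minus: "sqb phi ==> Itg phi (- u) = - Itg phi u"
 using Itg_scaleR[of phi "-1" u] by simp

text \<open>The test functions lie in the domain, so both \<open>A\<close> and minus its adjoint describe \<open>D\<close> there. Testing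
  against \<open>phi\<close> and \<open>x \<mapsto> x $ j * phi x\<close> separates the coefficients.\<close>

lemma A_skew: "adjoint (A j) c = - A j c"
proof -
 define phi where "phi = (plateau 1 (\<chi> i. -2) (\<chi> i. 2) :: real^'n => real)"
 have phi: "testf phi" unfolding phi_def by (rule test_function_plateau) simp
 define B where "B = (%i. A i c+adjoint (A i) c)"
 let ?a = "%psi \<eta> i. LB x. psi x*pd i \<eta> x"
 have key: "(\<Sum>i\<in>UNIV. ?a psi \<eta> i *R B i) = 0" if psi: "testf psi" and \<eta>: "testf \<eta>" for psi \<eta>
 proof -
  note q = sqb_test[OF psi] sqb_test[OF \<eta>] sqb_test[OF test_partial_deriv[OF psi]] sqb_test[OF test_partial_deriv[OF \<eta>]]
  have "A i (Itg (pd i psi) (tv \<eta> c)) = - (?a psi \<eta> i *R A i c)" for i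
   unfolding Itg_tv[OF q(2,3)] integration_by_parts_test[OF psi \<eta>] by (simp add: A_simps)
  with weak[OF tests_adjoint_D[OF \<eta>] psi]
  have "(\<Sum>i\<in>UNIV. ?a psi \<eta> i *R adjoint (A i) c)+(\<Sum>i\<in>UNIV. ?a psi \<eta> i *R A i c) = 0"
   by (simp add: Itg_minus[OF q(1)] Itg_sum[OF q(1)] Itg_tv[OF q(4,1)] sum_negf add_eq_0_iff)
  thus ?thesis by (simp add: B_def scaleR_add_right sum.distrib add.commute)
 qed
 let ?psi = "%x. phi x*x $ j"
 have psi: "testf ?psi" using test_mult[OF phi C_k_affine_coordinate[of _ j 0]] by simp
 have i1: "integrable lborel (%x. phi x*phi x)" by (rule integrable_test[OF test_mult2[OF phi phi]])
 have i2: "integrable lborel (%x. ?psi x*pd i phi x)" for i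
  by (rule integrable_test[OF test_mult2[OF psi test_partial_deriv[OF phi]]])
 have e: "?a phi ?psi i = (if i = j then LB x. phi x*phi x else 0)+?a ?psi phi i" for i
 proof -
  have "?a phi ?psi i = (LB x. (if i = j then 1 else 0)*(phi x*phi x)+?psi x*pd i phi x)"
   using partial_deriv_mult_coordinate[OF phi, of i j 0] by (intro Bochner_Integration.integral_cong) (auto simp: algebra_simps)
  also have "... = (LB x. (if i = j then 1 else 0)*(phi x*phi x))+?a ?psi phi i"
   by (rule Bochner_Integration.integral_add) (use i1 i2 in auto)
  finally show ?thesis by simp
 qed
 have "(LB x. phi x*phi x) *R B j = (\<Sum>i\<in>UNIV. (if i = j then LB x. phi x*phi x else 0) *R B i)"
  by (simp add: if_distrib[of "%r. r *R _"] if_distribR cong: if_cong)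
 also have "... = 0" using key[OF phi psi] key[OF psi phi] unfolding e by (simp add: scaleR_add_left sum.distrib)
 finally have "(LB x. phi x*phi x) *R B j = 0" .
 moreover have "0 < (LB x. phi x*phi x)"
 proof -
  let ?C = "cbox (\<chi> i. -1) (\<chi> i. 1) :: (real^'n) set"
  have "0 < measure lborel ?C"
   using content_pos_lt_eq[of "(\<chi> i. -1) :: real^'n" "\<chi> i. 1"] by (auto simp: Basis_vec_def inner_axis)
  also have "... = (LB x. indicator ?C x)" by simp
  also have "... <= (LB x. phi x*phi x)"
  proof (rule integral_mono[OF _ i1])
   show "integrable lborel (indicator ?C :: _ => real)" by (intro integrable_real_indicator emeasure_bounded_finite) (auto simp: bounded_cbox)
   show "indicator ?C x <= phi x*phi x" for x
    using plateau_1[of 1 "\<chi> i. -2" x "\<chi> i. 2"] by (auto simp: phi_def mem_box_cart indicator_def)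
  qed
  finally show ?thesis .
 qed
 ultimately have "B j = 0" by simp
 thus ?thesis by (simp add: B_def add_eq_0_iff)
qed

lemma inner_A: "A j x \<bullet> y = - (x \<bullet> A j y)"
 using adjoint_works[OF A_linear, of x j y] by (simp add: A_skew)

lemma tests_D:
 assumes "testf phi"
 shows "(tv phi c, \<Sum>j\<in>UNIV. tv (pd j phi) (A j c)) : D"
proof -
 have "tv (pd j phi) (- A j c) = - tv (pd j phi) (A j c)" for j
  using tv_scale_vec[OF sqb_test[OF test_partial_deriv[OF assms]], where r = "-1"] by simp
 thus ?thesis using tests_adjoint_D[OF assms, of c] by (simp add: A_skew sum_negf)
qed

end

subsection \<open>Convolution with a test function\<close>

text \<open>Absolute integrability follows from \<open>\<bar>fb z y \<bullet> fb g x\<bar> \<le> \<parallel>fb z y\<parallel>\<^sup>2 +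
  \<parallel>fb g x\<parallel>\<^sup>2\<close>: in each term the kernel can be integrated first.\<close>

lemma convolution_integrable:
 fixes z :: "(real^'n::finite, 'b::euclidean_space) L2"
 assumes k: "testf k"
 shows "integrable (lborel \<Otimes>\<^sub>M lborel) (%(x, y). k (y-x)*(fb z y \<bullet> fb g x))"
proof -
 have [measurable]: "k : borelm" by (rule test_function_measurable[OF k])
 have ki: "integrable lborel (%x. \<bar>k x\<bar>)" using integrable_test[OF k] by simp
 have shift: "(NN y. ennreal \<bar>k (y-x)\<bar>) = (NN y. ennreal \<bar>k y\<bar>)" for x
  using nn_integral_shift[of "%y. ennreal \<bar>k y\<bar>" "- x"] by simp
 have refl: "(NN x. ennreal \<bar>k (y-x)\<bar>) = (NN x. ennreal \<bar>k x\<bar>)" for y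
  by (subst (2) lborel_affine[of "-1" y]) (simp_all add: nn_integral_density nn_integral_distr density_1)
 define I where "I = (NN x. ennreal \<bar>k x\<bar>)"
 have I: "I < \<infinity>" using ki unfolding I_def integrable_iff_bounded by simp
 show ?thesis
 proof (rule integrableI_bounded)
  let ?e = "%y. ennreal ((norm (fb z y))^2)"
  let ?g = "%x. ennreal ((norm (fb g x))^2)"
  have "(\<integral>\<^sup>+p. ennreal (norm (case p of (x, y) => k (y-x)*(fb z y \<bullet> fb g x))) \<partial>(lborel \<Otimes>\<^sub>M lborel))
   <= (\<integral>\<^sup>+p. (case p of (x, y) => ennreal \<bar>k (y-x)\<bar>*(?e y))+(case p of (x, y) => ennreal \<bar>k (y-x)\<bar>*(?g x)) \<partial>(lborel \<Otimes>\<^sub>M lborel))"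
  proof (rule nn_integral_mono, safe)
   fix x y :: "real^'n"
   have "\<bar>fb z y \<bullet> fb g x\<bar> <= norm (fb z y)*norm (fb g x)" by (rule Cauchy_Schwarz_ineq2)
   also have "... <= (norm (fb z y))^2+(norm (fb g x))^2"
    using sum_squares_bound[of "norm (fb z y)" "norm (fb g x)"] mult_nonneg_nonneg[OF norm_ge_zero[of "fb z y"] norm_ge_zero[of "fb g x"]] by linarith
   finally have "\<bar>k (y-x)\<bar>*\<bar>fb z y \<bullet> fb g x\<bar> <= \<bar>k (y-x)\<bar>*((norm (fb z y))^2+(norm (fb g x))^2)" by (intro mult_left_mono) auto
   thus "ennreal (norm (k (y-x)*(fb z y \<bullet> fb g x))) <= ennreal \<bar>k (y-x)\<bar>*(?e y)+ennreal \<bar>k (y-x)\<bar>*(?g x)"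
    by (simp add: ennreal_mult[symmetric] ennreal_plus[symmetric] abs_mult distrib_left ennreal_leI del: ennreal_plus)
  qed
  also have "... = (\<integral>\<^sup>+p. (case p of (x, y) => ennreal \<bar>k (y-x)\<bar>*(?e y)) \<partial>(lborel \<Otimes>\<^sub>M lborel))
   + (\<integral>\<^sup>+p. (case p of (x, y) => ennreal \<bar>k (y-x)\<bar>*(?g x)) \<partial>(lborel \<Otimes>\<^sub>M lborel))"
   by (rule nn_integral_add) measurable
  also have "(\<integral>\<^sup>+p. (case p of (x, y) => ennreal \<bar>k (y-x)\<bar>*(?e y)) \<partial>(lborel \<Otimes>\<^sub>M lborel))
   = (NN y. \<integral>\<^sup>+x. ennreal \<bar>k (y-x)\<bar>*(?e y) \<partial>lborel)"
   by (subst lborel_pair.nn_integral_snd[symmetric]) auto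
  also have "... = (NN y. I*(?e y))"
   by (simp add: nn_integral_multc refl I_def)
  also have "... = I*ennreal ((norm z)^2)" by (simp add: nn_integral_cmult nn_norm_L2)
  also have "(\<integral>\<^sup>+p. (case p of (x, y) => ennreal \<bar>k (y-x)\<bar>*(?g x)) \<partial>(lborel \<Otimes>\<^sub>M lborel))
   = (NN x. \<integral>\<^sup>+y. ennreal \<bar>k (y-x)\<bar>*(?g x) \<partial>lborel)"
   by (subst lborel.nn_integral_fst[symmetric]) auto
  also have "... = (NN x. I*(?g x))"
   by (simp add: nn_integral_multc shift I_def)
  also have "... = I*ennreal ((norm g)^2)" by (simp add: nn_integral_cmult nn_norm_L2)
  also have "I*ennreal ((norm z)^2)+I*ennreal ((norm g)^2) < \<infinity>" using I by (simp add: ennreal_mult_less_top less_top)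
  finally show "(\<integral>\<^sup>+p. ennreal (norm (case p of (x, y) => k (y-x)*(fb z y \<bullet> fb g x))) \<partial>(lborel \<Otimes>\<^sub>M lborel)) < \<infinity>" .
 qed measurable
qed

text \<open>Fubini's theorem in three forms: integrating first over \<open>y\<close>, over \<open>x\<close>, or along the diagonals \<open>y
  = x + s\<close>.\<close>

lemma inner_convolution:
 fixes z :: "(real^'n::finite, 'b::euclidean_space) L2"
 assumes k: "testf k"
 shows convolution_swap: "(LB x. Itg (%y. k (y-x)) z \<bullet> fb g x) = (LB y. fb z y \<bullet> Itg (%x. k (y-x)) g)"
  and convolution_translates: "(LB s. k s*inner (tr s z) g) = (LB x. Itg (%y. k (y-x)) z \<bullet> fb g x)"
  and convolution_inner_integrable: "integrable lborel (%x. Itg (%y. k (y-x)) z \<bullet> fb g x)"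
  and convolution_inner_integrable2: "integrable lborel (%y. fb z y \<bullet> Itg (%x. k (y-x)) g)"
proof -
 have [measurable]: "k : borelm" by (rule test_function_measurable[OF k])
 note int = convolution_integrable[OF k, of z g]
 have sq1: "sqb (%y. k (y-x))" for x using sqb_test[OF test_shift[OF k, of "- x"]] by simp
 have sq2: "sqb (%x. k (y-x))" for y using sqb_test[OF test_reflect[OF k, of y]] .
 let ?e = "%x y. fb z y \<bullet> fb g x"
 have in1: "(LB y. k (y-x)*(?e x y)) = Itg (%y. k (y-x)) z \<bullet> fb g x" for x
  unfolding Itg_def by (subst integral_inner_left[symmetric]) (auto intro: integrable_Itg[OF sq1])
 have in2: "(LB x. k (y-x)*(?e x y)) = fb z y \<bullet> Itg (%x. k (y-x)) g" for y
  unfolding Itg_def by (subst integral_inner_right[symmetric]) (auto intro: integrable_Itg[OF sq2])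
 show "(LB x. Itg (%y. k (y-x)) z \<bullet> fb g x) = (LB y. fb z y \<bullet> Itg (%x. k (y-x)) g)"
  using lborel_pair.Fubini_integral[OF int] by (simp add: in1 in2)
 show "integrable lborel (%x. Itg (%y. k (y-x)) z \<bullet> fb g x)"
  using lborel_pair.integrable_fst'[OF int] by (simp add: in1)
 show "integrable lborel (%y. fb z y \<bullet> Itg (%x. k (y-x)) g)"
  using lborel_pair.integrable_fst'[OF lborel_pair.integrable_product_swap[OF int]] by (simp add: in2)
 let ?f = "%x s. fb z (x+s) \<bullet> fb g x"
 have sh: "integrable (lborel \<Otimes>\<^sub>M lborel) (%(x, s). k s*(?f x s))"
 proof (rule integrableI_bounded)
  have "(\<integral>\<^sup>+p. ennreal (norm (case p of (x, s) => k s*(?f x s))) \<partial>(lborel \<Otimes>\<^sub>M lborel))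
   = (NN x. \<integral>\<^sup>+s. ennreal (norm (k s*(?f x s))) \<partial>lborel)"
   by (subst lborel.nn_integral_fst[symmetric]) auto
  also have "... = (NN x. \<integral>\<^sup>+y. ennreal (norm (k (y-x)*(?e x y))) \<partial>lborel)"
  proof (rule nn_integral_cong)
   fix x :: "real^'n"
   show "(NN s. ennreal (norm (k s*(?f x s)))) = (NN y. ennreal (norm (k (y-x)*(?e x y))))"
    using nn_integral_shift[of "%y. ennreal (norm (k (y-x)*(?e x y)))" x] by (simp add: add.commute)
  qed
  also have "... = (\<integral>\<^sup>+p. ennreal (norm (case p of (x, y) => k (y-x)*(?e x y))) \<partial>(lborel \<Otimes>\<^sub>M lborel))"
   by (subst lborel.nn_integral_fst[symmetric]) auto
  also have "... < \<infinity>" using int unfolding integrable_iff_bounded by simp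
  finally show "(\<integral>\<^sup>+p. ennreal (norm (case p of (x, s) => k s*(?f x s))) \<partial>(lborel \<Otimes>\<^sub>M lborel)) < \<infinity>" .
 qed measurable
 have tr: "(LB x. k s*(?f x s)) = k s*inner (tr s z) g" for s
 proof -
  have "inner (tr s z) g = (LB x. fb z (x+s) \<bullet> fb g x)" unfolding inner_L2
   by (rule integral_cong_AE) (measurable, use fb_tr[of s z] in \<open>eventually_elim, simp\<close>)
  thus ?thesis by simp
 qed
 have "(LB s. k s*inner (tr s z) g) = (LB x. LB s. k s*(?f x s))"
  using lborel_pair.Fubini_integral[OF sh] by (simp only: tr split_conv)
 also have "... = (LB x. LB y. k (y-x)*(?e x y))"
  using lborel_integral_shift[of "%y. k (y-x)*(?e x y)" x for x] by (simp add: add.commute)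
 also have "... = (LB x. Itg (%y. k (y-x)) z \<bullet> fb g x)" by (simp only: in1)
 finally show "(LB s. k s*inner (tr s z) g) = (LB x. Itg (%y. k (y-x)) z \<bullet> fb g x)" .
qed

text \<open>Otherwise \<open>f\<close> would have a sign near zero, and a plateau function supported there would have a nonzero integral
  against it.\<close>

lemma continuous_zero_of_test_integrals:
 fixes f :: "real^'n::finite => real"
 assumes cont: "!!X. X ----> 0 ==> (%n. f (X n)) ----> f 0"
  and zero: "!!\<rho>. testf \<rho> ==> integrable lborel (%x. \<rho> x*f x) & (LB x. \<rho> x*f x) = 0"
 shows "f 0 = 0"
proof (rule ccontr)
 assume f0: "f 0 ~= 0"
 define \<sigma> where "\<sigma> = sgn (f 0)"
 have cf: "isCont f 0" unfolding continuous_at_sequentially using cont by (auto simp: o_def)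
 have "(%x. \<sigma>*f x) \<midarrow>0\<rightarrow> \<sigma>*f 0" using cf by (intro tendsto_intros) (simp add: isCont_def)
 moreover have pos: "\<sigma>*f 0 > 0" using f0 by (simp add: \<sigma>_def sgn_mult_abs abs_sgn[symmetric] mult.commute)
 ultimately have "eventually (%x. \<sigma>*f x > \<sigma>*f 0/2) (at 0)"
  by (intro order_tendstoD(1)[where a = "\<sigma>*f 0/2"]) auto
 then obtain d where d: "d > 0" "!!x. norm x < d ==> x ~= 0 ==> \<sigma>*f x > \<sigma>*f 0/2"
  by (auto simp: eventually_at dist_norm)
 hence d': "\<sigma>*f x > \<sigma>*f 0/2" if "norm x < d" for x using that pos by (cases "x = 0") auto
 define e where "e = d/(2*real CARD('n))"
 have e: "e > 0" using d by (simp add: e_def)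
 define \<rho> where "\<rho> = (plateau (e/2) (\<chi> i. - e) (\<chi> i. e) :: real^'n => real)"
 have \<rho>: "testf \<rho>" unfolding \<rho>_def using e by (intro test_function_plateau) auto
 have small: "norm x < d" if "\<rho> x ~= 0" for x
 proof -
  have "x : box (\<chi> i. - e) (\<chi> i. e)" using that plateau_0[of "e/2" x] e unfolding \<rho>_def by fastforce
  hence "\<bar>x $ i\<bar> <= e" for i by (auto simp: mem_box_cart abs_le_iff) (smt (verit))+
  hence "norm x <= (\<Sum>i\<in>(UNIV::'n set). e)" by (intro order_trans[OF norm_le_l1_cart] sum_mono) auto
  also have "... < d" using d by (simp add: e_def)
  finally show ?thesis .
 qed
 note z = zero[OF \<rho>]
 have i\<rho>: "integrable lborel \<rho>" by (rule integrable_test[OF \<rho>])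
 have "(LB x. \<rho> x*(\<sigma>*f 0/2)) <= (LB x. \<sigma>*(\<rho> x*f x))"
 proof (rule integral_mono)
  show "integrable lborel (%x. \<rho> x*(\<sigma>*f 0/2))" using i\<rho> by simp
  show "integrable lborel (%x. \<sigma>*(\<rho> x*f x))" using z by simp
  fix x
  have "\<rho> x*(\<sigma>*f 0/2) <= \<rho> x*(\<sigma>*f x)"
   using small[of x] d'[of x] plateau_bounds(1)[of "e/2" "\<chi> i. - e" "\<chi> i. e" x]
   by (cases "\<rho> x = 0") (auto simp: \<rho>_def intro!: mult_left_mono)
  thus "\<rho> x*(\<sigma>*f 0/2) <= \<sigma>*(\<rho> x*f x)" by (simp add: mult_ac)
 qed
 hence "(LB x. \<rho> x)*(\<sigma>*f 0/2) <= 0" using z by simp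
 hence "(LB x. \<rho> x) <= 0" using pos by (metis half_gt_zero mult_pos_pos not_less)
 hence "AE x in lborel. \<rho> x = 0"
 proof -
  have p: "0 <= \<rho> x" for x unfolding \<rho>_def by (rule plateau_bounds(1))
  have "0 <= (LB x. \<rho> x)" by (intro Bochner_Integration.integral_nonneg p)
  with \<open>(LB x. \<rho> x) <= 0\<close> show ?thesis using integral_nonneg_eq_0_iff_AE[OF i\<rho> AE_I2[OF p]] by linarith
 qed
 hence "AE x in lborel. x \<notin> (box (\<chi> i. - e/2) (\<chi> i. e/2) :: (real^'n) set)"
 proof eventually_elim
  case (elim x)
  show ?case
  proof
   assume "x : box (\<chi> i. - e/2) (\<chi> i. e/2)"
   hence "\<rho> x = 1" unfolding \<rho>_def using e by (intro plateau_1) (auto simp: mem_box_cart less_imp_le algebra_simps, (smt (verit) field_sum_of_halves)+)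
   with elim show False by simp
  qed
 qed
 hence "emeasure lborel (box (\<chi> i. - e/2) (\<chi> i. e/2) :: (real^'n) set) = 0"
  by (simp add: AE_iff_measurable[OF _ refl])
 moreover have "0 < measure lborel (cbox (\<chi> i. - e/2) (\<chi> i. e/2) :: (real^'n) set)"
  using e content_pos_lt_eq[of "(\<chi> i. - e/2) :: real^'n" "\<chi> i. e/2"] by (auto simp: Basis_vec_def inner_axis)
 ultimately show False
  by (simp add: emeasure_lborel_box_eq emeasure_lborel_cbox_eq measure_def box_eq_empty)
qed

lemma isCont_tr: "isCont (%s. tr s u) s" for u :: "(real^'n::finite, 'b::euclidean_space) L2"
 unfolding continuous_at_sequentially
proof (intro allI impI)
 fix X assume X: "X ----> s"
 have "(%n. X n-s) ----> s-s" by (intro tendsto_intros X)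
 hence "(%n. tr (X n-s) (tr s u)) ----> tr s u" by (intro tr_continuous) simp
 thus "((%s. tr s u) \<circ> X) ----> tr s u" by (simp add: tr_tr o_def)
qed

context dirac
begin

text \<open>\<open>D\<close> is the maximal realisation: mollifying moves all derivatives onto a test function, where skewness of the
  coefficients makes the pairing symmetric.\<close>

lemma weak_imp_D:
 assumes gh: "!!phi. testf phi ==> Itg phi h = - (\<Sum>j\<in>UNIV. A j (Itg (pd j phi) g))"
 shows "(g, h) : D"
proof (subst D_adj, intro allI impI)
 fix w z assume wz: "(w, z) : D"
 define f where "f = (%s. inner (tr s z) g-inner (tr s w) h)"
 have eq: "(LB s. \<rho> s*inner (tr s z) g) = (LB s. \<rho> s*inner (tr s w) h)" if \<rho>: "testf \<rho>" for \<rho>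
 proof -
  have d: "\<rho> differentiable_on UNIV" by (rule test_function_differentiable[OF \<rho>])
  have t1: "testf (%y. \<rho> (y-x))" for x using test_shift[OF \<rho>, of "- x"] by simp
  have t2: "testf (%x. \<rho> (y-x))" for y by (rule test_reflect[OF \<rho>])
  have tj: "testf (pd j \<rho>)" for j by (rule test_partial_deriv[OF \<rho>])
  have p1: "pd j (%y. \<rho> (y-x)) = (%y. pd j \<rho> (y-x))" for j x
   using partial_deriv_shift[OF d, of j "- x"] by auto
  have p2: "pd j (%x. \<rho> (y-x)) = (%x. - pd j \<rho> (y-x))" for j y
   using partial_deriv_reflect[OF d] by auto
  have "(LB s. \<rho> s*inner (tr s z) g) = (LB x. Itg (%y. \<rho> (y-x)) z \<bullet> fb g x)"
   by (rule convolution_translates[OF \<rho>])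
  also have "... = (LB x. (\<Sum>j\<in>UNIV. Itg (%y. pd j \<rho> (y-x)) w \<bullet> A j (fb g x)))"
   by (simp add: weak[OF wz t1] p1 inner_sum_left inner_A sum_negf)
  also have "... = (LB x. (\<Sum>j\<in>UNIV. Itg (%y. pd j \<rho> (y-x)) w \<bullet> fb (lmap (A j) g) x))"
  proof (rule integral_cong_AE)
   have "AE x in lborel. \<forall>j\<in>UNIV. fb (lmap (A j) g) x = A j (fb g x)"
    by (rule AE_finite_allI) (auto intro: fb_lmap[OF A_linear])
   thus "AE x in lborel. (\<Sum>j\<in>UNIV. Itg (%y. pd j \<rho> (y-x)) w \<bullet> A j (fb g x)) = (\<Sum>j\<in>UNIV. Itg (%y. pd j \<rho> (y-x)) w \<bullet> fb (lmap (A j) g) x)"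
    by eventually_elim simp
   show m2: "(%x. \<Sum>j\<in>UNIV. Itg (%y. pd j \<rho> (y-x)) w \<bullet> fb (lmap (A j) g) x) : borel_measurable lborel"
    by (intro borel_measurable_sum borel_measurable_integrable convolution_inner_integrable[OF tj])
   have m1: "(%x. Itg (%y. \<rho> (y-x)) z \<bullet> fb g x) : borel_measurable lborel"
    by (intro borel_measurable_integrable convolution_inner_integrable[OF \<rho>])
   thus "(%x. \<Sum>j\<in>UNIV. Itg (%y. pd j \<rho> (y-x)) w \<bullet> A j (fb g x)) : borel_measurable lborel"
    by (simp add: weak[OF wz t1] p1 inner_sum_left inner_A sum_negf)
  qed
  also have "... = (\<Sum>j\<in>UNIV. LB x. Itg (%y. pd j \<rho> (y-x)) w \<bullet> fb (lmap (A j) g) x)"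
   by (rule Bochner_Integration.integral_sum) (rule convolution_inner_integrable[OF tj])
  also have "... = (\<Sum>j\<in>UNIV. LB y. fb w y \<bullet> Itg (%x. pd j \<rho> (y-x)) (lmap (A j) g))"
   by (simp only: convolution_swap[OF tj])
  also have "... = (LB y. (\<Sum>j\<in>UNIV. fb w y \<bullet> Itg (%x. pd j \<rho> (y-x)) (lmap (A j) g)))"
   by (rule Bochner_Integration.integral_sum[symmetric]) (rule convolution_inner_integrable2[OF tj])
  also have "... = (LB y. fb w y \<bullet> Itg (%x. \<rho> (y-x)) h)"
   by (simp add: Itg_lmap[OF A_linear sqb_test[OF test_reflect[OF tj]]] gh[OF t2] p2 Itg_minus_fun A_simps sum_negf inner_sum_right)
  also have "... = (LB x. Itg (%y. \<rho> (y-x)) w \<bullet> fb h x)" by (rule convolution_swap[OF \<rho>, symmetric])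
  also have "... = (LB s. \<rho> s*inner (tr s w) h)" by (rule convolution_translates[OF \<rho>, symmetric])
  finally show ?thesis .
 qed
 have cint: "integrable lborel (%s. \<rho> s*inner (tr s u) v)" if \<rho>: "testf \<rho>" for \<rho> and u v :: "(real^'n, 'b) L2"
 proof (rule integrable_dominated)
  show "integrable lborel (%s. \<bar>\<rho> s\<bar>*(norm u*norm v))" using integrable_test[OF \<rho>] by simp
  show "AE s in lborel. norm (\<rho> s*inner (tr s u) v) <= norm (\<bar>\<rho> s\<bar>*(norm u*norm v))"
   using Cauchy_Schwarz_ineq2[of "tr s u" v for s] by (intro AE_I2) (auto simp: abs_mult intro!: mult_left_mono)
  have "continuous_on UNIV (%s. inner (tr s u) v)"
   by (intro continuous_at_imp_continuous_on ballI continuous_intros isCont_tr)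
  hence "(%s. inner (tr s u) v) : borelm" by (rule borel_measurable_continuous_onI)
  thus "(%s. \<rho> s*inner (tr s u) v) : borel_measurable lborel" using test_function_measurable[OF \<rho>] by measurable
 qed
 have "f 0 = 0"
 proof (rule continuous_zero_of_test_integrals)
  show "(%n. f (X n)) ----> f 0" if "X ----> 0" for X
   unfolding f_def by (intro tendsto_intros) (simp_all add: tr_continuous[OF that])
  fix \<rho> :: "real^'n => real" assume \<rho>: "testf \<rho>"
  show "integrable lborel (%x. \<rho> x*f x) & (LB x. \<rho> x*f x) = 0"
   unfolding f_def right_diff_distrib using cint[OF \<rho>] eq[OF \<rho>] by simp
 qed
 thus "inner z g = inner w h" by (simp add: f_def)
qed

text \<open>The product rule holds weakly, and the weak formula characterises \<open>D\<close>.\<close>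

lemma leibniz:
 assumes \<eta>: "testf \<eta>" and uv: "(u, v) : D"
 shows "(mulr \<eta> u, mulr \<eta> v+(\<Sum>j\<in>UNIV. lmap (A j) (mulr (pd j \<eta>) u))) : D"
proof (rule weak_imp_D)
 fix phi :: "real^'n => real" assume phi: "testf phi"
 have t\<eta>: "testf (pd j \<eta>)" and tphi: "testf (pd j phi)" for j
  using test_partial_deriv phi \<eta> by auto
 note q = sqb_test[OF phi] test_function_measurable[OF phi]
 have pd: "pd j (%x. phi x*\<eta> x) = (%x. phi x*pd j \<eta> x+pd j phi x*\<eta> x)" for j
  by (rule ext, rule partial_deriv_mult) (intro test_function_differentiable phi \<eta>)+
 have split: "Itg (pd j (%x. phi x*\<eta> x)) u = Itg (%x. phi x*pd j \<eta> x) u+Itg (%x. pd j phi x*\<eta> x) u" for j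
  unfolding pd by (intro Itg_add_fun sqb_test test_mult2 phi \<eta> t\<eta> tphi)
 have "Itg phi (mulr \<eta> v+(\<Sum>j\<in>UNIV. lmap (A j) (mulr (pd j \<eta>) u)))
  = Itg (%x. phi x*\<eta> x) v+(\<Sum>j\<in>UNIV. A j (Itg (%x. phi x*pd j \<eta> x) u))"
  by (simp add: Itg_add[OF q(1)] Itg_sum[OF q(1)] Itg_lmap[OF A_linear q(1)] Itg_mulr[OF bdd_test[OF \<eta>] q(2)] Itg_mulr[OF bdd_test[OF t\<eta>] q(2)])
 also have "Itg (%x. phi x*\<eta> x) v = - (\<Sum>j\<in>UNIV. A j (Itg (pd j (%x. phi x*\<eta> x)) u))"
  by (rule weak[OF uv test_mult2[OF phi \<eta>]])
 also have "...+(\<Sum>j\<in>UNIV. A j (Itg (%x. phi x*pd j \<eta> x) u)) = - (\<Sum>j\<in>UNIV. A j (Itg (%x. pd j phi x*\<eta> x) u))"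
  unfolding split by (simp add: A_simps sum.distrib)
 also have "... = - (\<Sum>j\<in>UNIV. A j (Itg (pd j phi) (mulr \<eta> u)))"
  by (simp add: Itg_mulr[OF bdd_test[OF \<eta>] test_function_measurable[OF tphi]])
 finally show "Itg phi (mulr \<eta> v+(\<Sum>j\<in>UNIV. lmap (A j) (mulr (pd j \<eta>) u))) = - (\<Sum>j\<in>UNIV. A j (Itg (pd j phi) (mulr \<eta> u)))" .
qed

text \<open>Let \<open>G\<close> be the derivative of \<open>u\<close> in direction \<open>h\<close>. Tested against the dense set of test
  functions, the derivative of \<open>tr (t h) u\<close> in \<open>t\<close> is \<open>tr (t h) G\<close>, so \<open>tr h u - u\<close> is
  an average of translates of \<open>G\<close>.\<close>

lemma translation_estimate:
 assumes uv: "(u, v) : D" and u: "u : closure (Range D)"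
 shows "norm (tr h u-u) <= (\<Sum>j\<in>UNIV. \<bar>h $ j\<bar>)*(C0*norm v)"
proof -
 obtain g where g: "!!j. norm (g j) <= C0*norm v" "!!j phi. testf phi ==> Itg phi (g j) = - Itg (pd j phi) u"
  using coercive[OF uv u] by blast
 define G where "G = (\<Sum>j\<in>UNIV. h $ j *R g j)"
 have G: "norm G <= (\<Sum>j\<in>UNIV. \<bar>h $ j\<bar>)*(C0*norm v)"
  unfolding G_def sum_distrib_right
  by (rule order_trans[OF norm_sum]) (auto intro!: sum_mono mult_left_mono g)
 have IG: "Itg phi G = - Itg (dird h phi) u" if phi: "testf phi" for phi
 proof -
  have s: "Itg (%x. \<Sum>j\<in>I. h $ j*pd j phi x) u = (\<Sum>j\<in>I. h $ j *R Itg (pd j phi) u)" if "finite I" for I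
   using that
  proof (induction I rule: finite_induct)
   case empty thus ?case by (simp add: Itg_def)
  next
   case (insert i I)
   have "Itg (%x. h $ i*pd i phi x+(\<Sum>j\<in>I. h $ j*pd j phi x)) u
    = Itg (%x. h $ i*pd i phi x) u+Itg (%x. \<Sum>j\<in>I. h $ j*pd j phi x) u"
    by (intro Itg_add_fun sqb_test test_cmult test_sum test_partial_deriv phi insert)
   thus ?case using insert by (simp add: Itg_scaleR_fun)
  qed
  have "Itg phi G = (\<Sum>j\<in>UNIV. h $ j *R Itg phi (g j))" unfolding G_def
   by (simp add: Itg_sum[OF sqb_test[OF phi]] Itg_scaleR[OF sqb_test[OF phi]])
  also have "... = - Itg (dird h phi) u" unfolding dird_def[abs_def] s[OF finite[of UNIV]]
   by (simp add: g(2)[OF phi] sum_negf)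
  finally show ?thesis .
 qed
 have der: "((%t. inner (tr (t *R h) u) (tv phi c)) has_real_derivative inner (tr (t *R h) G) (tv phi c)) (at t)"
  if phi: "testf phi" for phi c t
  unfolding DERIV_def tendsto_at_iff_sequentially
 proof (intro allI impI)
  fix s :: "nat => real" assume s: "\<forall>i. s i : UNIV - {0}" "s ----> 0"
  let ?psi = "%x. phi (x + - (t *R h))"
  have psi: "testf ?psi" by (rule test_shift[OF phi])
  have "(%n. (1/- s n) *R (tr (- s n *R h) (tv ?psi c)-tv ?psi c)) ----> tv (dird h ?psi) c"
   using s tendsto_minus[OF s(2)] by (intro tr_difference_quotient[OF psi]) auto
  hence "(%n. - inner u ((1/- s n) *R (tr (- s n *R h) (tv ?psi c)-tv ?psi c))) ---->-inner u (tv (dird h ?psi) c)" by (intro tendsto_intros)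
  also have "- inner u (tv (dird h ?psi) c) = inner G (tv ?psi c)" unfolding inner_tv[OF sqb_test[OF psi]] inner_tv[OF sqb_test[OF test_dird[OF psi]]] IG[OF psi] by simp
  also have "... = inner (tr (t *R h) G) (tv phi c)" by (simp add: inner_tr tr_tv[OF phi])
  finally have L: "(%n. - inner u ((1/- s n) *R (tr (- s n *R h) (tv ?psi c)-tv ?psi c))) ----> inner (tr (t *R h) G) (tv phi c)" .
  have tpsi: "tv ?psi c = tr (- (t *R h)) (tv phi c)" by (simp add: tr_tv[OF phi])
  have s': "- r *R h + - (t *R h) = - ((t+r) *R h)" for r by (simp add: scaleR_add_left)
  show "((%s. (inner (tr ((t+s) *R h) u) (tv phi c)-inner (tr (t *R h) u) (tv phi c))/s) \<circ> s) ----> inner (tr (t *R h) G) (tv phi c)"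
   using L unfolding tpsi tr_tr s' inner_tr o_def by (simp add: inner_diff_right diff_divide_distrib)
 qed
 define I where "I = integral {0..1} (%t. tr (t *R h) G)"
 have c: "continuous_on {0..1} (%t. tr (t *R h) G)"
  by (intro continuous_at_imp_continuous_on ballI isCont_o2[OF _ isCont_tr]) (intro continuous_intros)
 have "inner (tr h u-u-I) (tv phi c') = 0" if phi: "testf phi" for phi c'
 proof -
  have "((%t. inner (tr (t *R h) G) (tv phi c')) has_integral inner (tr (1 *R h) u) (tv phi c')-inner (tr (0 *R h) u) (tv phi c')) {0..1}"
   using der[OF phi] by (intro fundamental_theorem_of_calculus) (auto simp: has_real_derivative_iff_has_vector_derivative intro: has_vector_derivative_at_within)
  thus ?thesis
   using integral_inner_commute[OF integrable_continuous_interval[OF c], of "tv phi c'"] by (simp add: I_def inner_diff_left integral_unique)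
 qed
 hence "Itg phi (tr h u-u-I) \<bullet> c' = 0" if "testf phi" for phi c' using that by (simp add: inner_tv sqb_test)
 hence "tr h u-u-I = 0" by (intro test_functions_separate) (metis inner_eq_zero_iff)
 moreover have "norm I <= norm G*(1-0)" unfolding I_def by (rule integral_bound) (use c in auto)
 ultimately show ?thesis using G by simp
qed

end

section \<open>Off-diagonal decay of the resolvents\<close>

lemma plateau_slope:
 obtains B where "B >= 1" "!!eps a b j x. eps > 0 ==> \<bar>pd j (plateau eps a b :: real^'n::finite => real) x\<bar> <= B/eps"
proof -
 obtain S where "S >= 1" and S: "!!x. \<bar>step' x\<bar> <= S" using step'_bounded by blast
 thus ?thesis using plateau_partial_deriv_bound[OF _ S] by (intro that[of "2*S"]) auto
qed

lemma power_div_fact_le_exp: "0 <= x ==> x^n/fact n <= exp x" for x :: real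
 using sum_le_suminf[OF summable_exp[of x], of "{n}"] by (simp add: exp_def divide_inverse mult.commute)

lemma mulr_scale_fun: assumes "bdd phi" shows "mulr (%x. c*phi x) u = c *R mulr phi u"
proof -
 have "bdd (%x. c*phi x)" using assms unfolding bdd_def
 proof (elim conjE exE, intro conjI exI allI)
  fix C x assume "\<forall>x. \<bar>phi x\<bar> <= C"
  thus "\<bar>c*phi x\<bar> <= \<bar>c\<bar>*C" by (simp add: abs_mult mult_left_mono)
 qed auto
 note bc = this
 show ?thesis
  by (rule L2_eqI) (use fb_mulr[OF bc, of u] fb_mulr[OF assms, of u] fb_scaleR[of c "mulr phi u"] in \<open>eventually_elim, simp\<close>)
qed

lemma bdd_mult: assumes "bdd phi" "bdd psi" shows "bdd (%x. phi x*psi x)"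
proof -
 obtain C C' where C: "!!x. \<bar>phi x\<bar> <= C" "!!x. \<bar>psi x\<bar> <= C'" using assms unfolding bdd_def by blast
 hence "\<bar>phi x*psi x\<bar> <= C*C'" for x
  using mult_mono[OF C(1)[of x] C(2)[of x]] order_trans[OF abs_ge_zero C(1)[of x]] by (simp add: abs_mult)
 thus ?thesis using assms unfolding bdd_def by (intro conjI exI[of _ "C*C'"]) auto
qed

lemma test_exp_minus_1:
 assumes p: "testf p" shows "testf (%x. exp (\<mu>*p x) + - 1)"
proof -
 obtain r where r: "!!x. norm x > r ==> p x = 0" using test_function_bounds[OF p] by metis
 show ?thesis
  by (rule test_functionI[where r = r]) (use p r in \<open>auto intro!: C_k_add[OF C_k_exp[OF C_k_mult[OF C_k_const]] C_k_const[of _ "-1"], simplified] simp: test_function_def\<close>)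
qed

locale dirac_mult = dirac D J A C0 + accretive_op D J b b' \<delta> K
 for D :: "((real^'n::finite, 'b::euclidean_space) L2 \<times> (real^'n, 'b) L2) set" and J A C0 b b' \<delta> K +
 assumes b_mulr: "bdd phi ==> b (mulr phi u) = mulr phi (b u)" and b'_mulr: "bdd phi ==> b' (mulr phi u) = mulr phi (b' u)"
begin

definition A1 :: real where "A1 = 1+(\<Sum>j\<in>UNIV. onorm (A j))"

lemma onorm_A: "norm (A j x) <= onorm (A j)*norm x" "onorm (A j) >= 0" "onorm (A j) <= A1"
proof -
 have bl: "bounded_linear (A j)" for j using A_linear by (simp add: linear_conv_bounded_linear)
 show "norm (A j x) <= onorm (A j)*norm x" "onorm (A j) >= 0" using onorm[OF bl] onorm_pos_le[OF bl] by auto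
 show "onorm (A j) <= A1" unfolding A1_def using member_le_sum[of j UNIV "%j. onorm (A j)"] onorm_pos_le[OF bl] by simp
qed

text \<open>Conjugating with \<open>exp (\<mu> * p)\<close> perturbs the resolvent equation only by multiplication with the slope of the
  weight, which is absorbed when that slope is small compared to \<open>1 / s\<close>.\<close>

lemma exponential_decay:
 assumes p: "testf p" and dp: "!!j x. \<bar>pd j p x\<bar> <= m" and S: "S : sets borel" and p1: "!!x. x : S ==> p x = 1"
  and f: "AE x in lborel. p x = 0 | fb f x = 0" and s: "s ~= 0" and \<mu>: "\<mu> >= 0"
  and small: "\<bar>s\<bar>*(\<bar>K\<bar>*(A1*(\<mu>*m))) <= 1/(2*CR)"
 shows "norm (chi S (R s f)) <= exp (- \<mu>)*(2*CR*norm f)"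
proof -
 \<comment> \<open>Subtracting one makes the weight a test function.\<close>
 define phi where "phi = (%x. exp (\<mu>*p x) + - 1)"
 define x where "x = R s f"
 define y where "y = W s f"
 define z where "z = mulr phi x+x"
 define g where "g = (\<Sum>j\<in>UNIV. lmap (A j) (mulr (pd j phi) x))"
 have t: "testf phi" unfolding phi_def by (rule test_exp_minus_1[OF p])
 note bt = bdd_test[OF t]
 have m0: "m >= 0" using dp[of undefined undefined] by linarith
 have xy: "(x, y) : D" "x+s *R J (b y) = f" unfolding x_def y_def by (rule RW[OF s])+
 have zD: "(z, mulr phi y+g+y) : D" unfolding z_def g_def by (intro D_add leibniz[OF t] xy)
 have phif: "mulr phi f = 0"
  by (rule L2_eqI) (use fb_mulr[OF bt, of f] f fb_zero[where ?'a = "real^'n" and ?'b = 'b] in \<open>eventually_elim, auto simp: phi_def\<close>)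
 have eq: "mulr phi x+x+s *R J (b (mulr phi y+g+y)) = mulr phi (x+s *R J (b y))+(x+s *R J (b y))+s *R J (b g)"
  by (simp add: b_mulr[OF bt] J_mulr[OF bt] mulr_simps[OF bt] scaleR_add_right)
 have "z+s *R J (b (mulr phi y+g+y)) = f+s *R J (b g)" unfolding z_def eq xy(2) phif by simp
 hence zR: "z = R s (f+s *R J (b g))" using RW_eqI(1)[OF s zD] by simp
 have dphi: "pd j phi = (%x. \<mu>*(pd j p x*phi x)+\<mu>*pd j p x)" for j
 proof
  fix x
  have "phi = (%x. exp (\<mu>*p x)*1+(- 1))" by (simp add: phi_def)
  have dl: "(%x. \<mu>*p x) differentiable_on UNIV" by (intro test_function_differentiable test_cmult p)
  have de: "(%x. exp (\<mu>*p x)) differentiable_on UNIV"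
   unfolding differentiable_on_def using has_derivative_exp[OF has_derivative_frechet[OF dl]] differentiableI by blast
  have "pd j phi x = pd j (%x. exp (\<mu>*p x)) x"
   unfolding phi_def by (subst partial_deriv_eqI[OF has_derivative_add[OF has_derivative_frechet[OF de] has_derivative_const]]) (simp add: partial_deriv_def)
  also have "... = \<mu>*pd j p x*exp (\<mu>*p x)"
   unfolding partial_deriv_exp[OF dl]
   by (subst partial_deriv_eqI[OF has_derivative_mult_right[OF has_derivative_frechet[OF test_function_differentiable[OF p]]]]) (simp add: partial_deriv_def)
  finally show "pd j phi x = \<mu>*(pd j p x*phi x)+\<mu>*pd j p x"
   by (simp add: phi_def algebra_simps)
 qed
 have tp: "testf (pd j p)" for j by (rule test_partial_deriv[OF p])
 have mz: "mulr (pd j phi) x = \<mu> *R mulr (pd j p) z" for j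
  unfolding dphi z_def
  by (simp add: mulr_add_fun bdd_test test_cmult test_mult2 test_add t tp mulr_scale_fun mulr_simps mulr_mulr scaleR_add_right)
 have ng: "norm g <= A1*(\<mu>*m)*norm z"
 proof -
  have "norm g <= (\<Sum>j\<in>UNIV. onorm (A j)*(\<mu>*(m*norm z)))" unfolding g_def mz
   by (rule order_trans[OF norm_sum], rule sum_mono, rule order_trans[OF norm_lmap_le[OF A_linear]])
    (use \<mu> norm_mulr_le[OF test_function_measurable[OF tp] dp] onorm_A in \<open>auto intro!: mult_left_mono\<close>)
  also have "... <= A1*(\<mu>*m)*norm z" unfolding sum_distrib_right[symmetric] A1_def using \<mu> m0 by (simp add: mult_ac mult_left_mono distrib_left)
  finally show ?thesis .
 qed
 have "norm (b g) <= \<bar>K\<bar>*(A1*(\<mu>*m)*norm z)"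
 proof -
  have "norm (b g) <= \<bar>K\<bar>*norm g" using b_le[of g] mult_right_mono[OF abs_ge_self norm_ge_zero] order_trans by blast
  also have "... <= \<bar>K\<bar>*(A1*(\<mu>*m)*norm z)" by (intro mult_left_mono ng) auto
  finally show ?thesis .
 qed
 hence "\<bar>s\<bar>*norm (b g) <= \<bar>s\<bar>*(\<bar>K\<bar>*(A1*(\<mu>*m)))*norm z"
  by (simp add: mult.assoc mult_left_mono)
 also have "... <= 1/(2*CR)*norm z" by (rule mult_right_mono[OF small]) simp
 finally have "norm (f+s *R J (b g)) <= norm f+1/(2*CR)*norm z"
  by (intro order_trans[OF norm_triangle_ineq]) simp
 hence "CR*norm (f+s *R J (b g)) <= CR*(norm f+1/(2*CR)*norm z)" using CR_ge1 by (intro mult_left_mono) auto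
 with R_bound[OF s, of "f+s *R J (b g)"] have "norm z <= CR*(norm f+1/(2*CR)*norm z)" unfolding zR[symmetric] by linarith
 hence nz: "norm z <= 2*CR*norm f" using CR_ge1 by (simp add: field_simps)
 have "chi S z = mulr (%x. indicator S x*phi x) x+chi S x"
  unfolding z_def mulr_simps[OF bdd_indicator[OF S]]
  by (simp only: mulr_mulr[OF bdd_indicator[OF S] bt bdd_mult[OF bdd_indicator[OF S] bt]])
 also have "(%x. indicator S x*phi x) = (%x. (exp \<mu>-1)*indicator S x)" by (auto simp: indicator_def phi_def p1)
 finally have "chi S z = exp \<mu> *R chi S x"
  by (simp add: mulr_scale_fun[OF bdd_indicator[OF S]] scaleR_diff_left)
 hence "exp \<mu>*norm (chi S x) <= norm z" using norm_chi_le[OF S, of z] by simp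
 with nz have "exp \<mu>*norm (chi S x) <= 2*CR*norm f" by linarith
 thus ?thesis unfolding x_def by (simp add: exp_minus field_simps)
qed

end

definition cube :: "real^'n => real => (real^'n::finite) set" where "cube a l = {x. \<forall>i. a $ i <= x $ i & x $ i < a $ i+l}"

text \<open>The concentric open cube of side \<open>2 ^ (k + 1) * l\<close>.\<close>

definition dil :: "nat => real^'n => real => (real^'n::finite) set" where
 "dil k a l = box (\<chi> i. a $ i+l/2-2^k*l) (\<chi> i. a $ i+l/2+2^k*l)"

abbreviation cnorm where "cnorm a l u == norm(chi (cube a l) u)"

lemma cube_sets [measurable]: "cube a l : sets borel"
proof -
 have "cube a l = {x : space borel. \<forall>i\<in>UNIV. a $ i <= x $ i & x $ i < a $ i+l}" by (auto simp: cube_def)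
 also have "... : sets borel" by measurable
 finally show ?thesis .
qed

lemma dil_sets [measurable]: "dil k a l : sets borel" by (simp add: dil_def)

context dirac_mult
begin

abbreviation Th :: "real => (real^'n, 'b) L2 => (real^'n, 'b) L2" where "Th l f \<equiv> Q l (b f)"

definition KT :: real where "KT = CR*\<bar>K\<bar>"

lemma Th_bound: "l ~= 0 ==> norm (Th l f) <= KT*norm f"
proof -
 assume "l ~= 0"
 hence "norm (Th l f) <= CR*norm (b f)" by (rule Q_bound)
 also have "... <= CR*(\<bar>K\<bar>*norm f)"
  using b_le[of f] mult_right_mono[OF abs_ge_self norm_ge_zero] CR_ge1 by (intro mult_left_mono) (auto intro: order_trans)
 finally show ?thesis by (simp add: KT_def)
qed


text \<open>The weight is a plateau around the cube with slope of order \<open>1 / (2 ^ k l)\<close>, so a \<open>\<mu>\<close> of size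
  \<open>2 ^ k\<close> is allowed and the gain is \<open>exp (- \<alpha> 2 ^ k)\<close>. This is stated as a power that outweighs the growth
  of volumes and of oscillations in the sums over annuli.\<close>

lemma off_diagonal:
 obtains C where "C >= 0" "!!a l k f. l > 0 ==> chi (dil k a l) f = 0 ==> cnorm a l (Th l f) <= C*(1/2)^(k*(CARD('n)+3))*norm f"
proof -
 obtain B where B: "B >= 1" "!!eps a b j x. eps > 0 ==> \<bar>pd j (plateau eps a b :: real^'n => real) x\<bar> <= B/eps" using plateau_slope[where ?'n = 'n] by blast
 define \<alpha> where "\<alpha> = 1/(4*CR*B*A1*(1+\<bar>K\<bar>))"
 have A1: "A1 >= 1" unfolding A1_def using onorm_A(2) by (simp add: sum_nonneg)
 have pos: "4*CR*B*A1*(1+\<bar>K\<bar>) > 0" using CR_ge1 B(1) A1 by (simp add: add_pos_nonneg)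
 hence \<alpha>: "\<alpha> > 0" by (simp add: \<alpha>_def)
 define C where "C = fact (CARD('n)+3)/\<alpha>^(CARD('n)+3)*(2*CR)*\<bar>K\<bar>"
 have main: "cnorm a l (Th l f) <= C*(1/2)^(k*(CARD('n)+3))*norm f" if l: "l > 0" and f: "chi (dil k a l) f = 0" for a l k and f :: "(real^'n, 'b) L2"
 proof -
  define e where "e = 2^k*l/2"
  have e: "e > 0" using l by (simp add: e_def)
  define p :: "real^'n => real" where "p = plateau e (\<chi> i. a $ i+l/2-2^k*l) (\<chi> i. a $ i+l/2+2^k*l)"
  have l2: "l/2 <= 2^k*l/2" using l by simp
  have p: "testf p" unfolding p_def by (rule test_function_plateau[OF e])
  have dec: "cnorm a l (R s (b f)) <= exp (- (\<alpha>*2^k))*(2*CR*norm (b f))" if s: "\<bar>s\<bar> = l" for s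
  proof (rule exponential_decay[OF p])
   show "\<bar>pd j p x\<bar> <= B/e" for j x unfolding p_def by (rule B(2)[OF e])
   show "p x = 1" if "x : cube a l" for x unfolding p_def
   proof (rule plateau_1[OF e])
    fix i
    have "a $ i <= x $ i & x $ i < a $ i+l" using that by (simp add: cube_def)
    with l2 show "(\<chi> i. a $ i+l/2-2^k*l) $ i+e <= x $ i" "x $ i+e <= (\<chi> i. a $ i+l/2+2^k*l) $ i"
     unfolding e_def vec_lambda_beta by linarith+
   qed
   have "chi (dil k a l) (b f) = 0" by (simp add: b_mulr[symmetric] bdd_indicator f)
   hence "AE x in lborel. indicator (dil k a l) x *R fb (b f) x = 0"
    using fb_mulr[OF bdd_indicator[OF dil_sets[of k a l]], of "b f"] fb_zero[where ?'a = "real^'n" and ?'b = 'b] by (auto elim: eventually_elim2)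
   thus "AE x in lborel. p x = 0 | fb (b f) x = 0"
    unfolding p_def dil_def
    by eventually_elim (use plateau_0[OF e] in \<open>auto simp: indicator_def split: if_splits\<close>)
   have "\<bar>s\<bar>*(\<bar>K\<bar>*(A1*(\<alpha>*2^k*(B/e)))) = 2*\<alpha>*B*A1*\<bar>K\<bar>" using l s by (simp add: e_def field_simps)
   also have "... <= 2*\<alpha>*B*A1*(1+\<bar>K\<bar>)" using \<alpha> B(1) A1 by simp
   also have "... = 1/(2*CR)"
   proof -
    define c where "c = 1+\<bar>K\<bar>"
    have "c ~= 0" "CR ~= 0" "B ~= 0" "A1 ~= 0" using CR_ge1 B(1) A1 by (auto simp: c_def)
    thus ?thesis unfolding \<alpha>_def c_def[symmetric] by simp
   qed
   finally show "\<bar>s\<bar>*(\<bar>K\<bar>*(A1*(\<alpha>*2^k*(B/e)))) <= 1/(2*CR)" .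
  qed (use s l \<alpha> in auto)
  have "chi (cube a l) (Th l f) = (1/2) *R J (chi (cube a l) (R l (b f))-chi (cube a l) (R (- l) (b f)))"
   unfolding Q_def by (simp add: mulr_simps bdd_indicator J_mulr)
  hence "cnorm a l (Th l f) <= (cnorm a l (R l (b f))+cnorm a l (R (- l) (b f)))/2"
   using norm_triangle_ineq4[of "chi (cube a l) (R l (b f))" "chi (cube a l) (R (- l) (b f))"] by (simp only: norm_scaleR norm_J) simp
  also have "... <= exp (- (\<alpha>*2^k))*(2*CR*norm (b f))" using dec[of l] dec[of "- l"] l by simp
  also have "... <= (fact (CARD('n)+3)/\<alpha>^(CARD('n)+3)*(1/2)^(k*(CARD('n)+3)))*(2*CR*(\<bar>K\<bar>*norm f))"
  proof (rule mult_mono)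
   define M where "M = CARD('n)+3"
   have "(\<alpha>*2^k)^M/fact M <= exp (\<alpha>*2^k)" using \<alpha> by (intro power_div_fact_le_exp) simp
   moreover have "(\<alpha>*2^k)^M > 0" using \<alpha> by simp
   ultimately have "exp (- (\<alpha>*2^k)) <= fact M/(\<alpha>*2^k)^M" by (simp add: exp_minus field_simps)
   also have "... = fact M/\<alpha>^M*(1/2)^(k*M)" by (simp add: power_mult_distrib power_mult power_divide)
   finally show "exp (- (\<alpha>*2^k)) <= fact (CARD('n)+3)/\<alpha>^(CARD('n)+3)*(1/2)^(k*(CARD('n)+3))" unfolding M_def .
   show "2*CR*norm (b f) <= 2*CR*(\<bar>K\<bar>*norm f)"
    using b_le[of f] mult_right_mono[OF abs_ge_self norm_ge_zero] CR_ge1 by (intro mult_left_mono) (auto intro: order_trans)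
  qed (use CR_ge1 \<alpha> in auto)
  finally show ?thesis by (simp add: C_def mult_ac)
 qed
 show ?thesis by (rule that[OF _ main]) (use CR_ge1 \<alpha> in \<open>auto simp: C_def\<close>)
qed

end

section \<open>Dyadic subcubes\<close>

definition child :: "real^'n => real => ('n => bool) => real^'n::finite" where
 "child a l e = (\<chi> i. a $ i+(if e i then l/2 else 0))"

text \<open>Sums of a function of cubes over the subcubes of generation \<open>g\<close>, respectively of the generations below
  \<open>g\<close>.\<close>

primrec lev :: "nat => (real^'n => real => 'c::comm_monoid_add) => real^'n::finite => real => 'c" where
 "lev 0 F a l = F a l"
| "lev (Suc g) F a l = (\<Sum>e\<in>UNIV. lev g F (child a l e) (l/2))"

primrec tot :: "nat => (real^'n => real => 'c::comm_monoid_add) => real^'n::finite => real => 'c" where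
 "tot 0 F a l = 0"
| "tot (Suc g) F a l = F a l+(\<Sum>e\<in>UNIV. tot g F (child a l e) (l/2))"

lemma lev_mono:
 fixes F G :: "real^'n::finite => real => 'c::ordered_comm_monoid_add"
 shows "(!!a. F a (l/2^g) <= G a (l/2^g)) ==> lev g F a l <= lev g G a l"
 by (induction g arbitrary: a l) (auto intro!: sum_mono simp: field_simps)

lemma tot_mono:
 fixes F G :: "real^'n::finite => real => 'c::ordered_comm_monoid_add"
 shows "(!!a l. l > 0 ==> F a l <= G a l) ==> l > 0 ==> tot g F a l <= tot g G a l"
 by (induction g arbitrary: a l) (auto intro!: sum_mono add_mono)

lemma lev_additive:
 assumes "!!a l. l > 0 ==> F a l = (\<Sum>e\<in>UNIV. F (child a l e) (l/2))" and "l > 0"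
 shows "lev g F a l = F a l"
 using assms(2)
proof (induction g arbitrary: a l)
 case (Suc g) thus ?case using assms(1)[of l a] by simp
qed simp

lemma tot_eq_sum_lev: "tot N F a l = (\<Sum>g<N. lev g F a l)"
proof (induction N arbitrary: a l)
 case (Suc N)
 have "tot (Suc N) F a l = lev 0 F a l+(\<Sum>e\<in>UNIV. \<Sum>g<N. lev g F (child a l e) (l/2))" by (simp add: Suc)
 also have "(\<Sum>e\<in>UNIV. \<Sum>g<N. lev g F (child a l e) (l/2)) = (\<Sum>g<N. lev (Suc g) F a l)" by (subst sum.swap) simp
 finally show ?case by (simp add: sum.lessThan_Suc_shift del: lev.simps sum.lessThan_Suc)
qed simp

lemma lev_sum: "lev g (%a l. \<Sum>i\<in>I. F i a l) a l = (\<Sum>i\<in>I. lev g (F i) a l)"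
 by (induction g arbitrary: a l) (auto intro: sum.swap)

lemma lev_add: "lev g (%a l. F a l+G a l) a l = lev g F a l+lev g G a l"
 by (induction g arbitrary: a l) (auto simp: sum.distrib)

lemma lev_cmult: "lev g (%a l. c*F a l) a l = c*lev g F a l" for c :: "'c::semiring_0"
 by (induction g arbitrary: a l) (auto simp: sum_distrib_left)

lemma tot_add: "tot g (%a l. F a l+G a l) a l = tot g F a l+tot g G a l"
 and tot_cmult: "tot g (%a l. (c::real)*H a l) a l = c*tot g H a l"
 and tot_sum: "tot g (%a l. \<Sum>i\<in>I. F' i a l) a l = (\<Sum>i\<in>I. tot g (F' i) a l)"
proof -
 show "tot g (%a l. F a l+G a l) a l = tot g F a l+tot g G a l" by (simp add: tot_eq_sum_lev lev_add sum.distrib)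
 show "tot g (%a l. (c::real)*H a l) a l = c*tot g H a l" by (simp add: tot_eq_sum_lev lev_cmult sum_distrib_left)
 show "tot g (%a l. \<Sum>i\<in>I. F' i a l) a l = (\<Sum>i\<in>I. tot g (F' i) a l)" by (simp add: tot_eq_sum_lev lev_sum) (rule sum.swap)
qed

lemma lev_nonneg: "(!!a l. 0 <= F a l) ==> 0 <= lev g F a l" for F :: "_ => _ => real"
 by (induction g arbitrary: a l) (auto intro: sum_nonneg)

lemma ennreal_lev: "(!!a l. 0 <= F a l) ==> ennreal (lev g F a l) = lev g (%a l. ennreal (F a l)) a l"
 by (induction g arbitrary: a l) (auto simp: lev_nonneg sum_ennreal[symmetric])

lemma lev_tendsto:
 fixes F :: "nat => real^'n::finite => real => real"
 shows "(!!a. (%N. F N a (l/2^g)) ----> G a (l/2^g)) ==> (%N. lev g (F N) a l) ----> lev g G a l"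
 by (induction g arbitrary: a l) (auto intro!: tendsto_sum simp: field_simps)

lemma cube_child: "l > 0 ==> x : cube (child a l e) (l/2) \<longleftrightarrow> x : cube a l & e = (%i. a $ i+l/2 <= x $ i)"
 unfolding cube_def child_def fun_eq_iff mem_Collect_eq vec_lambda_beta all_conj_distrib[symmetric]
 by (rule iff_allI) (auto split: if_splits)

lemma indicator_children:
 assumes "l > 0" shows "(indicator (cube a l) x :: 'c::comm_semiring_1) = (\<Sum>e\<in>UNIV. indicator (cube (child a l e) (l/2)) x)"
proof -
 have "(indicator (cube (child a l e) (l/2)) x :: 'c) = (if e = (%i. a $ i+l/2 <= x $ i) then indicator (cube a l) x else 0)" for e
  unfolding indicator_def cube_child[OF assms] by auto
 thus ?thesis by (simp add: sum.delta)
qed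

lemma emeasure_cube: assumes "l > 0" shows "emeasure lborel (cube a l :: (real^'n::finite) set) = ennreal (l^CARD('n))"
proof -
 let ?b = "\<chi> i. a $ i+l"
 have c: "measure lborel (cbox a ?b) = l^CARD('n)" using assms by (subst content_cbox_cart) (auto simp: interval_eq_empty_cart intro: less_imp_le)
 have e: "emeasure lborel (cbox a ?b) = ennreal (l^CARD('n))"
  using emeasure_eq_ennreal_measure[of lborel "cbox a ?b"] c emeasure_lborel_cbox_finite[of a ?b] by (simp add: less_top)
 have "emeasure lborel (cube a l) <= emeasure lborel (cbox a ?b)"
  by (rule emeasure_mono) (auto simp: cube_def mem_box_cart less_imp_le)
 moreover have "emeasure lborel (cbox a ?b) <= emeasure lborel (cube a l)"
 proof -
  have "emeasure lborel (cbox a ?b) = emeasure lborel (box a ?b)" by (simp add: emeasure_lborel_cbox_eq emeasure_lborel_box_eq)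
  also have "... <= emeasure lborel (cube a l)" by (rule emeasure_mono) (auto simp: cube_def mem_box_cart less_imp_le)
  finally show ?thesis .
 qed
 ultimately show ?thesis using e by simp
qed

lemma measure_cube: "l > 0 ==> measure lborel (cube a l :: (real^'n::finite) set) = l^CARD('n)"
 by (simp add: measure_def emeasure_cube)

lemma sqb_indicator: assumes [measurable]: "S : sets borel" and "bounded S" shows "sqb (indicator S :: 'a::euclidean_space => real)"
proof -
 obtain r where "!!x. x : S ==> norm x <= r" using assms(2) unfolding bounded_iff by blast
 thus ?thesis by (intro sqb_bounded_support[where r = r and M = 1]) (auto simp: indicator_def not_le[symmetric])
qed

lemma bounded_cube: "bounded (cube a l :: (real^'n::finite) set)"
 by (rule bounded_subset[OF bounded_cbox[of a "\<chi> i. a $ i+l"]]) (auto simp: cube_def mem_box_cart less_imp_le)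

lemma sqb_cube [simp]: "sqb (indicator (cube a l) :: real^'n::finite => real)"
 and sqb_dil [simp]: "sqb (indicator (dil k a l) :: real^'n::finite => real)"
 by (auto intro!: sqb_indicator bounded_cube simp: dil_def bounded_box)

lemma bdd_cube [simp]: "bdd (indicator (cube a l))" and bdd_dil [simp]: "bdd (indicator (dil k a l))"
 by (auto intro: bdd_indicator)

lemma chi_chi: assumes "S : sets borel" "T : sets borel" shows "chi S (chi T u) = chi (S \<inter> T) u"
proof -
 have "(%x. indicator S x*indicator T x) = (indicator (S \<inter> T) :: _ => real)" by (auto simp: indicator_def)
 thus ?thesis using mulr_mulr[OF bdd_indicator[OF assms(1)] bdd_indicator[OF assms(2)]] bdd_indicator[of "S \<inter> T"] assms by simp
qed

lemma Itg_ind_chi: "S : sets borel ==> Itg (indicator S) (chi S u) = Itg (indicator S) u"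
 by (subst Itg_mulr) (auto simp: bdd_indicator indicator_def intro!: arg_cong[where f = "%h. Itg h u"])

lemma norm_Itg_indicator:
 assumes S: "S : sets borel" "bounded S" shows "(norm (Itg (indicator S) u))^2 <= measure lborel S*(norm (chi S u))^2"
proof -
 have "(%x. (indicator S x :: real)^2) = indicator S" by (auto simp: indicator_def)
 hence "norm (Itg (indicator S) (chi S u)) <= sqrt (measure lborel S)*norm (chi S u)"
  using norm_Itg_le[OF sqb_indicator[OF S], of "chi S u"] S by simp
 thus ?thesis using power_mono[of "norm (Itg (indicator S) u)" "sqrt (measure lborel S)*norm (chi S u)" 2] by (simp add: Itg_ind_chi[OF S(1)] power_mult_distrib)
qed

definition avg :: "real^'n::finite => real => (real^'n, 'b::euclidean_space) L2 => 'b" where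
 "avg a l u = (1/l^CARD('n)) *R Itg (indicator (cube a l)) u"

lemma avg_simps: "avg a l (u+v) = avg a l u+avg a l v" "avg a l (u-v) = avg a l u-avg a l v"
 by (simp_all add: avg_def Itg_add Itg_diff scaleR_add_right scaleR_diff_right)

lemma avg_le: "l > 0 ==> l^CARD('n)*(norm (avg a l (u :: (real^'n::finite, 'b::euclidean_space) L2)))^2 <= (cnorm a l u)^2"
 using norm_Itg_indicator[of "cube a l" u] by (simp add: avg_def bounded_cube measure_cube power_mult_distrib power2_eq_square divide_simps mult_ac)

lemma Itg_children:
 fixes u :: "(real^'n::finite, 'b::euclidean_space) L2"
 assumes "l > 0" shows "Itg (indicator (cube a l)) u = (\<Sum>e\<in>UNIV. Itg (indicator (cube (child a l e) (l/2))) u)"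
 unfolding Itg_def indicator_children[OF assms] scaleR_sum_left
 by (rule Bochner_Integration.integral_sum) (rule integrable_Itg, simp)

lemma nn_integral_children:
 assumes "l > 0" "f : borelm"
 shows "(NN x. indicator (cube a l) x*f x) = (\<Sum>e\<in>UNIV. NN x. indicator (cube (child a l e) (l/2)) x*f x)"
 unfolding indicator_children[OF assms(1)] sum_distrib_right using assms(2) by (intro nn_integral_sum) measurable

lemma lev_nn_integral: "l > 0 ==> f : borelm ==>
 lev g (%a l. NN x. indicator (cube a l) x*f x) a l = (NN x. indicator (cube a l) x*f x)"
 by (rule lev_additive) (auto intro: nn_integral_children)

lemma norm_chi_children: "l > 0 ==> (cnorm a l u)^2 = (\<Sum>e\<in>UNIV. (cnorm (child a l e) (l/2) u)^2)"
 using nn_integral_children[of l "%x. ennreal ((norm (fb u x))^2)" a]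
 by (simp add: nn_norm_chi[symmetric] sum_nonneg)

lemma lev_norm_chi: "l > 0 ==> lev g (%a l. (cnorm a l u)^2) a l = (cnorm a l u)^2"
 by (rule lev_additive) (auto intro: norm_chi_children)

lemma vol_children: "(l::real)^CARD('n) = (\<Sum>e\<in>(UNIV :: ('n::finite => bool) set). (l/2)^CARD('n))"
 by (simp add: card_fun power_divide)

section \<open>The principal part and the oscillation estimate\<close>

lemma chi_tendsto:
 fixes u :: "('a::euclidean_space, 'b::euclidean_space) L2"
 assumes S: "!!n. S n : sets borel" and ev: "!!x. eventually (%n. x : S n) sequentially"
 shows "(%n. chi (S n) u) ----> u"
proof -
 have [measurable]: "S n : sets borel" for n by (rule S)
 have e: "(norm (chi (S n) u-u))^2 = (LB x. (1-indicator (S n) x)*(norm (fb u x))^2)" for n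
  unfolding norm_L2_sq
  by (rule integral_cong_AE, measurable)
   (use fb_diff[of "chi (S n) u" u] fb_mulr[OF bdd_indicator[OF S[of n]], of u] in \<open>eventually_elim, auto simp: indicator_def\<close>)
 have "(%n. LB x. (1-indicator (S n) x)*(norm (fb u x))^2) ----> (LINT x|(lborel::'a measure). 0)"
 proof (rule integral_dominated_convergence[where w = "%x. (norm (fb u x))^2"])
  show "AE x in lborel. (%n. (1-indicator (S n) x)*(norm (fb u x))^2) ----> 0"
  proof (intro AE_I2 tendsto_eventually)
   fix x show "eventually (%n. (1-indicator (S n) x)*(norm (fb u x))^2 = 0) sequentially"
    by (rule eventually_mono[OF ev[of x]]) simp
  qed
 qed (auto simp: integrable_fb_sq indicator_def)
 hence "(%n. (norm (chi (S n) u-u))^2) ----> 0" unfolding e by simp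
 hence "(%n. sqrt ((norm (chi (S n) u-u))^2)) ----> sqrt 0" by (intro tendsto_intros)
 thus ?thesis by (simp add: LIM_zero_iff tendsto_norm_zero_iff)
qed

lemma chi_tv: assumes S: "S : sets borel" and T: "T : sets borel" "bounded T"
 shows "chi S (tv (indicator T) w) = tv (indicator (S \<inter> T)) w"
proof -
 have q: "sqb (indicator (S \<inter> T) :: _ => real)" using S T by (intro sqb_indicator) (auto intro: bounded_subset)
 show ?thesis
  by (rule L2_eqI) (use fb_mulr[OF bdd_indicator[OF S], of "tv (indicator T) w"] fb_tv[OF sqb_indicator[OF T], of w] fb_tv[OF q, of w] in
    \<open>eventually_elim, simp add: indicator_inter_arith\<close>)
qed

lemma bounded_dil [simp]: "bounded (dil k a l)" by (simp add: dil_def bounded_box)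

lemma norm_minus_chi_le: assumes "S : sets borel" shows "norm (u-chi S u) <= norm u"
proof -
 have i: "inner (chi S u) (chi S u) = inner u (chi S u)"
  using inner_mulr[OF bdd_indicator[OF assms], of u "chi S u"] chi_chi[OF assms assms, of u] by simp
 have "inner (u-chi S u) (u-chi S u) = inner u u-inner (chi S u) (chi S u)"
  using i by (simp add: inner_diff_left inner_diff_right inner_commute)
 also have "... <= inner u u" by simp
 finally show ?thesis by (simp add: norm_eq_sqrt_inner)
qed

lemma half_power_sum: "(\<Sum>k\<le>N. (1/2 :: real)^k) <= 2"
proof -
 have "(\<Sum>k\<le>N. (1/2 :: real)^k) = 2-(1/2)^N" by (induction N) (auto simp: field_simps)
 thus ?thesis by simp
qed

lemma dil_Suc_subset: "l > 0 ==> dil k a l \<subseteq> dil (Suc k) a l"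
 by (auto simp: dil_def mem_box_cart) (smt (verit, best) mult_less_cancel_right_pos zero_less_power mult_pos_pos)+

lemma measure_dil: assumes "l > 0" shows "measure lborel (dil k a l :: (real^'n::finite) set) = (2^Suc k*l)^CARD('n)"
proof -
 have p: "2^k*l > 0" using assms by simp
 let ?lo = "\<chi> i. a $ i+l/2-2^k*l :: real^'n" and ?hi = "\<chi> i. a $ i+l/2+2^k*l :: real^'n"
 have "measure lborel (dil k a l) = measure lborel (cbox ?lo ?hi)" unfolding dil_def by (simp add: measure_def emeasure_lborel_cbox_eq emeasure_lborel_box_eq)
 also have "... = (2^Suc k*l)^CARD('n)" using p by (subst content_cbox_cart) (auto simp: interval_eq_empty_cart algebra_simps simp flip: power_mult_distrib)
 finally show ?thesis .
qed

text \<open>The deviation of \<open>u\<close> from a constant on an enlarged cube.\<close>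

definition dev :: "nat => real^'n => real => (real^'n::finite, 'b::euclidean_space) L2 => 'b => (real^'n, 'b) L2" where
 "dev k a l u w = chi (dil k a l) u-tv (indicator (dil k a l)) w"

lemma fb_dev: "AE x in lborel. fb (dev k a l u w) x = indicator (dil k a l) x *R (fb u x-w)"
 using fb_diff[of "chi (dil k a l) u" "tv (indicator (dil k a l)) w"] fb_mulr[OF bdd_dil[of k a l], of u] fb_tv[OF sqb_dil[of k a l], of w]
 unfolding dev_def by eventually_elim (simp add: scaleR_diff_right)

lemma chi_dev: "l > 0 ==> chi (dil k a l) (dev (Suc k) a l u w) = dev k a l u w"
 using dil_Suc_subset[of l k a] by (simp add: dev_def mulr_simps chi_chi chi_tv Int_absorb2)

lemma integral_indicator_dil: "(LB x. indicator (dil k a l) x) = measure lborel (dil k a l)" by simp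

lemma norm_tv_dil: "l > 0 ==> norm (tv (indicator (dil k a l)) w :: (real^'n::finite, 'b::euclidean_space) L2) <= 2^(Suc k*CARD('n))*(sqrt (l^CARD('n))*norm w)"
proof -
 assume l: "l > 0"
 have i: "(%x. (indicator (dil k a l) x :: real)^2) = indicator (dil k a l)" by (auto simp: indicator_def)
 have m: "measure lborel (dil k a l) = 2^(Suc k*CARD('n))*l^CARD('n)"
  unfolding measure_dil[OF l] by (simp only: power_mult_distrib power_mult)
 have n: "norm (tv (indicator (dil k a l)) w :: (real^'n, 'b) L2) = sqrt (2^(Suc k*CARD('n)))*(sqrt (l^CARD('n))*norm w)"
  unfolding norm_tv[OF sqb_dil] i by (simp only: integral_indicator_dil m real_sqrt_mult mult.assoc)
 have "sqrt x <= x" if "x >= 1" for x :: real using that by (simp add: real_le_lsqrt power2_eq_square sqrt_le_D)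
 hence "sqrt (2^(Suc k*CARD('n))) <= 2^(Suc k*CARD('n))" by simp
 thus ?thesis unfolding n by (rule mult_right_mono) (use l in simp)
qed

context dirac_mult
begin

text \<open>Split the enlarged cube into dyadic annuli and apply the off-diagonal decay to each.\<close>

lemma annuli:
 obtains C where "C >= 0" "!!N a l u w. l > 0 ==> cnorm a l (Th l (dev N a l u w)) <= C*(\<Sum>k\<le>N. (1/2)^(k*(CARD('n)+3))*norm (dev k a l u w))"
proof -
 obtain C0 where C0: "C0 >= 0" "!!a l k f. l > 0 ==> chi (dil k a l) f = 0 ==> cnorm a l (Th l f) <= C0*(1/2)^(k*(CARD('n)+3))*norm f"
  using off_diagonal by blast
 define M where "M = CARD('n)+3"
 define C where "C = KT+C0*2^M"
 have KT: "KT >= 0" using CR_ge1 by (simp add: KT_def)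
 have main: "cnorm a l (Th l (dev N a l u w)) <= C*(\<Sum>k\<le>N. (1/2)^(k*M)*norm (dev k a l u w))" if l: "l > 0" for N a l u w
 proof (induction N)
  case 0
  have "cnorm a l (Th l (dev 0 a l u w)) <= KT*norm (dev 0 a l u w)"
   using l by (intro order_trans[OF norm_chi_le Th_bound]) auto
  also have "... <= C*norm (dev 0 a l u w)" using C0(1) by (intro mult_right_mono) (auto simp: C_def)
  finally show ?case by simp
 next
  case (Suc N)
  define d where "d = dev (Suc N) a l u w-chi (dil N a l) (dev (Suc N) a l u w)"
  have e: "dev (Suc N) a l u w = dev N a l u w+d" by (simp add: d_def chi_dev[OF l])
  have d0: "chi (dil N a l) d = 0" by (simp add: d_def mulr_simps chi_chi)
  have nd: "norm d <= norm (dev (Suc N) a l u w)" unfolding d_def by (rule norm_minus_chi_le) simp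
  have "cnorm a l (Th l (dev (Suc N) a l u w)) <= cnorm a l (Th l (dev N a l u w))+cnorm a l (Th l d)"
   unfolding e using l by (simp add: UQ_simps mulr_simps norm_triangle_ineq)
  also have "cnorm a l (Th l d) <= C0*(1/2)^(N*M)*norm (dev (Suc N) a l u w)"
   using C0(2)[OF l d0] mult_left_mono[OF nd, of "C0*(1/2)^(N*M)"] C0(1) by (simp add: M_def)
  also have "... = C0*2^M*((1/2)^(Suc N*M)*norm (dev (Suc N) a l u w))" by (simp add: power_add power_divide)
  also have "... <= C*((1/2)^(Suc N*M)*norm (dev (Suc N) a l u w))" by (rule mult_right_mono) (auto simp: C_def KT)
  finally show ?case using Suc.IH by (simp add: distrib_left)
 qed
 show ?thesis by (rule that[of C]) (use main C0(1) KT in \<open>auto simp: C_def M_def\<close>)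
qed

text \<open>The action of \<open>Th l\<close> on constants, localised to a cube of the matching scale.\<close>

definition G :: "real^'n => real => 'b => (real^'n, 'b) L2" where
 "G a l w = lim (%N. chi (cube a l) (Th l (tv (indicator (dil N a l)) w)))"

text \<open>Consecutive terms differ by the value of \<open>Th l\<close> on a constant in an annulus, where the decay outweighs the volume
  \<open>2 ^ (k n)\<close>.\<close>

lemma G_lim: assumes l: "l > 0" shows "(%N. chi (cube a l) (Th l (tv (indicator (dil N a l)) w))) ----> G a l w"
proof -
 define X where "X = (%N. chi (cube a l) (Th l (tv (indicator (dil N a l)) w)))"
 define c where "c = sqrt (l^CARD('n))*norm w"
 obtain C0 where C0: "C0 >= 0" "!!a l k f. l > 0 ==> chi (dil k a l) f = 0 ==> cnorm a l (Th l f) <= C0*(1/2)^(k*(CARD('n)+3))*norm f"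
  using off_diagonal by blast
 have step: "norm (X (Suc N)-X N) <= C0*4^CARD('n)*c*(1/2)^N" for N
 proof -
  define t where "t = (tv (indicator (dil (Suc N) a l)) w :: (real^'n, 'b) L2)"
  have e: "tv (indicator (dil N a l)) w = chi (dil N a l) t"
   unfolding t_def using dil_Suc_subset[OF l, of N a] by (subst chi_tv) (auto simp: Int_absorb2)
  have "norm (X (Suc N)-X N) = cnorm a l (Th l (t-chi (dil N a l) t))"
   unfolding X_def e t_def[symmetric] using l by (simp add: UQ_simps mulr_simps)
  also have "... <= C0*(1/2)^(N*(CARD('n)+3))*norm (t-chi (dil N a l) t)"
   by (rule C0(2)[OF l]) (simp add: mulr_simps chi_chi)
  also have "... <= C0*(1/2)^(N*(CARD('n)+3))*(2^(Suc (Suc N)*CARD('n))*c)"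
   unfolding c_def using C0(1) by (intro mult_left_mono order_trans[OF norm_minus_chi_le norm_tv_dil[OF l, of "Suc N" a w, folded t_def]]) auto
  also have "... = C0*4^CARD('n)*c*(1/2)^(3*N)"
  proof -
   have "(2::real)^(Suc (Suc N)*CARD('n)) = 4^CARD('n)*2^(N*CARD('n))"
    by (simp add: power_add power_mult_distrib[symmetric] flip: power_mult_distrib)
   moreover have "(1/2::real)^(N*(CARD('n)+3)) = (1/2)^(3*N)*(1/2)^(N*CARD('n))"
    by (simp add: power_add[symmetric] algebra_simps)
   moreover have "(1/2::real)^(N*CARD('n))*2^(N*CARD('n)) = 1" by (simp add: power_mult_distrib[symmetric])
   ultimately show ?thesis by simp
  qed
  also have "... <= C0*4^CARD('n)*c*(1/2)^N"
   using C0(1) l by (intro mult_left_mono power_decreasing) (auto simp: c_def)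
  finally show ?thesis .
 qed
 have "summable (%N. X (Suc N)-X N)"
  by (rule summable_comparison_test'[OF _ step]) (intro summable_mult summable_geometric, simp)
 hence "(%n. \<Sum>N<n. X (Suc N)-X N) ----> (\<Sum>N. X (Suc N)-X N)" by (rule summable_LIMSEQ)
 hence "(%n. X n-X 0) ----> (\<Sum>N. X (Suc N)-X N)" by (simp add: sum_lessThan_telescope)
 hence "(%n. (X n-X 0)+X 0) ----> (\<Sum>N. X (Suc N)-X N)+X 0" by (intro tendsto_intros)
 hence "convergent X" by (auto simp: convergent_def)
 thus ?thesis unfolding G_def X_def[symmetric] by (simp add: convergent_LIMSEQ_iff)
qed

lemma G_linear: assumes l: "l > 0" shows "linear (G a l)"
proof (rule linearI)
 fix w w' and c :: real
 have "(%N. chi (cube a l) (Th l (tv (indicator (dil N a l)) (w+w')))) ----> G a l w+G a l w'"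
  using tendsto_add[OF G_lim[OF l, of a w] G_lim[OF l, of a w']] l by (simp add: tv_add_vec UQ_simps mulr_simps)
 thus "G a l (w+w') = G a l w+G a l w'" using LIMSEQ_unique[OF G_lim[OF l]] by blast
 have "(%N. chi (cube a l) (Th l (tv (indicator (dil N a l)) (c *R w)))) ----> c *R G a l w"
  using tendsto_scaleR[OF tendsto_const G_lim[OF l, of a w]] l by (simp add: tv_scale_vec UQ_simps mulr_simps)
 thus "G a l (c *R w) = c *R G a l w" using LIMSEQ_unique[OF G_lim[OF l]] by blast
qed

lemma G_bound:
 obtains C where "C >= 0" "!!a l w. l > 0 ==> (norm (G a l w))^2 <= C*(l^CARD('n)*(norm w)^2)"
proof -
 obtain C where C: "C >= 0" "!!N a l u w. l > 0 ==> cnorm a l (Th l (dev N a l u w)) <= C*(\<Sum>k\<le>N. (1/2)^(k*(CARD('n)+3))*norm (dev k a l u w))"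
  using annuli by blast
 define C' where "C' = C*(2^CARD('n)*2)"
 have b: "norm (G a l w) <= C'*(sqrt (l^CARD('n))*norm w)" if l: "l > 0" for a l w
 proof (rule LIMSEQ_le_const2[OF tendsto_norm[OF G_lim[OF l]]], intro exI allI impI)
  fix N
  define c where "c = sqrt (l^CARD('n))*norm w"
  have d: "dev k a l 0 w = - tv (indicator (dil k a l)) w" for k by (simp add: dev_def mulr_simps)
  have "cnorm a l (Th l (tv (indicator (dil N a l)) w)) = cnorm a l (Th l (dev N a l 0 w))"
   unfolding d using l by (simp add: linear_neg[OF linear_mulr[OF bdd_cube]] linear_neg[OF Q_linear])
  also have "... <= C*(\<Sum>k\<le>N. (1/2)^(k*(CARD('n)+3))*norm (dev k a l 0 w))" by (rule C(2)[OF l])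
  also have "... <= C*(\<Sum>k\<le>N. 2^CARD('n)*c*(1/2)^k)"
  proof (intro mult_left_mono sum_mono C(1))
   fix k
   have "(1/2)^(k*(CARD('n)+3))*norm (dev k a l 0 w) <= (1/2)^(k*(CARD('n)+3))*(2^(Suc k*CARD('n))*c)"
    unfolding d norm_minus_cancel c_def by (intro mult_left_mono norm_tv_dil l) auto
   also have "... = 2^CARD('n)*c*(1/2)^(3 * k)"
   proof -
    have "(1/2::real)^(k*(CARD('n)+3)) = (1/2)^(3 * k)*(1/2)^(k*CARD('n))"
     by (simp add: power_add[symmetric] algebra_simps)
    moreover have "(1/2::real)^(k*CARD('n))*2^(k*CARD('n)) = 1" by (simp add: power_mult_distrib[symmetric])
    ultimately show ?thesis by (simp add: power_add)
   qed
   also have "... <= 2^CARD('n)*c*(1/2)^k"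
    using l by (intro mult_left_mono power_decreasing) (auto simp: c_def)
   finally show "(1/2)^(k*(CARD('n)+3))*norm (dev k a l 0 w) <= 2^CARD('n)*c*(1/2)^k" .
  qed
  also have "... <= C*(2^CARD('n)*c*2)"
   unfolding sum_distrib_left[symmetric] using l by (intro mult_left_mono half_power_sum C(1)) (auto simp: c_def)
  finally show "cnorm a l (Th l (tv (indicator (dil N a l)) w)) <= C'*c" by (simp add: C'_def mult_ac)
 qed
 show ?thesis
 proof (rule that[of "C'^2"])
  show "(norm (G a l w))^2 <= C'^2*(l^CARD('n)*(norm w)^2)" if l: "l > 0" for a l w
   using power_mono[OF b[OF l, of a w], of 2] l by (simp add: power_mult_distrib)
 qed simp
qed

end

text \<open>By Jensen's inequality the deviation from the mean is controlled by differences, \<open>u (y + h) - u y\<close> with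
  \<open>y\<close> in the cube; these have bounded overlap when summed over the cubes of one generation.\<close>

lemma dev_avg_le:
 fixes u :: "(real^'n::finite, 'b::euclidean_space) L2"
 assumes l: "l > 0"
 shows "ennreal ((norm (dev k a l u (avg a l u)))^2) <= (NN y. indicator (cube a l) y *
  (ennreal (1/l^CARD('n))*(NN h. indicator {h. \<forall>i. \<bar>h $ i\<bar> <= 2^Suc k*l} h*ennreal ((norm (fb u (y+h)-fb u y))^2))))"
proof -
 let ?n = "l^CARD('n)" and ?H = "{h :: real^'n. \<forall>i. \<bar>h $ i\<bar> <= 2^Suc k*l}"
 have n0: "?n > 0" using l by simp
 have H [measurable]: "?H : sets borel"
  by (intro borel_closed) (auto intro!: closed_Collect_all closed_Collect_le continuous_intros)
 have jensen: "ennreal ((norm (c-avg a l u))^2) <= ennreal (1/?n)*(NN y. indicator (cube a l) y*ennreal ((norm (c-fb u y))^2))" for c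
 proof -
  let ?v = "tv (indicator (cube a l)) c-u"
  have "Itg (indicator (cube a l)) ?v = ?n *R (c-avg a l u)"
  proof -
   have i: "indicator (cube a l) x *R (indicator (cube a l) x *R c) = indicator (cube a l) x *R c" for x by (simp add: indicator_def)
   have "Itg (indicator (cube a l)) (tv (indicator (cube a l)) c) = (LB x. indicator (cube a l) x *R c)"
    using Itg_cong[OF fb_tv[OF sqb_cube[of a l], of c], of "indicator (cube a l)"] unfolding i by simp
   also have "... = ?n *R c" using l by (simp add: measure_cube emeasure_cube)
   finally have "Itg (indicator (cube a l)) (tv (indicator (cube a l)) c) = ?n *R c" .
   thus ?thesis using l by (simp add: Itg_diff avg_def scaleR_diff_right)
  qed
  hence "(?n*norm (c-avg a l u))^2 <= ?n*(cnorm a l ?v)^2"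
   using norm_Itg_indicator[of "cube a l" ?v] l by (simp add: bounded_cube measure_cube)
  hence "(norm (c-avg a l u))^2 <= 1/?n*(cnorm a l ?v)^2"
   using n0 by (simp add: field_simps power2_eq_square)
  hence "ennreal ((norm (c-avg a l u))^2) <= ennreal (1/?n)*ennreal ((cnorm a l ?v)^2)"
   using n0 by (simp add: ennreal_mult[symmetric] ennreal_leI)
  also have "ennreal ((cnorm a l ?v)^2) = (NN y. indicator (cube a l) y*ennreal ((norm (c-fb u y))^2))"
   unfolding nn_norm_chi[OF cube_sets]
   by (rule nn_integral_cong_AE) (use fb_diff[of "tv (indicator (cube a l)) c" u] fb_tv[OF sqb_cube[of a l], of c] in \<open>eventually_elim, simp add: indicator_def\<close>)
  finally show ?thesis .
 qed
 let ?f = "%h y. ennreal ((norm (fb u (y+h)-fb u y))^2)"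
 let ?e = "%x y. ennreal ((norm (fb u x-fb u y))^2)"
 have "ennreal ((norm (dev k a l u (avg a l u)))^2) = (NN x. indicator (dil k a l) x*ennreal ((norm (fb u x-avg a l u))^2))"
  unfolding nn_norm_L2 by (rule nn_integral_cong_AE) (use fb_dev[of k a l u "avg a l u"] in \<open>eventually_elim, simp add: indicator_def\<close>)
 also have "... <= (NN x. indicator (dil k a l) x*(ennreal (1/?n)*(NN y. indicator (cube a l) y*(?e x y))))"
  by (intro nn_integral_mono mult_left_mono jensen) simp
 also have "... = (NN x. (NN y. indicator (dil k a l) x*(ennreal (1/?n)*(indicator (cube a l) y*(?e x y)))))"
  by (simp add: nn_integral_cmult)
 also have "... = (NN y. (NN x. indicator (dil k a l) x*(ennreal (1/?n)*(indicator (cube a l) y*(?e x y)))))"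
  by (rule lborel_pair.Fubini') measurable
 also have "... <= (NN y. indicator (cube a l) y*(ennreal (1/?n)*(NN h. indicator ?H h*(?f h y))))"
 proof (rule nn_integral_mono)
  fix y :: "real^'n"
  have "(NN x. indicator (dil k a l) x*(ennreal (1/?n)*(indicator (cube a l) y*(?e x y))))
   = (NN h. indicator (dil k a l) (h+y)*(ennreal (1/?n)*(indicator (cube a l) y*ennreal ((norm (fb u (h+y)-fb u y))^2))))"
   by (rule nn_integral_shift[symmetric]) measurable
  also have "... <= (NN h. indicator (cube a l) y*(ennreal (1/?n)*(indicator ?H h*(?f h y))))"
  proof (rule nn_integral_mono)
   fix h :: "real^'n"
   have "h : ?H" if "h+y : dil k a l" "y : cube a l"
   proof safe
    fix i
    have "l <= 2^k*l" using l by simp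
    moreover have "a $ i+l/2-2^k*l < h $ i+y $ i" "h $ i+y $ i < a $ i+l/2+2^k*l"
     using that(1) by (auto simp: dil_def mem_box_cart)
    moreover have "a $ i <= y $ i" "y $ i < a $ i+l" using that(2) by (auto simp: cube_def)
    ultimately show "\<bar>h $ i\<bar> <= 2^Suc k*l" unfolding power_Suc mult.assoc using l by linarith
   qed
   thus "indicator (dil k a l) (h+y)*(ennreal (1/?n)*(indicator (cube a l) y*ennreal ((norm (fb u (h+y)-fb u y))^2)))
    <= indicator (cube a l) y*(ennreal (1/?n)*(indicator ?H h*(?f h y)))"
    by (cases "h+y : dil k a l & y : cube a l") (auto simp: indicator_def add.commute)
  qed
  also have "... = indicator (cube a l) y*(ennreal (1/?n)*(NN h. indicator ?H h*(?f h y)))"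
   by (simp add: nn_integral_cmult)
  finally show "(NN x. indicator (dil k a l) x*(ennreal (1/?n)*(indicator (cube a l) y*(?e x y))))
   <= indicator (cube a l) y*(ennreal (1/?n)*(NN h. indicator ?H h*(?f h y)))" .
 qed
 finally show ?thesis .
qed

context dirac_mult
begin

lemma C0_nonneg: "(u, v) : D ==> u : closure (Range D) ==> 0 <= C0*norm v"
 using coercive by (meson norm_ge_zero order_trans)

text \<open>Each \<open>y\<close> lies in one cube of the generation, so the sum over cubes of the right-hand side of
  \<open>dev_avg_le\<close> is an integral over \<open>h\<close> of squared norms of \<open>u - tr h u\<close>, to which
  \<open>translation_estimate\<close> applies.\<close>

lemma lev_dev:
 assumes l: "l > 0" and uv: "(u, v) : D" and u: "u : closure (Range D)"
 shows "lev g (%a l. (norm (dev k a l u (avg a l u)))^2) a l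
  <= (2^(k+2))^CARD('n)*(real CARD('n)*(2^Suc k*(l/2^g))*(C0*norm v))^2"
proof -
 define r where "r = l/2^g"
 have r: "r > 0" using l by (simp add: r_def)
 let ?n = "r^CARD('n)" and ?H = "{h :: real^'n. \<forall>i. \<bar>h $ i\<bar> <= 2^Suc k*r}"
 let ?c = "real CARD('n)*(2^Suc k*r)*(C0*norm v)"
 have n0: "?n > 0" using r by simp
 have C0v: "C0*norm v >= 0" by (rule C0_nonneg[OF uv u])
 have Hc: "?H = cbox (\<chi> i. - (2^Suc k*r)) (\<chi> i. 2^Suc k*r)" by (auto simp: mem_box_cart abs_le_iff) (smt (verit))+
 have H [measurable]: "?H : sets borel" unfolding Hc by simp
 have eH: "emeasure lborel ?H = ennreal ((2^(k+2)*r)^CARD('n))"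
  unfolding Hc using r by (subst emeasure_lborel_cbox_eq, auto simp: Basis_vec_def inner_axis image_UN[symmetric] prod.UNION_disjoint axis_eq_axis card_UN_disjoint, simp add: power_mult_distrib)
 let ?e = "%h y. ennreal ((norm (fb u (y+h)-fb u y))^2)"
 define psi where "psi = (%y. ennreal (1/?n)*(NN h. indicator ?H h*(?e h y)))"
 have psim [measurable]: "psi : borelm" unfolding psi_def by measurable
 have "ennreal (lev g (%a l. (norm (dev k a l u (avg a l u)))^2) a l) = lev g (%a l. ennreal ((norm (dev k a l u (avg a l u)))^2)) a l"
  by (rule ennreal_lev) simp
 also have "... <= lev g (%a l. NN y. indicator (cube a l) y*psi y) a l"
  by (rule lev_mono) (use dev_avg_le[OF r, of k _ u] in \<open>simp add: psi_def r_def\<close>)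
 also have "... = (NN y. indicator (cube a l) y*psi y)" by (rule lev_nn_integral[OF l psim])
 also have "... <= (NN y. psi y)" by (rule nn_integral_mono) (simp add: indicator_def)
 also have "... = ennreal (1/?n)*(NN y. (NN h. indicator ?H h*(?e h y)))"
  unfolding psi_def by (rule nn_integral_cmult) measurable
 also have "(NN y. (NN h. indicator ?H h*(?e h y)))
  = (NN h. (NN y. indicator ?H h*(?e h y)))"
  by (rule lborel_pair.Fubini') measurable
 also have "... = (NN h. indicator ?H h*ennreal ((norm (tr h u-u))^2))"
 proof (rule nn_integral_cong)
  fix h
  have "(NN y. (?e h y)) = ennreal ((norm (tr h u-u))^2)"
   unfolding nn_norm_L2 by (rule nn_integral_cong_AE) (use fb_diff[of "tr h u" u] fb_tr[of h u] in \<open>eventually_elim, simp\<close>)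
  thus "(NN y. indicator ?H h*(?e h y)) = indicator ?H h*ennreal ((norm (tr h u-u))^2)"
   by (simp add: nn_integral_cmult)
 qed
 also have "... <= (NN h. ennreal (?c^2)*indicator ?H h)"
 proof (rule nn_integral_mono)
  fix h :: "real^'n"
  have "(norm (tr h u-u))^2 <= ?c^2" if h: "h : ?H"
  proof (rule power_mono)
   have "(\<Sum>j\<in>UNIV. \<bar>h $ j\<bar>) <= (\<Sum>j\<in>(UNIV::'n set). 2^Suc k*r)" by (rule sum_mono) (use h in auto)
   hence "(\<Sum>j\<in>UNIV. \<bar>h $ j\<bar>)*(C0*norm v) <= real CARD('n)*(2^Suc k*r)*(C0*norm v)"
    using C0v by (intro mult_right_mono) auto
   thus "norm (tr h u-u) <= ?c" using translation_estimate[OF uv u, of h] by linarith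
  qed simp
  thus "indicator ?H h*ennreal ((norm (tr h u-u))^2) <= ennreal (?c^2)*indicator ?H h"
   by (auto simp: indicator_def ennreal_leI)
 qed
 also have "... = ennreal (?c^2)*ennreal ((2^(k+2)*r)^CARD('n))" unfolding eH[symmetric] by (rule nn_integral_cmult_indicator) simp
 finally have "ennreal (lev g (%a l. (norm (dev k a l u (avg a l u)))^2) a l) <= ennreal (1/?n)*(ennreal (?c^2)*ennreal ((2^(k+2)*r)^CARD('n)))"
  by (simp add: mult_left_mono)
 also have "... = ennreal (1/?n*(?c^2*(2^(k+2)*r)^CARD('n)))" using r by (simp add: ennreal_mult[symmetric])
 also have "1/?n*(?c^2*(2^(k+2)*r)^CARD('n)) = (2^(k+2))^CARD('n)*?c^2" using n0 by (simp add: power_mult_distrib)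
 finally show ?thesis unfolding r_def by (subst (asm) ennreal_le_iff) auto
qed

text \<open>The difference is the limit of \<open>Th l\<close> applied to the deviation of \<open>u\<close> from its mean, on larger and
  larger cubes. The deviations grow polynomially in the size of the annulus, with total degree below the exponent in
  \<open>annuli\<close>.\<close>

lemma principal_part_smooth:
 obtains C where "C >= 0" "!!g a l u v. l > 0 ==> (u, v) : D ==> u : closure (Range D) ==>
  lev g (%a l. (norm (chi (cube a l) (Th l u)-G a l (avg a l u)))^2) a l <= C*((l/2^g)*norm v)^2"
proof -
 obtain C where C: "C >= 0" "!!N a l u w. l > 0 ==> cnorm a l (Th l (dev N a l u w)) <= C*(\<Sum>k\<le>N. (1/2)^(k*(CARD('n)+3))*norm (dev k a l u w))"
  using annuli by blast
 define C' where "C' = C^2*(2*(4^CARD('n)*(4*(real CARD('n)*C0)^2)*2))"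
 have main: "lev g (%a l. (norm (chi (cube a l) (Th l u)-G a l (avg a l u)))^2) a l <= C'*((l/2^g)*norm v)^2"
  if l: "l > 0" and uv: "(u, v) : D" and u: "u : closure (Range D)" for g a l u v
 proof (rule LIMSEQ_le_const2)
  define r where "r = l/2^g"
  let ?T = "%N a l. (cnorm a l (Th l (dev N a l u (avg a l u))))^2"
  have r: "r > 0" using l by (simp add: r_def)
  let ?M = "4^CARD('n)*(4*(real CARD('n)*C0)^2)*(r*norm v)^2"
  show "(%N. lev g (%a l. (?T N a l)) a l) ---->
   lev g (%a l. (norm (chi (cube a l) (Th l u)-G a l (avg a l u)))^2) a l"
  proof (rule lev_tendsto, fold r_def)
   fix a :: "real^'n"
   have ev: "eventually (%N. x : dil N a r) sequentially" for x
   proof -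
    obtain N where N: "norm (x-(\<chi> i. a $ i+r/2))/r < 2^N" using real_arch_pow[of 2] by auto
    have "x : dil M a r" if "M >= N" for M
    proof -
     have "norm (x-(\<chi> i. a $ i+r/2)) < 2^M*r"
      using order_less_le_trans[OF N power_increasing[OF that]] r by (simp add: pos_divide_less_eq)
     hence "\<bar>x $ i-(a $ i+r/2)\<bar> < 2^M*r" for i using component_le_norm_cart[of "x-(\<chi> i. a $ i+r/2)" i] by simp
     thus ?thesis by (auto simp: dil_def mem_box_cart abs_less_iff) (smt (verit))+
    qed
    thus ?thesis by (auto simp: eventually_sequentially)
   qed
   have bl: "bounded_linear (%f. chi (cube a r) (Th r f))"
   proof (rule bounded_linear_intro[where K = KT])
    show "cnorm a r (Th r x) <= norm x*KT" for x
     using order_trans[OF norm_chi_le Th_bound] r by (simp add: mult.commute)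
   qed (use r in \<open>simp_all add: UQ_simps mulr_simps\<close>)
   have "(%N. chi (cube a r) (Th r (chi (dil N a r) u))-chi (cube a r) (Th r (tv (indicator (dil N a r)) (avg a r u))))
    ----> chi (cube a r) (Th r u)-G a r (avg a r u)"
    by (intro tendsto_diff G_lim r bounded_linear.tendsto[OF bl] chi_tendsto ev) simp
   thus "(%N. (cnorm a r (Th r (dev N a r u (avg a r u))))^2) ----> (norm (chi (cube a r) (Th r u)-G a r (avg a r u)))^2"
    using r by (intro tendsto_intros) (simp add: dev_def UQ_simps mulr_simps)
  qed
  show "\<exists>N0. \<forall>N\<ge>N0. lev g (%a l. (?T N a l)) a l <= C'*((l/2^g)*norm v)^2"
  proof (intro exI allI impI)
   fix N
   let ?w = "%k. (1/2 :: real)^(k*(CARD('n)+3))"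
   have sq: "(cnorm a r (Th r (dev N a r u w)))^2 <= C^2*(2*(\<Sum>k\<le>N. ?w k*(norm (dev k a r u w))^2))" for a w
   proof -
    have "(\<Sum>k\<le>N. ?w k*norm (dev k a r u w))^2 = (\<Sum>k\<le>N. sqrt (?w k)*(sqrt (?w k)*norm (dev k a r u w)))^2"
     by (simp add: mult.assoc[symmetric])
    also have "... <= (\<Sum>k\<le>N. (sqrt (?w k))^2)*(\<Sum>k\<le>N. (sqrt (?w k)*norm (dev k a r u w))^2)" by (rule Cauchy_Schwarz_ineq_sum)
    also have "... = (\<Sum>k\<le>N. ?w k)*(\<Sum>k\<le>N. ?w k*(norm (dev k a r u w))^2)" by (simp add: power_mult_distrib)
    also have "... <= 2*(\<Sum>k\<le>N. ?w k*(norm (dev k a r u w))^2)"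
    proof (rule mult_right_mono)
     have "(\<Sum>k\<le>N. ?w k) <= (\<Sum>k\<le>N. (1/2)^k)" by (intro sum_mono power_decreasing) auto
     thus "(\<Sum>k\<le>N. ?w k) <= 2" using half_power_sum[of N] by linarith
    qed (auto intro: sum_nonneg)
    finally have "C^2*(\<Sum>k\<le>N. ?w k*norm (dev k a r u w))^2 <= C^2*(2*(\<Sum>k\<le>N. ?w k*(norm (dev k a r u w))^2))" by (rule mult_left_mono) simp
    with power_mono[OF C(2)[OF r, of a N u w], of 2] show ?thesis by (simp add: power_mult_distrib)
   qed
   have "lev g (%a l. (?T N a l)) a l
    <= lev g (%a l. C^2*(2*(\<Sum>k\<le>N. ?w k*(norm (dev k a l u (avg a l u)))^2))) a l"
    by (rule lev_mono, fold r_def) (rule sq)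
   also have "... = C^2*(2*(\<Sum>k\<le>N. ?w k*lev g (%a l. (norm (dev k a l u (avg a l u)))^2) a l))"
    by (simp only: lev_cmult lev_sum)
   also have "... <= C^2*(2*(\<Sum>k\<le>N. (?M)*(1/2)^k))"
   proof (intro mult_left_mono sum_mono)
    fix k
    have "?w k*lev g (%a l. (norm (dev k a l u (avg a l u)))^2) a l
     <= ?w k*((2^(k+2))^CARD('n)*(real CARD('n)*(2^Suc k*r)*(C0*norm v))^2)"
     unfolding r_def by (intro mult_left_mono lev_dev l uv u) simp
    also have "... = (?M)*(1/2)^k"
    proof -
     have 1: "(2^(k+2) :: real)^CARD('n) = 4^CARD('n)*2^(k*CARD('n))"
      by (simp add: power_add power_mult_distrib power_mult)
     have 2: "?w k = (1/2)^k*(1/2)^(k*2)*(1/2)^(k*CARD('n))" by (simp only: power_add[symmetric]) (simp add: algebra_simps)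
     have 3: "(1/2 :: real)^(k*CARD('n))*2^(k*CARD('n)) = 1" by (simp add: power_mult_distrib[symmetric])
     have 4: "(1/2 :: real)^(k*2)*(2^k)^2 = 1" by (simp add: power_mult power_mult_distrib[symmetric])
     have "?w k*((2^(k+2))^CARD('n)*(real CARD('n)*(2^Suc k*r)*(C0*norm v))^2)
      = ((1/2)^(k*CARD('n))*2^(k*CARD('n)))*((1/2)^(k*2)*(2^k)^2)*((?M)*(1/2)^k)"
      unfolding 1 2 by (simp add: power_mult_distrib mult_ac)
     thus ?thesis unfolding 3 4 by simp
    qed
    finally show "?w k*lev g (%a l. (norm (dev k a l u (avg a l u)))^2) a l
     <= (?M)*(1/2)^k" .
   qed auto
   also have "... <= C^2*(2*((?M)*2))"
    unfolding sum_distrib_left[symmetric] by (intro mult_left_mono half_power_sum) auto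
   finally show "lev g (%a l. (?T N a l)) a l <= C'*((l/2^g)*norm v)^2"
    unfolding C'_def r_def by (simp add: mult_ac)
  qed
 qed
 show ?thesis by (rule that[of C']) (use main in \<open>auto simp: C'_def\<close>)
qed

end

section \<open>The square function of a self-adjoint operator\<close>

context selfadj_op
begin

text \<open>The unperturbed operator is the special case \<open>b = id\<close>.\<close>

lemma identity_accretive: "accretive_op D J (%x. x) (%x. x) 1 1"
proof -
 have "selfadj_op D J" by (rule selfadj_op_axioms)
 thus ?thesis by (intro accretive_op.intro accretive_op_axioms.intro) (auto simp: power2_norm_eq_inner linear_id[unfolded id_def])
qed

interpretation ID: accretive_op D J "%x. x" "%x. x" 1 1 by (rule identity_accretive)
declare ID.b_simps [simp del]

lemma identity_energy: assumes t: "t ~= 0" shows "inner (ID.U t f) f = (norm (ID.U t f))^2+(norm (ID.Q t f))^2"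
proof -
 have "inner (ID.U t f) f = inner (ID.U t f) (ID.U t f)+inner (ID.U t f) (t *R ID.WQ t f)"
  unfolding inner_add_right[symmetric] ID.b_WQ[OF t] by simp
 also have "inner (ID.U t f) (t *R ID.WQ t f) = inner (t *R ID.WU t f) (ID.Q t f)"
  using D_sym[OF ID.UQ_D(1)[OF t, of f] ID.UQ_D(2)[OF t, of f]] by simp
 finally show ?thesis by (simp add: ID.b_WU[OF t] power2_norm_eq_inner)
qed

lemma identity_U_contraction: assumes t: "t ~= 0" shows "inner (ID.U t f) f <= (norm f)^2" "0 <= inner (ID.U t f) f"
proof -
 show "0 <= inner (ID.U t f) f" unfolding identity_energy[OF t] by simp
 have "norm (ID.U t f)*norm (ID.U t f) <= norm (ID.U t f)*norm f"
  using identity_energy[OF t, of f] norm_cauchy_schwarz[of "ID.U t f" f] by (simp add: power2_eq_square) (smt (verit) zero_le_square)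
 hence "norm (ID.U t f) <= norm f" by (cases "ID.U t f = 0") auto
 hence "norm (ID.U t f)*norm f <= norm f*norm f" by (rule mult_right_mono) simp
 thus "inner (ID.U t f) f <= (norm f)^2" using norm_cauchy_schwarz[of "ID.U t f" f] by (simp add: power2_eq_square)
qed

lemma identity_Q_symmetric: assumes t: "t ~= 0" shows "inner (ID.Q t f) g = inner f (ID.Q t g)"
proof -
 have 1: "inner (ID.Q t f) (t *R ID.WQ t g) = inner (t *R ID.WQ t f) (ID.Q t g)"
  using D_sym[OF ID.UQ_D(2)[OF t, of f] ID.UQ_D(2)[OF t, of g]] by simp
 have 2: "inner (ID.Q t f) (ID.U t g) = inner (ID.U t f) (ID.Q t g)"
  using D_sym[OF ID.UQ_D(1)[OF t, of f] ID.UQ_D(1)[OF t, of g]] unfolding ID.b_WU[OF t, symmetric] by simp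
 show ?thesis using 1 2 unfolding ID.b_WQ[OF t] by (simp add: inner_diff_left inner_diff_right)
qed

text \<open>The factor is \<open>((2s)\<^sup>2 - s\<^sup>2) / (2s * s) = 3/2\<close>.\<close>

lemma identity_U_diff: assumes s: "s ~= 0" shows "ID.U s f-ID.U (2 * s) f = (3/2) *R ID.Q s (ID.Q (2 * s) f)"
proof -
 have "(2 * s * s) *R (ID.U s f-ID.U (2 * s) f) = (2 * s * s) *R ((3/2) *R ID.Q s (ID.Q (2 * s) f))"
  using ID.frullani_identity[of s "2 * s" f] s by (simp add: power2_eq_square ID.UQ_commute)
 thus ?thesis using s by (simp only: scaleR_cancel_left) simp
qed

text \<open>\<open>Q (2 * s)\<close> is dominated by the increment of the decreasing family \<open>U\<close>, so its square sums
  telescope.\<close>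

lemma identity_Q_le_increment:
 assumes s: "s > 0"
 shows "(norm (ID.Q (2 * s) f))^2 <= 4/3*(inner (ID.U s f) f-inner (ID.U (2 * s) f) f)"
proof -
 define g where "g = ID.Q (2 * s) f"
 have s0: "s ~= 0" "2 * s ~= 0" using s by auto
 have "(ID.U s f-ID.U (2 * s) f, ID.WU s f-ID.WU (2 * s) f) : D" by (intro D_diff ID.UQ_D s0)
 moreover have "(ID.U s f-ID.U (2 * s) f, (3/2) *R ID.WQ s g) : D"
  unfolding identity_U_diff[OF s0(1)] g_def by (intro D_scale ID.UQ_D s0)
 ultimately have "ID.WU s f-ID.WU (2 * s) f = (3/2) *R ID.WQ s g" by (rule D_fun)
 hence "s *R ID.WU s f = (1/2) *R ((2 * s) *R ID.WU (2 * s) f)+(3/2) *R (s *R ID.WQ s g)"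
  by (simp add: algebra_simps)
 hence "ID.Q s f = (1/2) *R g+(3/2) *R (g-ID.U s g)"
  unfolding ID.b_WU[OF s0(1)] ID.b_WU[OF s0(2)] ID.b_WQ[OF s0(1)] g_def .
 hence "inner (ID.Q s f) g = 1/2*(norm g)^2+3/2*((norm g)^2-inner (ID.U s g) g)"
  by (simp add: inner_add_left inner_diff_left power2_norm_eq_inner)
 moreover have "0 <= 3/2*((norm g)^2-inner (ID.U s g) g)" using identity_U_contraction(1)[OF s0(1), of g] by simp
 ultimately have "1/2*(norm g)^2 <= inner (ID.Q s f) g" by simp
 also have "inner (ID.Q s f) g = inner (ID.Q s g) f" using identity_Q_symmetric[OF s0(1), of f g] by (simp add: inner_commute)
 also have "... = 2/3*(inner (ID.U s f) f-inner (ID.U (2 * s) f) f)"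
  unfolding inner_diff_left[symmetric] identity_U_diff[OF s0(1)] g_def[symmetric] by simp
 finally show ?thesis unfolding g_def by linarith
qed

lemma identity_square_function:
 assumes t: "t > 0"
 shows "(\<Sum>k<N. (norm (ID.Q (t/2^k) f))^2) <= 4*(norm f)^2"
proof (cases N)
 case (Suc M)
 have "(\<Sum>k<N. (norm (ID.Q (t/2^k) f))^2) <= (\<Sum>k<N. 4/3*(inner (ID.U (t/2^Suc k) f) f-inner (ID.U (t/2^k) f) f))"
  using identity_Q_le_increment[of "t/2^Suc k" f for k] t by (intro sum_mono) simp
 also have "... = 4/3*(inner (ID.U (t/2^N) f) f-inner (ID.U t f) f)"
  unfolding sum_distrib_left[symmetric] using sum_lessThan_telescope[of "%k. inner (ID.U (t/2^k) f) f" N] by simp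
 also have "... <= 4/3*(norm f)^2" using identity_U_contraction[of "t/2^N" f] identity_U_contraction[of t f] t by simp
 also have "... <= 4*(norm f)^2" by simp
 finally show ?thesis .
qed simp

end

section \<open>The principal part approximation\<close>

lemma norm_Itg_support:
 fixes u :: "('a::euclidean_space, 'b::euclidean_space) L2"
 assumes [measurable]: "phi : borelm" and T: "T : sets borel" "bounded T" and m: "m >= 0" and le: "!!x. \<bar>phi x\<bar> <= m*indicator T x"
 shows "norm (Itg phi u) <= m * sqrt (measure lborel T)*norm (chi T u)"
proof -
 have [measurable]: "T : sets borel" by (rule T)
 obtain r where r: "!!x. x : T ==> norm x <= r" using T(2) unfolding bounded_iff by blast
 have z: "phi x = 0" if "x \<notin> T" for x using le[of x] that by simp
 have "\<bar>phi x\<bar> <= m" for x using le[of x] m by (cases "x : T") auto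
 hence q: "sqb phi"
  by (intro sqb_bounded_support[where r = r and M = m]) (use r z in \<open>auto simp: not_less[symmetric]\<close>)
 have su: "(%x. phi x*indicator T x) = phi" by (rule ext) (use z in \<open>auto simp: indicator_def\<close>)
 have iu: "Itg phi u = Itg phi (chi T u)" using Itg_mulr[OF bdd_indicator[OF T(1)], of phi u] su by simp
 have n1: "norm (Itg phi u) <= sqrt (LB x. (phi x)^2)*norm (chi T u)" unfolding iu by (rule norm_Itg_le[OF q])
 have "sqrt (LB x. (phi x)^2) <= m * sqrt (measure lborel T)"
 proof -
  have "(LB x. (phi x)^2) <= (LB x. m^2*indicator T x)"
  proof (rule integral_mono)
   show "integrable lborel (%x. (phi x)^2)" using q by (simp add: sqb_def)
   show "integrable lborel (%x. m^2*indicator T x)"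
    using T emeasure_bounded_finite[OF T(2)] by simp
   show "(phi x)^2 <= m^2*indicator T x" for x
    using power_mono[OF le[of x], of 2] by (auto simp: indicator_def split: if_splits)
  qed
  also have "... = m^2*measure lborel T" by simp
  finally have "sqrt (LB x. (phi x)^2) <= sqrt (m^2*measure lborel T)" by (rule real_sqrt_le_mono)
  thus ?thesis using m by (simp add: real_sqrt_mult)
 qed
 from n1 mult_right_mono[OF this norm_ge_zero, of "chi T u"] show ?thesis by linarith
qed

lemma partial_deriv_extremum:
 assumes "phi differentiable_on UNIV" and "(\<forall>y. phi y <= phi x) | (\<forall>y. phi x <= phi y)"
 shows "pd j phi x = 0"
 using differential_zero_maxmin[OF UNIV_I open_UNIV has_derivative_frechet[OF assms(1)]] assms(2) by (simp add: partial_deriv_def)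

context dirac_mult
begin

interpretation ID: accretive_op D J "%x. x" "%x. x" 1 1 by (rule identity_accretive)
declare ID.b_simps [simp del]

text \<open>The means of vectors in the range of \<open>D\<close> lie in \<open>V\<close>, so a Carleson estimate for
  \<open>G a l\<close> on \<open>V\<close> suffices.\<close>

definition V :: "'b set" where "V = span (\<Union>j. range (A j))"

text \<open>Replace the indicator of the cube by a plateau \<open>p\<close> that differs from it only in a boundary layer of relative width
  \<open>eps\<close>, and take \<open>z = \<integral> p y\<close>. The first bound is the Cauchy--Schwarz inequality on the layer.
  For the second, integrate by parts: the derivative of \<open>p\<close> lives on the layer and is of size \<open>1 / (eps
  l)\<close>.\<close>

lemma smooth_cutoff:
 obtains C where "C >= 0"
  "!!a l eps x y. l > 0 ==> 0 < eps ==> eps <= 1/2 ==> (x, y) : D ==> \<exists>z\<in>V.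
   (norm (Itg (indicator (cube a l)) y-z))^2 <= C*eps*l^CARD('n)*(cnorm a l y)^2 &
   (norm z)^2 <= C*eps*l^CARD('n)*((cnorm a l x)^2/(eps*l)^2)"
proof -
 obtain B where B: "B >= 1" "!!eps a b j x. eps > 0 ==> \<bar>pd j (plateau eps a b :: real^'n => real) x\<bar> <= B/eps" using plateau_slope[where ?'n = 'n] by blast
 define C where "C = 2*real CARD('n)*(1+(A1*B)^2)"
 have main: "\<exists>z\<in>V.
   (norm (Itg (indicator (cube a l)) y-z))^2 <= C*eps*l^CARD('n)*(cnorm a l y)^2 &
   (norm z)^2 <= C*eps*l^CARD('n)*((cnorm a l x)^2/(eps*l)^2)"
  if l: "l > 0" and e: "0 < eps" "eps <= 1/2" and xy: "(x, y) : D" for a l eps x y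
 proof -
  let ?Q = "cube a l" and ?n = "l^CARD('n)"
  define I where "I = box (\<chi> i. a $ i+eps*l) (\<chi> i. a $ i+l-eps*l :: real^'n)"
  define p where "p = plateau (eps*l) a (\<chi> i. a $ i+l)"
  define T where "T = ?Q-I"
  have el: "eps*l > 0" "2*(eps*l) <= l" using l e by auto
  have T [measurable]: "T : sets borel" "bounded T" unfolding T_def I_def using bounded_cube[of a l] by (auto intro: bounded_subset)
  have IQ: "I \<subseteq> ?Q" unfolding I_def cube_def using el by (auto simp: mem_box_cart) (smt (verit))+
  have p1: "p x = 1" if "x : I" for x unfolding p_def
   by (rule plateau_1[OF el(1)]) (use that in \<open>auto simp: I_def mem_box_cart less_imp_le\<close>, (smt (verit))+)
  have p0: "p x = 0" if "x \<notin> ?Q" for x unfolding p_def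
  proof (rule plateau_0[OF el(1)])
   have "box a (\<chi> i. a $ i+l) \<subseteq> ?Q" by (auto simp: cube_def mem_box_cart less_imp_le)
   thus "x \<notin> box a (\<chi> i. a $ i+l)" using that by blast
  qed
  have pb: "0 <= p x" "p x <= 1" for x unfolding p_def by (rule plateau_bounds)+
  have tp: "testf p" unfolding p_def by (rule test_function_plateau[OF el(1)])
  have "measure lborel I = (l-2*(eps*l))^CARD('n)"
  proof -
   have "measure lborel I = measure lborel (cbox (\<chi> i. a $ i+eps*l) (\<chi> i. a $ i+l-eps*l) :: (real^'n) set)"
    unfolding I_def by (simp add: measure_def emeasure_lborel_cbox_eq emeasure_lborel_box_eq)
   also have "... = (l-2*(eps*l))^CARD('n)"
    using el e by (subst content_cbox_cart) (auto simp: interval_eq_empty_cart algebra_simps)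
   finally show ?thesis .
  qed
  also have "... = ?n*(1+(- (2*eps)))^CARD('n)" by (simp only: power_mult_distrib[symmetric]) (simp add: algebra_simps)
  finally have mI: "measure lborel I = ?n*(1+(- (2*eps)))^CARD('n)" .
  have "1+real CARD('n)*(- (2*eps)) <= (1+(- (2*eps)))^CARD('n)" by (rule Bernoulli_inequality) (use e in simp)
  hence "?n*(1+real CARD('n)*(- (2*eps))) <= measure lborel I" unfolding mI using l by (intro mult_left_mono) auto
  moreover have "measure lborel T = ?n-measure lborel I"
   unfolding T_def measure_cube[OF l, of a, symmetric] by (rule measure_Diff) (use IQ l in \<open>auto simp: I_def emeasure_cube\<close>)
  ultimately have mT: "measure lborel T <= 2*real CARD('n)*eps*?n" by (simp add: algebra_simps)
  have chiT: "norm (chi T u) <= norm (chi ?Q u)" for u :: "(real^'n, 'b) L2"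
  proof -
   have "T \<inter> ?Q = T" by (auto simp: T_def)
   thus ?thesis using norm_chi_le[OF T(1), of "chi ?Q u"] by (simp add: chi_chi T(1))
  qed
  have sq: "(norm z)^2 <= 2*real CARD('n)*eps*?n*(m^2*(norm (chi ?Q u))^2)" if "norm z <= m * sqrt (measure lborel T)*norm (chi T u)" "m >= 0"
   for z :: 'b and u :: "(real^'n, 'b) L2" and m
  proof -
   have "norm z <= m * sqrt (measure lborel T)*norm (chi ?Q u)"
    by (rule order_trans[OF that(1)]) (intro mult_left_mono chiT, use that in auto)
   hence "(norm z)^2 <= (m * sqrt (measure lborel T)*norm (chi ?Q u))^2" by (rule power_mono) simp
   also have "... = measure lborel T*(m^2*(norm (chi ?Q u))^2)" by (simp add: power_mult_distrib)
   also have "... <= 2*real CARD('n)*eps*?n*(m^2*(norm (chi ?Q u))^2)" by (rule mult_right_mono[OF mT]) simp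
   finally show ?thesis .
  qed
  have "norm (Itg (%x. indicator ?Q x-p x) y) <= 1 * sqrt (measure lborel T)*norm (chi T y)"
  proof (rule norm_Itg_support)
   show "\<bar>indicator ?Q x-p x\<bar> <= 1*indicator T x" for x
    using p0[of x] p1[of x] pb[of x] IQ by (auto simp: T_def indicator_def)
  qed (use test_function_measurable[OF tp] T in auto)
  moreover have "Itg (%x. indicator ?Q x-p x) y = Itg (indicator ?Q) y-Itg p y"
   by (rule Itg_diff_fun) (auto intro: sqb_test tp)
  ultimately have 1: "(norm (Itg (indicator ?Q) y-Itg p y))^2 <= 2*real CARD('n)*eps*?n*(1^2*(norm (chi ?Q y))^2)"
   using sq[of "Itg (indicator ?Q) y-Itg p y" 1 y] by simp
  have dj: "norm (Itg (pd j p) x) <= (B/(eps*l)) * sqrt (measure lborel T)*norm (chi T x)" for j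
  proof (rule norm_Itg_support)
   show "\<bar>pd j p x\<bar> <= B/(eps*l)*indicator T x" for x
   proof (cases "x : T")
    case True thus ?thesis using B(2)[OF el(1)] by (simp add: p_def)
   next
    case False
    hence "p x = 0 | p x = 1" using p0 p1 by (auto simp: T_def)
    hence "pd j p x = 0" using pb by (intro partial_deriv_extremum test_function_differentiable tp) auto
    thus ?thesis using el B(1) by (simp add: indicator_def)
   qed
  qed (use test_function_measurable[OF test_partial_deriv[OF tp]] T el B(1) in auto)
  have "norm (Itg p y) <= (\<Sum>j\<in>UNIV. onorm (A j)*((B/(eps*l)) * sqrt (measure lborel T)*norm (chi T x)))"
   unfolding weak[OF xy tp] norm_minus_cancel
   by (rule order_trans[OF norm_sum], rule sum_mono, rule order_trans[OF onorm_A(1)], rule mult_left_mono[OF dj onorm_A(2)])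
  also have "... <= A1*(B/(eps*l)) * sqrt (measure lborel T)*norm (chi T x)"
   unfolding sum_distrib_right[symmetric] A1_def using el B(1) by (auto simp: mult.assoc[symmetric] intro!: mult_right_mono divide_right_mono)
  finally have "(norm (Itg p y))^2 <= 2*real CARD('n)*eps*?n*((A1*(B/(eps*l)))^2*(norm (chi ?Q x))^2)"
   by (rule sq) (use el B(1) order_trans[OF onorm_A(2,3)] in auto)
  hence 2: "(norm (Itg p y))^2 <= (2*real CARD('n)*eps*?n)*((A1*B)^2*((norm (chi ?Q x))^2/(eps*l)^2))"
   by (simp add: power_divide power_mult_distrib)
  have c: "C*eps*?n * s = (2*real CARD('n)*eps*?n)*((1+(A1*B)^2) * s)" for s by (simp add: C_def mult_ac)
  have V: "Itg p y : V" unfolding weak[OF xy tp] V_def by (intro span_neg span_sum span_base) blast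
  have m: "(2*real CARD('n)*eps*?n)*(1^2 * s) <= C*eps*?n * s" "(2*real CARD('n)*eps*?n)*((A1*B)^2 * s) <= C*eps*?n * s" if "s >= 0" for s
   unfolding c using that l e mult_right_mono[of 1 "1+(A1*B)^2" s] by (auto intro!: mult_left_mono mult_right_mono)
  show ?thesis by (intro bexI[OF _ V] conjI order_trans[OF 1 m(1)] order_trans[OF 2 m(2)]) auto
 qed
 show ?thesis by (rule that[OF _ main]) (simp add: C_def)
qed

end

lemma norm_add_sq_le: "(norm (x+y))^2 <= 2*(norm x)^2+2*(norm y)^2" for x y :: "'a::real_normed_vector"
proof -
 have "(norm (x+y))^2 <= (norm x+norm y)^2" by (simp add: norm_triangle_ineq power_mono)
 also have "... <= 2*(norm x)^2+2*(norm y)^2" using sum_squares_bound[of "norm x" "norm y"] by (simp add: power2_sum)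
 finally show ?thesis .
qed

lemma linear_avg: "linear (avg a l)"
 by (rule linearI) (simp_all add: avg_simps, simp add: avg_def Itg_scaleR)

lemma geometric_partial_sum_le: "0 <= x ==> x < 1 ==> (\<Sum>j<n. x^j) <= 1/(1-x)" for x :: real
 using sum_le_suminf[OF summable_geometric[of x], of "{..<n}"] by (simp add: suminf_geometric)

context dirac_mult
begin

interpretation ID: accretive_op D J "%x. x" "%x. x" 1 1 by (rule identity_accretive)
declare ID.b_simps [simp del]

text \<open>Let \<open>eps\<close> tend to zero in the preceding approximation; \<open>V\<close> is closed, being finite
  dimensional.\<close>

lemma Itg_in_V: assumes uv: "(u, v) : D" and l: "l > 0" shows "Itg (indicator (cube a l)) v : V"
proof -
 obtain C where C: "C >= 0" "!!eps. 0 < eps ==> eps <= 1/2 ==> \<exists>z\<in>V. (norm (Itg (indicator (cube a l)) v-z))^2 <= C*eps*l^CARD('n)*(cnorm a l v)^2"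
  using smooth_cutoff uv l by metis
 define c where "c = C*l^CARD('n)*(cnorm a l v)^2"
 have c: "c >= 0" using C(1) l by (simp add: c_def)
 have "Itg (indicator (cube a l)) v : closure V" unfolding closure_approachable
 proof (intro allI impI)
  fix e :: real assume e: "e > 0"
  define eps where "eps = min (1/2) (e^2/(2*(c+1)))"
  have eps: "0 < eps" "eps <= 1/2" "eps <= e^2/(2*(c+1))" unfolding eps_def using e c by (simp_all only: min.cobounded1 min.cobounded2) simp
  obtain z where z: "z : V" "(norm (Itg (indicator (cube a l)) v-z))^2 <= C*eps*l^CARD('n)*(cnorm a l v)^2"
   using C(2)[OF eps(1,2)] by blast
  note z(2)
  also have "C*eps*l^CARD('n)*(cnorm a l v)^2 = eps*c" by (simp add: c_def)
  also have "... <= e^2/(2*(c+1))*c" by (rule mult_right_mono[OF eps(3) c])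
  also have "... < e^2" using c e by (simp add: field_simps) (smt (verit) mult_nonneg_nonneg zero_less_power)
  finally have "norm (Itg (indicator (cube a l)) v-z) < e" using e by (simp add: power_less_imp_less_base)
  thus "\<exists>y\<in>V. dist y (Itg (indicator (cube a l)) v) < e" using z(1) by (auto simp: dist_norm norm_minus_commute)
 qed
 thus ?thesis unfolding V_def using closed_subspace[OF subspace_span] by (simp add: closure_closed)
qed

lemma avg_in_V: "(u, v) : D ==> l > 0 ==> avg a l v : V"
 unfolding avg_def by (metis Itg_in_V V_def span_scale)

text \<open>The two bounds for the cut-off balance: the mean of \<open>D x\<close> over a cube is small if \<open>x\<close> is small
  compared to the scale.\<close>

lemma average_interpolation:
 obtains C where "C >= 0" "!!a l eps x y. l > 0 ==> 0 < eps ==> eps <= 1/2 ==> (x, y) : D ==>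
   l^CARD('n)*(norm (avg a l y))^2 <= C*eps*((cnorm a l y)^2+(cnorm a l x)^2/(eps*l)^2)"
proof -
 obtain C where C: "C >= 0"
  "!!a l eps x y. l > 0 ==> 0 < eps ==> eps <= 1/2 ==> (x, y) : D ==> \<exists>z\<in>V.
   (norm (Itg (indicator (cube a l)) y-z))^2 <= C*eps*l^CARD('n)*(cnorm a l y)^2 &
   (norm z)^2 <= C*eps*l^CARD('n)*((cnorm a l x)^2/(eps*l)^2)" using smooth_cutoff by blast
 have "l^CARD('n)*(norm (avg a l y))^2 <= 2*C*eps*((cnorm a l y)^2+(cnorm a l x)^2/(eps*l)^2)"
  if l: "l > 0" and eps: "0 < eps" "eps <= 1/2" and xy: "(x, y) : D" for a l eps x y
 proof -
  let ?I = "Itg (indicator (cube a l)) y" and ?n = "l^CARD('n)"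
  have n: "?n > 0" using l by simp
  obtain z where z: "(norm (?I-z))^2 <= C*eps*?n*(cnorm a l y)^2" "(norm z)^2 <= C*eps*?n*((cnorm a l x)^2/(eps*l)^2)"
   using C(2)[OF l eps xy] by blast
  have "(norm ?I)^2 <= 2*(norm (?I-z))^2+2*(norm z)^2" using norm_add_sq_le[of "?I-z" z] by simp
  also have "... <= 2*(C*eps*?n*(cnorm a l y)^2)+2*(C*eps*?n*((cnorm a l x)^2/(eps*l)^2))"
   using z by linarith
  also have "... = (2*C*eps*((cnorm a l y)^2+(cnorm a l x)^2/(eps*l)^2))*?n" by (simp only: distrib_left distrib_right mult_ac)
  finally have "(norm ?I)^2/?n <= 2*C*eps*((cnorm a l y)^2+(cnorm a l x)^2/(eps*l)^2)" using n by (simp add: pos_divide_le_eq)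
  thus ?thesis using l by (simp add: avg_def power_divide power2_eq_square)
 qed
 thus ?thesis using that[of "2*C"] C(1) by simp
qed

text \<open>Writing \<open>v - U l v\<close> as a telescoping sum of products of \<open>Q\<close> at the finer scales, each term is
  oscillating on scale \<open>l\<close>, and its averages gain a geometric factor.\<close>

lemma averages_of_high_frequencies:
 obtains C where "C >= 0" "!!N a l v. l > 0 ==> (\<Sum>g<N. lev g (%a l. l^CARD('n)*(norm (avg a l (v-ID.U l v)))^2) a l) <= C*(norm v)^2"
proof -
 obtain C0 where C0: "C0 >= 0" "!!a l eps x y. l > 0 ==> 0 < eps ==> eps <= 1/2 ==> (x, y) : D ==>
   l^CARD('n)*(norm (avg a l y))^2 <= C0*eps*((cnorm a l y)^2+(cnorm a l x)^2/(eps*l)^2)"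
  using average_interpolation by blast
 have CR2: "ID.CR = 2" by (simp add: ID.CR_def)
 have main: "(\<Sum>g<N. lev g (%a l. l^CARD('n)*(norm (avg a l (v-ID.U l v)))^2) a l) <= (864*C0)*(norm v)^2"
  if l: "l > 0" for N a l and v :: "(real^'n, 'b) L2"
 proof -
  define t where "t = (%k::nat. l/2^k)"
  define x where "x = (%k. ID.U (t (Suc k)) v-ID.U (t k) v)"
  define q where "q = (%k. (norm (ID.Q (t k) v))^2)"
  define rem where "rem = (%K. (norm (v-ID.U (t K) v))^2)"
  have td: "l/2^k = t k" for k by (simp add: t_def)
  have t: "t k > 0" "t k ~= 0" "t k = 2*t (Suc k)" for k using l by (auto simp: t_def)
  let ?E = "%g w. lev g (%a l. l^CARD('n)*(norm (avg a l w))^2) a l"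
  have Ex: "?E g (x (g+j)) <= 9*C0*(1/2)^j*q (g+j)" for g j
  proof -
   define s where "s = t (Suc (g+j))"
   define f where "f = ID.Q (t (g+j)) v"
   have s: "s > 0" "s ~= 0" using t(1,2) by (auto simp: s_def)
   have xe: "x (g+j) = (3/2) *R ID.Q s f"
    unfolding x_def f_def s_def t(3)[of "g+j"] by (rule identity_U_diff[OF t(2)])
   have D: "((3/2) *R s *R ID.U s f, x (g+j)) : D"
    unfolding xe ID.b_WU[OF s(2), symmetric] by (intro D_scale ID.UQ_D s)
   have st: "s = (1/2)^Suc j*t g" by (simp add: s_def t_def power_add power_divide)
   have "?E g (x (g+j)) <= lev g (%a l. C0*(1/2)^Suc j*((cnorm a l (x (g+j)))^2+1/s^2*(cnorm a l ((3/2) *R s *R ID.U s f))^2)) a l"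
   proof (rule lev_mono, unfold td)
    fix a
    have "(1/2 :: real)^Suc j <= 1/2" using power_le_one[of "1/2::real" j] by simp
    from C0(2)[OF t(1)[of g] _ this D, of a]
    show "t g^CARD('n)*(norm (avg a (t g) (x (g+j))))^2 <= C0*(1/2)^Suc j *
     ((cnorm a (t g) (x (g+j)))^2+1/s^2*(cnorm a (t g) ((3/2) *R s *R ID.U s f))^2)"
     unfolding st by simp
   qed
   also have "... = C0*(1/2)^Suc j*((cnorm a l (x (g+j)))^2+1/s^2*(cnorm a l ((3/2) *R s *R ID.U s f))^2)"
    by (simp only: lev_cmult lev_add lev_norm_chi[OF l])
   also have "... <= C0*(1/2)^Suc j*((3*norm f)^2+1/s^2*(3 * s*norm f)^2)"
   proof (intro mult_left_mono add_mono power_mono)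
    show "cnorm a l (x (g+j)) <= 3*norm f"
     using norm_chi_le[OF cube_sets, of a l "x (g+j)"] ID.Q_bound[OF s(2), of f] unfolding xe CR2 by simp
    have "cnorm a l ((3/2) *R s *R ID.U s f) <= 3/2*(s*norm (ID.U s f))"
     using norm_chi_le[OF cube_sets, of a l "(3/2) *R s *R ID.U s f"] s by simp
    also have "... <= 3/2*(s*(2*norm f))" using ID.U_bound[OF s(2), of f] s unfolding CR2 by (intro mult_left_mono) auto
    finally show "cnorm a l ((3/2) *R s *R ID.U s f) <= 3 * s*norm f" by simp
   qed (use C0 in auto)
   also have "... = 9*C0*(1/2)^j*q (g+j)" using s by (simp add: q_def f_def power_mult_distrib)
   finally show ?thesis .
  qed
  have Eg: "?E g (v-ID.U (t g) v) <= 2*(3*(\<Sum>j<K. (3/2)^j*(9*C0*(1/2)^j*q (g+j))))+2*rem (g+K)" for g K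
  proof -
   have tel: "v-ID.U (t g) v = (\<Sum>j<K. x (g+j))+(v-ID.U (t (g+K)) v)"
    using sum_lessThan_telescope[of "%j. ID.U (t (g+j)) v" K] by (simp add: x_def)
   have "?E g (v-ID.U (t g) v) <= lev g (%a l. 2*(3*(\<Sum>j<K. (3/2)^j*(l^CARD('n)*(norm (avg a l (x (g+j))))^2)))
     + 2*(cnorm a l (v-ID.U (t (g+K)) v))^2) a l"
   proof (rule lev_mono, unfold td)
    fix a
    let ?n = "t g^CARD('n)" and ?y = "%j. avg a (t g) (x (g+j))"
    have av: "avg a (t g) (v-ID.U (t g) v) = (\<Sum>j<K. ?y j)+avg a (t g) (v-ID.U (t (g+K)) v)"
     unfolding tel avg_simps(1) linear_sum[OF linear_avg] ..
    \<comment> \<open>The Cauchy--Schwarz inequality with geometric weights; the factor \<open>(3/2) ^ j\<close> lost here is outweighed by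
      the gain \<open>(1/2) ^ j\<close> in \<open>Ex\<close>.\<close>
    have "norm (\<Sum>j<K. ?y j) <= (\<Sum>j<K. sqrt ((2/3)^j)*(sqrt ((3/2)^j)*norm (?y j)))"
     by (rule order_trans[OF norm_sum]) (simp add: mult.assoc[symmetric] real_sqrt_mult[symmetric] power_mult_distrib[symmetric])
    hence "(norm (\<Sum>j<K. ?y j))^2 <= (\<Sum>j<K. sqrt ((2/3)^j)*(sqrt ((3/2)^j)*norm (?y j)))^2" by (rule power_mono) simp
    also have "... <= (\<Sum>j<K. (sqrt ((2/3)^j))^2)*(\<Sum>j<K. (sqrt ((3/2)^j)*norm (?y j))^2)" by (rule Cauchy_Schwarz_ineq_sum)
    also have "... = (\<Sum>j<K. (2/3)^j)*(\<Sum>j<K. (3/2)^j*(norm (?y j))^2)" by (simp add: power_mult_distrib)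
    also have "... <= 3*(\<Sum>j<K. (3/2)^j*(norm (?y j))^2)"
     using geometric_partial_sum_le[of "2/3" K] by (intro mult_right_mono) (auto intro: sum_nonneg)
    finally have s: "(norm (\<Sum>j<K. ?y j))^2 <= 3*(\<Sum>j<K. (3/2)^j*(norm (?y j))^2)" .
    have "?n*(norm (avg a (t g) (v-ID.U (t g) v)))^2 <= ?n*(2*(norm (\<Sum>j<K. ?y j))^2+2*(norm (avg a (t g) (v-ID.U (t (g+K)) v)))^2)"
     unfolding av using t(1)[of g] by (intro mult_left_mono norm_add_sq_le) simp
    also have "... <= ?n*(2*(3*(\<Sum>j<K. (3/2)^j*(norm (?y j))^2)))+2*(?n*(norm (avg a (t g) (v-ID.U (t (g+K)) v)))^2)"
     using s t(1)[of g] by (simp add: distrib_left)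
    also have "... <= ?n*(2*(3*(\<Sum>j<K. (3/2)^j*(norm (?y j))^2)))+2*(cnorm a (t g) (v-ID.U (t (g+K)) v))^2"
     using avg_le[OF t(1)[of g], of a "v-ID.U (t (g+K)) v"] by simp
    also have "?n*(2*(3*(\<Sum>j<K. (3/2)^j*(norm (?y j))^2))) = 2*(3*(\<Sum>j<K. (3/2)^j*(?n*(norm (?y j))^2)))"
     by (simp add: sum_distrib_left mult_ac)
    finally show "?n*(norm (avg a (t g) (v-ID.U (t g) v)))^2 <= 2*(3*(\<Sum>j<K. (3/2)^j*(?n*(norm (?y j))^2)))
     + 2*(cnorm a (t g) (v-ID.U (t (g+K)) v))^2" .
   qed
   also have "... = 2*(3*(\<Sum>j<K. (3/2)^j*?E g (x (g+j))))+2*(cnorm a l (v-ID.U (t (g+K)) v))^2"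
    by (simp only: lev_add lev_cmult lev_sum lev_norm_chi[OF l])
   also have "... <= 2*(3*(\<Sum>j<K. (3/2)^j*(9*C0*(1/2)^j*q (g+j))))+2*rem (g+K)"
    unfolding rem_def by (intro add_mono mult_left_mono sum_mono Ex power_mono norm_chi_le) auto
   finally show ?thesis .
  qed
  have "(\<Sum>g<N. ?E g (v-ID.U (t g) v)) <= 864*C0*(norm v)^2+2*(\<Sum>g<N. rem (g+K))" for K
  proof -
   have "(\<Sum>g<N. ?E g (v-ID.U (t g) v)) <= (\<Sum>g<N. 2*(3*(\<Sum>j<K. (3/2)^j*(9*C0*(1/2)^j*q (g+j))))+2*rem (g+K))"
    by (intro sum_mono Eg)
   also have "... = 54*C0*(\<Sum>g<N. \<Sum>j<K. (3/4)^j*q (g+j))+2*(\<Sum>g<N. rem (g+K))"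
   proof -
    have "(3/2 :: real)^j*(9*C0*(1/2)^j*q (g+j)) = 9*C0*((3/4)^j*q (g+j))" for g j
    proof -
     have "(3/4 :: real)^j = (3/2)^j*(1/2)^j" by (simp flip: power_mult_distrib)
     thus ?thesis by simp
    qed
    thus ?thesis by (simp only: sum.distrib) (simp add: sum_distrib_left mult.assoc)
   qed
   also have "(\<Sum>g<N. \<Sum>j<K. (3/4)^j*q (g+j)) = (\<Sum>j<K. (3/4)^j*(\<Sum>g<N. q (g+j)))"
    by (subst sum.swap) (simp add: sum_distrib_left)
   also have "... <= (\<Sum>j<K. (3/4)^j*(4*(norm v)^2))"
   proof (intro sum_mono mult_left_mono)
    fix j
    show "(\<Sum>g<N. q (g+j)) <= 4*(norm v)^2"
     using identity_square_function[OF t(1)[of j], of v N] by (simp add: q_def t_def power_add mult.commute)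
   qed simp
   also have "... <= 4*(4*(norm v)^2)"
    unfolding sum_distrib_right[symmetric] using geometric_partial_sum_le[of "3/4" K] by (intro mult_right_mono) auto
   finally show ?thesis using C0(1) by (simp add: mult_left_mono)
  qed
  moreover have "(%K. 864*C0*(norm v)^2+2*(\<Sum>g<N. rem (g+K))) ----> 864*C0*(norm v)^2+2*(\<Sum>g<N. 0)"
  proof (intro tendsto_intros)
   fix g
   have "(%k. t k) ----> 0" unfolding t_def by (rule LIMSEQ_divide_realpow_zero) simp
   hence "filterlim t (at 0) sequentially" using t(2) by (simp add: filterlim_at)
   hence "(%k. ID.U (t k) v) ----> v" by (rule filterlim_compose[OF ID.U_tendsto_0])
   hence "(%k. (norm (v-ID.U (t k) v))^2) ----> (norm (v-v))^2" by (intro tendsto_intros)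
   hence "rem ----> 0" by (simp add: rem_def)
   thus "(%K. rem (g+K)) ----> 0" using LIMSEQ_ignore_initial_segment[of rem 0 g] by (simp add: add.commute)
  qed
  ultimately have "(\<Sum>g<N. ?E g (v-ID.U (t g) v)) <= 864*C0*(norm v)^2" by (intro LIMSEQ_le_const) auto
  moreover have "lev g (%a l. l^CARD('n)*(norm (avg a l (v-ID.U l v)))^2) a l = ?E g (v-ID.U (t g) v)" for g
   by (intro antisym lev_mono) (simp_all add: td)
  ultimately show ?thesis by simp
 qed
 show ?thesis by (rule that[OF _ main]) (use C0 in auto)
qed

end

context dirac_mult
begin

interpretation ID: accretive_op D J "%x. x" "%x. x" 1 1 by (rule identity_accretive)
declare ID.b_simps [simp del]

text \<open>Split \<open>v = P v + (v - P v)\<close> with \<open>P = ID.U l\<close>. The smooth part is covered by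
  \<open>principal_part_smooth\<close> and yields \<open>l \<parallel>D P v\<parallel> = \<parallel>ID.Q l v\<parallel>\<close>. On the
  other part \<open>Th l (v - P v)\<close> is itself bounded by \<open>ID.Q l v\<close>, and the mean is covered by
  \<open>averages_of_high_frequencies\<close>.\<close>

theorem principal_part:
 obtains C where "C >= 0" "!!N a l u v. l > 0 ==> (u, v) : D ==>
  (\<Sum>g<N. lev g (%a l. (norm (chi (cube a l) (Th l v)-G a l (avg a l v)))^2) a l) <= C*(norm v)^2"
proof -
 obtain C1 where C1: "C1 >= 0" "!!g a l u v. l > 0 ==> (u, v) : D ==> u : closure (Range D) ==>
  lev g (%a l. (norm (chi (cube a l) (Th l u)-G a l (avg a l u)))^2) a l <= C1*((l/2^g)*norm v)^2"
  using principal_part_smooth by blast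
 obtain C2 where C2: "C2 >= 0" "!!N a l v. l > 0 ==> (\<Sum>g<N. lev g (%a l. l^CARD('n)*(norm (avg a l (v-ID.U l v)))^2) a l) <= C2*(norm v)^2"
  using averages_of_high_frequencies by blast
 obtain CG where CG: "CG >= 0" "!!a l w. l > 0 ==> (norm (G a l w))^2 <= CG*(l^CARD('n)*(norm w)^2)" using G_bound by blast
 define c where "c = 2*C1+4*(1+CR)^2"
 have c: "c >= 0" using C1 by (simp add: c_def)
 have "(\<Sum>g<N. lev g (%a l. (norm (chi (cube a l) (Th l v)-G a l (avg a l v)))^2) a l) <= (c*4+4*CG*C2)*(norm v)^2"
  if l: "l > 0" and uv: "(u, v) : D" for N a l u v
 proof -
  let ?A = "%g. lev g (%a l. l^CARD('n)*(norm (avg a l (v-ID.U l v)))^2) a l"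
  have step: "lev g (%a l. (norm (chi (cube a l) (Th l v)-G a l (avg a l v)))^2) a l
   <= c*(norm (ID.Q (l/2^g) v))^2+4*CG*?A g" for g
  proof -
   define r where "r = l/2^g"
   have r: "r > 0" "r ~= 0" using l by (auto simp: r_def)
   let ?P = "ID.U r v" and ?q = "norm (ID.Q r v)"
   have "ID.WU r u = ID.U r v" unfolding ID.WU_def ID.U_def using r ID.bW_domain[OF _ uv] by simp
   hence P: "?P : closure (Range D)" using ID.UQ_D(1)[OF r(2), of u] closure_subset by fastforce
   have PD: "(?P, ID.WU r v) : D" by (rule ID.UQ_D(1)[OF r(2)])
   have qe: "r*norm (ID.WU r v) = ?q" using r by (simp flip: ID.b_WU[OF r(2)])
   have high: "norm (Th r (v-?P)) <= (1+CR)*?q"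
   proof -
    have "Th r (v-?P) = r *R Q r (b (ID.WQ r v))" using r by (simp add: UQ_simps flip: ID.b_WQ[OF r(2)])
    also have "... = ID.Q r v-U r (ID.Q r v)" using UQ_domain(1)[OF r(2) ID.UQ_D(2)[OF r(2), of v]] by (metis add_diff_cancel_left')
    also have "norm ... <= ?q+CR*?q" by (rule order_trans[OF norm_triangle_ineq4]) (simp add: U_bound r)
    finally show ?thesis by (simp add: distrib_right)
   qed
   have "lev g (%a l. (norm (chi (cube a l) (Th l v)-G a l (avg a l v)))^2) a l
    <= lev g (%a l. 2*(norm (chi (cube a l) (Th l ?P)-G a l (avg a l ?P)))^2 +
     (4*(cnorm a l (Th r (v-?P)))^2+4*CG*(l^CARD('n)*(norm (avg a l (v-ID.U l v)))^2))) a l"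
   proof (rule lev_mono, fold r_def)
    fix a
    let ?X = "chi (cube a r) (Th r ?P)-G a r (avg a r ?P)" and ?x = "v-?P"
    have "chi (cube a r) (Th r v)-G a r (avg a r v) = ?X+(chi (cube a r) (Th r ?x)+(- G a r (avg a r ?x)))"
     using r by (simp add: UQ_simps mulr_simps avg_simps linear_diff[OF G_linear])
    hence "(norm (chi (cube a r) (Th r v)-G a r (avg a r v)))^2 <= 2*(norm ?X)^2+2*(norm (chi (cube a r) (Th r ?x)+(- G a r (avg a r ?x))))^2"
     using norm_add_sq_le by metis
    also have "(norm (chi (cube a r) (Th r ?x)+(- G a r (avg a r ?x))))^2 <= 2*(cnorm a r (Th r ?x))^2+2*(CG*(r^CARD('n)*(norm (avg a r ?x))^2))"
     using norm_add_sq_le[of "chi (cube a r) (Th r ?x)" "- G a r (avg a r ?x)"] CG(2)[OF r(1), of a "avg a r ?x"] by simp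
    finally show "(norm (chi (cube a r) (Th r v)-G a r (avg a r v)))^2 <= 2*(norm ?X)^2 +
     (4*(cnorm a r (Th r ?x))^2+4*CG*(r^CARD('n)*(norm (avg a r ?x))^2))" by simp
   qed
   also have "... = 2*lev g (%a l. (norm (chi (cube a l) (Th l ?P)-G a l (avg a l ?P)))^2) a l+(4*(cnorm a l (Th r (v-?P)))^2+4*CG*?A g)"
    by (simp only: lev_add lev_cmult lev_norm_chi[OF l])
   also have "... <= 2*(C1*?q^2)+(4*((1+CR)*?q)^2+4*CG*?A g)"
    using CG(1) C1(2)[OF l PD P, of g a, folded r_def, unfolded qe]
    by (intro add_mono mult_left_mono power_mono order_trans[OF norm_chi_le high]) auto
   finally show ?thesis unfolding r_def c_def power_mult_distrib by (simp add: algebra_simps)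
  qed
  have "(\<Sum>g<N. lev g (%a l. (norm (chi (cube a l) (Th l v)-G a l (avg a l v)))^2) a l) <= (\<Sum>g<N. c*(norm (ID.Q (l/2^g) v))^2+4*CG*?A g)"
   by (intro sum_mono step)
  also have "... = c*(\<Sum>g<N. (norm (ID.Q (l/2^g) v))^2)+4*CG*(\<Sum>g<N. ?A g)" by (simp add: sum.distrib sum_distrib_left)
  also have "... <= c*(4*(norm v)^2)+4*CG*(C2*(norm v)^2)"
   using c CG(1) by (intro add_mono mult_left_mono identity_square_function C2(2) l) auto
  finally show ?thesis by (simp add: algebra_simps)
 qed
 thus ?thesis using that[of "c*4+4*CG*C2"] c CG(1) C2(1) by simp
qed

end

section \<open>The dyadic Carleson embedding theorem\<close>

lemma norm_sum_sq_le_weighted: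
 fixes x :: "'i => 'b::real_normed_vector"
 assumes d: "!!i. i : I ==> d i > 0"
 shows "(norm (\<Sum>i\<in>I. x i))^2 <= (\<Sum>i\<in>I. d i)*(\<Sum>i\<in>I. (norm (x i))^2/d i)"
proof -
 have "norm (\<Sum>i\<in>I. x i) <= (\<Sum>i\<in>I. norm (x i))" by (rule norm_sum)
 also have "... = (\<Sum>i\<in>I. sqrt (d i)*(norm (x i)/sqrt (d i)))" using d by (intro sum.cong) fastforce+
 finally have "(norm (\<Sum>i\<in>I. x i))^2 <= (\<Sum>i\<in>I. sqrt (d i)*(norm (x i)/sqrt (d i)))^2" by (rule power_mono) simp
 also have "... <= (\<Sum>i\<in>I. (sqrt (d i))^2)*(\<Sum>i\<in>I. (norm (x i)/sqrt (d i))^2)" by (rule Cauchy_Schwarz_ineq_sum)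
 also have "... = (\<Sum>i\<in>I. d i)*(\<Sum>i\<in>I. (norm (x i))^2/d i)"
  using d by (intro arg_cong2[where f = "(*)"] sum.cong) (auto simp: power_divide less_imp_le)
 finally show ?thesis .
qed

text \<open>The function \<open>4 * (F - f\<^sup>2 / (1 + T))\<close> is a Bellman function for the embedding: it is concave, and its
  derivative in \<open>T\<close> is at least \<open>f\<^sup>2\<close> as long as \<open>T \<le> 1\<close>. Here \<open>F\<close>,
  \<open>f\<close> and \<open>T\<close> are the normalised energy, the mean and the normalised Carleson mass.\<close>

lemma carleson_embedding_aux:
 fixes v :: "(real^'n::finite, 'b::euclidean_space) L2"
 assumes \<gamma>: "!!a l. \<gamma> a l >= 0" and T: "!!g a l. l > 0 ==> tot g \<gamma> a l <= l^CARD('n)" and l: "l > 0"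
 shows "tot g (%a l. \<gamma> a l*(norm (avg a l v))^2) a l
  <= 4*((cnorm a l v)^2-(norm (Itg (indicator (cube a l)) v))^2/(l^CARD('n)+tot g \<gamma> a l))"
 using l
proof (induction g arbitrary: a l)
 case 0
 thus ?case using norm_Itg_indicator[of "cube a l" v] by (simp add: bounded_cube measure_cube pos_divide_le_eq mult.commute)
next
 case (Suc g)
 let ?I = "%a l. Itg (indicator (cube a l)) v" and ?n = "l^CARD('n)" and ?c = "child a l"
 define d where "d = (%e. (l/2)^CARD('n)+tot g \<gamma> (?c e) (l/2))"
 have l2: "l/2 > 0" and n: "?n > 0" using Suc.prems by auto
 have t0: "tot g \<gamma> a' l' >= 0" for a' l' by (simp add: tot_eq_sum_lev sum_nonneg lev_nonneg \<gamma>)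
 have d: "d e > 0" for e using l2 t0[of "?c e" "l/2"] by (simp add: d_def add_pos_nonneg)
 define s where "s = (\<Sum>e\<in>UNIV. d e)"
 have se: "s = ?n+(\<Sum>e\<in>UNIV. tot g \<gamma> (?c e) (l/2))" unfolding s_def d_def sum.distrib vol_children[of l, symmetric] ..
 have s: "s > 0" "s+\<gamma> a l <= 2*?n" "?n+tot (Suc g) \<gamma> a l = s+\<gamma> a l"
  using T[OF Suc.prems, of "Suc g" a] n t0 unfolding se by (auto intro!: add_pos_nonneg sum_nonneg)
 have cs: "(norm (?I a l))^2/s <= (\<Sum>e\<in>UNIV. (norm (?I (?c e) (l/2)))^2/d e)"
  using norm_sum_sq_le_weighted[of UNIV d "%e. ?I (?c e) (l/2)"] d s(1) unfolding Itg_children[OF Suc.prems] s_def[symmetric]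
  by (simp add: pos_divide_le_eq mult.commute)
 have "(\<Sum>e\<in>UNIV. tot g (%a l. \<gamma> a l*(norm (avg a l v))^2) (?c e) (l/2))
  <= (\<Sum>e\<in>UNIV. 4*((cnorm (?c e) (l/2) v)^2-(norm (?I (?c e) (l/2)))^2/d e))"
  unfolding d_def by (intro sum_mono Suc.IH l2)
 also have "... = 4*((cnorm a l v)^2-(\<Sum>e\<in>UNIV. (norm (?I (?c e) (l/2)))^2/d e))"
  by (simp only: norm_chi_children[OF Suc.prems, of a v] sum_distrib_left[symmetric] sum_subtractf)
 also have "... <= 4*((cnorm a l v)^2-(norm (?I a l))^2/s)" using cs by simp
 finally have 1: "(\<Sum>e\<in>UNIV. tot g (%a l. \<gamma> a l*(norm (avg a l v))^2) (?c e) (l/2)) <= 4*((cnorm a l v)^2-(norm (?I a l))^2/s)" .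
 have "s*(s+\<gamma> a l) <= (2*?n)*(2*?n)" using s \<gamma>[of a l] by (intro mult_mono) auto
 hence "\<gamma> a l/?n^2 <= \<gamma> a l*(4/(s*(s+\<gamma> a l)))"
  using n s(1) \<gamma>[of a l] unfolding divide_inverse[of _ "?n^2"]
  by (intro mult_left_mono) (auto simp: field_simps power2_eq_square add_pos_nonneg)
 also have "... = 4*(1/s-1/(s+\<gamma> a l))" using s(1) \<gamma>[of a l] by (simp add: field_simps add_pos_nonneg)
 finally have "(norm (?I a l))^2*(\<gamma> a l/?n^2) <= (norm (?I a l))^2*(4*(1/s-1/(s+\<gamma> a l)))" by (rule mult_left_mono) simp
 hence 2: "\<gamma> a l*(norm (avg a l v))^2 <= 4*((norm (?I a l))^2/s-(norm (?I a l))^2/(s+\<gamma> a l))"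
  by (simp add: avg_def power_divide right_diff_distrib mult.commute)
 show ?case unfolding s(3) using 1 2 by simp
qed

theorem carleson_embedding:
 fixes v :: "(real^'n::finite, 'b::euclidean_space) L2"
 assumes \<gamma>: "!!a l. \<gamma> a l >= 0" and T: "!!g a l. l > 0 ==> tot g \<gamma> a l <= M*l^CARD('n)" and M: "M > 0" and l: "l > 0"
 shows "tot g (%a l. \<gamma> a l*(norm (avg a l v))^2) a l <= 4*M*(norm v)^2"
proof -
 let ?\<gamma> = "%a l. 1/M*\<gamma> a l"
 have T': "tot g ?\<gamma> a l <= l^CARD('n)" if "l > 0" for g a l
  using T[OF that, of g a] M unfolding tot_cmult by (simp add: pos_divide_le_eq mult.commute)
 have "tot g (%a l. ?\<gamma> a l*(norm (avg a l v))^2) a l <= 4*((cnorm a l v)^2-(norm (Itg (indicator (cube a l)) v))^2/(l^CARD('n)+tot g ?\<gamma> a l))"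
  by (rule carleson_embedding_aux) (use \<gamma> M T' l in auto)
 also have "... <= 4*(cnorm a l v)^2"
  using l M by (auto intro!: divide_nonneg_nonneg add_nonneg_nonneg simp: tot_eq_sum_lev sum_nonneg lev_nonneg \<gamma>)
 also have "... <= 4*(norm v)^2" by (intro mult_left_mono power_mono norm_chi_le) auto
 finally have "1/M*tot g (%a l. \<gamma> a l*(norm (avg a l v))^2) a l <= 4*(norm v)^2" by (simp only: tot_cmult[symmetric] mult.assoc)
 thus ?thesis using M by (simp add: pos_divide_le_eq mult_ac)
qed

section \<open>Test functions and stopping times\<close>

context dirac_mult
begin

text \<open>A vector in \<open>V\<close> is the mean over the given cube of some \<open>D u\<close> of comparable energy: cut off a linear
  function.\<close>

lemma test_potential:
 assumes "\<beta> : V"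
 shows "\<exists>C\<ge>0. \<forall>a l. l > 0 --> (\<exists>u y. (u, y) : D & avg a l y = \<beta> & (norm y)^2 <= C*l^CARD('n))"
 using assms unfolding V_def
proof (induction rule: span_induct_alt)
 case base
 show ?case by (intro exI[of _ 0] conjI allI impI exI[of _ "0 :: (real^'n, 'b) L2"] D_zero) (simp_all add: linear_0[OF linear_avg])
next
 case (step r x x')
 then obtain j z where x: "x = A j z" by auto
 obtain B where B: "B >= 1" "!!eps a b j x. eps > 0 ==> \<bar>pd j (plateau eps a b :: real^'n => real) x\<bar> <= B/eps" using plateau_slope[where ?'n = 'n] by blast
 define c where "c = (\<Sum>i\<in>UNIV. (1+2*B) * sqrt (3^CARD('n))*norm (A i z))"
 have gen: "\<exists>u y. (u, y) : D & avg a l y = x & (norm y)^2 <= c^2*l^CARD('n)" if l: "l > 0" for a l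
 proof -
  define p where "p = plateau l (\<chi> i. a $ i-l) (\<chi> i. a $ i+2*l)"
  define T where "T = cube (\<chi> i. a $ i-l) (3*l)"
  define psi where "psi = (%x. p x*(x $ j + - a $ j))"
  have tp: "testf p" and tpsi: "testf psi"
   unfolding psi_def p_def by (intro test_mult C_k_affine_coordinate test_function_plateau l)+
  have p1: "p x = 1" if "x : cube a l" for x unfolding p_def
  proof (rule plateau_1[OF l])
   fix i
   have "a $ i <= x $ i & x $ i < a $ i+l" using that by (simp add: cube_def)
   thus "(\<chi> i. a $ i-l) $ i+l <= x $ i" "x $ i+l <= (\<chi> i. a $ i+2*l) $ i" by auto
  qed
  have pT: "p x = 0" if "x \<notin> T" for x unfolding p_def
  proof (rule plateau_0[OF l])
   have "box (\<chi> i. a $ i-l) (\<chi> i. a $ i+2*l) \<subseteq> T"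
   proof
    fix x assume "x : box (\<chi> i. a $ i-l) (\<chi> i. a $ i+2*l)"
    hence p: "a $ i-l < x $ i & x $ i < a $ i+2*l" for i by (simp add: mem_box_cart)
    show "x : T" unfolding T_def cube_def mem_Collect_eq vec_lambda_beta
    proof
     fix i from p[of i] show "a $ i-l <= x $ i & x $ i < a $ i-l+3*l" by linarith
    qed
   qed
   thus "x \<notin> box (\<chi> i. a $ i-l) (\<chi> i. a $ i+2*l)" using that by blast
  qed
  have pb: "0 <= p x" "p x <= 1" for x unfolding p_def by (rule plateau_bounds)+
  have ext: "pd i p x = 0" if "p x = 0 | p x = 1" for i x
   using that pb by (intro partial_deriv_extremum test_function_differentiable tp) auto
  have dq: "pd i psi x = p x*(if i = j then 1 else 0)+pd i p x*(x $ j-a $ j)" for i x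
   unfolding psi_def partial_deriv_mult_coordinate[OF tp] by simp
  have bound: "\<bar>pd i psi x\<bar> <= (1+2*B)*indicator T x" for i x
  proof (cases "x : T")
   case True
   hence "a $ j-l <= x $ j" "x $ j < a $ j-l+3*l" by (auto simp: T_def cube_def)
   hence "\<bar>pd i p x\<bar>*\<bar>x $ j-a $ j\<bar> <= B/l*(2*l)"
    using B l by (intro mult_mono) (auto simp: p_def)
   thus ?thesis using True pb[of x] l unfolding dq by (intro order_trans[OF abs_triangle_ineq]) (auto simp: abs_mult)
  qed (simp add: dq pT ext)
  note td = test_partial_deriv[OF tpsi]
  let ?y = "\<Sum>i\<in>UNIV. tv (pd i psi) (A i z)"
  have "Itg (indicator (cube a l)) ?y = (\<Sum>i\<in>UNIV. (if i = j then l^CARD('n) else 0) *R A i z)"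
  proof -
   have "(%x. indicator (cube a l) x*pd i psi x) = (%x. indicator (cube a l) x*(if i = j then 1 else 0))" for i
    by (auto simp: fun_eq_iff dq p1 ext indicator_def)
   thus ?thesis using l by (simp add: Itg_sum Itg_tv sqb_test[OF td] measure_cube) (auto intro!: sum.cong)
  qed
  hence "Itg (indicator (cube a l)) ?y = l^CARD('n) *R x" by (simp add: x if_distrib[of "%r. r *R _"] if_distribR cong: if_cong)
  hence av: "avg a l ?y = x" using l by (simp add: avg_def)
  have "norm ?y <= (\<Sum>i\<in>UNIV. (1+2*B) * sqrt ((3*l)^CARD('n))*norm (A i z))"
  proof (rule order_trans[OF norm_sum], rule sum_mono)
   fix i
   have "(LB x. (pd i psi x)^2) <= (LB x. (1+2*B)^2*indicator T x)"
   proof (rule integral_mono)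
    show "integrable lborel (%x. (pd i psi x)^2)" using sqb_test[OF td] by (simp add: sqb_def)
    show "integrable lborel (%x. (1+2*B)^2*indicator T x)" using l by (simp add: T_def emeasure_cube)
    show "(pd i psi x)^2 <= (1+2*B)^2*indicator T x" for x
     using power_mono[OF bound[of i x], of 2] by (auto simp: indicator_def split: if_splits)
   qed
   also have "... = (1+2*B)^2*(3*l)^CARD('n)" using l by (simp add: T_def measure_cube)
   finally have "sqrt (LB x. (pd i psi x)^2) <= (1+2*B) * sqrt ((3*l)^CARD('n))"
    using real_sqrt_le_mono B(1) by (fastforce simp: real_sqrt_mult)
   thus "norm (tv (pd i psi) (A i z) :: (real^'n, 'b) L2) <= (1+2*B) * sqrt ((3*l)^CARD('n))*norm (A i z)"
    unfolding norm_tv[OF sqb_test[OF td]] by (rule mult_right_mono) simp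
  qed
  also have "... = c * sqrt (l^CARD('n))" unfolding c_def sum_distrib_right by (simp add: power_mult_distrib real_sqrt_mult mult_ac)
  finally have "(norm ?y)^2 <= (c * sqrt (l^CARD('n)))^2" by (rule power_mono) simp
  hence "(norm ?y)^2 <= c^2*l^CARD('n)" using l by (simp add: power_mult_distrib)
  with av tests_D[OF tpsi, of z] show ?thesis by blast
 qed
 from step obtain C where C: "C >= 0" "!!a l. l > 0 ==> \<exists>u y. (u, y) : D & avg a l y = x' & (norm y)^2 <= C*l^CARD('n)" by blast
 show ?case
 proof (intro exI[of _ "2*(r^2*c^2)+2*C"] conjI allI impI)
  fix a :: "real^'n" and l :: real assume l: "l > 0"
  obtain u y u' y' where y: "(u, y) : D" "avg a l y = x" "(norm y)^2 <= c^2*l^CARD('n)" and y': "(u', y') : D" "avg a l y' = x'" "(norm y')^2 <= C*l^CARD('n)"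
   using gen[OF l, of a] C(2)[OF l, of a] by blast
  have "(norm (r *R y+y'))^2 <= 2*(r^2*(norm y)^2)+2*(norm y')^2" using norm_add_sq_le[of "r *R y" y'] by (simp add: power_mult_distrib)
  also have "... <= 2*(r^2*(c^2*l^CARD('n)))+2*(C*l^CARD('n))" using y y' by (intro add_mono mult_left_mono) auto
  finally have "(norm (r *R y+y'))^2 <= (2*(r^2*c^2)+2*C)*l^CARD('n)" by (simp add: algebra_simps)
  moreover have "avg a l (r *R y+y') = r *R x+x'" by (simp add: avg_simps linear_scale[OF linear_avg] y y')
  ultimately show "\<exists>u y. (u, y) : D & avg a l y = r *R x+x' & (norm y)^2 <= (2*(r^2*c^2)+2*C)*l^CARD('n)"
   using D_add[OF D_scale[OF y(1), of r] y'(1)] by blast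
 qed (use C in auto)
qed

text \<open>The test function is \<open>v = D (I + s * J * b * D)\<^sup>-\<^sup>1 u\<close> with \<open>s = eps * l\<close>. For
  small \<open>eps\<close> its mean is close to that of \<open>D u\<close> by interpolation, and \<open>Th r v\<close> has size
  \<open>r / s\<close>, hence is square summable over the dyadic \<open>r \<le> l\<close>.\<close>

lemma test_vector:
 assumes w: "w : V"
 obtains C C' where "C >= 0" "C' >= 0" "!!a l. l > 0 ==> \<exists>u v. (u, v) : D & (norm v)^2 <= C*l^CARD('n) &
  norm (avg a l v-w) <= 1/8 & (\<forall>N. (\<Sum>g<N. (norm (Th (l/2^g) v))^2) <= C'*l^CARD('n))"
proof -
 obtain CY where CY: "CY >= 0" "!!a l. l > 0 ==> \<exists>u y. (u, y) : D & avg a l y = w & (norm y)^2 <= CY*l^CARD('n)" using test_potential[OF w] by blast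
 obtain CA where CA: "CA >= 0" "!!a l eps x y. l > 0 ==> 0 < eps ==> eps <= 1/2 ==> (x, y) : D ==>
   l^CARD('n)*(norm (avg a l y))^2 <= CA*eps*((cnorm a l y)^2+(cnorm a l x)^2/(eps*l)^2)" using average_interpolation by blast
 define k where "k = CR*\<bar>K\<bar>"
 define c where "c = k/\<delta>"
 define E where "E = CA*(((c+1)^2+k^2)*CY)"
 \<comment> \<open>Small enough for an error of at most \<open>1/8\<close> in the mean.\<close>
 define eps where "eps = 1/(64*(E+1))"
 define C' where "C' = (CR*(\<bar>K\<bar>/\<delta>*\<bar>K\<bar>)/eps)^2*2*CY"
 have k: "k >= 0" "c >= 0" using CR_ge1 delta_pos by (auto simp: k_def c_def)
 have E: "E >= 0" using CA(1) CY(1) by (simp add: E_def)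
 have eps: "eps > 0" "eps <= 1/2" "E*eps <= (1/8)^2" using E by (auto simp: eps_def field_simps power2_eq_square)
 have bK: "norm (b f) <= \<bar>K\<bar>*norm f" for f using b_le[of f] mult_right_mono[OF abs_ge_self norm_ge_zero, of K f] by linarith
 have main: "\<exists>u v. (u, v) : D & (norm v)^2 <= (c^2*CY)*l^CARD('n) & norm (avg a l v-w) <= 1/8 & (\<forall>N. (\<Sum>g<N. (norm (Th (l/2^g) v))^2) <= C'*l^CARD('n))"
  if l: "l > 0" for a l
 proof -
  obtain u y where uy: "(u, y) : D" "avg a l y = w" and Y: "(norm y)^2 <= CY*l^CARD('n)" using CY(2)[OF l] by blast
  define s where "s = eps*l"
  have s: "s > 0" "s ~= 0" using eps l by (auto simp: s_def)
  define v where "v = W s u"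
  have D: "(R s u, v) : D" unfolding v_def by (rule RW(1)[OF s(2)])
  have bv: "b v = R s (b y)" unfolding v_def by (rule bW_domain[OF s(2) uy(1)])
  have nR: "norm (R s (b y)) <= k*norm y"
   using order_trans[OF R_bound[OF s(2)] mult_left_mono[OF bK[of y]]] CR_ge1 by (simp add: k_def mult.assoc)
  hence nv: "norm v <= c*norm y"
   using acc_le[OF D] delta_pos unfolding bv c_def by (simp add: field_simps)
  have "norm (R s u-u) = s*norm (R s (b y))"
   using R_domain[OF s(2) uy(1)] s by (metis abs_of_pos add_diff_cancel_left' norm_J norm_minus_commute norm_scaleR)
  hence nx: "norm (R s u-u) <= s*(k*norm y)" using nR s by simp
  have xD: "(R s u-u, v-y) : D" by (rule D_diff[OF D uy(1)])
  have "l^CARD('n)*(norm (avg a l v-w))^2 = l^CARD('n)*(norm (avg a l (v-y)))^2" by (simp add: avg_simps uy)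
  also have "... <= CA*eps*((cnorm a l (v-y))^2+(cnorm a l (R s u-u))^2/s^2)"
   using CA(2)[OF l eps(1,2) xD, of a] by (simp add: s_def)
  also have "... <= CA*eps*(((c+1)*norm y)^2+(s*(k*norm y))^2/s^2)"
  proof (intro mult_left_mono add_mono divide_right_mono power_mono)
   show "cnorm a l (v-y) <= (c+1)*norm y"
    using norm_chi_le[OF cube_sets, of a l "v-y"] norm_triangle_ineq4[of v y] nv by (simp add: distrib_right)
   show "cnorm a l (R s u-u) <= s*(k*norm y)" using norm_chi_le[OF cube_sets, of a l "R s u-u"] nx by linarith
  qed (use CA eps in auto)
  also have "... = CA*eps*((c+1)^2+k^2)*(norm y)^2" using s unfolding power_mult_distrib by (simp add: algebra_simps)
  also have "... <= CA*eps*((c+1)^2+k^2)*(CY*l^CARD('n))" using Y CA eps by (intro mult_left_mono) auto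
  also have "... = l^CARD('n)*(E*eps)" by (simp add: E_def)
  also have "... <= l^CARD('n)*(1/8)^2" using eps l by (intro mult_left_mono) auto
  finally have "(norm (avg a l v-w))^2 <= (1/8)^2" using l by simp
  hence av: "norm (avg a l v-w) <= 1/8" by (rule power2_le_imp_le) simp
  have "(norm v)^2 <= (c*norm y)^2" by (rule power_mono[OF nv]) simp
  also have "... <= (c^2*CY)*l^CARD('n)" using mult_left_mono[OF Y, of "c^2"] by (simp add: power_mult_distrib mult.assoc)
  finally have v2: "(norm v)^2 <= (c^2*CY)*l^CARD('n)" .
  have Th: "norm (Th (l/2^g) v) <= (CR*(\<bar>K\<bar>/\<delta>*\<bar>K\<bar>)/eps)*norm y*(1/2)^g" for g
  proof -
   define r where "r = l/2^g"
   have r: "r > 0" "r ~= 0" using l by (auto simp: r_def)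
   have "Th r v = r *R U r (b (W s (b y)))" unfolding bv by (rule UQ_domain(2)[OF r(2) RW(1)[OF s(2)]])
   hence "norm (Th r v) <= r*(CR*norm (b (W s (b y))))" using U_bound[OF r(2)] r by simp
   also have "norm (b (W s (b y))) <= (\<bar>K\<bar>/\<delta>*(\<bar>K\<bar>*norm y))/s"
    using order_trans[OF bW_bound[OF s(2), of "b y"] mult_left_mono[OF bK[of y]]] delta_pos s by (simp add: pos_le_divide_eq mult.commute)
   finally have "norm (Th r v) <= r*(CR*((\<bar>K\<bar>/\<delta>*(\<bar>K\<bar>*norm y))/s))" using r CR_ge1 by (simp add: mult_left_mono)
   also have "... = (CR*(\<bar>K\<bar>/\<delta>*\<bar>K\<bar>)/eps)*norm y*(1/2)^g" using l by (simp add: r_def s_def power_divide mult_ac del: abs_mult_self_eq)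
   finally show ?thesis unfolding r_def .
  qed
  have "(\<Sum>g<N. (norm (Th (l/2^g) v))^2) <= C'*l^CARD('n)" for N
  proof -
   let ?m = "CR*(\<bar>K\<bar>/\<delta>*\<bar>K\<bar>)/eps"
   have "(\<Sum>g<N. (norm (Th (l/2^g) v))^2) <= (\<Sum>g<N. (?m*norm y)^2*(1/4)^g)"
   proof (rule sum_mono)
    fix g
    have "(norm (Th (l/2^g) v))^2 <= (?m*norm y*(1/2)^g)^2" by (rule power_mono[OF Th]) simp
    also have "... = (?m*norm y)^2*(1/4)^g" by (simp add: power_mult_distrib power2_eq_square flip: power_mult_distrib)
    finally show "(norm (Th (l/2^g) v))^2 <= (?m*norm y)^2*(1/4)^g" .
   qed
   also have "... <= (?m*norm y)^2*2" unfolding sum_distrib_left[symmetric]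
    using geometric_partial_sum_le[of "1/4" N] by (intro mult_left_mono) auto
   also have "... = ?m^2*2*(norm y)^2" by (simp only: power_mult_distrib mult_ac)
   also have "... <= ?m^2*2*(CY*l^CARD('n))" by (rule mult_left_mono[OF Y]) simp
   finally show ?thesis by (simp only: C'_def mult.assoc)
  qed
  with D v2 av show ?thesis by blast
 qed
 show ?thesis by (rule that[OF _ _ main]) (use CY in \<open>auto simp: C'_def\<close>)
qed

end

text \<open>The total volume of the maximal cubes with a given property among those of generation below \<open>g\<close>.\<close>

primrec bm :: "nat => (real^'n => real => bool) => real^'n::finite => real => real" where
 "bm 0 bad a l = 0"
| "bm (Suc g) bad a l = (if bad a l then l^CARD('n) else (\<Sum>e\<in>UNIV. bm g bad (child a l e) (l/2)))"

lemma bm_bounds: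
 fixes a :: "real^'n::finite"
 shows "l > 0 ==> 0 <= bm g bad a l" "l > 0 ==> bm g bad a l <= l^CARD('n)"
proof (induction g arbitrary: a l)
 case (Suc g)
 { case 1 thus ?case using Suc(1) by (auto intro!: sum_nonneg) }
 { case 2
  have "(\<Sum>e\<in>UNIV. bm g bad (child a l e) (l/2)) <= (\<Sum>e\<in>(UNIV :: ('n => bool) set). (l/2)^CARD('n))"
   by (intro sum_mono Suc(2)) (use 2 in auto)
  thus ?case unfolding vol_children[of l, symmetric] by simp }
qed auto

text \<open>On a stopping cube either the mean in direction \<open>w\<close> is below \<open>3/4\<close>, or the large mean is paid for by
  the energy, with the small factor \<open>\<kappa>\<close>. On the remaining set the arithmetic--geometric inequality \<open>x \<le>
  \<kappa> x\<^sup>2 + 1 / (4 \<kappa>)\<close> is used. If the total mean is near one, the stopping cubes therefore cannot cover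
  everything.\<close>

lemma stopping_mean:
 fixes v :: "(real^'n::finite, 'b::euclidean_space) L2"
 assumes w: "norm w = 1" and \<kappa>: "\<kappa> > 0" and bad: "!!a l. bad a l \<longleftrightarrow> w \<bullet> avg a l v < 3/4 | 1 < \<kappa>*norm (avg a l v)"
 shows "l > 0 ==> w \<bullet> Itg (indicator (cube a l)) v <= 3/4*bm g bad a l+\<kappa>*(cnorm a l v)^2+(l^CARD('n)-bm g bad a l)/(4*\<kappa>)"
proof (induction g arbitrary: a l)
 case 0
 let ?X = "cnorm a l v" and ?L = "sqrt (l^CARD('n))"
 have "(norm (Itg (indicator (cube a l)) v))^2 <= (?L*?X)^2"
  using norm_Itg_indicator[of "cube a l" v] 0 by (simp add: bounded_cube measure_cube power_mult_distrib)
 hence "norm (Itg (indicator (cube a l)) v) <= ?L*?X" by (rule power2_le_imp_le) (use 0 in simp)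
 hence "w \<bullet> Itg (indicator (cube a l)) v <= ?L*?X" using norm_cauchy_schwarz[of w "Itg (indicator (cube a l)) v"] w by simp
 moreover have "4*\<kappa>*(?L*?X) <= 4*\<kappa>*(\<kappa>*?X^2)+?L^2"
  using zero_le_power2[of "2*\<kappa>*?X-?L"] by (simp add: power2_eq_square algebra_simps)
 ultimately show ?case using \<kappa> 0 by (simp add: field_simps) (smt (verit) mult_left_mono mult.commute)
next
 case (Suc g)
 let ?I = "Itg (indicator (cube a l)) v" and ?n = "l^CARD('n)"
 have n: "?n > 0" using Suc.prems by simp
 have I: "?I = ?n *R avg a l v" using Suc.prems by (simp add: avg_def)
 show ?case
 proof (cases "bad a l")
  case True
  then consider "w \<bullet> avg a l v < 3/4" | "1 < \<kappa>*norm (avg a l v)" using bad by blast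
  hence "w \<bullet> ?I <= 3/4*?n+\<kappa>*(cnorm a l v)^2"
  proof cases
   case 1 hence "w \<bullet> ?I <= 3/4*?n" using n unfolding I by simp
   thus ?thesis using \<kappa> by (smt (verit) zero_le_power2 mult_nonneg_nonneg)
  next
   case 2
   have "w \<bullet> ?I <= ?n*norm (avg a l v)" using norm_cauchy_schwarz[of w ?I] w n unfolding I by simp
   also have "... <= ?n*norm (avg a l v)*(\<kappa>*norm (avg a l v))" using 2 n mult_left_mono[of 1 "\<kappa>*norm (avg a l v)" "?n*norm (avg a l v)"] by simp
   also have "... = \<kappa>*(?n*(norm (avg a l v))^2)" by (simp add: power2_eq_square)
   also have "... <= \<kappa>*(cnorm a l v)^2" using \<kappa> by (intro mult_left_mono avg_le Suc.prems) simp
   finally show ?thesis using n by simp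
  qed
  thus ?thesis using True by simp
 next
  case False
  let ?c = "child a l"
  have "w \<bullet> ?I = (\<Sum>e\<in>UNIV. w \<bullet> Itg (indicator (cube (?c e) (l/2))) v)" by (simp add: Itg_children[OF Suc.prems] inner_sum_right)
  also have "... <= (\<Sum>e\<in>UNIV. 3/4*bm g bad (?c e) (l/2)+\<kappa>*(cnorm (?c e) (l/2) v)^2+((l/2)^CARD('n)-bm g bad (?c e) (l/2))/(4*\<kappa>))"
   using Suc.prems by (intro sum_mono Suc.IH) simp
  also have "... = 3/4*bm (Suc g) bad a l+\<kappa>*(cnorm a l v)^2+(?n-bm (Suc g) bad a l)/(4*\<kappa>)"
   using False by (simp only: norm_chi_children[OF Suc.prems, of a v] vol_children[of l] sum.distrib sum_distrib_left sum_subtractf sum_divide_distrib[symmetric] bm.simps if_False)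
  finally show ?thesis .
 qed
qed

text \<open>Inside a stopping cube the sum is bounded by induction, by the Carleson constant times its volume.\<close>

lemma stopping_sum:
 fixes a :: "real^'n::finite"
 assumes FH: "!!a l. l > 0 ==> ~ bad a l ==> F a l <= H a l" and H: "!!a l. 0 <= H a l" and M: "!!h a l. h < N ==> l > 0 ==> tot h F a l <= M*l^CARD('n)"
 shows "g < N ==> l > 0 ==> tot g F a l <= tot g H a l+M*bm g bad a (l::real)"
proof (induction g arbitrary: a l)
 case (Suc g)
 have H0: "0 <= tot g' H a l" for g' and a :: "real^'n" and l by (simp add: tot_eq_sum_lev sum_nonneg lev_nonneg H)
 show ?case
 proof (cases "bad a l")
  case True thus ?thesis using M[OF Suc.prems, of a] H0[of "Suc g" a l] by (simp del: tot.simps)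
 next
  case False
  have "(\<Sum>e\<in>UNIV. tot g F (child a l e) (l/2)) <= (\<Sum>e\<in>UNIV. tot g H (child a l e) (l/2)+M*bm g bad (child a l e) (l/2))"
   using Suc.prems by (intro sum_mono Suc.IH) auto
  thus ?thesis using False FH[OF Suc.prems(2) False] by (simp add: sum.distrib sum_distrib_left)
 qed
qed simp

section \<open>The Carleson measure estimate and the quadratic estimate\<close>

lemma fb_sum: "finite I ==> AE x in lborel. fb (\<Sum>i\<in>I. f i) x = (\<Sum>i\<in>I. fb (f i) x)"
 for f :: "'i => ('a::euclidean_space, 'b::euclidean_space) L2"
proof (induction I rule: finite_induct)
 case empty show ?case using fb_zero[where ?'a = 'a and ?'b = 'b] by simp
next
 case (insert i I)
 show ?case using insert.IH fb_add[of "f i" "sum f I"] by eventually_elim (simp add: insert.hyps)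
qed

text \<open>The closed cone of relative aperture \<open>\<sigma>\<close> around a unit vector.\<close>

definition wcone :: "'b::real_normed_vector => real => 'b set" where
 "wcone w \<sigma> = {c. norm (c-norm c *R w) <= \<sigma>*norm c}"

lemma cone_sets: "{x. fb u x : wcone w \<sigma>} : sets borel" for u :: "('a::euclidean_space, 'b::euclidean_space) L2"
proof -
 have "{x : space borel. norm (fb u x-norm (fb u x) *R w) <= \<sigma>*norm (fb u x)} : sets borel" by measurable
 thus ?thesis by (simp add: wcone_def)
qed

lemma integrable_cone: "integrable lborel (%x. indicator {x. fb u x : wcone w \<sigma>} x*(norm (fb u x))^2)"
 by (subst mult.commute) (rule integrable_real_mult_indicator[OF cone_sets[folded sets_lborel] integrable_fb_sq])

text \<open>Up to the factor \<open>norm c\<close>, replacing \<open>c\<close> by \<open>w\<close> changes the product with \<open>y\<close>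
  by at most \<open>1/4\<close>, out of at least \<open>3/4\<close>.\<close>

lemma cone_inner_ge:
 assumes c: "c : wcone w \<sigma>" and y: "3/4 <= w \<bullet> y" "\<sigma>*norm y <= 1/4" shows "norm c <= 2*\<bar>c \<bullet> y\<bar>"
proof -
 have "c \<bullet> y = norm c*(w \<bullet> y)+(c-norm c *R w) \<bullet> y" by (simp add: inner_diff_left)
 moreover have "\<bar>(c-norm c *R w) \<bullet> y\<bar> <= norm c*(1/4)"
 proof -
  have "\<bar>(c-norm c *R w) \<bullet> y\<bar> <= norm (c-norm c *R w)*norm y" by (rule Cauchy_Schwarz_ineq2)
  also have "... <= (\<sigma>*norm c)*norm y" using c by (intro mult_right_mono) (auto simp: wcone_def)
  also have "... = norm c*(\<sigma>*norm y)" by simp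
  also have "... <= norm c*(1/4)" by (rule mult_left_mono[OF y(2)]) simp
  finally show ?thesis .
 qed
 moreover have "norm c*(3/4) <= norm c*(w \<bullet> y)" by (rule mult_left_mono[OF y(1)]) simp
 ultimately show ?thesis by linarith
qed

context dirac_mult
begin

text \<open>An orthonormal basis of \<open>V\<close>.\<close>

definition BB :: "'b set" where "BB = (SOME B. pairwise orthogonal B & (\<forall>x\<in>B. norm x = 1) & finite B & span B = V)"

lemma BB: "finite BB" "span BB = V" "y : V ==> (\<Sum>\<beta>\<in>BB. (y \<bullet> \<beta>) *R \<beta>) = y"
proof -
 have "subspace V" by (simp add: V_def)
 then obtain B where "B \<subseteq> V" "pairwise orthogonal B" "!!x. x : B ==> norm x = 1" "independent B" "span B = V" by (rule orthonormal_basis_subspace) blast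
 hence "\<exists>B. pairwise orthogonal B & (\<forall>x\<in>B. norm x = 1) & finite B & span B = V" by (auto intro: independent_imp_finite)
 hence p: "pairwise orthogonal BB & (\<forall>x\<in>BB. norm x = 1) & finite BB & span BB = V" unfolding BB_def by (rule someI_ex)
 thus "finite BB" "span BB = V" by auto
 show "(\<Sum>\<beta>\<in>BB. (y \<bullet> \<beta>) *R \<beta>) = y" if "y : V" using orthonormal_basis_expand[of BB y] p that by blast
qed

text \<open>The component of \<open>G a l\<close> in the direction \<open>e\<close>, as a function with values in \<open>V\<close> acting
  through the inner product.\<close>

definition cv :: "'b => real^'n => real => (real^'n, 'b) L2" where
 "cv e a l = (\<Sum>\<beta>\<in>BB. lmap (%z. (e \<bullet> z) *R \<beta>) (G a l \<beta>))"

lemma fb_cv: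
 assumes l: "l > 0" shows "AE x in lborel. fb (cv e a l) x : V & (y : V --> fb (cv e a l) x \<bullet> y = e \<bullet> fb (G a l y) x)"
proof -
 have lin: "linear (%z. (e \<bullet> z) *R \<beta>)" for \<beta> :: 'b by (rule linearI) (simp_all add: inner_add_right scaleR_add_left)
 have 1: "AE x in lborel. \<forall>\<beta>\<in>BB. fb (lmap (%z. (e \<bullet> z) *R \<beta>) (G a l \<beta>)) x = (e \<bullet> fb (G a l \<beta>) x) *R \<beta>"
  by (rule AE_ball_countable[THEN iffD2, OF countable_finite[OF BB(1)]]) (use fb_lmap[OF lin] in blast)
 have 2: "AE x in lborel. \<forall>\<beta>\<in>BB. fb ((y \<bullet> \<beta>) *R G a l \<beta>) x = (y \<bullet> \<beta>) *R fb (G a l \<beta>) x"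
  by (rule AE_ball_countable[THEN iffD2, OF countable_finite[OF BB(1)]]) (use fb_scaleR in blast)
 have Gy: "G a l y = (\<Sum>\<beta>\<in>BB. (y \<bullet> \<beta>) *R G a l \<beta>)" if "y : V"
  using BB(3)[OF that] linear_sum[OF G_linear[OF l, of a], of "%\<beta>. (y \<bullet> \<beta>) *R \<beta>" BB] by (simp add: linear_scale[OF G_linear[OF l]])
 show ?thesis
  using 1 2 fb_sum[OF BB(1), of "%\<beta>. lmap (%z. (e \<bullet> z) *R \<beta>) (G a l \<beta>)"] fb_sum[OF BB(1), of "%\<beta>. (y \<bullet> \<beta>) *R G a l \<beta>"]
 proof eventually_elim
  case (elim x)
  hence c: "fb (cv e a l) x = (\<Sum>\<beta>\<in>BB. (e \<bullet> fb (G a l \<beta>) x) *R \<beta>)" by (simp add: cv_def)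
  have "fb (cv e a l) x : V" unfolding c BB(2)[symmetric] by (intro span_sum span_scale span_base)
  moreover have "fb (cv e a l) x \<bullet> y = e \<bullet> fb (G a l y) x" if "y : V"
   using elim unfolding Gy[OF that] c by (simp add: inner_sum_left inner_sum_right inner_commute mult.commute)
  ultimately show ?case by blast
 qed
qed

text \<open>This dominates the squared operator norm of \<open>G a l\<close> on \<open>V\<close>.\<close>

definition gam :: "real^'n => real => real" where "gam a l = DIM('b)*(\<Sum>e\<in>Basis. (norm (cv e a l))^2)"

lemma norm_G_le_gam: assumes l: "l > 0" and y: "y : V" shows "(norm (G a l y))^2 <= gam a l*(norm y)^2"
proof -
 have "AE x in lborel. \<forall>e\<in>Basis. fb (cv e a l) x \<bullet> y = e \<bullet> fb (G a l y) x"
  by (rule AE_ball_countable[THEN iffD2, OF countable_finite[OF finite_Basis]]) (use fb_cv[OF l, of _ a y] y in \<open>auto elim: eventually_mono\<close>)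
 hence "AE x in lborel. (norm (fb (G a l y) x))^2 <= (\<Sum>e\<in>Basis. DIM('b)*(norm y)^2*(norm (fb (cv e a l) x))^2)"
 proof eventually_elim
  case (elim x)
  have "(norm (fb (G a l y) x))^2 = (\<Sum>e\<in>Basis. (e \<bullet> fb (G a l y) x)^2)"
   unfolding power2_norm_eq_inner euclidean_inner[of "fb (G a l y) x" "fb (G a l y) x"] by (simp add: inner_commute power2_eq_square)
  also have "... <= (\<Sum>e\<in>Basis. DIM('b)*(norm y)^2*(norm (fb (cv e a l) x))^2)"
  proof (rule sum_mono)
   fix e :: 'b assume "e : Basis"
   hence "(e \<bullet> fb (G a l y) x)^2 <= (norm (fb (cv e a l) x)*norm y)^2"
    using elim power_mono[OF Cauchy_Schwarz_ineq2[of "fb (cv e a l) x" y], of 2] by simp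
   also have "... <= DIM('b)*((norm (fb (cv e a l) x)*norm y)^2)" using DIM_ge_Suc0[where ?'a = 'b] by (intro mult_right_mono[of 1 "real DIM('b)", simplified]) auto
   finally show "(e \<bullet> fb (G a l y) x)^2 <= DIM('b)*(norm y)^2*(norm (fb (cv e a l) x))^2" by (simp add: power_mult_distrib mult_ac)
  qed
  finally show ?case .
 qed
 hence "(norm (G a l y))^2 <= (LB x. (\<Sum>e\<in>Basis. DIM('b)*(norm y)^2*(norm (fb (cv e a l) x))^2))"
  unfolding norm_L2_sq by (intro integral_mono_AE) (auto simp: integrable_fb_sq)
 also have "... = gam a l*(norm y)^2" by (simp add: integrable_fb_sq gam_def norm_L2_sq[symmetric] sum_distrib_left sum_distrib_right mult_ac)
 finally show ?thesis .
qed

text \<open>The part of \<open>cv e a l\<close> where its direction is close to \<open>w\<close>.\<close>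

definition FC :: "'b => real => 'b => real^'n => real => real" where
 "FC w \<sigma> e a l = (norm (chi {x. fb (cv e a l) x : wcone w \<sigma>} (cv e a l)))^2"

text \<open>At a point of the cone, \<open>cv e a l\<close> is dominated by its product with \<open>y\<close>, which is a component of
  \<open>G a l y\<close>.\<close>

lemma FC_le:
 assumes l: "l > 0" and e: "e : Basis" and y: "y : V" "3/4 <= w \<bullet> y" "\<sigma>*norm y <= 1/4"
 shows "FC w \<sigma> e a l <= 4*(norm (G a l y))^2"
proof -
 have "FC w \<sigma> e a l = (LB x. indicator {x. fb (cv e a l) x : wcone w \<sigma>} x*(norm (fb (cv e a l) x))^2)"
  unfolding FC_def by (rule norm_chi_sq[OF cone_sets])
 also have "... <= (LB x. 4*(norm (fb (G a l y) x))^2)"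
 proof (rule integral_mono_AE)
  show "integrable lborel (%x. indicator {x. fb (cv e a l) x : wcone w \<sigma>} x*(norm (fb (cv e a l) x))^2)"
   by (rule integrable_cone)
  show "AE x in lborel. indicator {x. fb (cv e a l) x : wcone w \<sigma>} x*(norm (fb (cv e a l) x))^2 <= 4*(norm (fb (G a l y) x))^2"
   using fb_cv[OF l, of e a y]
  proof eventually_elim
   case (elim x)
   have "(norm (fb (cv e a l) x))^2 <= 4*(norm (fb (G a l y) x))^2" if "fb (cv e a l) x : wcone w \<sigma>"
   proof -
    have "norm (fb (cv e a l) x) <= 2*\<bar>e \<bullet> fb (G a l y) x\<bar>" using cone_inner_ge[OF that y(2,3)] elim y(1) by simp
    also have "... <= 2*norm (fb (G a l y) x)" using Basis_le_norm[OF e, of "fb (G a l y) x"] by (simp add: inner_commute)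
    finally show ?thesis using power_mono[of "norm (fb (cv e a l) x)" _ 2] by (fastforce simp: power_mult_distrib)
   qed
   thus ?case by (auto simp: indicator_def)
  qed
 qed (simp add: integrable_fb_sq)
 also have "... = 4*(norm (G a l y))^2" by (simp add: norm_L2_sq)
 finally show ?thesis .
qed

text \<open>On the cubes that are not contained in a stopping cube, the mean of the test function detects a fixed proportion of the part of
  \<open>G\<close> in the cone. The stopping cubes miss a fixed proportion of the volume, so the Carleson estimate propagates.\<close>

lemma carleson_cone:
 assumes w: "w : V" "norm w = 1"
 shows "\<exists>\<sigma>>0. \<exists>M\<ge>0. \<forall>e\<in>Basis. \<forall>N a l. l > 0 --> tot N (FC w \<sigma> e) a l <= M*l^CARD('n)"
proof -
 obtain C C' where C: "C >= 0" "C' >= 0" and tv: "!!a l. l > 0 ==> \<exists>u v. (u, v) : D & (norm v)^2 <= C*l^CARD('n) &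
  norm (avg a l v-w) <= 1/8 & (\<forall>N. (\<Sum>g<N. (norm (Th (l/2^g) v))^2) <= C'*l^CARD('n))" using test_vector[OF w(1)] by blast
 obtain CP where CP: "CP >= 0" "!!N a l u v. l > 0 ==> (u, v) : D ==>
  (\<Sum>g<N. lev g (%a l. (norm (chi (cube a l) (Th l v)-G a l (avg a l v)))^2) a l) <= CP*(norm v)^2" using principal_part by blast
 \<comment> \<open>The energy of a test vector is at most \<open>C l ^ n\<close>, so \<open>\<kappa>\<close> times it is at most one
   sixteenth of the volume. Then the stopping cubes miss the proportion \<open>\<kappa> / 4\<close> of the cube, and \<open>M\<close> solves
   \<open>C3 = M * (\<kappa> / 4)\<close>.\<close>
 define \<kappa> where "\<kappa> = 1/(16*(C+1))"
 define C3 where "C3 = 8*C'+8*(CP*C)"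
 define M where "M = C3/(\<kappa>/4)"
 have \<kappa>: "\<kappa> > 0" "\<kappa>*C <= 1/16" "\<kappa> <= 1/16" using C by (auto simp: \<kappa>_def field_simps)
 have M: "M >= 0" using C CP \<kappa> by (simp add: M_def C3_def)
 have "tot N (FC w (\<kappa>/4) e) a l <= M*l^CARD('n)" if e: "e : Basis" and l: "l > 0" for e N a l
  using l
 proof (induction N arbitrary: a l rule: less_induct)
  case (less N)
  let ?F = "FC w (\<kappa>/4) e" and ?n = "l^CARD('n)"
  have n: "?n > 0" using less.prems by simp
  show ?case
  proof (cases N)
   case (Suc g)
   obtain u v where D: "(u, v) : D" and v: "(norm v)^2 <= C*?n" "norm (avg a l v-w) <= 1/8" "!!N. (\<Sum>g<N. (norm (Th (l/2^g) v))^2) <= C'*?n"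
    using tv[OF less.prems] by blast
   define bad where "bad = (%a l. w \<bullet> avg a l v < 3/4 | 1 < \<kappa>*norm (avg a l v))"
   define H where "H = (%a l. 8*(cnorm a l (Th l v))^2+8*(norm (chi (cube a l) (Th l v)-G a l (avg a l v)))^2)"
   have FH: "?F a l <= H a l" if "l > 0" "~ bad a l" for a l
   proof -
    have "?F a l <= 4*(norm (G a l (avg a l v)))^2"
     by (rule FC_le[OF that(1) e avg_in_V[OF D that(1)]]) (use that(2) in \<open>auto simp: bad_def\<close>)
    also have "... <= H a l"
     using norm_add_sq_le[of "chi (cube a l) (Th l v)" "G a l (avg a l v)-chi (cube a l) (Th l v)"] by (simp add: H_def norm_minus_commute)
    finally show ?thesis .
   qed
   have wv: "w \<bullet> avg a l v >= 7/8" "norm (avg a l v) <= 9/8"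
   proof -
    have "\<bar>w \<bullet> (avg a l v-w)\<bar> <= 1/8" using Cauchy_Schwarz_ineq2[of w "avg a l v-w"] v(2) w by simp
    moreover have "w \<bullet> w = 1" using w by (simp add: dot_square_norm)
    ultimately show "w \<bullet> avg a l v >= 7/8" unfolding inner_diff_right by linarith
    show "norm (avg a l v) <= 9/8" using norm_triangle_sub[of "avg a l v" w] v(2) w by simp
   qed
   have nb: "~ bad a l" using wv mult_mono[OF \<kappa>(3) wv(2)] by (auto simp: bad_def)
   define m where "m = bm N bad a l"
   have "tot N ?F a l <= tot N H a l+M*m"
   proof -
    have "(\<Sum>e\<in>UNIV. tot g ?F (child a l e) (l/2)) <= (\<Sum>e\<in>UNIV. tot g H (child a l e) (l/2)+M*bm g bad (child a l e) (l/2))"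
     by (intro sum_mono stopping_sum[where N = N] FH less.IH) (use Suc less.prems in \<open>auto simp: H_def\<close>)
    thus ?thesis using FH[OF less.prems nb] nb unfolding m_def Suc by (simp add: sum.distrib sum_distrib_left)
   qed
   also have "tot N H a l <= C3*?n"
   proof -
    have "tot N (%a l. (cnorm a l (Th l v))^2) a l <= C'*?n"
    proof -
     have "lev g (%a l. (cnorm a l (Th l v))^2) a l <= (norm (Th (l/2^g) v))^2" for g
     proof -
      have "lev g (%a l. (cnorm a l (Th l v))^2) a l <= lev g (%a l'. (cnorm a l' (Th (l/2^g) v))^2) a l" by (rule lev_mono) simp
      also have "... <= (norm (Th (l/2^g) v))^2" unfolding lev_norm_chi[OF less.prems] by (intro power_mono norm_chi_le) auto
      finally show ?thesis .
     qed
     thus ?thesis unfolding tot_eq_sum_lev by (rule order_trans[OF sum_mono v(3)])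
    qed
    moreover have "tot N (%a l. (norm (chi (cube a l) (Th l v)-G a l (avg a l v)))^2) a l <= CP*(C*?n)"
     unfolding tot_eq_sum_lev by (rule order_trans[OF CP(2)[OF less.prems D] mult_left_mono[OF v(1) CP(1)]])
    ultimately show ?thesis unfolding H_def tot_add tot_cmult C3_def by (simp add: algebra_simps)
   qed
   also have "C3*?n+M*m <= M*?n"
   proof -
    have "w \<bullet> Itg (indicator (cube a l)) v = ?n*(w \<bullet> avg a l v)" using less.prems by (simp add: avg_def)
    hence 1: "?n*(7/8) <= w \<bullet> Itg (indicator (cube a l)) v" using mult_left_mono[OF wv(1), of ?n] n by simp
    define X where "X = (?n-m)/(4*\<kappa>)"
    have 2: "w \<bullet> Itg (indicator (cube a l)) v <= 3/4*m+\<kappa>*(cnorm a l v)^2+X"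
     unfolding m_def X_def by (rule stopping_mean[OF w(2) \<kappa>(1) _ less.prems]) (simp add: bad_def)
    have 3: "\<kappa>*(cnorm a l v)^2 <= ?n/16"
    proof -
     have "(cnorm a l v)^2 <= C*?n" by (rule order_trans[OF power_mono v(1)]) (auto intro: norm_chi_le)
     hence "\<kappa>*(cnorm a l v)^2 <= \<kappa>*C*?n" using \<kappa> by (simp add: mult.assoc mult_left_mono)
     also have "... <= 1/16*?n" using \<kappa> n by (intro mult_right_mono) auto
     finally show ?thesis by simp
    qed
    have "m <= ?n" unfolding m_def by (rule bm_bounds(2)[OF less.prems])
    with 1 2 3 have "?n/16 <= X" by linarith
    hence "\<kappa>/4*?n <= ?n-m" using \<kappa>(1) by (simp add: X_def pos_le_divide_eq algebra_simps)
    hence "M*(\<kappa>/4*?n) <= M*(?n-m)" by (rule mult_left_mono[OF _ M])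
    moreover have "M*(\<kappa>/4*?n) = C3*?n" using \<kappa>(1) by (simp add: M_def)
    ultimately show ?thesis unfolding right_diff_distrib by linarith
   qed
   finally show ?thesis by simp
  qed (use M n in simp)
 qed
 with \<kappa> M show ?thesis by (intro exI[of _ "\<kappa>/4"] conjI exI[of _ M]) auto
qed

text \<open>Cover the unit sphere of \<open>V\<close> by finitely many balls; every nonzero value of \<open>cv e a l\<close> lies in one of
  the corresponding cones.\<close>

lemma carleson_measure:
 obtains M where "M > 0" "!!N a l. l > 0 ==> tot N gam a l <= M*l^CARD('n)"
proof -
 define S where "S = {w : V. norm w = 1}"
 have "compact S"
 proof -
  have "S = V \<inter> sphere 0 1" by (auto simp: S_def)
  thus ?thesis using closed_subspace[of V] by (simp add: V_def closed_Int_compact)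
 qed
 moreover have "\<exists>\<sigma> M. \<forall>w\<in>S. \<sigma> w > 0 & M w >= 0 & (\<forall>e\<in>Basis. \<forall>N a l. l > 0 --> tot N (FC w (\<sigma> w) e) a l <= M w*l^CARD('n))"
  using carleson_cone unfolding S_def by (auto intro!: bchoice simp flip: choice_iff) (metis (no_types, lifting))
 then obtain \<sigma> M where \<sigma>: "!!w. w : S ==> \<sigma> w > 0" and M: "!!w. w : S ==> M w >= 0"
  "!!w e N a l. w : S ==> e : Basis ==> l > 0 ==> tot N (FC w (\<sigma> w) e) a l <= M w*l^CARD('n)" by metis
 ultimately obtain W where W: "W \<subseteq> S" "finite W" "S \<subseteq> (\<Union>w\<in>W. ball w (\<sigma> w))"
  by (elim compactE_image[where S = S and f = "%w. ball w (\<sigma> w)"]) (auto intro: centre_in_ball[THEN iffD2])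
 have g: "gam a l <= DIM('b)*(\<Sum>e\<in>Basis. \<Sum>w\<in>W. FC w (\<sigma> w) e a l)" if l: "l > 0" for a l
  unfolding gam_def
 proof (intro mult_left_mono sum_mono)
  fix e :: 'b
  let ?c = "fb (cv e a l)" and ?S = "%w. {x. fb (cv e a l) x : wcone w (\<sigma> w)}"
  have i: "integrable lborel (%x. indicator (?S w) x*(norm (?c x))^2)" for w
   by (rule integrable_cone)
  have "(norm (cv e a l))^2 <= (LB x. (\<Sum>w\<in>W. indicator (?S w) x*(norm (?c x))^2))"
   unfolding norm_L2_sq
  proof (rule integral_mono_AE)
   show "AE x in lborel. (norm (?c x))^2 <= (\<Sum>w\<in>W. indicator (?S w) x*(norm (?c x))^2)"
    using fb_cv[OF l, of e a 0]
   proof eventually_elim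
    case (elim x)
    show ?case
    proof (cases "?c x = 0")
     case False
     hence "?c x /\<^sub>R norm (?c x) : S" using elim unfolding S_def by (auto simp: V_def span_scale)
     then obtain w where w: "w : W" "dist w (?c x /\<^sub>R norm (?c x)) < \<sigma> w" using W(3) by auto
     have "norm (?c x-norm (?c x) *R w) = norm (?c x)*dist w (?c x /\<^sub>R norm (?c x))"
     proof -
      have "?c x-norm (?c x) *R w = norm (?c x) *R (?c x /\<^sub>R norm (?c x)-w)" using False by (simp add: scaleR_diff_right)
      thus ?thesis by (simp add: dist_norm norm_minus_commute)
     qed
     hence "x : ?S w" using mult_left_mono[OF less_imp_le[OF w(2)], of "norm (?c x)"] by (simp add: wcone_def mult.commute)
     hence "(norm (?c x))^2 = indicator (?S w) x*(norm (?c x))^2" by simp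
     also have "... <= (\<Sum>w\<in>W. indicator (?S w) x*(norm (?c x))^2)" by (rule member_le_sum[OF w(1)]) (auto simp: W)
     finally show ?thesis .
    qed (simp add: sum_nonneg)
   qed
  qed (auto simp: integrable_fb_sq i)
  also have "... = (\<Sum>w\<in>W. FC w (\<sigma> w) e a l)" by (simp add: i FC_def norm_chi_sq[OF cone_sets])
  finally show "(norm (cv e a l))^2 <= (\<Sum>w\<in>W. FC w (\<sigma> w) e a l)" .
 qed simp
 define M' where "M' = real DIM('b)*(\<Sum>e\<in>(Basis::'b set). \<Sum>w\<in>W. M w)+1"
 have "tot N gam a l <= M'*l^CARD('n)" if l: "l > 0" for N a l
 proof -
  have "tot N gam a l <= tot N (%a l. DIM('b)*(\<Sum>e\<in>Basis. \<Sum>w\<in>W. FC w (\<sigma> w) e a l)) a l" by (rule tot_mono[OF g l])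
  also have "... = DIM('b)*(\<Sum>e\<in>Basis. \<Sum>w\<in>W. tot N (FC w (\<sigma> w) e) a l)" by (simp only: tot_cmult tot_sum)
  also have "... <= DIM('b)*(\<Sum>e\<in>(Basis::'b set). \<Sum>w\<in>W. M w*l^CARD('n))"
   using W(1) by (intro mult_left_mono sum_mono M l) auto
  also have "... <= M'*l^CARD('n)" using l unfolding M'_def distrib_right by (simp add: sum_distrib_right mult.assoc)
  finally show ?thesis .
 qed
 moreover have "M' > 0" using W(1) M(1) unfolding M'_def by (auto intro!: add_nonneg_pos mult_nonneg_nonneg sum_nonneg)
 ultimately show ?thesis using that by blast
qed

text \<open>The estimate is proved on one dyadic system in a cube of side \<open>t 2 ^ L\<close>. Only its generations from \<open>L\<close>
  on are wanted; then let \<open>L\<close> tend to infinity.\<close>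

theorem quadratic_estimate:
 obtains C where "square_bound C"
proof -
 obtain CP where CP: "CP >= 0" "!!N a l u v. l > 0 ==> (u, v) : D ==>
  (\<Sum>g<N. lev g (%a l. (norm (chi (cube a l) (Th l v)-G a l (avg a l v)))^2) a l) <= CP*(norm v)^2" using principal_part by blast
 obtain M where M: "M > 0" "!!N a l. l > 0 ==> tot N gam a l <= M*l^CARD('n)" using carleson_measure by blast
 define C where "C = 2*CP+2*(4*M)"
 have g0: "gam a l >= 0" for a l by (simp add: gam_def sum_nonneg)
 have loc: "(\<Sum>g<N. (cnorm a l (Th (l/2^g) v))^2) <= C*(norm v)^2" if l: "l > 0" and uv: "(u, v) : D" for a l N u v
 proof -
  have "(cnorm a l (Th (l/2^g) v))^2 = lev g (%a l. (cnorm a l (Th l v))^2) a l" for g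
   unfolding lev_norm_chi[OF l, of g, symmetric] by (intro antisym lev_mono) auto
  hence "(\<Sum>g<N. (cnorm a l (Th (l/2^g) v))^2) = tot N (%a l. (cnorm a l (Th l v))^2) a l" by (simp add: tot_eq_sum_lev)
  also have "... <= tot N (%a l. 2*(norm (chi (cube a l) (Th l v)-G a l (avg a l v)))^2+2*(gam a l*(norm (avg a l v))^2)) a l"
  proof (rule tot_mono[OF _ l])
   fix a and l :: real assume l: "l > 0"
   show "(cnorm a l (Th l v))^2 <= 2*(norm (chi (cube a l) (Th l v)-G a l (avg a l v)))^2+2*(gam a l*(norm (avg a l v))^2)"
    using norm_add_sq_le[of "chi (cube a l) (Th l v)-G a l (avg a l v)" "G a l (avg a l v)"] norm_G_le_gam[OF l avg_in_V[OF uv l], of a a] by simp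
  qed
  also have "... = 2*tot N (%a l. (norm (chi (cube a l) (Th l v)-G a l (avg a l v)))^2) a l+2*tot N (%a l. gam a l*(norm (avg a l v))^2) a l"
   by (simp only: tot_add tot_cmult)
  also have "... <= 2*(CP*(norm v)^2)+2*(4*M*(norm v)^2)"
   using CP(2)[OF l uv, where N = N and a = a] carleson_embedding[OF g0 M(2) M(1) l, where g = N and a = a and v = v] by (simp add: tot_eq_sum_lev[of N "%a l. (norm (chi (cube a l) (Th l v)-G a l (avg a l v)))^2"])
  finally show ?thesis by (simp add: C_def algebra_simps)
 qed
 have "(\<Sum>i<N. (norm (Th (t/2^i) v))^2) <= C*(norm v)^2" if uv: "(u, v) : D" and t: "t > 0" for u v t N
 proof (rule LIMSEQ_le_const2)
  let ?Q = "%L. cube (\<chi> i. - (t*2^L)/2) (t*2^L) :: (real^'n) set"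
  have ev: "eventually (%L. x : ?Q L) sequentially" for x
  proof -
   obtain L0 where L0: "2*norm x/t < 2^L0" using real_arch_pow[of 2] by auto
   have "x : ?Q L" if "L >= L0" for L
   proof -
    have "2*norm x < t*2^L" using order_less_le_trans[OF L0 power_increasing[OF that]] t by (simp add: pos_divide_less_eq mult.commute)
    thus ?thesis using component_le_norm_cart[of x] unfolding cube_def mem_Collect_eq vec_lambda_beta by (smt (verit) field_sum_of_halves minus_divide_left)
   qed
   thus ?thesis by (auto simp: eventually_sequentially)
  qed
  show "(%L. \<Sum>i<N. (norm (chi (?Q L) (Th (t/2^i) v)))^2) ----> (\<Sum>i<N. (norm (Th (t/2^i) v))^2)"
   by (intro tendsto_intros chi_tendsto ev) simp
  have "(\<Sum>i<N. (norm (chi (?Q L) (Th (t/2^i) v)))^2) <= C*(norm v)^2" for L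
  proof -
   let ?f = "%g. (norm (chi (?Q L) (Th (t*2^L/2^g) v)))^2"
   have "(\<Sum>i<N. (norm (chi (?Q L) (Th (t/2^i) v)))^2) = (\<Sum>i<N. ?f (i+L))" by (simp add: power_add)
   also have "... = sum ?f {L..<N+L}" using sum.shift_bounds_nat_ivl[of ?f 0 L N] by (simp add: atLeast0LessThan)
   also have "... <= sum ?f {..<N+L}" by (rule sum_mono2) auto
   also have "... <= C*(norm v)^2" by (rule loc[OF _ uv]) (use t in simp)
   finally show ?thesis .
  qed
  thus "\<exists>L0. \<forall>L\<ge>L0. (\<Sum>i<N. (norm (chi (?Q L) (Th (t/2^i) v)))^2) <= C*(norm v)^2" by blast
 qed
 thus ?thesis using that[of C] CP(1) M(1) by (simp add: square_bound_def C_def)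
qed

end

section \<open>Complex structure and multiplication operators\<close>

lemma matrix_vector_scalar: "M *v (c *s z) = c *s (M *v z)" for M :: "complex^'m::finite^'k::finite"
 by (simp add: vec_eq_iff matrix_vector_mult_def sum_distrib_left mult_ac)

lemma scaleR_eq_scalar: "r *R z = complex_of_real r *s z" for z :: "complex^'m::finite"
 by (simp add: vec_eq_iff scaleR_conv_of_real[where 'a = complex])

lemma linear_matrix: "linear (%z. M *v z)" for M :: "complex^'m::finite^'k::finite"
 by (rule linearI) (simp_all add: matrix_vector_right_distrib matrix_vector_scalar scaleR_eq_scalar)

lemma linear_scalar: "linear (%z :: complex^'m::finite. c *s z)"
 by (rule linearI) (simp_all add: vec_eq_iff algebra_simps)

lemma bounded_bilinear_matrix: "bounded_bilinear (%(M :: complex^'m::finite^'k::finite) z. M *v z)"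
 unfolding bilinear_conv_bounded_bilinear[symmetric] bilinear_def
proof (intro conjI allI linear_matrix)
 show "linear (%M :: complex^'m^'k. M *v z)" for z
  by (rule linearI) (simp_all add: vec_eq_iff matrix_vector_mult_def algebra_simps sum.distrib scaleR_sum_right)
qed

lemma measurable_matrix_vector [measurable]:
 fixes F :: "'x => complex^'m::finite^'k::finite"
 assumes "F : borel_measurable M" "f : borel_measurable M" shows "(%x. F x *v f x) : borel_measurable M"
 by (rule borel_measurable_continuous_Pair[OF assms])
  (intro bounded_bilinear.continuous_on[OF bounded_bilinear_matrix] continuous_intros)

lemma lebesgue_integral_lborel: "f : borelm ==> (LINT x|lebesgue. f x) = (LB x. f x)"
 for f :: "'a::euclidean_space => 'b::{banach, second_countable_topology}"
 by (rule integral_completion) simp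

lemma cscale_eq_lmap: "cscale c u = lmap (%z. c *s z) u"
proof -
 have "L2_rel (fb u) (fb u)" using sqb_sq_integrable[OF sqb_fb[of u]] by (simp add: L2_rel_def)
 from cscale.abs_eq[OF this, of c] show ?thesis by (simp add: mk_fb[unfolded mk_def] lmap_def mk_def)
qed

lemma fb_cscale: "AE x in lborel. fb (cscale c u) x = c *s fb u x"
 unfolding cscale_eq_lmap by (rule fb_lmap[OF linear_scalar])

lemma inner_complex_eq_Re: "z \<bullet> w = Re (\<Sum>i\<in>UNIV. z $ i*cnj (w $ i))" for z w :: "complex^'m::finite"
 by (simp add: inner_vec_def inner_complex_def)

lemma cinner_eq:
 fixes u v :: "(real^'n::finite, complex^'m::finite) L2"
 shows "integrable lborel (%x. \<Sum>i\<in>UNIV. fb u x $ i*cnj (fb v x $ i))"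
  and "cinner u v = (LB x. (\<Sum>i\<in>UNIV. fb u x $ i*cnj (fb v x $ i)))"
proof -
 have m: "(%x. \<Sum>i\<in>UNIV. fb u x $ i*cnj (fb v x $ i)) : borelm"
  by (rule borel_measurable_continuous_Pair[where H = "%z w. \<Sum>i\<in>UNIV. z $ i*cnj (w $ i)"]) (measurable, intro continuous_intros)
 show "integrable lborel (%x. \<Sum>i\<in>UNIV. fb u x $ i*cnj (fb v x $ i))"
 proof (rule integrable_dominated)
  show "integrable lborel (%x. real CARD('m)*((norm (fb u x))^2+(norm (fb v x))^2))" by (simp add: integrable_fb_sq)
  have "norm (\<Sum>i\<in>UNIV. z $ i*cnj (w $ i)) <= real CARD('m)*((norm z)^2+(norm w)^2)" for z w :: "complex^'m"
  proof -
   have "norm (\<Sum>i\<in>UNIV. z $ i*cnj (w $ i)) <= (\<Sum>i\<in>(UNIV :: 'm set). (norm z)^2+(norm w)^2)"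
   proof (rule order_trans[OF norm_sum], rule sum_mono)
    fix i
    have "norm (z $ i*cnj (w $ i)) <= norm z*norm w" unfolding norm_mult complex_mod_cnj by (intro mult_mono Finite_Cartesian_Product.norm_nth_le) auto
    also have "... <= (norm z)^2+(norm w)^2" using sum_squares_bound[of "norm z" "norm w"] mult_nonneg_nonneg[OF norm_ge_zero norm_ge_zero, of z w] by linarith
    finally show "norm (z $ i*cnj (w $ i)) <= (norm z)^2+(norm w)^2" .
   qed
   thus ?thesis by simp
  qed
  thus "AE x in lborel. norm (\<Sum>i\<in>UNIV. fb u x $ i*cnj (fb v x $ i)) <= norm (real CARD('m)*((norm (fb u x))^2+(norm (fb v x))^2))"
   by (intro AE_I2) simp
 qed (use m in simp)
 have "L2_rel (fb u) (fb u)" "L2_rel (fb v) (fb v)" using sqb_sq_integrable[OF sqb_fb] by (auto simp: L2_rel_def)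
 from cinner.abs_eq[OF this] show "cinner u v = (LB x. (\<Sum>i\<in>UNIV. fb u x $ i*cnj (fb v x $ i)))"
  unfolding lebesgue_integral_lborel[OF m, symmetric] by (simp add: mk_fb[unfolded mk_def])
qed

text \<open>The real Hilbert space structure used throughout is the real part of the given complex one.\<close>

lemma Re_cinner: "Re (cinner u v) = inner u v" for u v :: "(real^'n::finite, complex^'m::finite) L2"
 unfolding cinner_eq(2) inner_L2 inner_complex_eq_Re by (rule integral_Re[OF cinner_eq(1), symmetric])

lemma cinner_cscale: "cinner (cscale c u) v = c*cinner u v" for u v :: "(real^'n::finite, complex^'m::finite) L2"
proof -
 have "cinner (cscale c u) v = (LB x. c*(\<Sum>i\<in>UNIV. fb u x $ i*cnj (fb v x $ i)))"
  unfolding cinner_eq(2)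
 proof (rule integral_cong_AE)
  show "(%x. c*(\<Sum>i\<in>UNIV. fb u x $ i*cnj (fb v x $ i))) : borel_measurable lborel"
   by (rule borel_measurable_times[OF borel_measurable_const borel_measurable_integrable[OF cinner_eq(1)]])
  show "AE x in lborel. (\<Sum>i\<in>UNIV. fb (cscale c u) x $ i*cnj (fb v x $ i)) = c*(\<Sum>i\<in>UNIV. fb u x $ i*cnj (fb v x $ i))"
   using fb_cscale[of c u] by eventually_elim (simp add: sum_distrib_left mult.assoc)
 qed (rule borel_measurable_integrable[OF cinner_eq(1)])
 also have "... = c*cinner u v" unfolding cinner_eq(2) by simp
 finally show ?thesis .
qed

lemma linear_lmap: assumes L: "linear L" shows "linear (lmap L)"
proof (rule linearI)
 show "lmap L (u+v) = lmap L u+lmap L v" for u v :: "('x::euclidean_space, 'a) L2"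
  by (rule L2_eqI) (use fb_lmap[OF L, of "u+v"] fb_lmap[OF L, of u] fb_lmap[OF L, of v] fb_add[of u v] fb_add[of "lmap L u" "lmap L v"] in
    \<open>eventually_elim, simp add: linear_add[OF L]\<close>)
 show "lmap L (r *R u) = r *R lmap L u" for r and u :: "('x::euclidean_space, 'a) L2"
  by (rule L2_eqI) (use fb_lmap[OF L, of "r *R u"] fb_lmap[OF L, of u] fb_scaleR[of r u] fb_scaleR[of r "lmap L u"] in
    \<open>eventually_elim, simp add: linear_scale[OF L]\<close>)
qed

abbreviation JC :: "(real^'n::finite, complex^'m::finite) L2 => (real^'n, complex^'m) L2" where "JC \<equiv> cscale \<i>"

lemma JC:
 fixes u v :: "(real^'n::finite, complex^'m::finite) L2"
 shows "linear (JC :: (real^'n, complex^'m) L2 => _)" "JC (JC u) = - u" "inner (JC u) (JC v) = inner u v" "bdd phi ==> JC (mulr phi u) = mulr phi (JC u)"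
  "cscale c u = Re c *R u+Im c *R JC u"
proof -
 show "linear (JC :: (real^'n, complex^'m) L2 => _)" unfolding cscale_eq_lmap[abs_def] by (rule linear_lmap[OF linear_scalar])
 have m: "AE x in lborel. fb (- u) x = - fb u x" using fb_scaleR[of "- 1" u] by simp
 show "JC (JC u) = - u"
  by (rule L2_eqI) (use fb_cscale[of \<i> "JC u"] fb_cscale[of \<i> u] m in \<open>eventually_elim, simp add: vec_eq_iff\<close>)
 have "(\<i> *s z) \<bullet> (\<i> *s w) = z \<bullet> w" for z w :: "complex^'m" by (simp add: inner_vec_def inner_complex_def add.commute)
 thus "inner (JC u) (JC v) = inner u v" unfolding inner_L2
  by (intro integral_cong_AE) (use fb_cscale[of \<i> u] fb_cscale[of \<i> v] in \<open>auto elim!: eventually_elim2\<close>)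
 show "JC (mulr phi u) = mulr phi (JC u)" if "bdd phi"
  by (rule L2_eqI) (use fb_cscale[of \<i> "mulr phi u"] fb_cscale[of \<i> u] fb_mulr[OF that, of u] fb_mulr[OF that, of "JC u"] in
    \<open>eventually_elim, simp add: linear_scale[OF linear_scalar]\<close>)
 show "cscale c u = Re c *R u+Im c *R JC u"
  by (rule L2_eqI) (use fb_cscale[of c u] fb_cscale[of \<i> u] fb_add[of "Re c *R u" "Im c *R JC u"] fb_scaleR[of "Re c" u] fb_scaleR[of "Im c" "JC u"] in
    \<open>eventually_elim, simp add: vec_eq_iff complex_eq_iff\<close>)
qed

definition mulB :: "(real^'n => complex^'m^'m) => (real^'n::finite, complex^'m::finite) L2 => (real^'n, complex^'m) L2" where
 "mulB B u = mk (%x. B x *v fb u x)"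

definition adjB :: "(real^'n => complex^'m^'m) => real^'n::finite => complex^'m^'m::finite" where
 "adjB B x = (\<chi> i j. cnj (B x $ j $ i))"

lemma inner_adjoint_matrix: "(M *v z) \<bullet> w = z \<bullet> ((\<chi> i j. cnj (M $ j $ i)) *v w)" for M :: "complex^'m::finite^'m"
proof -
 have "(\<Sum>i\<in>UNIV. (M *v z) $ i*cnj (w $ i)) = (\<Sum>i\<in>UNIV. \<Sum>j\<in>UNIV. M $ i $ j*z $ j*cnj (w $ i))"
  by (simp add: matrix_vector_mult_def sum_distrib_right)
 also have "... = (\<Sum>j\<in>UNIV. z $ j*cnj (((\<chi> i j. cnj (M $ j $ i)) *v w) $ j))"
  by (subst sum.swap) (simp add: matrix_vector_mult_def sum_distrib_left mult_ac)
 finally show ?thesis unfolding inner_complex_eq_Re by simp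
qed

lemma mulB_props:
 fixes B :: "real^'n::finite => complex^'m::finite^'m"
 assumes B: "B : borelm" "!!x. norm (B x) <= C"
 obtains K where "!!u. norm (mulB B u) <= K*norm u" "!!u. AE x in lborel. fb (mulB B u) x = B x *v fb u x"
  "linear (mulB B)" "!!u. mulB B (JC u) = JC (mulB B u)" "!!phi u. bdd phi ==> mulB B (mulr phi u) = mulr phi (mulB B u)"
proof -
 note [measurable] = B(1)
 obtain k where k: "k > 0" "!!M (z :: complex^'m). norm (M *v z :: complex^'m) <= norm M*norm z * k"
  using bounded_bilinear.pos_bounded[OF bounded_bilinear_matrix] by blast
 have C: "C >= 0" using order_trans[OF norm_ge_zero B(2)] .
 have le: "norm (B x *v z) <= (C * k)*norm z" for x z
  using order_trans[OF k(2) mult_right_mono[OF mult_right_mono[OF B(2) norm_ge_zero]]] k(1) by (simp add: mult_ac)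
 note sb = sqb_bound[of "%x. B x *v fb u x" "C * k" u for u, OF measurable_matrix_vector[OF B(1)] AE_I2[OF le]]
 have s: "sqb (%x. B x *v fb u x)" "norm (mulB B u) <= (C * k)*norm u" for u
  unfolding mulB_def using sb[of u] C k(1) by auto
 have fb: "AE x in lborel. fb (mulB B u) x = B x *v fb u x" for u unfolding mulB_def by (rule fb_mk[OF s(1)])
 show ?thesis
 proof (rule that[OF s(2) fb])
  show "linear (mulB B)"
  proof (rule linearI)
   show "mulB B (u+v) = mulB B u+mulB B v" for u v
    by (rule L2_eqI) (use fb[of "u+v"] fb[of u] fb[of v] fb_add[of u v] fb_add[of "mulB B u" "mulB B v"] in
      \<open>eventually_elim, simp add: matrix_vector_right_distrib\<close>)
   show "mulB B (r *R u) = r *R mulB B u" for r u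
    by (rule L2_eqI) (use fb[of "r *R u"] fb[of u] fb_scaleR[of r u] fb_scaleR[of r "mulB B u"] in
      \<open>eventually_elim, simp add: linear_scale[OF linear_matrix]\<close>)
  qed
  show "mulB B (JC u) = JC (mulB B u)" for u
   by (rule L2_eqI) (use fb[of "JC u"] fb[of u] fb_cscale[of \<i> u] fb_cscale[of \<i> "mulB B u"] in \<open>eventually_elim, simp add: matrix_vector_scalar\<close>)
  show "mulB B (mulr phi u) = mulr phi (mulB B u)" if "bdd phi" for phi u
   by (rule L2_eqI) (use fb[of "mulr phi u"] fb[of u] fb_mulr[OF that, of u] fb_mulr[OF that, of "mulB B u"] in
     \<open>eventually_elim, simp add: linear_scale[OF linear_matrix]\<close>)
 qed
qed

text \<open>A Borel representative, set to zero where it exceeds the essential bound, is bounded everywhere.\<close>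

lemma mult_op_eq:
 fixes B :: "real^'n::finite => complex^'m::finite^'m"
 assumes "L_infinity B"
 obtains B0 C where "B0 : borelm" "!!x. norm (B0 x) <= C" "mult_op B = mulB B0"
proof -
 obtain C where m: "B : borel_measurable lebesgue" and C: "AE x in lebesgue. norm (B x) <= C" using assms by (auto simp: L_infinity_def)
 obtain g where g: "g : borelm" "AE x in lborel. B x = g x" using lebesgue_borel_representative[OF m] by blast
 define B0 where "B0 = (%x. if norm (g x) <= \<bar>C\<bar> then g x else 0)"
 have B0: "B0 : borelm" "!!x. norm (B0 x) <= \<bar>C\<bar>" unfolding B0_def using g(1) by auto
 have eq: "AE x in lborel. B x = B0 x" using g(2) C unfolding AE_lebesgue_iff by eventually_elim (auto simp: B0_def)
 have "mult_op B u = mulB B0 u" for u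
 proof -
  obtain k where k: "k > 0" "!!M (z :: complex^'m). norm (M *v z :: complex^'m) <= norm M*norm z * k"
   using bounded_bilinear.pos_bounded[OF bounded_bilinear_matrix] by blast
  have "norm (B0 x *v z) <= (\<bar>C\<bar> * k)*norm z" for x z
   using order_trans[OF k(2) mult_right_mono[OF mult_right_mono[OF B0(2) norm_ge_zero]]] k(1) by (simp add: mult_ac)
  hence q: "sq_integrable (%x. B0 x *v fb u x)"
   using k by (intro sqb_sq_integrable sqb_bound(1)[where C = "\<bar>C\<bar> * k" and u = u] measurable_matrix_vector B0 AE_I2) auto
  have ae: "AE x in lebesgue. B x *v fn u x = B0 x *v fb u x"
   using eq[folded AE_lebesgue_iff] fn_eq_fb_lebesgue[of u] by eventually_elim simp
  have m': "(%x. B x *v fn u x) : borel_measurable lebesgue"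
   using sq_integrable_fn[of u] by (intro measurable_matrix_vector m) (simp add: sq_integrable_def)
  have "integrable lebesgue (%x. (norm (B x *v fn u x))^2) \<longleftrightarrow> integrable lebesgue (%x. (norm (B0 x *v fb u x))^2)"
   by (rule integrable_cong_AE) (use m' q ae in \<open>auto simp: sq_integrable_def elim: eventually_mono\<close>)
  hence "sq_integrable (%x. B x *v fn u x)" using q m' by (simp add: sq_integrable_def)
  thus ?thesis unfolding mult_op_def mulB_def mk_def by (rule abs_L2_eqI[OF _ q ae])
 qed
 thus ?thesis using that B0 by blast
qed

lemma Itg_fn: assumes [measurable]: "phi : borelm" shows "(LINT x|lebesgue. phi x *R fn u x) = Itg phi u"
proof -
 have m: "phi : borel_measurable lebesgue" "fb u : borel_measurable lebesgue" "fn u : borel_measurable lebesgue"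
  using assms sq_integrable_fn[of u] by (auto simp: sq_integrable_def intro: measurable_completion)
 have "(LINT x|lebesgue. phi x *R fn u x) = (LINT x|lebesgue. phi x *R fb u x)"
  by (rule integral_cong_AE) (use m fn_eq_fb_lebesgue[of u] in \<open>auto elim: eventually_mono\<close>)
 also have "... = Itg phi u" unfolding Itg_def by (rule lebesgue_integral_lborel) measurable
 finally show ?thesis .
qed

lemma Itg_fn_nth:
 fixes G :: "(real^'n::finite, complex^'m::finite^'k::finite) L2"
 assumes phi: "testf phi" shows "(LINT x|lebesgue. phi x *R (fn G x $ j)) = Itg phi (lmap (%w. w $ j) G)"
proof -
 have lin: "linear (%w :: complex^'m^'k. w $ j)" by (simp add: linearI)
 have "Itg phi (lmap (%w. w $ j) G) = (LINT x|lebesgue. phi x *R fn G x) $ j"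
  unfolding Itg_lmap[OF lin sqb_test[OF phi]] Itg_fn[OF test_function_measurable[OF phi]] ..
 also have "... = (LINT x|lebesgue. phi x *R (fn G x $ j))"
 proof -
  have "integrable lborel (%x. phi x *R fb G x)" by (rule integrable_Itg[OF sqb_test[OF phi]])
  hence "integrable lebesgue (%x. phi x *R fb G x)" by (simp add: integrable_completion)
  hence "integrable lebesgue (%x. phi x *R fn G x)"
   by (rule integrable_cong_AE_imp)
    (use fn_eq_fb_lebesgue[of G] measurable_completion[of phi lborel borel] test_function_measurable[OF phi] sq_integrable_fn[of G] in \<open>auto simp: sq_integrable_def intro!: borel_measurable_scaleR elim: eventually_mono\<close>)
  from integral_bounded_linear[OF bounded_linear_vec_nth this, of j] show ?thesis by simp
 qed
 finally show ?thesis by simp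
qed

section \<open>The sign of the operator\<close>

text \<open>The antiderivative is \<open>(arctan u + (u\<^sup>3 - u) / (1 + u\<^sup>2)\<^sup>2) / 8\<close>.\<close>

lemma integral_sgn_const: "integral {0<..} (%u::real. u^2*(1/(1+u^2)^3)) = pi/16"
proof -
 let ?f = "%u::real. u^2/(1+u^2)^3"
 have nz: "1+u^2 ~= 0" for u :: real using add_pos_nonneg[of 1 "u^2"] by simp
 define F where "F = (%u::real. (arctan u+(u^3-u)/(1+u^2)^2)/8)"
 have F': "(F has_real_derivative ?f u) (at u)" for u
 proof -
  have "(F has_real_derivative (inverse (1+u^2)+((3*u^2-1)*(1+u^2)^2-(u^3-u)*(2*(1+u^2)*(2*u)))/((1+u^2)^2*(1+u^2)^2))/8) (at u)"
   unfolding F_def by (rule derivative_eq_intros refl | simp add: nz)+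
  moreover have "(3*u^2-1)*(1+u^2)^2-(u^3-u)*(2*(1+u^2)*(2*u)) = (1+u^2)*(8*u^2-(1+u^2)^2)"
   by (simp add: power2_eq_square power3_eq_cube algebra_simps)
  moreover have "(inverse w+w*(8*x-w^2)/(w^2*w^2))/8 = x/w^3" if "w ~= 0" for w x :: real
   using that by (simp add: field_simps power2_eq_square power3_eq_cube)
  ultimately show ?thesis using nz[of u] by simp
 qed
 have "((%u::real. (u^3-u)/(1+u^2)^2) \<longlongrightarrow> 0) at_top"
 proof (rule Lim_null_comparison[OF _ tendsto_inverse_0_at_top[OF filterlim_ident]], rule eventually_mono[OF eventually_ge_at_top[of 1]])
  fix u :: real assume u: "1 <= u"
  have "(u^3-u)*u <= (1+u^2)^2" by (simp add: power2_eq_square power3_eq_cube algebra_simps)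
  moreover have "u^3-u >= 0" using u self_le_power[of u 3] by simp
  ultimately show "norm ((u^3-u)/(1+u^2)^2) <= inverse u" using u nz[of u] by (simp add: field_simps)
 qed
 from tendsto_divide[OF tendsto_add[OF tendsto_arctan_at_top this] tendsto_const[of "8::real"]]
 have top: "(F \<longlongrightarrow> pi/16) at_top" by (simp add: F_def)
 have "F 0 = 0" by (simp add: F_def)
 hence bot: "(F \<longlongrightarrow> 0) (at_right 0)"
  using DERIV_isCont[OF F'[of 0]] unfolding isCont_def filterlim_at_split by metis
 have FTC: "set_integrable lborel (einterval 0 \<infinity>) ?f" "(LBINT u=0..\<infinity>. ?f u) = pi/16-0"
  using interval_integral_FTC_nonneg[of 0 \<infinity> F ?f 0 "pi/16"] F' top bot nz
  by (auto simp: zero_ereal_def ereal_tendsto_simps1 intro!: continuous_intros)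
 have e: "einterval 0 \<infinity> = {0::real<..}" by (auto simp: einterval_def)
 have "integral {0<..} ?f = pi/16"
  using set_borel_integral_eq_integral(2)[OF FTC(1)] FTC(2) by (simp add: e interval_lebesgue_integral_def)
 thus ?thesis by simp
qed

text \<open>Each factor \<open>(I + t\<^sup>2 T\<^sup>2)\<^sup>-\<^sup>1\<close> is \<open>U t\<close>, and \<open>t T U t = Q t\<close>
  commutes with it.\<close>

lemma sgn_integrand_eq:
 fixes D :: "('n::finite, 'm::finite) oper"
 assumes acc: "accretive_op D J (mult_op B) b' \<delta> K" and t: "t ~= 0"
 shows "sgn_integrand (mult_comp B D) f t = (1/t) *R accretive_op.Q D J (mult_op B) t (accretive_op.Q D J (mult_op B) t (accretive_op.Q D J (mult_op B) t f))"
proof -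
 interpret accretive_op D J "mult_op B" b' \<delta> K by (rule acc)
 let ?T = "mult_comp B D" and ?b = "mult_op B"
 have T: "(u, z) : ?T \<longleftrightarrow> (\<exists>v. (u, v) : D & z = ?b v)" for u z by (auto simp: mult_comp_def)
 have res: "(g, u) : (id_plus (scale_op (t^2) (?T^^2)))\<inverse> \<longleftrightarrow> u = U t g" for g u
 proof
  assume "(g, u) : (id_plus (scale_op (t^2) (?T^^2)))\<inverse>"
  then obtain z x where zx: "(u, x) : ?T" "(x, z) : ?T" "g = u+t^2 *R z" by (auto simp: id_plus_def scale_op_def numeral_2_eq_2)
  then obtain v v' where v: "(u, v) : D" "x = ?b v" "(x, v') : D" "z = ?b v'" using T by blast
  show "u = U t g" by (rule UQ_eqI(1)[OF t v(1), symmetric, of "t *R v'"]) (use D_scale[OF v(3), of t] v zx in \<open>simp_all add: power2_eq_square\<close>)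
 next
  assume u: "u = U t g"
  have "(U t g, ?b (WU t g)) : ?T" using T UQ_D(1)[OF t] by blast
  moreover have "(?b (WU t g), ?b ((1/t) *R WQ t g)) : ?T"
  proof -
   have "?b (WU t g) = (1/t) *R Q t g" using t by (simp flip: b_WU[OF t])
   thus ?thesis using T D_scale[OF UQ_D(2)[OF t, of g], of "1/t"] by auto
  qed
  moreover have "g = U t g+t^2 *R ?b ((1/t) *R WQ t g)" using t b_WQ[OF t, of g] by (simp add: power2_eq_square)
  ultimately show "(g, u) : (id_plus (scale_op (t^2) (?T^^2)))\<inverse>"
   unfolding u by (auto simp: id_plus_def scale_op_def numeral_2_eq_2 intro!: exI)
 qed
 have tT: "(U t h, y) : scale_op t ?T \<longleftrightarrow> y = Q t h" for h y
  using UQ_D(1)[OF t, of h] D_fun b_WU[OF t, of h] by (auto simp: scale_op_def T) metis+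
 have c: "Q t (U t h) = U t (Q t h)" for h by (rule UQ_commute(3)[OF t t, symmetric])
 have "(f, y) : ((id_plus (scale_op (t^2) (?T^^2)))\<inverse>)^^3 O (scale_op t ?T)^^3 \<longleftrightarrow> y = Q t (Q t (Q t f))" for y
  by (simp only: numeral_3_eq_3 relpow.simps relcomp_unfold mem_Collect_eq case_prod_conv res) (simp add: relcomp_unfold res tT c)
 thus ?thesis unfolding sgn_integrand_def by simp
qed

theorem corollary1p3:
  fixes D :: "('n::finite, 'm::finite) oper"
    and B :: "real ^ 'n \<Rightarrow> complex ^ 'm ^ 'm"
    and \<delta> :: real
  assumes "self_adjoint D"
    and "homogeneous_first_order_const_coeff D"
    and "\<exists>C. \<forall>(u, v)\<in>D. u \<in> closure (Range D) \<longrightarrow>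
           (\<exists>G. weak_gradient u G \<and> norm G \<le> C * norm v)"
    and "L_infinity B"
    and "\<delta> > 0"
    and "\<forall>(u, v)\<in>D. Re (cinner (mult_op B v) v) \<ge> \<delta> * (norm v)\<^sup>2"
  shows "Domain (sgn_op (mult_comp B D)) = sgn_domain (mult_comp B D) \<and>
    (\<exists>S. bounded_extension (sgn_op (mult_comp B D)) S \<and>
         invertible_on S (closure (Range (mult_comp B D))))"
proof -
 let ?J = "JC :: ('n, 'm) H => ('n, 'm) H"
 let ?T = "mult_comp B D"
 have sa: "linear_op D" "closure (Domain D) = UNIV" "adjoint_op D = D" using assms(1) by (auto simp: self_adjoint_def)
 have DJ: "(?J u, ?J v) : D" if "(u, v) : D" for u v using sa(1) that unfolding linear_op_def by blast
 have selfadj: "selfadj_op D ?J"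
 proof (rule selfadj_op.intro)
  fix v w
  \<comment> \<open>Real and complex adjoints agree: the imaginary part of \<open>cinner z v\<close> is a real pairing for \<open>J
    u\<close>, which lies in the domain too.\<close>
  have "(v, w) : adjoint_op D \<longleftrightarrow> (\<forall>u z. (u, z) : D --> cinner z v = cinner u w)" by (auto simp: adjoint_op_def)
  also have "... \<longleftrightarrow> (\<forall>u z. (u, z) : D --> inner z v = inner u w)"
  proof (intro iffI allI impI)
   fix u z assume a: "\<forall>u z. (u, z) : D --> inner z v = inner u w" and uz: "(u, z) : D"
   have "Re (cinner z v) = Re (cinner u w)" "Re (\<i>*cinner z v) = Re (\<i>*cinner u w)"
    unfolding cinner_cscale[symmetric] Re_cinner using a uz DJ[OF uz] by auto
   thus "cinner z v = cinner u w" by (simp add: complex_eq_iff)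
  qed (simp flip: Re_cinner)
  finally show "(v, w) : D \<longleftrightarrow> (\<forall>u z. (u, z) : D --> inner z v = inner u w)" unfolding sa(3) .
 qed (simp_all add: sa(2) DJ JC(1,2,3))
 obtain A :: "'n => complex^'m^'m" where A: "!!u v phi. (u, v) : D ==> testf phi ==>
   (LINT x|lebesgue. phi x *R fn v x) = - (\<Sum>j\<in>UNIV. A j *v (LINT x|lebesgue. pd j phi x *R fn u x))"
  using assms(2) unfolding homogeneous_first_order_const_coeff_def by blast
 obtain C0 where C0: "!!u v. (u, v) : D ==> u : closure (Range D) ==> \<exists>G. weak_gradient u G & norm G <= C0*norm v" using assms(3) by blast
 note Itg = Itg_fn[OF test_function_measurable] Itg_fn[OF test_function_measurable[OF test_partial_deriv]]
 have dirac: "dirac D ?J (%j z. A j *v z) C0"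
 proof (intro dirac.intro selfadj dirac_axioms.intro)
  show "linear (%z. A j *v z)" for j by (rule linear_matrix)
  show "?J (mulr phi u) = mulr phi (?J u)" if "bdd phi" for phi u by (rule JC(4)[OF that])
  show "Itg phi v = - (\<Sum>j\<in>UNIV. A j *v Itg (pd j phi) u)" if "(u, v) : D" "testf phi" for u v phi
   using A[OF that] by (simp add: Itg that)
  fix u v assume uv: "(u, v) : D" and u: "u : closure (Range D)"
  obtain G where G: "weak_gradient u G" "norm G <= C0*norm v" using C0[OF uv u] by blast
  have "norm (lmap (%w. w $ j) G) <= C0*norm v" for j
  proof -
   have lin: "linear (%w :: complex^'m^'n. w $ j)" by (simp add: linearI)
   have "onorm (%w :: complex^'m^'n. w $ j) <= 1" by (rule onorm_le) (simp add: Finite_Cartesian_Product.norm_nth_le)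
   thus ?thesis using norm_lmap_le[OF lin, of G] mult_right_mono[OF _ norm_ge_zero[of G], of "onorm (%w :: complex^'m^'n. w $ j)" 1] G(2) by linarith
  qed
  moreover have "Itg phi (lmap (%w. w $ j) G) = - Itg (pd j phi) u" if "testf phi" for j phi
   using G(1) that unfolding weak_gradient_def Itg_fn_nth[OF that, symmetric] by (simp add: Itg that)
  ultimately show "\<exists>g. \<forall>j. norm (g j) <= C0*norm v & (\<forall>phi. testf phi --> Itg phi (g j) = - Itg (pd j phi) u)"
   by (intro exI[of _ "%j. lmap (%w. w $ j) G"]) auto
 qed
 obtain B0 C where B0: "B0 : borelm" "!!x. norm (B0 x) <= C" "mult_op B = mulB B0" using mult_op_eq[OF assms(4)] by blast
 obtain C' where B0': "adjB B0 : borelm" "!!x. norm (adjB B0 x) <= C'"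
 proof -
  have lin: "linear (%M :: complex^'m^'m. (\<chi> i j. cnj (M $ j $ i)) :: complex^'m^'m)" by (rule linearI) (simp_all add: vec_eq_iff)
  hence bl: "bounded_linear (%M :: complex^'m^'m. (\<chi> i j. cnj (M $ j $ i)) :: complex^'m^'m)" by (simp add: linear_conv_bounded_linear)
  obtain k where k: "k > 0" "!!M :: complex^'m^'m. norm ((\<chi> i j. cnj (M $ j $ i)) :: complex^'m^'m) <= norm M * k" using bounded_linear.pos_bounded[OF bl] by blast
  have "adjB B0 : borelm" unfolding adjB_def[abs_def]
   by (rule borel_measurable_continuous_on[OF _ B0(1)]) (rule bounded_linear.continuous_on[OF bl continuous_on_id])
  thus ?thesis
  proof (rule that)
   show "norm (adjB B0 x) <= C * k" for x unfolding adjB_def using order_trans[OF k(2) mult_right_mono[OF B0(2)]] k(1) by simp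
  qed
 qed
 obtain K where K: "!!u. norm (mulB B0 u) <= K*norm u" "!!u. AE x in lborel. fb (mulB B0 u) x = B0 x *v fb u x" "linear (mulB B0)"
  "!!u. mulB B0 (?J u) = ?J (mulB B0 u)" "!!phi u. bdd phi ==> mulB B0 (mulr phi u) = mulr phi (mulB B0 u)" using mulB_props[OF B0(1,2)] by blast
 obtain K' where K': "!!u. AE x in lborel. fb (mulB (adjB B0) u) x = adjB B0 x *v fb u x" "linear (mulB (adjB B0))"
  "!!phi u. bdd phi ==> mulB (adjB B0) (mulr phi u) = mulr phi (mulB (adjB B0) u)" using mulB_props[OF B0'] by blast
 have acc_B: "accretive_op D ?J (mult_op B) (mulB (adjB B0)) \<delta> K"
 proof (intro accretive_op.intro selfadj accretive_op_axioms.intro)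
  show "inner (mult_op B x) y = inner x (mulB (adjB B0) y)" for x y
   unfolding B0(3) inner_L2
   by (rule integral_cong_AE) (measurable, use K(2)[of x] K'(1)[of y] in \<open>eventually_elim, simp add: inner_adjoint_matrix adjB_def\<close>)
  show "\<delta>*(norm v)^2 <= inner (mult_op B v) v" if "(u, v) : D" for u v using assms(6) that by (auto simp: Re_cinner)
 qed (use K K' assms(5) B0(3) in auto)
 have dm: "dirac_mult D ?J (%j z. A j *v z) C0 (mult_op B) (mulB (adjB B0)) \<delta> K"
  by (intro dirac_mult.intro dirac acc_B dirac_mult_axioms.intro) (use K K' B0(3) in auto)
 have dm': "dirac_mult D ?J (%j z. A j *v z) C0 (mulB (adjB B0)) (mult_op B) \<delta> K"
  by (intro dirac_mult.intro dirac accretive_op.flip[OF acc_B] dirac_mult_axioms.intro) (use K K' B0(3) in auto)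
 interpret accretive_op D ?J "mult_op B" "mulB (adjB B0)" \<delta> K by (rule acc_B)
 obtain C1 where C1: "square_bound C1" using dirac_mult.quadratic_estimate[OF dm] by blast
 obtain C2 where C2: "accretive_op.square_bound D ?J (mulB (adjB B0)) C2" using dirac_mult.quadratic_estimate[OF dm'] by blast
 obtain S \<kappa> where S: "bounded_linear S" "!!f. S (?J f) = ?J (S f)" "!!n. (n, 0) : D ==> S n = 0"
  "!!f. f : nice ==> ((%t. (1/t) *R Q t (Q t (Q t f))) has_integral S f) {0<..}"
  "!!f. S f : closure (mult_op B ` Range D)" "\<kappa> ~= 0" "!!f. f : closure (mult_op B ` Range D) ==> S (S f) = \<kappa> *R f"
  using sign_operator[OF C1 C2] by blast
 have null: "null_space ?T = {n. (n, 0) : D}"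
 proof -
  have z: "v = 0" if "(u, v) : D" "mult_op B v = 0" for u v using acc_le[OF that(1)] that(2) by simp
  have "(n, 0) : ?T \<longleftrightarrow> (\<exists>v. (n, v) : D & mult_op B v = 0)" for n
   unfolding mult_comp_def by (simp, metis)
  moreover have "(\<exists>v. (n, v) : D & mult_op B v = 0) \<longleftrightarrow> (n, 0) : D" for n
  proof
   assume "\<exists>v. (n, v) : D & mult_op B v = 0"
   then obtain v where v: "(n, v) : D" "mult_op B v = 0" by blast
   show "(n, 0) : D" using v(1) unfolding z[OF v] .
  qed (use b_simps(4) in blast)
  ultimately show ?thesis unfolding null_space_def by blast
 qed
 have nice: "Domain ?T \<inter> Range ?T = nice" by (fastforce simp: mult_comp_def nice_def)
 have R: "Range ?T = mult_op B ` Range D" by (fastforce simp: mult_comp_def)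
 have int: "(sgn_integrand ?T f has_integral y) {0<..} \<longleftrightarrow> y = S f" if "f : nice" for f y
 proof -
  have "(sgn_integrand ?T f has_integral y) {0<..} \<longleftrightarrow> ((%t. (1/t) *R Q t (Q t (Q t f))) has_integral y) {0<..}"
   by (rule has_integral_cong) (simp add: sgn_integrand_eq[OF acc_B])
  thus ?thesis using S(4)[OF that] has_integral_unique by blast
 qed
 have op: "sgn_op ?T = {(g+f, sgn_const *R S f) |g f. (g, 0) : D & f : nice}"
  unfolding sgn_op_def null nice by (auto simp: int cong: conj_cong)
 have dom: "Domain (sgn_op ?T) = sgn_domain ?T" unfolding op sgn_domain_def null nice by (auto simp: Domain_iff)
 define S' where "S' = (%f. sgn_const *R S f)"
 define \<mu> where "\<mu> = sgn_const^2*\<kappa>"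
 have \<mu>: "\<mu> ~= 0" using S(6) unfolding \<mu>_def sgn_const_def integral_sgn_const by simp
 have lin: "bounded_linear S'" unfolding S'_def by (rule bounded_linear_compose[OF bounded_linear_scaleR_right S(1)])
 interpret S': bounded_linear S' by (rule lin)
 interpret S: bounded_linear S by (rule S(1))
 have "bounded_extension (sgn_op ?T) S'"
  unfolding bounded_extension_def bounded_clinear_def
 proof (intro conjI allI lin)
  show "S' (cscale c u) = cscale c (S' u)" for c u
   unfolding JC(5)[of c] S'.add S'.scaleR by (simp add: S'_def S(2) linear_scale[OF JC(1)])
  show "closure (Domain (sgn_op ?T)) = UNIV" unfolding dom sgn_domain_def null nice using null_plus_nice_dense by simp
  show "\<forall>(u, v)\<in>sgn_op ?T. S' u = v" unfolding op by (auto simp: S'_def S.add S(3))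
 qed
 moreover have "invertible_on S' (closure (Range ?T))"
 proof -
  let ?K = "closure (Range ?T)"
  have sub: "subspace ?K"
   unfolding R by (intro subspace_closure linear_subspace_image[OF b_linear] subspace_Range)
  have K: "S' f : ?K" for f unfolding S'_def by (rule subspace_scale[OF sub]) (use S(5) R in simp)
  have SS: "S' (S' f) = \<mu> *R f" if "f : ?K" for f using that S(7) unfolding R by (simp add: S'_def \<mu>_def S.scaleR power2_eq_square)
  have bij: "bij_betw S' ?K ?K"
  proof (rule bij_betw_byWitness[where f' = "%f. (1/\<mu>) *R S' f"])
   show "\<forall>a\<in>?K. (1/\<mu>) *R S' (S' a) = a" using \<mu> by (simp add: SS)
   show "\<forall>a\<in>?K. S' ((1/\<mu>) *R S' a) = a" using \<mu> by (simp add: SS S'.scaleR)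
  qed (auto intro!: K subspace_scale[OF sub])
  obtain M where M: "!!f. norm (S' f) <= norm f*M" using S'.bounded by blast
  have "norm (inv_into ?K S' u) <= (M/\<bar>\<mu>\<bar>)*norm u" if u: "u : ?K" for u
  proof -
   have "inv_into ?K S' u : ?K" "S' (inv_into ?K S' u) = u"
    using u bij by (auto simp: bij_betw_def intro: inv_into_into f_inv_into_f)
   hence "\<mu> *R inv_into ?K S' u = S' u" using SS by metis
   hence "\<bar>\<mu>\<bar>*norm (inv_into ?K S' u) <= norm u*M" using M[of u] by (metis norm_scaleR)
   thus ?thesis using \<mu> by (simp add: pos_le_divide_eq mult.commute)
  qed
  with bij show ?thesis unfolding invertible_on_def by blast
 qed
 ultimately show ?thesis using dom by blast
qed

end
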